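(* Let $N\geq 1$, let $m_k>0$ and $\gamma_k\in\mathbb{R}$ for $k=1,\dots,N$, let $\omega_0\in L^\infty(\mathbb{R}^2)$ be compactly supported in some ball $B(0,R_0)$, let $h_{k,0}\in\mathbb{R}^2$ ($k=1,\dots,N$) be pairwise distinct, and let $\ell_{k,0}\in\mathbb{R}^2$ ($k=1,\dots,N$). Then there exists $T_*>0$ such that for any $T\in(0,T_* )$ there exists a weak solution $(\omega,\{h_k\}_{1\leq k\leq N})$ on $[0,T]$ of the massive vortex-wave system (S), with initial data $\omega(0,\cdot)=\omega_0$, $h_k(0)=h_{k,0}$, $\dot h_k(0)=\ell_{k,0}$ for $k=1,\dots,N$. Moreover, if all the $\gamma_k$, $k=1,\dots,N$, have the same sign (all strictly positive or all strictly negative), then one can take $T_*=+\infty$.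
   Context: For $x=(x_1,x_2)\in\mathbb{R}^2$, $x^\perp=(-x_2,x_1)$, and $K(x)=\frac{1}{2\pi}\frac{x^\perp}{|x|^2}$. The massive vortex-wave system (S), with unknowns $\omega:[0,T]\times\mathbb{R}^2\to\mathbb{R}$ and $h_k:[0,T]\to\mathbb{R}^2$, is $$\partial_t\omega+\mathrm{div}(v\omega)=0,\qquad v(t,x)=u(t,x)+\sum_{k=1}^N\frac{\gamma_k}{2\pi}\frac{(x-h_k(t))^\perp}{|x-h_k(t)|^2},\qquad u=K\ast\omega\ (\text{convolution in }x),$$ $$m_k\ddot h_k=\gamma_k\Big(\dot h_k-u(t,h_k)-\sum_{j\neq k}\frac{\gamma_j}{2\pi}\frac{(h_k-h_j)^\perp}{|h_k-h_j|^2}\Big)^\perp,\qquad k=1,\dots,N.$$ A weak solution of (S) on $[0,T]$ with given initial data is a pair $(\omega,\{h_k\})$ such that $\omega\in L^\infty([0,T],L^1\cap L^\infty(\mathbb{R}^2))\cap C([0,T],L^\infty(\mathbb{R}^2)\text{-}w^* )$ (continuous in time with values in $L^\infty$ endowed with the weak-$*$ topology), $h_k\in C^2([0,T])$ for all $k$, the PDE is satisfied in the sense of distributions, the ODEs are satisfied in the classical sense, and the initial conditions hold. *)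

theory Defs
  imports "HOL-Analysis.Analysis"
begin

type_synonym plane = "real ^ 2"

definition perp :: "plane \<Rightarrow> plane" where
  "perp x = vector [- (x $ 2), x $ 1]"

definition K :: "plane \<Rightarrow> plane" where
  "K x = (1 / (2 * pi)) *\<^sub>R (perp x /\<^sub>R (norm x)\<^sup>2)"

definition K_conv :: "(plane \<Rightarrow> real) \<Rightarrow> plane \<Rightarrow> plane" where
  "K_conv w x = (LINT y|lebesgue. w y *\<^sub>R K (x - y))"

definition velocity ::
  "nat \<Rightarrow> (nat \<Rightarrow> real) \<Rightarrow> (real \<Rightarrow> plane \<Rightarrow> real) \<Rightarrow> (nat \<Rightarrow> real \<Rightarrow> plane) \<Rightarrow>
   real \<Rightarrow> plane \<Rightarrow> plane" where
  "velocity N \<gamma> \<omega> h t x = K_conv (\<omega> t) x + (\<Sum>k=1..N. \<gamma> k *\<^sub>R K (x - h k t))"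


text \<open>Elements of Lebesgue spaces are represented by Lebesgue measurable functions;
  equality in these spaces is equality almost everywhere.\<close>

definition Linfty :: "(plane \<Rightarrow> real) \<Rightarrow> bool" where
  "Linfty f \<longleftrightarrow> f \<in> borel_measurable lebesgue \<and> (\<exists>C. AE x in lebesgue. \<bar>f x\<bar> \<le> C)"

text \<open>Measurability of a class in \<open>L\<^sup>\<infinity>([0,T], L\<^sup>1 \<inter> L\<^sup>\<infinity>)\<close> is joint measurability
  in \<open>(t,x)\<close>; strong (Bochner) measurability with values in the nonseparable space
  \<open>L\<^sup>\<infinity>\<close> is not what is meant.\<close>

definition Linfty_L1_Linfty :: "real \<Rightarrow> (real \<Rightarrow> plane \<Rightarrow> real) \<Rightarrow> bool" where
  "Linfty_L1_Linfty T \<omega> \<longleftrightarrow>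
     (\<lambda>(t, x). \<omega> t x) \<in> borel_measurable (lebesgue_on ({0..T} \<times> UNIV)) \<and>
     (\<exists>C. AE t in lebesgue_on {0..T}.
        integrable lebesgue (\<omega> t) \<and> (LINT x|lebesgue. \<bar>\<omega> t x\<bar>) \<le> C \<and>
        (AE x in lebesgue. \<bar>\<omega> t x\<bar> \<le> C))"

text \<open>Together with the preceding condition, weak-* continuity forces the bounds in
  \<open>L\<^sup>1\<close> and \<open>L\<^sup>\<infinity>\<close> at every \<open>t\<close> in \<open>[0,T]\<close> (lower semicontinuity of the norms), so that
  \<open>K_conv (\<omega> t) x\<close> is an absolutely convergent integral for every such \<open>t\<close> and every \<open>x\<close>.\<close>

definition weakstar_continuous :: "real \<Rightarrow> (real \<Rightarrow> plane \<Rightarrow> real) \<Rightarrow> bool" where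
  "weakstar_continuous T \<omega> \<longleftrightarrow>
     (\<forall>t\<in>{0..T}. Linfty (\<omega> t)) \<and>
     (\<forall>g. integrable lebesgue g \<longrightarrow>
        continuous_on {0..T} (\<lambda>t. LINT x|lebesgue. \<omega> t x * g x))"


text \<open>Derivatives on \<open>[0,T]\<close> are one-sided at the end points.\<close>

definition time_deriv :: "real \<Rightarrow> (real \<Rightarrow> plane) \<Rightarrow> real \<Rightarrow> plane" where
  "time_deriv T f t = vector_derivative f (at t within {0..T})"

definition C2_on_interval :: "real \<Rightarrow> (real \<Rightarrow> plane) \<Rightarrow> bool" where
  "C2_on_interval T f \<longleftrightarrow>
     f differentiable_on {0..T} \<and>
     time_deriv T f differentiable_on {0..T} \<and>
     continuous_on {0..T} (time_deriv T (time_deriv T f))"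


primrec Ck :: "nat \<Rightarrow> ('a::euclidean_space \<Rightarrow> real) \<Rightarrow> bool" where
  "Ck 0 f \<longleftrightarrow> continuous_on UNIV f"
| "Ck (Suc n) f \<longleftrightarrow> f differentiable_on UNIV \<and>
     (\<forall>b\<in>Basis. Ck n (\<lambda>x. frechet_derivative f (at x) b))"

definition test_function :: "real \<Rightarrow> (real \<times> plane \<Rightarrow> real) \<Rightarrow> bool" where
  "test_function T \<phi> \<longleftrightarrow> (\<forall>n. Ck n \<phi>) \<and>
     compact (closure {p. \<phi> p \<noteq> 0}) \<and> closure {p. \<phi> p \<noteq> 0} \<subseteq> {0<..<T} \<times> UNIV"

definition partial_t :: "(real \<times> plane \<Rightarrow> real) \<Rightarrow> real \<times> plane \<Rightarrow> real" where
  "partial_t \<phi> p = frechet_derivative \<phi> (at p) (1, 0)"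

definition grad_x :: "(real \<times> plane \<Rightarrow> real) \<Rightarrow> real \<times> plane \<Rightarrow> plane" where
  "grad_x \<phi> p = (\<chi> i. frechet_derivative \<phi> (at p) (0, axis i 1))"

text \<open>The equation \<open>\<partial>\<^sub>t \<omega> + div (v \<omega>) = 0\<close> in the sense of distributions
  on \<open>(0,T) \<times> \<real>\<^sup>2\<close>.\<close>

definition transport_distributional ::
  "real \<Rightarrow> (real \<Rightarrow> plane \<Rightarrow> plane) \<Rightarrow> (real \<Rightarrow> plane \<Rightarrow> real) \<Rightarrow> bool" where
  "transport_distributional T v \<omega> \<longleftrightarrow>
     (\<forall>\<phi>. test_function T \<phi> \<longrightarrow>
        (LINT (t, x)|lebesgue_on ({0<..<T} \<times> UNIV).
           \<omega> t x * (partial_t \<phi> (t, x) + v t x \<bullet> grad_x \<phi> (t, x))) = 0)"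


text \<open>The right-hand side of the point vortex equations only makes sense at times without
  collisions; since division by zero is total in HOL, absence of collisions is part of
  the statement that the equations hold.\<close>

definition vortex_odes ::
  "real \<Rightarrow> nat \<Rightarrow> (nat \<Rightarrow> real) \<Rightarrow> (nat \<Rightarrow> real) \<Rightarrow>
   (real \<Rightarrow> plane \<Rightarrow> real) \<Rightarrow> (nat \<Rightarrow> real \<Rightarrow> plane) \<Rightarrow> bool" where
  "vortex_odes T N m \<gamma> \<omega> h \<longleftrightarrow>
     (\<forall>t\<in>{0..T}. inj_on (\<lambda>k. h k t) {1..N} \<and>
        (\<forall>k\<in>{1..N}.
           m k *\<^sub>R time_deriv T (time_deriv T (h k)) t =
           \<gamma> k *\<^sub>R perp (time_deriv T (h k) t - K_conv (\<omega> t) (h k t)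
                       - (\<Sum>j\<in>{1..N} - {k}. \<gamma> j *\<^sub>R K (h k t - h j t)))))"

definition weak_solution ::
  "real \<Rightarrow> nat \<Rightarrow> (nat \<Rightarrow> real) \<Rightarrow> (nat \<Rightarrow> real) \<Rightarrow>
   (plane \<Rightarrow> real) \<Rightarrow> (nat \<Rightarrow> plane) \<Rightarrow> (nat \<Rightarrow> plane) \<Rightarrow>
   (real \<Rightarrow> plane \<Rightarrow> real) \<Rightarrow> (nat \<Rightarrow> real \<Rightarrow> plane) \<Rightarrow> bool" where
  "weak_solution T N m \<gamma> \<omega>0 h0 l0 \<omega> h \<longleftrightarrow>
     Linfty_L1_Linfty T \<omega> \<and> weakstar_continuous T \<omega> \<and>
     (\<forall>k\<in>{1..N}. C2_on_interval T (h k)) \<and>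
     transport_distributional T (velocity N \<gamma> \<omega> h) \<omega> \<and>
     vortex_odes T N m \<gamma> \<omega> h \<and>
     (AE x in lebesgue. \<omega> 0 x = \<omega>0 x) \<and>
     (\<forall>k\<in>{1..N}. h k 0 = h0 k \<and> time_deriv T (h k) 0 = l0 k)"

end

theory Submission
  imports Defs "HOL-Complex_Analysis.Great_Picard"
begin

text \<open>The vorticity is advanced by a Markov finite-difference scheme and the vortices by the
  Euler method. The discrete velocity is a centred discrete perpendicular gradient, so its
  discrete divergence vanishes identically, and under a CFL condition each step averages values:
  positivity and the \<open>L\<^sup>1\<close> and \<open>L\<^sup>\<infinity>\<close> bounds are inherited from the data without any
  regularity of the velocity or transport along characteristics. Ascoli's theorem, applied to
  countably many test functions, gives weak-* convergence at every time. The Biot--Savart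
  velocity converges pointwise and boundedly, because \<open>K\<close> is locally integrable, which is
  enough to pass to the limit in the nonlinear terms, with the vortex--vortex kernel truncated
  at distance \<open>\<delta>\<close>.

  The truncation is never active if the vortices stay \<open>\<delta>\<close>-separated. On a short time interval
  this follows from bounds on the speeds. If the circulations have one sign, the energy
  \<open>\<Sum>\<^sub>k m\<^sub>k |h\<^sub>k'|\<^sup>2 / 2 - \<Sum>\<^sub>i\<^sub><\<^sub>j \<gamma>\<^sub>i \<gamma>\<^sub>j ln |h\<^sub>i - h\<^sub>j| / 2\<pi>\<close> grows at most linearly in the maximal speed,
  which bounds the speeds and then, on any time interval, the distances from below.\<close>

section \<open>The Biot--Savart kernel and its truncation\<close>

text \<open>The velocity is unbounded at the vortices and the vorticity has no regularity, so
  products must pass to the limit on weak-* convergence alone. Oddness of \<open>K\<close> makes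
  this possible: the velocity of a vortex at y, tested against w g, turns into velocities generated
  by the components of w g and evaluated at y, so the singularity at a moving point becomes a
  convolution there. The scheme acts on functions on the whole plane by shifts of length h, not on a
  lattice. Three small parameters occur: the core radius \<epsilon>, the shift h and the time step
  \<tau>. The CFL condition asks for \<tau> of order at most h \<epsilon>, while the numerical
  diffusion h^2/\<tau> and the error h/\<epsilon>^2 have to vanish; h = \<epsilon>^3 with \<tau> of
  order \<epsilon>^5 meets all three. The cut-off \<delta> is of another nature: it is fixed before
  the limit and survives it, so it has to be chosen from constants that do not depend on it. Limits
  taken at each time separately need not be jointly measurable in (t,x), so a measurable version is
  built afterwards.\<close>

lemma lborel_distr_reflect:
  fixes t :: "'a::euclidean_space"
  shows "distr lborel borel (\<lambda>x. t - x) = lborel"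
proof -
  show ?thesis
    using lborel_affine[of "-1" t] by (simp add: density_1)
qed

lemma
  fixes f :: "'a::euclidean_space \<Rightarrow> 'b::{banach, second_countable_topology}"
  assumes "f \<in> borel_measurable borel"
  shows integral_lborel_translate: "(LINT x|lborel. f (c + x)) = (LINT x|lborel. f x)"
    and integral_lborel_reflect: "(LINT x|lborel. f (c - x)) = (LINT x|lborel. f x)"
    and integrable_lborel_translate: "integrable lborel (\<lambda>x. f (c + x)) \<longleftrightarrow> integrable lborel f"
    and integrable_lborel_reflect: "integrable lborel (\<lambda>x. f (c - x)) \<longleftrightarrow> integrable lborel f"
proof -
  show "(LINT x|lborel. f (c + x)) = (LINT x|lborel. f x)"
    by (subst lborel_distr_plus[of c, symmetric], subst integral_distr) (use assms in auto)
  show "(LINT x|lborel. f (c - x)) = (LINT x|lborel. f x)"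
    by (subst (2) lborel_distr_reflect[of c, symmetric], subst integral_distr) (use assms in auto)
  show "integrable lborel (\<lambda>x. f (c + x)) \<longleftrightarrow> integrable lborel f"
    by (subst (2) lborel_distr_plus[of c, symmetric], subst integrable_distr_eq) (use assms in auto)
  show "integrable lborel (\<lambda>x. f (c - x)) \<longleftrightarrow> integrable lborel f"
    by (subst (2) lborel_distr_reflect[of c, symmetric], subst integrable_distr_eq) (use assms in auto)
qed

lemma perp_nth [simp]: "perp x $ 1 = - (x $ 2)" "perp x $ 2 = x $ 1"
  by (simp_all add: perp_def)

lemma perp_add: "perp (x + y) = perp x + perp y"
  and perp_diff: "perp (x - y) = perp x - perp y"
  and perp_scaleR: "perp (c *\<^sub>R x) = c *\<^sub>R perp x"
  and perp_minus: "perp (- x) = - perp x"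
  and perp_perp: "perp (perp x) = - x"
  by (simp_all add: vec_eq_iff forall_2)

lemma perp_zero [simp]: "perp 0 = 0"
  by (simp add: vec_eq_iff forall_2)

lemma norm_plane: "norm (x :: plane) = sqrt ((x $ 1)\<^sup>2 + (x $ 2)\<^sup>2)"
  by (simp add: norm_vec_def L2_set_def sum_2)

lemma norm_perp [simp]: "norm (perp x) = norm x"
  by (simp add: norm_plane add.commute)

lemma inner_plane: "(x :: plane) \<bullet> y = x $ 1 * y $ 1 + x $ 2 * y $ 2"
  by (simp add: inner_vec_def sum_2)

lemma inner_perp_self [simp]: "x \<bullet> perp x = 0"
  by (simp add: inner_plane)

lemma bounded_linear_perp: "bounded_linear perp"
  by (rule bounded_linear_intro[where K = 1]) (simp_all add: perp_add perp_scaleR)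

lemmas continuous_on_perp [continuous_intros] = bounded_linear.continuous_on[OF bounded_linear_perp]
lemmas tendsto_perp [tendsto_intros] = bounded_linear.tendsto[OF bounded_linear_perp]

text \<open>The velocity field of a Rankine vortex of radius \<epsilon>: rigid rotation inside the
  disc, exactly \<open>K\<close> outside it. The exact equality is what lets a truncation disappear
  once the vortices are separated; oddness is kept as well.\<close>

definition Kreg :: "real \<Rightarrow> plane \<Rightarrow> plane" where
  "Kreg \<epsilon> x = (1 / (2 * pi * max ((norm x)\<^sup>2) (\<epsilon>\<^sup>2))) *\<^sub>R perp x"

lemma two_pi_gt_3: "2 * pi > 3"
  using pi_gt3 by linarith

lemma Kreg_eq_K:
  assumes "norm x \<ge> \<epsilon>" "\<epsilon> > 0"
  shows "Kreg \<epsilon> x = K x"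
proof -
  have "\<epsilon>\<^sup>2 \<le> (norm x)\<^sup>2"
    using assms by (intro power_mono) auto
  then have "max ((norm x)\<^sup>2) (\<epsilon>\<^sup>2) = (norm x)\<^sup>2"
    by (rule max_absorb1)
  then show ?thesis
    unfolding Kreg_def K_def by (simp add: inverse_eq_divide)
qed

lemma norm_K: "norm (K x) = 1 / (2 * pi * norm x)"
  by (cases "x = 0") (simp_all add: K_def power2_eq_square inverse_eq_divide)

lemma norm_K_le: "norm (K x) \<le> 1 / norm x"
proof (cases "x = 0")
  case False
  then show ?thesis
    unfolding norm_K using two_pi_gt_3 by (intro divide_left_mono) auto
qed (simp add: norm_K)

lemma norm_Kreg:
  assumes "\<epsilon> > 0"
  shows "norm (Kreg \<epsilon> x) \<le> 1 / \<epsilon>"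
proof -
  let ?m = "max (norm x) \<epsilon>"
  have m: "max ((norm x)\<^sup>2) (\<epsilon>\<^sup>2) = ?m\<^sup>2"
    using assms by (auto simp: max_def power2_le_iff_abs_le)
  have pos: "?m > 0" using assms by auto
  have "norm (Kreg \<epsilon> x) = norm x / (2 * pi * ?m\<^sup>2)"
    unfolding Kreg_def m by simp
  also have "\<dots> \<le> ?m / (1 * ?m\<^sup>2)"
    using pos pi_gt3 by (intro frac_le mult_mono) auto
  also have "\<dots> = 1 / ?m"
    using pos by (simp add: power2_eq_square)
  also have "\<dots> \<le> 1 / \<epsilon>"
    using assms by (intro divide_left_mono) auto
  finally show ?thesis .
qed

text \<open>With the truncated radii A and B, the difference x/A^2 - y/B^2 is split at y/A^2, and
  the truncated radius is a 1-Lipschitz function of the point. The resulting terms give the factor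
  3, which 2 pi > 3 absorbs.\<close>

lemma norm_Kreg_diff_le:
  assumes "\<epsilon> > 0"
  shows "norm (Kreg \<epsilon> x - Kreg \<epsilon> y) \<le> norm (x - y) / \<epsilon>\<^sup>2"
proof -
  define A where "A = max (norm x) \<epsilon>"
  define B where "B = max (norm y) \<epsilon>"
  have A2: "max ((norm x)\<^sup>2) (\<epsilon>\<^sup>2) = A\<^sup>2" and B2: "max ((norm y)\<^sup>2) (\<epsilon>\<^sup>2) = B\<^sup>2"
    using assms by (auto simp: A_def B_def max_def power2_le_iff_abs_le)
  have A: "A \<ge> \<epsilon>" "A > 0" and B: "B \<ge> \<epsilon>" "B > 0" "norm y \<le> B"
    using assms by (auto simp: A_def B_def)
  have AB: "\<bar>A - B\<bar> \<le> norm (x - y)"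
    using norm_triangle_ineq3[of x y] by (auto simp: A_def B_def max_def split: if_splits)
  have "Kreg \<epsilon> x - Kreg \<epsilon> y = (1 / (2 * pi)) *\<^sub>R perp ((1 / A\<^sup>2) *\<^sub>R (x - y) + (1 / A\<^sup>2 - 1 / B\<^sup>2) *\<^sub>R y)"
    unfolding Kreg_def A2 B2 by (simp add: perp_add perp_diff perp_scaleR algebra_simps)
  then have "norm (Kreg \<epsilon> x - Kreg \<epsilon> y)
      = (1 / (2 * pi)) * norm ((1 / A\<^sup>2) *\<^sub>R (x - y) + (1 / A\<^sup>2 - 1 / B\<^sup>2) *\<^sub>R y)"
    by simp
  also have "\<dots> \<le> (1 / (2 * pi)) * (norm (x - y) / A\<^sup>2 + \<bar>1 / A\<^sup>2 - 1 / B\<^sup>2\<bar> * norm y)"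
    using norm_triangle_ineq[of "(1 / A\<^sup>2) *\<^sub>R (x - y)" "(1 / A\<^sup>2 - 1 / B\<^sup>2) *\<^sub>R y"]
    by (intro mult_left_mono) auto
  also have "\<dots> \<le> (1 / (2 * pi)) * (norm (x - y) / \<epsilon>\<^sup>2 + 2 * norm (x - y) / \<epsilon>\<^sup>2)"
  proof (intro mult_left_mono add_mono)
    show "norm (x - y) / A\<^sup>2 \<le> norm (x - y) / \<epsilon>\<^sup>2"
      using A assms by (intro divide_left_mono power_mono) auto
    have "\<bar>1 / A\<^sup>2 - 1 / B\<^sup>2\<bar> * norm y = \<bar>A - B\<bar> * (A + B) / (A\<^sup>2 * B\<^sup>2) * norm y"
    proof -
      have "1 / A\<^sup>2 - 1 / B\<^sup>2 = (B - A) * (A + B) / (A\<^sup>2 * B\<^sup>2)"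
        using A B by (simp add: field_simps power2_eq_square)
      then show ?thesis
        using A B by (simp add: abs_mult abs_minus_commute)
    qed
    also have "\<dots> \<le> norm (x - y) * (A + B) / (A\<^sup>2 * B\<^sup>2) * B"
      using A B AB by (intro mult_mono divide_right_mono) auto
    also have "\<dots> = norm (x - y) * (1 / (A * B) + 1 / A\<^sup>2)"
      using A B by (simp add: field_simps power2_eq_square)
    also have "\<dots> \<le> norm (x - y) * (1 / (\<epsilon> * \<epsilon>) + 1 / \<epsilon>\<^sup>2)"
      using A B assms by (intro mult_left_mono add_mono divide_left_mono mult_mono power_mono) auto
    finally show "\<bar>1 / A\<^sup>2 - 1 / B\<^sup>2\<bar> * norm y \<le> 2 * norm (x - y) / \<epsilon>\<^sup>2"
      by (simp add: power2_eq_square mult.commute)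
  qed (use assms in auto)
  also have "\<dots> = (3 / (2 * pi)) * (norm (x - y) / \<epsilon>\<^sup>2)"
    by (simp add: field_simps)
  also have "\<dots> \<le> 1 * (norm (x - y) / \<epsilon>\<^sup>2)"
    using two_pi_gt_3 by (intro mult_right_mono) auto
  finally show ?thesis by simp
qed

lemma continuous_on_Kreg [continuous_intros]:
  assumes "\<epsilon> > 0" "continuous_on S f"
  shows "continuous_on S (\<lambda>x. Kreg \<epsilon> (f x))"
proof -
  have "max ((norm y)\<^sup>2) (\<epsilon>\<^sup>2) > 0" for y :: plane
    using assms(1) by (simp add: less_max_iff_disj)
  then have "2 * pi * max ((norm (f x))\<^sup>2) (\<epsilon>\<^sup>2) \<noteq> 0" for x
    by (metis less_irrefl mult_eq_0_iff pi_neq_zero zero_neq_numeral)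
  then show ?thesis
    unfolding Kreg_def by (intro continuous_intros assms(2)) auto
qed

lemma borel_measurable_perp [measurable (raw)]:
  "f \<in> borel_measurable M \<Longrightarrow> (\<lambda>x. perp (f x)) \<in> borel_measurable M"
  by (rule measurable_compose[where N = borel and f = f],
      assumption, intro borel_measurable_continuous_onI continuous_on_perp continuous_on_id)

lemma borel_measurable_Kreg [measurable (raw)]:
  "f \<in> borel_measurable M \<Longrightarrow> (\<lambda>x. Kreg \<epsilon> (f x)) \<in> borel_measurable M"
  unfolding Kreg_def
  by (intro borel_measurable_scaleR borel_measurable_perp borel_measurable_divide
      borel_measurable_times borel_measurable_max borel_measurable_power measurable_compose[OF _ borel_measurable_norm]
      borel_measurable_const)

lemma borel_measurable_K [measurable (raw)]:
  "f \<in> borel_measurable M \<Longrightarrow> (\<lambda>x. K (f x)) \<in> borel_measurable M"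
  unfolding K_def
  by (intro borel_measurable_scaleR borel_measurable_perp borel_measurable_inverse
      borel_measurable_power measurable_compose[OF _ borel_measurable_norm] borel_measurable_const)

lemma borel_measurable_indicator_ball [measurable]:
  "indicator (ball a r) \<in> borel_measurable borel"
  by (intro borel_measurable_indicator) simp

lemma borel_measurable_indicator_K:
  "(\<lambda>x. indicator (ball 0 r) x * norm (K x)) \<in> borel_measurable borel"
  by (intro borel_measurable_times borel_measurable_indicator_ball
      measurable_compose[OF _ borel_measurable_norm] borel_measurable_K measurable_ident_sets refl)

text \<open>Inside the disc \<open>Kreg\<close> is a multiple c in [0,1] of \<open>K\<close>, so the
  difference (c - 1) K is no larger than \<open>K\<close> itself. The error of the regularisation is
  thus controlled by the mass of \<open>K\<close> near 0.\<close>

lemma norm_Kreg_minus_K: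
  assumes "\<epsilon> > 0"
  shows "norm (Kreg \<epsilon> x - K x) \<le> indicator (ball 0 \<epsilon>) x * norm (K x)"
proof (cases "norm x \<ge> \<epsilon>")
  case True
  then show ?thesis using Kreg_eq_K[OF True assms] by simp
next
  case False
  then have x: "norm x < \<epsilon>" by simp
  show ?thesis
  proof (cases "x = 0")
    case True
    then show ?thesis by (simp add: Kreg_def K_def)
  next
    case False
    define c where "c = (norm x)\<^sup>2 / \<epsilon>\<^sup>2"
    have "(norm x)\<^sup>2 < \<epsilon>\<^sup>2" using x by (intro power_strict_mono) auto
    then have c: "0 \<le> c" "c \<le> 1" "Kreg \<epsilon> x = c *\<^sub>R K x"
      using False assms x by (auto simp: c_def Kreg_def K_def max_def field_simps)
    have "Kreg \<epsilon> x - K x = (c - 1) *\<^sub>R K x"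
      using c(3) by (simp add: algebra_simps)
    then have "norm (Kreg \<epsilon> x - K x) = (1 - c) * norm (K x)"
      using c by simp
    also have "\<dots> \<le> 1 * norm (K x)"
      using c by (intro mult_right_mono) auto
    finally show ?thesis using x by simp
  qed
qed

section \<open>Local integrability of the kernel\<close>

lemma emeasure_ball_plane:
  assumes "r \<ge> 0"
  shows "emeasure lborel (ball (0::plane) r) \<le> ennreal (4 * r\<^sup>2)"
proof -
  have "ball (0::plane) r \<subseteq> cbox (- r *\<^sub>R One) (r *\<^sub>R One)"
  proof
    fix x :: plane assume "x \<in> ball 0 r"
    then have "\<bar>x \<bullet> b\<bar> \<le> r" if "b \<in> Basis" for b
      using Basis_le_norm[OF that, of x] by simp
    then show "x \<in> cbox (- r *\<^sub>R One) (r *\<^sub>R One)"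
      by (force simp: mem_box abs_le_iff)
  qed
  then have "emeasure lborel (ball (0::plane) r) \<le> emeasure lborel (cbox (- r *\<^sub>R One) (r *\<^sub>R (One::plane)))"
    by (intro emeasure_mono) auto
  also have "\<dots> = ennreal (\<Prod>b\<in>(Basis::plane set). 2 * r)"
  proof (subst emeasure_lborel_cbox)
    have *: "(r *\<^sub>R One - - r *\<^sub>R One) \<bullet> b = 2 * r" if "b \<in> Basis" for b :: plane
      unfolding inner_diff_left inner_scaleR_left using that by simp
    have "(\<Prod>b\<in>(Basis::plane set). (r *\<^sub>R One - - r *\<^sub>R One) \<bullet> b) = (\<Prod>b\<in>(Basis::plane set). 2 * r)"
      by (rule prod.cong[OF refl]) (rule *)
    then show "ennreal (\<Prod>b\<in>(Basis::plane set). (r *\<^sub>R One - - r *\<^sub>R One) \<bullet> b) = ennreal (\<Prod>b\<in>(Basis::plane set). 2 * r)"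
      by (rule arg_cong)
  qed (use assms in auto)
  also have "\<dots> = ennreal (4 * r\<^sup>2)"
    by (simp add: power_mult_distrib)
  finally show ?thesis .
qed

text \<open>A dyadic decomposition bounds \<open>|x|\<^sup>-\<^sup>1\<close> by a convergent series of multiples of
  indicators of balls.\<close>

lemma integrable_K_ball1: "integrable lborel (\<lambda>x. indicator (ball 0 1) x * norm (K x))"
proof (rule integrableI_bounded)
  show "(\<lambda>x. indicator (ball 0 1) x * norm (K x)) \<in> borel_measurable lborel"
    using borel_measurable_indicator_K by simp
  have pt: "ennreal (norm (indicator (ball 0 1) x * norm (K x)))
      \<le> (\<Sum>j. ennreal (2 ^ (j+1)) * indicator (ball 0 ((1/2)^j)) x)" for x :: plane
  proof (cases "x \<noteq> 0 \<and> norm x < 1")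
    case False
    then show ?thesis by (auto simp: K_def)
  next
    case True
    have "\<exists>j. (1/2::real)^j \<le> norm x"
      using real_arch_pow_inv[of "norm x" "1/2"] True by (auto intro: less_imp_le)
    then have "\<exists>j. (1/2::real)^j \<le> norm x \<and> (\<forall>i<j. \<not> (1/2::real)^i \<le> norm x)"
      unfolding exists_least_iff[of "\<lambda>j. (1/2::real)^j \<le> norm x"] .
    then obtain j where j: "(1/2::real)^j \<le> norm x" "\<And>i. i < j \<Longrightarrow> \<not> (1/2::real)^i \<le> norm x"
      by blast
    have "j \<noteq> 0" using j(1) True by (intro notI) simp
    then obtain i where i: "j = Suc i" by (cases j) auto
    have "norm x < (1/2)^i" using j(2)[of i] i by simp
    moreover have "norm (K x) \<le> 2^(i+1)"
    proof -
      have "norm (K x) \<le> 1 / norm x" by (rule norm_K_le)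
      also have "\<dots> \<le> 1 / (1/2)^j" using j(1) True by (intro divide_left_mono) auto
      also have "\<dots> = 2 ^ (i+1)" using i by (simp add: power_one_over)
      finally show ?thesis .
    qed
    ultimately have "ennreal (norm (indicator (ball 0 1) x * norm (K x)))
       \<le> ennreal (2 ^ (i+1)) * indicator (ball 0 ((1/2)^i)) x"
      using True by (auto simp: intro!: ennreal_leI)
    also have "\<dots> = (\<Sum>j\<in>{i}. ennreal (2 ^ (j+1)) * indicator (ball 0 ((1/2)^j)) x)"
      by (subst sum.insert) (simp_all del: sum.insert)
    also have "\<dots> \<le> (\<Sum>j. ennreal (2 ^ (j+1)) * indicator (ball 0 ((1/2)^j)) x)"
      by (intro sum_le_suminf) auto
    finally show ?thesis .
  qed
  have "(\<integral>\<^sup>+ x. ennreal (norm (indicator (ball 0 1) x * norm (K x))) \<partial>lborel)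
    \<le> (\<integral>\<^sup>+ x. (\<Sum>j. ennreal (2 ^ (j+1)) * indicator (ball 0 ((1/2)^j)) x) \<partial>(lborel :: plane measure))"
    by (intro nn_integral_mono pt)
  also have "\<dots> = (\<Sum>j. \<integral>\<^sup>+ x. ennreal (2 ^ (j+1)) * indicator (ball 0 ((1/2)^j)) x \<partial>(lborel :: plane measure))"
    by (intro nn_integral_suminf borel_measurable_times_ennreal borel_measurable_indicator) simp_all
  also have "\<dots> = (\<Sum>j. ennreal (2 ^ (j+1)) * emeasure lborel (ball (0::plane) ((1/2)^j)))"
    by (simp add: nn_integral_cmult)
  also have "\<dots> \<le> (\<Sum>j. ennreal (8 * (1/2)^j))"
  proof (intro suminf_le allI)
    fix j :: nat
    have "ennreal (2 ^ (j+1)) * emeasure lborel (ball (0::plane) ((1/2)^j))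
       \<le> ennreal (2 ^ (j+1)) * ennreal (4 * ((1/2)^j)\<^sup>2)"
      by (intro mult_left_mono emeasure_ball_plane) auto
    also have "\<dots> = ennreal (2 ^ (j+1) * (4 * ((1/2)^j)\<^sup>2))"
      by (rule ennreal_mult[symmetric]) auto
    also have "2 ^ (j+1) * (4 * ((1/2)^j)\<^sup>2) = (8 * (1/2)^j :: real)"
      by (simp add: power2_eq_square power_one_over field_simps)
    finally show "ennreal (2 ^ (j+1)) * emeasure lborel (ball (0::plane) ((1/2)^j)) \<le> ennreal (8 * (1/2)^j)" .
  qed auto
  also have "\<dots> = ennreal (\<Sum>j. 8 * (1/2)^j)"
    by (intro suminf_ennreal2 summable_mult summable_geometric) auto
  also have "\<dots> < \<infinity>" by simp
  finally show "(\<integral>\<^sup>+ x. ennreal (norm (indicator (ball 0 1) (x::plane) * norm (K x))) \<partial>lborel) < \<infinity>" .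
qed

lemma integrable_K_ball: "integrable lborel (\<lambda>x. indicator (ball 0 r) x * norm (K x))"
proof -
  have "integrable lborel (\<lambda>x::plane. indicator (ball 0 1) x * norm (K x) + indicator (ball 0 r) x)"
    by (intro Bochner_Integration.integrable_add integrable_K_ball1 integrable_real_indicator)
       (use emeasure_lborel_ball_finite[of "0::plane" r] in simp_all)
  then show ?thesis
  proof (rule Bochner_Integration.integrable_bound)
    show "AE x in lborel. norm (indicator (ball 0 r) x * norm (K x)) \<le>
       norm (indicator (ball 0 1) (x::plane) * norm (K x) + indicator (ball 0 r) x)"
    proof (intro AE_I2)
      fix x :: plane
      have "norm (K x) \<le> 1" if "norm x \<ge> 1"
        using norm_K_le[of x] that by (smt (verit) divide_le_eq_1)
      then show "norm (indicator (ball 0 r) x * norm (K x)) \<le>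
         norm (indicator (ball 0 1) (x::plane) * norm (K x) + indicator (ball 0 r) x)"
        by (auto simp: indicator_def)
    qed
  qed (use borel_measurable_indicator_K in simp_all)
qed

text \<open>The modulus of local integrability of \<open>K\<close>: for a density bounded by M,
  cutting the kernel at radius r changes the velocity by at most M times this quantity, uniformly in
  the point.\<close>

definition K_mass :: "real \<Rightarrow> real" where
  "K_mass r = (LINT x|lborel. indicator (ball 0 r) x * norm (K x))"

lemma K_mass_nonneg: "K_mass r \<ge> 0"
  unfolding K_mass_def by (intro integral_nonneg_AE) auto

lemma K_mass_tendsto_0:
  assumes "r \<longlonglongrightarrow> 0"
  shows "(\<lambda>n::nat. K_mass (r n)) \<longlonglongrightarrow> 0"
proof -
  have ev: "eventually (\<lambda>n. r n < 1) sequentially"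
    using order_tendstoD(2)[OF assms, of 1] by simp
  \<comment> \<open>The cap at 1 supplies a dominating function that does not depend on n; it is
    inactive for large n.\<close>
  have "(\<lambda>n. LINT x|lborel. indicator (ball 0 (min 1 (r n))) x * norm (K x)) \<longlonglongrightarrow> (LINT x|(lborel::plane measure). 0)"
  proof (rule integral_dominated_convergence[where w = "\<lambda>x. indicator (ball 0 1) x * norm (K x)"])
    show "AE x in lborel. (\<lambda>n. indicator (ball 0 (min 1 (r n))) x * norm (K x)) \<longlonglongrightarrow> 0"
    proof (intro AE_I2)
      fix x :: plane
      show "(\<lambda>n. indicator (ball 0 (min 1 (r n))) x * norm (K x)) \<longlonglongrightarrow> 0"
      proof (cases "x = 0")
        case False
        then have "eventually (\<lambda>n. r n < norm x) sequentially"
          using order_tendstoD(2)[OF assms, of "norm x"] by simp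
        then have "eventually (\<lambda>n. indicator (ball 0 (min 1 (r n))) x * norm (K x) = 0) sequentially"
          by eventually_elim auto
        then show ?thesis by (rule tendsto_eventually)
      qed (simp add: K_def)
    qed
    show "AE x in lborel. norm (indicator (ball 0 (min 1 (r n))) x * norm (K x)) \<le> indicator (ball 0 1) x * norm (K x)" for n
      by (intro AE_I2) (auto simp: indicator_def)
  qed (use borel_measurable_indicator_K integrable_K_ball in simp_all)
  then have "(\<lambda>n. K_mass (min 1 (r n))) \<longlonglongrightarrow> 0" by (simp add: K_mass_def)
  moreover have "eventually (\<lambda>n. K_mass (min 1 (r n)) = K_mass (r n)) sequentially"
    using ev by eventually_elim (simp add: min_def)
  ultimately show ?thesis by (rule Lim_transform_eventually)
qed

section \<open>Functionals on \<open>L\<^sup>1\<close> and an asymptotic Ascoli theorem\<close>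

text \<open>In \<open>integrable_induct\<close> the limit step speaks of dominated pointwise
  convergence. Convergence in L^1 is the form that fits functionals bounded by a multiple of the L^1
  norm.\<close>

lemma integrable_L1_induct [consumes 1, case_names base add scale lim]:
  fixes f :: "'a \<Rightarrow> real"
  assumes "integrable M f"
    and base: "\<And>A. A \<in> sets M \<Longrightarrow> emeasure M A < \<infinity> \<Longrightarrow> P (indicator A)"
    and add: "\<And>f g. integrable M f \<Longrightarrow> integrable M g \<Longrightarrow> P f \<Longrightarrow> P g \<Longrightarrow> P (\<lambda>x. f x + g x)"
    and scale: "\<And>c f. integrable M f \<Longrightarrow> P f \<Longrightarrow> P (\<lambda>x. c * f x)"
    and lim: "\<And>f s. integrable M f \<Longrightarrow> (\<And>i::nat. integrable M (s i)) \<Longrightarrow> (\<And>i. P (s i)) \<Longrightarrow>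
       (\<lambda>i. LINT x|M. \<bar>s i x - f x\<bar>) \<longlonglongrightarrow> 0 \<Longrightarrow> P f"
  shows "P f"
  using assms(1)
proof (induction rule: integrable_induct)
  case (base A c)
  have "P (\<lambda>x. c * indicator A x)"
    by (rule scale) (use base assms(2) in auto)
  then show ?case by (simp add: mult.commute)
next
  case (add f g)
  then show ?case by (intro assms(3)) auto
next
  case (lim f s)
  have "(\<lambda>i. LINT x|M. \<bar>s i x - f x\<bar>) \<longlonglongrightarrow> (LINT x|M. 0)"
  \<comment> \<open>The approximants satisfy |s i| \<le> 2 |f|, hence the factor 3.\<close>
  proof (rule integral_dominated_convergence[where w = "\<lambda>x. 3 * \<bar>f x\<bar>"])
    show "AE x in M. (\<lambda>i. \<bar>s i x - f x\<bar>) \<longlonglongrightarrow> 0"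
    proof (intro AE_I2)
      fix x assume "x \<in> space M"
      then have "(\<lambda>i. s i x - f x) \<longlonglongrightarrow> 0"
        using lim(2) LIM_zero by blast
      then show "(\<lambda>i. \<bar>s i x - f x\<bar>) \<longlonglongrightarrow> 0"
        by (rule tendsto_rabs_zero)
    qed
    show "AE x in M. norm \<bar>s i x - f x\<bar> \<le> 3 * \<bar>f x\<bar>" for i
    proof (intro AE_I2)
      fix x assume "x \<in> space M"
      then have "\<bar>s i x\<bar> \<le> 2 * \<bar>f x\<bar>" using lim(3)[of x i] by simp
      then show "norm \<bar>s i x - f x\<bar> \<le> 3 * \<bar>f x\<bar>" by simp
    qed
  qed (use lim(1,4) in auto)
  then show ?case
    using lim by (intro assms(5)[of f s]) auto
qed

text \<open>The dual of L^1 is L^\<infinity>. The set function F(1_A) + C mu(A) is nonnegative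
  because |F(1_A)| \<le> C mu(A), so Radon-Nikodym applies to an ordinary measure and no signed
  measures occur; its density minus C represents F.\<close>

lemma L1_functional_finite_measure:
  fixes F :: "('a \<Rightarrow> real) \<Rightarrow> real"
  assumes fin: "finite_measure M" and C: "C \<ge> 0"
    and add: "\<And>f g. integrable M f \<Longrightarrow> integrable M g \<Longrightarrow> F (\<lambda>x. f x + g x) = F f + F g"
    and scale: "\<And>c f. integrable M f \<Longrightarrow> F (\<lambda>x. c * f x) = c * F f"
    and bound: "\<And>f. integrable M f \<Longrightarrow> \<bar>F f\<bar> \<le> C * (LINT x|M. \<bar>f x\<bar>)"
  shows "\<exists>k\<in>borel_measurable M. (\<forall>x. \<bar>k x\<bar> \<le> C) \<and>
      (\<forall>f. integrable M f \<longrightarrow> F f = (LINT x|M. k x * f x))"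
proof -
  interpret finite_measure M by fact
  have ind: "integrable M (indicator A :: 'a \<Rightarrow> real)" if "A \<in> sets M" for A
    using that by (intro integrable_real_indicator) (auto simp: emeasure_finite less_top[symmetric])
  have diff: "F (\<lambda>x. f x - g x) = F f - F g" if "integrable M f" "integrable M g" for f g
    using add[of f "\<lambda>x. (-1) * g x"] scale[of g "-1"] that by simp
  have F0: "F (\<lambda>x. 0) = 0"
    using scale[of "\<lambda>x. 0" 0] by simp
  have Fsum: "F (\<lambda>x. \<Sum>i<n. f i x) = (\<Sum>i<n. F (f i))" if "\<And>i. integrable M (f i)"
    for f :: "nat \<Rightarrow> 'a \<Rightarrow> real" and n :: nat
  proof (induction n)
    case (Suc n)
    show ?case using add[of "\<lambda>x. \<Sum>i<n. f i x" "f n"] that Suc by simp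
  qed (simp add: F0)
  have bi: "\<bar>F (indicator A)\<bar> \<le> C * measure M A" if "A \<in> sets M" for A
    using bound[OF ind[OF that]] that by simp
  define \<nu> where "\<nu> A = ennreal (F (indicator A) + C * measure M A)" for A
  define N where "N = measure_of (space M) (sets M) \<nu>"
  have N: "emeasure N A = \<nu> A" if "A \<in> sets M" for A
    unfolding N_def
  proof (rule emeasure_measure_of_sigma)
    show "positive (sets M) \<nu>"
      using bi[of "{}"] by (auto simp: positive_def \<nu>_def)
    show "countably_additive (sets M) \<nu>"
    proof (rule countably_additiveI)
      fix A :: "nat \<Rightarrow> 'a set"
      assume A: "range A \<subseteq> sets M" "disjoint_family A" "(\<Union>i. A i) \<in> sets M"
      have Ai: "A i \<in> sets M" for i using A by auto
      have m: "(\<lambda>i. measure M (A i)) sums measure M (\<Union>i. A i)"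
        by (rule finite_measure_UNION) (use A in auto)
      have le: "(\<Sum>i<n. indicator (A i) x) \<le> (indicator (\<Union>i. A i) x :: real)" for n x
      proof -
        have "(\<Sum>i<n. indicator (A i) x) = (indicator (\<Union>i<n. A i) x :: real)"
          by (subst indicator_UN_disjoint) (use A(2) in \<open>auto intro: disjoint_family_on_mono\<close>)
        then show ?thesis by (auto simp: indicator_def)
      qed
      \<comment> \<open>By linearity the defect of additivity is F of the indicator of the remaining
        union, at most C times its measure, which tends to 0.\<close>
      have "(\<lambda>n. F (indicator (\<Union>i. A i)) - (\<Sum>i<n. F (indicator (A i)))) \<longlonglongrightarrow> 0"
      proof (rule Lim_null_comparison)
        have "(\<lambda>n. measure M (\<Union>i. A i) - (\<Sum>i<n. measure M (A i))) \<longlonglongrightarrow> 0"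
          using tendsto_diff[OF tendsto_const m[unfolded sums_def], of "measure M (\<Union>i. A i)"] by simp
        then show "(\<lambda>n. C * (measure M (\<Union>i. A i) - (\<Sum>i<n. measure M (A i)))) \<longlonglongrightarrow> 0"
          by (rule tendsto_mult_right_zero)
        show "\<forall>\<^sub>F n in sequentially. norm (F (indicator (\<Union>i. A i)) - (\<Sum>i<n. F (indicator (A i))))
          \<le> C * (measure M (\<Union>i. A i) - (\<Sum>i<n. measure M (A i)))"
        proof (intro always_eventually allI)
          fix n
          have i: "integrable M (\<lambda>x. \<Sum>i<n. indicator (A i) x :: real)"
            by (intro Bochner_Integration.integrable_sum ind Ai)
          have "F (indicator (\<Union>i. A i)) - (\<Sum>i<n. F (indicator (A i)))
             = F (\<lambda>x. indicator (\<Union>i. A i) x - (\<Sum>i<n. indicator (A i) x))"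
            by (simp add: diff[OF ind[OF A(3)] i] Fsum[OF ind[OF Ai]])
          also have "norm \<dots> \<le> C * (LINT x|M. \<bar>indicator (\<Union>i. A i) x - (\<Sum>i<n. indicator (A i) x)\<bar>)"
            using bound[of "\<lambda>x. indicator (\<Union>i. A i) x - (\<Sum>i<n. indicator (A i) x)"] ind[OF A(3)] i by simp
          also have "(LINT x|M. \<bar>indicator (\<Union>i. A i) x - (\<Sum>i<n. indicator (A i) x :: real)\<bar>)
             = (LINT x|M. indicator (\<Union>i. A i) x - (\<Sum>i<n. indicator (A i) x))"
            using le by (intro Bochner_Integration.integral_cong refl) (simp add: abs_of_nonneg)
          also have "\<dots> = measure M (\<Union>i. A i) - (\<Sum>i<n. measure M (A i))"
            using A(3) Ai by (subst Bochner_Integration.integral_diff[OF ind[OF A(3)] i])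
              (simp add: Bochner_Integration.integral_sum[OF ind[OF Ai]])
          finally show "norm (F (indicator (\<Union>i. A i)) - (\<Sum>i<n. F (indicator (A i))))
            \<le> C * (measure M (\<Union>i. A i) - (\<Sum>i<n. measure M (A i)))" .
        qed
      qed
      then have "(\<lambda>i. F (indicator (A i))) sums F (indicator (\<Union>i. A i))"
        unfolding sums_def using tendsto_diff[OF tendsto_const[of "F (indicator (\<Union>i. A i))"]] by fastforce
      then have "(\<lambda>i. F (indicator (A i)) + C * measure M (A i)) sums (F (indicator (\<Union>i. A i)) + C * measure M (\<Union>i. A i))"
        by (intro sums_add sums_mult m)
      then show "(\<Sum>i. \<nu> (A i)) = \<nu> (\<Union>i. A i)"
        unfolding \<nu>_def
      proof (rule suminf_ennreal_eq[rotated])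
        show "0 \<le> F (indicator (A i)) + C * measure M (A i)" for i
          using bi[OF Ai, of i] by linarith
      qed
    qed
  qed (use that sets.sigma_algebra_axioms in auto)
  have sN: "sets N = sets M" by (simp add: N_def)
  have "absolutely_continuous M N"
    unfolding absolutely_continuous_def
  proof
    fix A assume A: "A \<in> null_sets M"
    then have "A \<in> sets M" "measure M A = 0" by (auto simp: null_sets_def measure_def)
    then have "emeasure N A = 0" using bi[of A] by (simp add: N \<nu>_def)
    then show "A \<in> null_sets N" using \<open>A \<in> sets M\<close> sN by auto
  qed
  from Radon_Nikodym[OF this sN] obtain f where f: "f \<in> borel_measurable M" "density M f = N"
    by auto
  have ff: "(\<integral>\<^sup>+x. f x * indicator A x \<partial>M) = \<nu> A" if "A \<in> sets M" for A
    using N[OF that] that f by (metis emeasure_density)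
  have "(\<integral>\<^sup>+x. f x \<partial>M) = \<nu> (space M)"
    using ff[of "space M"] by (simp cong: nn_integral_cong)
  then have fin_f: "(\<integral>\<^sup>+x. f x \<partial>M) \<noteq> \<infinity>"
    by (simp add: \<nu>_def)
  have aef: "AE x in M. f x = ennreal (enn2real (f x))"
    using nn_integral_PInf_AE[OF f(1) fin_f] by eventually_elim (auto simp: less_top)
  define g where "g x = enn2real (f x)" for x
  have g: "g \<in> borel_measurable M" "\<And>x. g x \<ge> 0" using f(1) by (auto simp: g_def[abs_def])
  have gi: "integrable M g"
  proof (rule integrableI_nonneg)
    have "(\<integral>\<^sup>+x. ennreal (g x) \<partial>M) = (\<integral>\<^sup>+x. f x \<partial>M)"
      using aef by (intro nn_integral_cong_AE) (auto simp: g_def)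
    then show "(\<integral>\<^sup>+x. ennreal (g x) \<partial>M) < \<infinity>" using fin_f by (simp add: less_top)
  qed (use g in auto)
  have gA: "(LINT x|M. g x * indicator A x) = F (indicator A) + C * measure M A" if "A \<in> sets M" for A
  proof (rule integral_eq_nn_integral[THEN trans])
    have "(\<integral>\<^sup>+x. ennreal (g x * indicator A x) \<partial>M) = (\<integral>\<^sup>+x. f x * indicator A x \<partial>M)"
      using aef by (intro nn_integral_cong_AE) (auto simp: g_def indicator_def)
    also have "\<dots> = \<nu> A" by (rule ff[OF that])
    finally show "enn2real (\<integral>\<^sup>+x. ennreal (g x * indicator A x) \<partial>M) = F (indicator A) + C * measure M A"
      using bi[OF that] by (simp add: \<nu>_def abs_le_iff)
  qed (use g that in auto)
  define k0 where "k0 x = g x - C" for x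
  have k0i: "integrable M k0" unfolding k0_def using gi by auto
  have k0A: "(LINT x|M. k0 x * indicator A x) = F (indicator A)" if "A \<in> sets M" for A
  proof -
    have "(LINT x|M. k0 x * indicator A x) = (LINT x|M. g x * indicator A x - C * indicator A x)"
      by (intro Bochner_Integration.integral_cong) (auto simp: k0_def algebra_simps)
    also have "\<dots> = (LINT x|M. g x * indicator A x) - (LINT x|M. C * indicator A x)"
      using that gi ind[OF that] by (intro Bochner_Integration.integral_diff integrable_real_mult_indicator) auto
    finally show ?thesis using gA[OF that] that by simp
  qed
  have [measurable]: "k0 \<in> borel_measurable M" using k0i by auto
  \<comment> \<open>The two signs give the two halves of |k0| \<le> C almost everywhere: on the set
    where s k0 exceeds C the excess has nonpositive integral, by the bound on F at the indicator of
    that set.\<close>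
  have up: "AE x in M. s * k0 x \<le> C" if s: "s = 1 \<or> s = -1" for s
  proof -
    define A where "A = {x\<in>space M. s * k0 x > C}"
    have A: "A \<in> sets M" unfolding A_def by measurable
    have i: "integrable M (\<lambda>x. (s * k0 x - C) * indicator A x)"
      using A k0i by (intro integrable_real_mult_indicator) auto
    have nn: "(s * k0 x - C) * indicator A x \<ge> 0" for x by (auto simp: A_def indicator_def)
    have "(LINT x|M. (s * k0 x - C) * indicator A x) = (LINT x|M. s * (k0 x * indicator A x) - C * indicator A x)"
      by (intro Bochner_Integration.integral_cong) (auto simp: algebra_simps)
    also have "\<dots> = (LINT x|M. s * (k0 x * indicator A x)) - (LINT x|M. C * indicator A x)"
      using A k0i ind[OF A] by (intro Bochner_Integration.integral_diff integrable_mult_right integrable_real_mult_indicator) auto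
    also have "\<dots> = s * F (indicator A) - C * measure M A"
      using k0A[OF A] A by simp
    also have "\<dots> \<le> 0" using bi[OF A] s by (auto simp: abs_le_iff)
    finally have "(LINT x|M. (s * k0 x - C) * indicator A x) = 0"
      using integral_nonneg_AE[where M = M and f = "\<lambda>x. (s * k0 x - C) * indicator A x"] nn
      by (auto intro: antisym)
    then have "AE x in M. (s * k0 x - C) * indicator A x = 0"
      using integral_nonneg_eq_0_iff_AE[OF i] nn by auto
    moreover have "AE x in M. x \<in> space M" by (rule AE_space)
    ultimately show ?thesis
      by eventually_elim (auto simp: A_def indicator_def split: if_splits)
  qed
  have ae: "AE x in M. \<bar>k0 x\<bar> \<le> C"
    using up[of 1, simplified] up[of "-1", simplified] by eventually_elim auto
  \<comment> \<open>Clipping changes \<open>k0\<close> only on a null set and makes the bound hold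
    at every point, as the class \<open>vort\<close> will demand.\<close>
  define k where "k x = max (-C) (min C (k0 x))" for x
  have km [measurable]: "k \<in> borel_measurable M" unfolding k_def by measurable
  have kb: "\<bar>k x\<bar> \<le> C" for x unfolding k_def using C by auto
  have aek: "AE x in M. k x = k0 x"
    using ae by eventually_elim (auto simp: k_def)
  have ki: "integrable M (\<lambda>x. k x * f x)" if "integrable M f" for f
  proof (rule Bochner_Integration.integrable_bound[where f = "\<lambda>x. C * f x"])
    show "AE x in M. norm (k x * f x) \<le> norm (C * f x)"
      using kb C by (auto simp: abs_mult intro!: AE_I2 mult_right_mono)
  qed (use that in auto)
  have "F f = (LINT x|M. k x * f x)" if "integrable M f" for f
    using that
  proof (induction rule: integrable_L1_induct)
    case (base A)
    have "(LINT x|M. k x * indicator A x) = (LINT x|M. k0 x * indicator A x)"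
      using aek base by (intro integral_cong_AE) auto
    then show ?case using k0A base by simp
  next
    case (add f g)
    then show ?case using ki assms(3) by (simp add: distrib_left)
  next
    case (scale c f)
    have "(LINT x|M. k x * (c * f x)) = (LINT x|M. c * (k x * f x))"
      by (intro Bochner_Integration.integral_cong) auto
    then show ?case using scale assms(4) by simp
  next
    case (lim f s)
    have "(\<lambda>i. F (s i) - F f) \<longlonglongrightarrow> 0"
    proof (rule Lim_null_comparison)
      show "(\<lambda>i. C * (LINT x|M. \<bar>s i x - f x\<bar>)) \<longlonglongrightarrow> 0"
        by (rule tendsto_mult_right_zero[OF lim.hyps(3)])
      show "\<forall>\<^sub>F i in sequentially. norm (F (s i) - F f) \<le> C * (LINT x|M. \<bar>s i x - f x\<bar>)"
      proof (intro always_eventually allI)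
        show "norm (F (s i) - F f) \<le> C * (LINT x|M. \<bar>s i x - f x\<bar>)" for i
          using lim.hyps(1,2) bound[of "\<lambda>x. s i x - f x"] by (simp add: diff)
      qed
    qed
    then have 1: "(\<lambda>i. F (s i)) \<longlonglongrightarrow> F f" by (rule LIM_zero_cancel)
    have "(\<lambda>i. (LINT x|M. k x * s i x) - (LINT x|M. k x * f x)) \<longlonglongrightarrow> 0"
    proof (rule Lim_null_comparison)
      show "(\<lambda>i. C * (LINT x|M. \<bar>s i x - f x\<bar>)) \<longlonglongrightarrow> 0"
        by (rule tendsto_mult_right_zero[OF lim.hyps(3)])
      show "\<forall>\<^sub>F i in sequentially. norm ((LINT x|M. k x * s i x) - (LINT x|M. k x * f x)) \<le> C * (LINT x|M. \<bar>s i x - f x\<bar>)"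
      proof (intro always_eventually allI)
        fix i
        have "norm ((LINT x|M. k x * s i x) - (LINT x|M. k x * f x)) = norm (LINT x|M. k x * (s i x - f x))"
          using lim ki by (simp add: right_diff_distrib)
        also have "\<dots> \<le> (LINT x|M. norm (k x * (s i x - f x)))"
          by (rule integral_norm_bound)
        also have "\<dots> \<le> (LINT x|M. C * \<bar>s i x - f x\<bar>)"
          using lim kb by (intro integral_mono integrable_norm ki) (auto simp: abs_mult intro!: mult_right_mono)
        finally show "norm ((LINT x|M. k x * s i x) - (LINT x|M. k x * f x)) \<le> C * (LINT x|M. \<bar>s i x - f x\<bar>)" by simp
      qed
    qed
    then have "(\<lambda>i. (LINT x|M. k x * s i x)) \<longlonglongrightarrow> (LINT x|M. k x * f x)" by (rule LIM_zero_cancel)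
    then show ?case using 1 lim.IH LIMSEQ_unique by simp
  qed
  then show ?thesis using km kb by blast
qed

text \<open>Multiplication by a strictly positive integrable \<eta> carries L^1 of the finite
  measure \<eta> dx isometrically onto L^1(dx); the representing function is the same for
  both.\<close>

lemma L1_functional_lborel:
  fixes F :: "('a::euclidean_space \<Rightarrow> real) \<Rightarrow> real"
  assumes C: "C \<ge> 0"
    and add: "\<And>f g. integrable lborel f \<Longrightarrow> integrable lborel g \<Longrightarrow> F (\<lambda>x. f x + g x) = F f + F g"
    and scale: "\<And>c f. integrable lborel f \<Longrightarrow> F (\<lambda>x. c * f x) = c * F f"
    and bound: "\<And>f. integrable lborel f \<Longrightarrow> \<bar>F f\<bar> \<le> C * (LINT x|lborel. \<bar>f x\<bar>)"
  shows "\<exists>k\<in>borel_measurable borel. (\<forall>x. \<bar>k x\<bar> \<le> C) \<and>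
      (\<forall>f. integrable lborel f \<longrightarrow> F f = (LINT x|lborel. k x * f x))"
proof -
  obtain h :: "'a \<Rightarrow> ennreal" where h: "h \<in> borel_measurable lborel" "integral\<^sup>N lborel h \<noteq> \<infinity>"
     "\<And>x. 0 < h x \<and> h x < \<infinity>"
    using sigma_finite_measure.Ex_finite_integrable_function[OF sigma_finite_lborel] by auto
  define \<eta> where "\<eta> x = enn2real (h x)" for x
  have \<eta>: "\<eta> \<in> borel_measurable lborel" "\<And>x. \<eta> x > 0" "\<And>x. h x = ennreal (\<eta> x)"
    using h by (auto simp: \<eta>_def[abs_def] enn2real_positive_iff)
  define M where "M = density lborel (\<lambda>x. ennreal (\<eta> x))"
  have fin: "finite_measure M"
  proof (rule finite_measureI)
    show "emeasure M (space M) \<noteq> \<infinity>"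
      using h \<eta> by (simp add: M_def emeasure_density cong: nn_integral_cong)
  qed
  have int: "integrable M f \<longleftrightarrow> integrable lborel (\<lambda>x. \<eta> x * f x)"
    "integral\<^sup>L M f = (LINT x|lborel. \<eta> x * f x)" if "f \<in> borel_measurable borel" for f :: "'a \<Rightarrow> real"
    unfolding M_def using \<eta> that
    by (simp_all add: integrable_density integral_density less_imp_le)
  have meas: "f \<in> borel_measurable borel" if "integrable M f" for f :: "'a \<Rightarrow> real"
    using borel_measurable_integrable[OF that] by (simp add: M_def)
  have "\<exists>k\<in>borel_measurable M. (\<forall>x. \<bar>k x\<bar> \<le> C) \<and>
      (\<forall>f. integrable M f \<longrightarrow> F (\<lambda>x. \<eta> x * f x) = (LINT x|M. k x * f x))"
  proof (rule L1_functional_finite_measure[OF fin C])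
    fix f g :: "'a \<Rightarrow> real" and c assume *: "integrable M f"
    have fi: "integrable lborel (\<lambda>x. \<eta> x * f x)" using int(1)[OF meas[OF *]] * by simp
    have "F (\<lambda>x. c * (\<eta> x * f x)) = c * F (\<lambda>x. \<eta> x * f x)" by (rule scale[OF fi])
    then show "F (\<lambda>x. \<eta> x * (c * f x)) = c * F (\<lambda>x. \<eta> x * f x)" by (simp add: mult.left_commute)
    show "\<bar>F (\<lambda>x. \<eta> x * f x)\<bar> \<le> C * (LINT x|M. \<bar>f x\<bar>)"
      using bound[OF fi] int(2)[of "\<lambda>x. \<bar>f x\<bar>"] meas[OF *] \<eta>(2) by (simp add: abs_mult less_imp_le)
    assume "integrable M g"
    then have "integrable lborel (\<lambda>x. \<eta> x * g x)" using int(1)[OF meas] by simp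
    from add[OF fi this] show "F (\<lambda>x. \<eta> x * (f x + g x)) = F (\<lambda>x. \<eta> x * f x) + F (\<lambda>x. \<eta> x * g x)"
      by (simp add: distrib_left)
  qed
  then obtain k where k: "k \<in> borel_measurable borel" "\<forall>x. \<bar>k x\<bar> \<le> C"
     "\<And>f. integrable M f \<Longrightarrow> F (\<lambda>x. \<eta> x * f x) = (LINT x|M. k x * f x)"
    by (auto simp: M_def)
  have "F f = (LINT x|lborel. k x * f x)" if f: "integrable lborel f" for f
  proof -
    have [measurable]: "f \<in> borel_measurable borel" using f by auto
    have m: "(\<lambda>x. f x / \<eta> x) \<in> borel_measurable borel" using \<eta>(1) by simp
    have [simp]: "\<eta> x * (f x / \<eta> x) = f x" for x using \<eta>(2)[of x] by simp
    have "F f = F (\<lambda>x. \<eta> x * (f x / \<eta> x))" by (simp only: \<open>\<And>x. \<eta> x * (f x / \<eta> x) = f x\<close>)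
    also have "\<dots> = (LINT x|M. k x * (f x / \<eta> x))"
      using f by (intro k(3)) (simp only: int(1)[OF m] \<open>\<And>x. \<eta> x * (f x / \<eta> x) = f x\<close>)
    also have "\<dots> = (LINT x|lborel. \<eta> x * (k x * (f x / \<eta> x)))"
      using k(1) m by (intro int(2)) (rule borel_measurable_times)
    also have "\<dots> = (LINT x|lborel. k x * f x)"
      by (intro Bochner_Integration.integral_cong refl)
        (simp only: mult.left_commute[of "\<eta> _"] \<open>\<And>x. \<eta> x * (f x / \<eta> x) = f x\<close>)
    finally show ?thesis .
  qed
  then show ?thesis using k by blast
qed

text \<open>The functions will be step functions of time, equicontinuous only up to an error
  \<open>e j n\<close> that vanishes with n. A diagonal sequence converging at countably many times
  is Cauchy at each fixed time, by comparison with a nearby time of the countable set.\<close>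

lemma asymptotic_Ascoli:
  fixes f :: "nat \<Rightarrow> 'j::countable \<Rightarrow> real \<Rightarrow> 'b::euclidean_space"
  assumes T: "0 \<le> T"
    and bound: "\<And>n j t. t \<in> {0..T} \<Longrightarrow> norm (f n j t) \<le> B j"
    and equi: "\<And>n j s t. s \<in> {0..T} \<Longrightarrow> t \<in> {0..T} \<Longrightarrow> norm (f n j t - f n j s) \<le> L j * \<bar>t - s\<bar> + e j n"
    and e: "\<And>j. e j \<longlonglongrightarrow> 0"
  obtains r where "strict_mono (r :: nat \<Rightarrow> nat)" "\<And>j t. t \<in> {0..T} \<Longrightarrow> convergent (\<lambda>n. f (r n) j t)"
proof -
  \<comment> \<open>Clamping the rationals to [0,T] yields a countable set of times within [0,T]
    that comes arbitrarily close to each of its points, the end points included, even if T =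
    0.\<close>
  define cl where "cl t = max 0 (min T t)" for t
  have cl: "cl t \<in> {0..T}" "s \<in> {0..T} \<Longrightarrow> \<bar>cl t - s\<bar> \<le> \<bar>t - s\<bar>" for s t
    using T by (auto simp: cl_def)
  \<comment> \<open>The scaling by 1 + |B| turns the bounds, which vary with the index, into the
    single bound 1 used in \<open>function_convergent_subsequence\<close>.\<close>
  define g where "g n p = (1 / (1 + \<bar>B (fst p)\<bar>)) *\<^sub>R f n (fst p) (cl (of_rat (snd p)))"
    for n :: nat and p :: "'j \<times> rat"
  have "norm (g n p) \<le> 1" for n p
  proof -
    have "norm (f n (fst p) (cl (of_rat (snd p)))) \<le> 1 + \<bar>B (fst p)\<bar>"
      using bound[OF cl(1), of n "fst p" "of_rat (snd p)"] by linarith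
    then show ?thesis by (simp add: g_def divide_le_eq)
  qed
  note g_le = this
  obtain r where r: "strict_mono (r::nat\<Rightarrow>nat)" "\<And>p. \<exists>l. (\<lambda>n. g (r n) p) \<longlonglongrightarrow> l"
    by (rule function_convergent_subsequence[of "UNIV :: ('j \<times> rat) set" g 1])
      (use g_le in auto)
  have cv: "convergent (\<lambda>n. f (r n) j (cl (of_rat q)))" for j q
  proof -
    have "convergent (\<lambda>n. (1 + \<bar>B j\<bar>) *\<^sub>R g (r n) (j, q))"
      using r(2)[of "(j, q)"] tendsto_scaleR[OF tendsto_const] unfolding convergent_def by blast
    moreover have "(1 + \<bar>B j\<bar>) *\<^sub>R g (r n) (j, q) = f (r n) j (cl (of_rat q))" for n
      by (simp add: g_def add_nonneg_eq_0_iff)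
    ultimately show ?thesis by simp
  qed
  have "convergent (\<lambda>n. f (r n) j t)" if t: "t \<in> {0..T}" for j t
  proof (rule Cauchy_convergent, rule metric_CauchyI)
    fix \<epsilon> :: real assume \<epsilon>: "\<epsilon> > 0"
    define d where "d = \<epsilon> / (8 * (1 + \<bar>L j\<bar>))"
    have d: "d > 0" "L j * d \<le> \<epsilon> / 8"
    proof -
      show "d > 0" using \<epsilon> by (simp add: d_def)
      have "L j * d \<le> (1 + \<bar>L j\<bar>) * d" using \<open>d > 0\<close> by (intro mult_right_mono) auto
      also have "\<dots> = \<epsilon> / 8"
      proof -
        have "1 + \<bar>L j\<bar> \<noteq> 0" by linarith
        moreover have "D * (\<epsilon> / (8 * D)) = \<epsilon> / 8" if "D \<noteq> 0" for D :: real
          using that by simp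
        ultimately show ?thesis unfolding d_def by blast
      qed
      finally show "L j * d \<le> \<epsilon> / 8" .
    qed
    obtain q where q: "t < of_rat q" "of_rat q < t + d"
      using of_rat_dense[of t "t + d"] d by auto
    define s where "s = cl (of_rat q)"
    have s: "s \<in> {0..T}" "\<bar>t - s\<bar> \<le> d" using cl(1) cl(2)[OF t, of "of_rat q"] q by (auto simp: s_def)
    have "eventually (\<lambda>n. e j (r n) < \<epsilon> / 8) sequentially"
      using order_tendstoD(2)[OF LIMSEQ_subseq_LIMSEQ[OF e r(1)], of "\<epsilon> / 8"] \<epsilon> by (simp add: o_def)
    then obtain N1 where N1: "\<And>n. n \<ge> N1 \<Longrightarrow> e j (r n) < \<epsilon> / 8"
      by (auto simp: eventually_sequentially)
    have "Cauchy (\<lambda>n. f (r n) j s)" using cv[of j q] convergent_Cauchy by (auto simp: s_def)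
    then obtain N2 where N2: "\<And>m n. m \<ge> N2 \<Longrightarrow> n \<ge> N2 \<Longrightarrow> dist (f (r m) j s) (f (r n) j s) < \<epsilon> / 4"
      using \<epsilon> metric_CauchyD[of "\<lambda>n. f (r n) j s" "\<epsilon> / 4"] by auto
    have near: "dist (f (r n) j t) (f (r n) j s) < \<epsilon> / 4" if "n \<ge> N1" for n
    proof -
      have "dist (f (r n) j t) (f (r n) j s) \<le> L j * \<bar>t - s\<bar> + e j (r n)"
        using equi[OF s(1) t] by (simp add: dist_norm)
      moreover have "L j * \<bar>t - s\<bar> \<le> \<epsilon> / 8"
      proof (cases "L j \<ge> 0")
        case True
        then have "L j * \<bar>t - s\<bar> \<le> L j * d" using s by (intro mult_left_mono) auto
        then show ?thesis using d by simp
      next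
        case False
        then have "L j * \<bar>t - s\<bar> \<le> 0" by (intro mult_nonpos_nonneg) auto
        then show ?thesis using \<epsilon> by linarith
      qed
      ultimately show ?thesis using N1[OF that] by linarith
    qed
    show "\<exists>M. \<forall>m\<ge>M. \<forall>n\<ge>M. dist (f (r m) j t) (f (r n) j t) < \<epsilon>"
    proof (intro exI[of _ "max N1 N2"] allI impI)
      fix m n assume mn: "max N1 N2 \<le> m" "max N1 N2 \<le> n"
      have "dist (f (r m) j t) (f (r n) j t) \<le> dist (f (r m) j t) (f (r m) j s)
          + dist (f (r m) j s) (f (r n) j s) + dist (f (r n) j t) (f (r n) j s)"
        by (metis add.commute add_right_mono dist_commute dist_triangle2 dist_triangle_le order_trans add.assoc)
      then show "dist (f (r m) j t) (f (r n) j t) < \<epsilon>"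
        using near[of m] near[of n] N2[of m n] mn \<epsilon> by simp
    qed
  qed
  then show ?thesis using r(1) that by blast
qed

section \<open>Functions with quadratic remainder\<close>

text \<open>A quadratic remainder bound replaces second derivatives throughout; it survives
  products and is enough for the consistency of the scheme.\<close>

definition C11 :: "real \<Rightarrow> ('a::real_inner \<Rightarrow> real) \<Rightarrow> ('a \<Rightarrow> 'a) \<Rightarrow> bool" where
  "C11 C \<phi> D \<longleftrightarrow> (\<forall>x. \<bar>\<phi> x\<bar> \<le> C) \<and> (\<forall>x. norm (D x) \<le> C) \<and>
     (\<forall>x q. \<bar>\<phi> (x + q) - \<phi> x - D x \<bullet> q\<bar> \<le> C * (norm q)\<^sup>2)"

lemma C11D:
  assumes "C11 C \<phi> D"
  shows "\<bar>\<phi> x\<bar> \<le> C" "norm (D x) \<le> C" "\<bar>\<phi> (x + q) - \<phi> x - D x \<bullet> q\<bar> \<le> C * (norm q)\<^sup>2" "C \<ge> 0"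
proof -
  show *: "\<bar>\<phi> x\<bar> \<le> C" for x using assms by (auto simp: C11_def)
  show "norm (D x) \<le> C" "\<bar>\<phi> (x + q) - \<phi> x - D x \<bullet> q\<bar> \<le> C * (norm q)\<^sup>2"
    using assms by (auto simp: C11_def)
  show "C \<ge> 0" using *[of 0] by linarith
qed

text \<open>For |q| \<le> 1 the quadratic remainder is absorbed by a linear term; for larger q the
  sup bound already gives 2 C.\<close>

lemma C11_Lipschitz:
  assumes "C11 C \<phi> D"
  shows "\<bar>\<phi> (x + q) - \<phi> x\<bar> \<le> 2 * C * norm q"
proof (cases "norm q \<le> 1")
  case True
  have "\<bar>\<phi> (x + q) - \<phi> x\<bar> \<le> \<bar>D x \<bullet> q\<bar> + C * (norm q)\<^sup>2"
    using C11D(3)[OF assms, of x q] by linarith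
  also have "\<bar>D x \<bullet> q\<bar> \<le> C * norm q"
    using Cauchy_Schwarz_ineq2[of "D x" q] C11D(2)[OF assms, of x]
    by (meson mult_right_mono norm_ge_zero order_trans)
  also have "C * (norm q)\<^sup>2 \<le> C * norm q"
    using True C11D(4)[OF assms] by (intro mult_left_mono) (auto simp: power2_eq_square mult_left_le)
  finally show ?thesis by simp
next
  case False
  have "\<bar>\<phi> (x + q) - \<phi> x\<bar> \<le> 2 * C * 1"
    using C11D(1)[OF assms, of x] C11D(1)[OF assms, of "x + q"] by linarith
  also have "\<dots> \<le> 2 * C * norm q"
    using False C11D(4)[OF assms] by (intro mult_left_mono) auto
  finally show ?thesis .
qed

lemma C11_mult:
  assumes "C11 C \<phi> D" "C11 C \<psi> E"
  shows "C11 (2 * C + 6 * C\<^sup>2) (\<lambda>x. \<phi> x * \<psi> x) (\<lambda>x. \<phi> x *\<^sub>R E x + \<psi> x *\<^sub>R D x)"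
  unfolding C11_def
proof (intro conjI allI)
  fix x q
  have C: "C \<ge> 0" by (rule C11D(4)[OF assms(1)])
  note a = C11D[OF assms(1)] and b = C11D[OF assms(2)]
  have "\<bar>\<phi> x * \<psi> x\<bar> \<le> C * C"
    unfolding abs_mult using a(1) b(1) C by (intro mult_mono) auto
  also have "\<dots> \<le> 2 * C + 6 * C\<^sup>2"
    using C by (auto simp: power2_eq_square intro!: add_increasing mult_right_mono)
  finally show "\<bar>\<phi> x * \<psi> x\<bar> \<le> 2 * C + 6 * C\<^sup>2" .
  have "norm (\<phi> x *\<^sub>R E x + \<psi> x *\<^sub>R D x) \<le> \<bar>\<phi> x\<bar> * norm (E x) + \<bar>\<psi> x\<bar> * norm (D x)"
    by (metis norm_scaleR norm_triangle_ineq)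
  also have "\<dots> \<le> C * C + C * C"
    using a(1,2) b(1,2) C by (intro mult_mono add_mono) auto
  also have "\<dots> \<le> 2 * C + 6 * C\<^sup>2"
    using C by (auto simp: power2_eq_square intro!: add_increasing)
  finally show "norm (\<phi> x *\<^sub>R E x + \<psi> x *\<^sub>R D x) \<le> 2 * C + 6 * C\<^sup>2" .
  define r where "r = \<phi> (x + q) - \<phi> x - D x \<bullet> q"
  define s where "s = \<psi> (x + q) - \<psi> x - E x \<bullet> q"
  define d where "d = \<phi> (x + q) - \<phi> x"
  define e where "e = \<psi> (x + q) - \<psi> x"
  have "\<phi> (x + q) * \<psi> (x + q) - \<phi> x * \<psi> x - (\<phi> x *\<^sub>R E x + \<psi> x *\<^sub>R D x) \<bullet> q
    = \<phi> x * s + \<psi> x * r + d * e"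
    by (simp add: r_def s_def d_def e_def algebra_simps)
  also have "\<bar>\<dots>\<bar> \<le> \<bar>\<phi> x\<bar> * \<bar>s\<bar> + \<bar>\<psi> x\<bar> * \<bar>r\<bar> + \<bar>d\<bar> * \<bar>e\<bar>"
    by (simp add: abs_mult[symmetric])
  \<comment> \<open>One C^2 from each of the two remainders and 4 C^2 from the product of the two
    increments.\<close>
  also have "\<dots> \<le> C * (C * (norm q)\<^sup>2) + C * (C * (norm q)\<^sup>2) + (2 * C * norm q) * (2 * C * norm q)"
    using a(1,3) b(1,3) C C11_Lipschitz[OF assms(1)] C11_Lipschitz[OF assms(2)]
    unfolding r_def s_def d_def e_def by (intro add_mono mult_mono) auto
  also have "\<dots> = 6 * C\<^sup>2 * (norm q)\<^sup>2" by (simp add: power2_eq_square)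
  also have "\<dots> \<le> (2 * C + 6 * C\<^sup>2) * (norm q)\<^sup>2"
    using C by (intro mult_right_mono) auto
  finally show "\<bar>\<phi> (x + q) * \<psi> (x + q) - \<phi> x * \<psi> x - (\<phi> x *\<^sub>R E x + \<psi> x *\<^sub>R D x) \<bullet> q\<bar>
      \<le> (2 * C + 6 * C\<^sup>2) * (norm q)\<^sup>2" .
qed

lemma C11_mono:
  assumes "C11 C \<phi> D" "C \<le> C'"
  shows "C11 C' \<phi> D"
proof -
  have "C * (norm q)\<^sup>2 \<le> C' * (norm q)\<^sup>2" for q :: 'a
    using assms(2) by (intro mult_right_mono) auto
  then show ?thesis
    using assms unfolding C11_def by (meson order_trans)
qed

definition tame :: "('a::real_inner \<Rightarrow> real) \<Rightarrow> bool" where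
  "tame \<phi> \<longleftrightarrow> (\<exists>C D. C11 C \<phi> D)"

lemma tame_mult:
  assumes "tame \<phi>" "tame \<psi>"
  shows "tame (\<lambda>x. \<phi> x * \<psi> x)"
proof -
  obtain C D C' D' where "C11 C \<phi> D" "C11 C' \<psi> D'" using assms by (auto simp: tame_def)
  then have "C11 (max C C') \<phi> D" "C11 (max C C') \<psi> D'" by (auto elim!: C11_mono)
  from C11_mult[OF this] show ?thesis unfolding tame_def by blast
qed

text \<open>An elementary C^{1,1} profile that vanishes on the left half-line, is positive on the
  right one and increases to 1 there; \<open>ramp (k * s)\<close> tends to the indicator of s > 0 as
  k grows.\<close>

definition ramp :: "real \<Rightarrow> real" where
  "ramp s = (max 0 s)\<^sup>2 / (1 + (max 0 s)\<^sup>2)"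

lemma ramp_bounds: "0 \<le> ramp s" "ramp s \<le> 1"
  and ramp_nonpos: "s \<le> 0 \<Longrightarrow> ramp s = 0"
  by (auto simp: ramp_def divide_le_eq add_pos_nonneg max_def)

lemma ramp_C11:
  "\<bar>ramp (s + r) - ramp s - 2 * max 0 s / (1 + (max 0 s)\<^sup>2)\<^sup>2 * r\<bar> \<le> 2 * r\<^sup>2"
proof -
  define p where "p = max 0 s"
  define p' where "p' = max 0 (s + r)"
  define Q where "Q = 1 + p\<^sup>2"
  define Q' where "Q' = 1 + p'\<^sup>2"
  define e where "e = p'\<^sup>2 - p\<^sup>2 - 2 * p * r"
  have p: "p \<ge> 0" "p' \<ge> 0" by (auto simp: p_def p'_def)
  have Q: "Q \<ge> 1" "Q' \<ge> 1" by (auto simp: Q_def Q'_def)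
  have pp: "\<bar>p' - p\<bar> \<le> \<bar>r\<bar>" by (auto simp: p_def p'_def)
  \<comment> \<open>e is the Taylor remainder of the squared positive part, a function whose
    derivative is 2-Lipschitz.\<close>
  have e: "\<bar>e\<bar> \<le> r\<^sup>2"
  proof (cases "s \<ge> 0")
    case s: True
    then have ps: "p = s" by (simp add: p_def)
    show ?thesis
    proof (cases "s + r \<ge> 0")
      case True
      then show ?thesis using ps by (simp add: p'_def e_def power2_eq_square algebra_simps)
    next
      case False
      then have p0: "p' = 0" by (simp add: p'_def)
      have *: "0 \<le> s * (- s - 2 * r)" using s False by (intro mult_nonneg_nonneg) auto
      have "e = s * (- s - 2 * r)" using ps p0 by (simp add: e_def power2_eq_square algebra_simps)
      moreover have "s * (- s - 2 * r) \<le> r\<^sup>2"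
        using zero_le_power2[of "s + r"] by (simp add: power2_eq_square algebra_simps)
      ultimately show ?thesis using * by simp
    qed
  next
    case s: False
    then have "p = 0" by (simp add: p_def)
    moreover have "p' \<le> \<bar>r\<bar>" using s by (auto simp: p'_def)
    then have "p'\<^sup>2 \<le> \<bar>r\<bar>\<^sup>2" using p by (intro power_mono) auto
    ultimately show ?thesis by (simp add: e_def)
  qed
  \<comment> \<open>Since ramp = 1 - 1/Q, the increment is (Q' - Q)/(Q' Q) with Q' - Q = e + 2 p r;
    the second summand is the cost of replacing Q' by Q in the linear term.\<close>
  have "ramp (s + r) - ramp s - 2 * p / Q\<^sup>2 * r = e / (Q' * Q) + 2 * p * r * ((p - p') * (p + p')) / (Q' * Q\<^sup>2)"
  proof -
    have "ramp (s + r) = 1 - 1 / Q'" "ramp s = 1 - 1 / Q"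
    proof -
      have "z / (1 + z) = 1 - 1 / (1 + z)" if "1 + z \<ge> 1" for z :: real
        using that by (simp add: field_simps)
      then show "ramp (s + r) = 1 - 1 / Q'" "ramp s = 1 - 1 / Q"
        using Q unfolding ramp_def p_def[symmetric] p'_def[symmetric] Q_def Q'_def by blast+
    qed
    then have "ramp (s + r) - ramp s = 1 / Q - 1 / Q'" by linarith
    also have "\<dots> = (Q' - Q) / (Q' * Q)"
      using Q by (simp add: field_simps)
    also have "Q' - Q = e + 2 * p * r" by (simp add: Q_def Q'_def e_def)
    finally have 1: "ramp (s + r) - ramp s = e / (Q' * Q) + 2 * p * r / (Q' * Q)"
      by (simp add: add_divide_distrib)
    have "2 * p * r / (Q' * Q) - 2 * p / Q\<^sup>2 * r = 2 * p * r * (Q - Q') / (Q' * Q\<^sup>2)"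
      using Q by (simp add: field_simps power2_eq_square)
    also have "Q - Q' = (p - p') * (p + p')"
      by (simp add: Q_def Q'_def power2_eq_square algebra_simps)
    finally show ?thesis using 1 by simp
  qed
  also have "\<bar>\<dots>\<bar> \<le> \<bar>e / (Q' * Q)\<bar> + \<bar>2 * p * r * ((p - p') * (p + p')) / (Q' * Q\<^sup>2)\<bar>"
    by (rule abs_triangle_ineq)
  also have "\<bar>e / (Q' * Q)\<bar> \<le> r\<^sup>2"
  proof -
    have "Q' * Q \<ge> 1 * 1" using Q by (intro mult_mono) auto
    then have "\<bar>e\<bar> / (Q' * Q) \<le> \<bar>e\<bar> / 1" by (intro divide_left_mono) auto
    then show ?thesis using e Q by (simp add: abs_mult)
  qed
  also have "\<bar>2 * p * r * ((p - p') * (p + p')) / (Q' * Q\<^sup>2)\<bar> \<le> r\<^sup>2"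
  proof -
    have "2 * p \<le> 1 * Q"
      using zero_le_power2[of "p - 1"] by (simp add: Q_def power2_eq_square algebra_simps)
    then have 1: "2 * p / Q \<le> 1"
      using Q by (intro divide_le_eq[THEN iffD2]) auto
    have 2: "(p + p') / (Q' * Q) \<le> 1"
    proof -
      have "p + p' \<le> Q' * Q"
        using zero_le_power2[of "p - 1/2"] zero_le_power2[of "p' - 1/2"] mult_nonneg_nonneg[of "p\<^sup>2" "p'\<^sup>2"]
        by (simp add: Q_def Q'_def power2_eq_square algebra_simps)
      then show ?thesis using Q by (simp add: divide_le_eq)
    qed
    have "\<bar>2 * p * r * ((p - p') * (p + p')) / (Q' * Q\<^sup>2)\<bar>
       = (2 * p / Q) * ((p + p') / (Q' * Q)) * (\<bar>r\<bar> * \<bar>p' - p\<bar>)"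
      using Q p by (simp add: abs_mult power2_eq_square abs_minus_commute mult_ac)
    also have "\<dots> \<le> 1 * 1 * (\<bar>r\<bar> * \<bar>r\<bar>)"
      using 1 2 pp Q p by (intro mult_mono) auto
    finally show ?thesis by (simp add: power2_eq_square)
  qed
  finally show ?thesis by (simp add: p_def Q_def)
qed

lemma ramp_deriv_bound: "\<bar>2 * max 0 s / (1 + (max 0 s)\<^sup>2)\<^sup>2\<bar> \<le> (1::real)"
proof -
  define p where "p = max 0 s"
  have p: "p \<ge> 0" unfolding p_def by (rule max.cobounded1)
  have "2 * p \<le> 1 + p\<^sup>2" using zero_le_power2[of "p - 1"] by (simp add: power2_eq_square algebra_simps)
  also have "\<dots> \<le> (1 + p\<^sup>2)\<^sup>2" by (rule self_le_power) auto
  finally show ?thesis using p unfolding p_def[symmetric] by (simp add: divide_le_eq add_pos_nonneg)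
qed

lemma tame_ramp:
  fixes v :: "'a::real_inner"
  shows "tame (\<lambda>x. ramp (c + v \<bullet> x))"
proof -
  define C where "C = 1 + norm v + 2 * (norm v)\<^sup>2"
  define g where "g s = 2 * max 0 s / (1 + (max 0 s)\<^sup>2)\<^sup>2" for s :: real
  have "C11 C (\<lambda>x. ramp (c + v \<bullet> x)) (\<lambda>x. g (c + v \<bullet> x) *\<^sub>R v)"
    unfolding C11_def
  proof (intro conjI allI)
    fix x q :: 'a
    have "\<bar>ramp (c + v \<bullet> x)\<bar> \<le> 1" using ramp_bounds[of "c + v \<bullet> x"] by simp
    also have "1 \<le> C" by (simp add: C_def)
    finally show "\<bar>ramp (c + v \<bullet> x)\<bar> \<le> C" .
    have "norm (g (c + v \<bullet> x) *\<^sub>R v) \<le> 1 * norm v"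
      unfolding norm_scaleR g_def by (intro mult_right_mono ramp_deriv_bound norm_ge_zero)
    also have "\<dots> \<le> C" by (simp add: C_def)
    finally show "norm (g (c + v \<bullet> x) *\<^sub>R v) \<le> C" .
    have "\<bar>ramp (c + v \<bullet> (x + q)) - ramp (c + v \<bullet> x) - (g (c + v \<bullet> x) *\<^sub>R v) \<bullet> q\<bar>
      = \<bar>ramp ((c + v \<bullet> x) + v \<bullet> q) - ramp (c + v \<bullet> x) - g (c + v \<bullet> x) * (v \<bullet> q)\<bar>"
      by (simp add: inner_add_right add.assoc)
    also have "\<dots> \<le> 2 * (v \<bullet> q)\<^sup>2" unfolding g_def by (rule ramp_C11)
    also have "\<dots> \<le> 2 * (norm v * norm q)\<^sup>2"
      using Cauchy_Schwarz_ineq2[of v q] by (intro mult_left_mono) (auto simp: abs_le_square_iff[symmetric])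
    also have "\<dots> \<le> C * (norm q)\<^sup>2"
      unfolding C_def power_mult_distrib by (simp add: algebra_simps)
    finally show "\<bar>ramp (c + v \<bullet> (x + q)) - ramp (c + v \<bullet> x) - (g (c + v \<bullet> x) *\<^sub>R v) \<bullet> q\<bar> \<le> C * (norm q)\<^sup>2" .
  qed
  then show ?thesis unfolding tame_def by blast
qed

section \<open>Test functions with rational data and their density in L^1\<close>

text \<open>The rational and natural parameters make the family countable, as
  \<open>asymptotic_Ascoli\<close> requires, while each member still has the quadratic remainder
  that the consistency estimate of the scheme asks for.\<close>

definition bump :: "rat \<times> rat \<times> rat \<times> rat \<times> nat \<Rightarrow> plane \<Rightarrow> real" where
  "bump = (\<lambda>(a, b, c, d, k) x.
     (ramp (real k * (x $ 1 - of_rat a)) * ramp (real k * (of_rat b - x $ 1))) *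
     (ramp (real k * (x $ 2 - of_rat c)) * ramp (real k * (of_rat d - x $ 2))))"

lemma tame_bump: "tame (bump j)"
proof -
  obtain a b c d k where j: "j = (a, b, c, d, k)" by (metis prod_cases5)
  have r: "tame (\<lambda>x::plane. ramp (real k * (x $ i - z)))" "tame (\<lambda>x::plane. ramp (real k * (z - x $ i)))" for z i
    using tame_ramp[of "- real k * z" "real k *\<^sub>R axis i (1::real)"]
      tame_ramp[of "real k * z" "- real k *\<^sub>R axis i (1::real)"]
    by (simp_all add: inner_axis' algebra_simps)
  show ?thesis unfolding bump_def j prod.case by (intro tame_mult r)
qed

lemma borel_measurable_ramp [measurable (raw)]:
  "f \<in> borel_measurable M \<Longrightarrow> (\<lambda>x. ramp (f x)) \<in> borel_measurable M"
  unfolding ramp_def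
  by (intro borel_measurable_divide borel_measurable_add borel_measurable_power
      borel_measurable_max borel_measurable_const)

lemma borel_measurable_nth [measurable (raw)]:
  "f \<in> borel_measurable M \<Longrightarrow> (\<lambda>x. f x $ i :: real) \<in> borel_measurable M"
  for f :: "_ \<Rightarrow> real^'n"
  by (rule measurable_compose[where f = f and g = "\<lambda>x. x $ i"], assumption,
      intro borel_measurable_continuous_onI continuous_intros)

lemma borel_measurable_bump: "bump j \<in> borel_measurable borel"
  unfolding bump_def case_prod_beta
  by (intro borel_measurable_times borel_measurable_ramp borel_measurable_diff
      borel_measurable_const borel_measurable_nth measurable_ident_sets refl)

definition rbox :: "real \<Rightarrow> real \<Rightarrow> real \<Rightarrow> real \<Rightarrow> plane set" where
  "rbox a b c d = {x. a < x $ 1 \<and> x $ 1 < b \<and> c < x $ 2 \<and> x $ 2 < d}"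

lemma rbox_eq_box: "rbox a b c d = box (vector [a, c]) (vector [b, d])"
  by (auto simp: rbox_def mem_box_cart forall_2)

lemma integrable_rbox: "integrable lborel (indicator (rbox a b c d) :: plane \<Rightarrow> real)"
  using emeasure_lborel_box_finite[of "vector [a, c] :: plane" "vector [b, d]"]
  by (intro integrable_real_indicator) (auto simp: rbox_eq_box)

lemma bump_bounds:
  "0 \<le> bump (a, b, c, d, k) x"
  "bump (a, b, c, d, k) x \<le> indicator (rbox (of_rat a) (of_rat b) (of_rat c) (of_rat d)) x"
proof -
  show "0 \<le> bump (a, b, c, d, k) x" by (simp add: bump_def ramp_bounds)
  show "bump (a, b, c, d, k) x \<le> indicator (rbox (of_rat a) (of_rat b) (of_rat c) (of_rat d)) x"
  proof (cases "x \<in> rbox (of_rat a) (of_rat b) (of_rat c) (of_rat d)")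
    case True
    have "bump (a, b, c, d, k) x \<le> (1 * 1) * (1 * 1)"
      unfolding bump_def prod.case by (intro mult_mono ramp_bounds mult_nonneg_nonneg) auto
    then show ?thesis using True by simp
  next
    case False
    then have "x $ 1 - of_rat a \<le> 0 \<or> of_rat b - x $ 1 \<le> 0 \<or> x $ 2 - of_rat c \<le> 0 \<or> of_rat d - x $ 2 \<le> 0"
      by (auto simp: rbox_def)
    then have "ramp (real k * (x $ 1 - of_rat a)) = 0 \<or> ramp (real k * (of_rat b - x $ 1)) = 0 \<or>
       ramp (real k * (x $ 2 - of_rat c)) = 0 \<or> ramp (real k * (of_rat d - x $ 2)) = 0"
      by (meson mult_nonneg_nonpos of_nat_0_le_iff ramp_nonpos)
    then show ?thesis using False by (auto simp: bump_def)
  qed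
qed

lemma integrable_bump: "integrable lborel (bump j)"
proof -
  obtain a b c d k where j: "j = (a, b, c, d, k)" by (metis prod_cases5)
  show ?thesis
    unfolding j
  proof (rule Bochner_Integration.integrable_bound[OF integrable_rbox])
    show "AE x in lborel. norm (bump (a, b, c, d, k) x) \<le> norm (indicat_real (rbox (of_rat a) (of_rat b) (of_rat c) (of_rat d)) x)"
      using bump_bounds by (auto intro!: AE_I2 simp: abs_of_nonneg)
  qed (use borel_measurable_bump in simp)
qed

lemma ramp_tendsto:
  assumes "s > 0"
  shows "(\<lambda>k. ramp (real k * s)) \<longlonglongrightarrow> 1"
proof -
  have "(\<lambda>k. 1 - inverse (1 + (real k * s)\<^sup>2)) \<longlonglongrightarrow> 1 - 0"
  proof (intro tendsto_diff tendsto_const tendsto_inverse_0_at_top filterlim_tendsto_add_at_top[OF tendsto_const])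
    have "filterlim (\<lambda>k. real k * s) at_top sequentially"
      using assms by (intro filterlim_at_top_mult_tendsto_pos[OF tendsto_const] filterlim_real_sequentially)
    then show "filterlim (\<lambda>k. (real k * s)\<^sup>2) at_top sequentially"
      by (rule filterlim_pow_at_top[rotated]) simp
  qed
  moreover have "1 - inverse (1 + (real k * s)\<^sup>2) = ramp (real k * s)" for k
    using assms add_pos_nonneg[of 1 "(real k * s)\<^sup>2"] by (simp add: ramp_def max_def field_simps)
  ultimately show ?thesis by simp
qed

lemma bump_tendsto:
  "(\<lambda>k. bump (a, b, c, d, k) x) \<longlonglongrightarrow> indicator (rbox (of_rat a) (of_rat b) (of_rat c) (of_rat d)) x"
proof (cases "x \<in> rbox (of_rat a) (of_rat b) (of_rat c) (of_rat d)")
  case True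
  then have "(\<lambda>k. bump (a, b, c, d, k) x) \<longlonglongrightarrow> (1 * 1) * (1 * 1)"
    unfolding bump_def prod.case by (intro tendsto_mult ramp_tendsto) (auto simp: rbox_def)
  then show ?thesis using True by simp
next
  case False
  then have "bump (a, b, c, d, k) x = 0" for k
    using bump_bounds[of a b c d k x] by simp
  then show ?thesis using False by simp
qed

text \<open>The span of the bumps is dense in L^1: boxes with rational corners are limits of bumps
  as k grows, all boxes are limits of rational ones from inside, a Dynkin argument reaches the Borel
  subsets of a fixed box, and large boxes exhaust a set of finite measure.\<close>

lemma L1_bump_induct [consumes 1, case_names bump add scale lim]:
  fixes f :: "plane \<Rightarrow> real"
  assumes "integrable lborel f"
    and bump: "\<And>j. P (bump j)"
    and add: "\<And>f g. integrable lborel f \<Longrightarrow> integrable lborel g \<Longrightarrow> P f \<Longrightarrow> P g \<Longrightarrow> P (\<lambda>x. f x + g x)"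
    and scale: "\<And>c f. integrable lborel f \<Longrightarrow> P f \<Longrightarrow> P (\<lambda>x. c * f x)"
    and lim: "\<And>f s. integrable lborel f \<Longrightarrow> (\<And>i::nat. integrable lborel (s i)) \<Longrightarrow> (\<And>i. P (s i)) \<Longrightarrow>
       (\<lambda>i. LINT x|lborel. \<bar>s i x - f x\<bar>) \<longlonglongrightarrow> 0 \<Longrightarrow> P f"
  shows "P f"
proof -
  \<comment> \<open>Every limit taken below is pointwise with an integrable bound; here this is
    turned into L^1 convergence once and for all.\<close>
  have dom: "P g" if g: "integrable lborel g" and s: "\<And>i::nat. integrable lborel (s i)" "\<And>i. P (s i)"
    and l: "\<And>x. (\<lambda>i. s i x) \<longlonglongrightarrow> g x" and w: "integrable lborel w" "\<And>i x. \<bar>s i x\<bar> \<le> w x" for g s and w :: "plane \<Rightarrow> real"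
  proof (rule lim[OF g s])
    have gw: "\<bar>g x\<bar> \<le> w x" for x
      by (rule LIMSEQ_le_const2[OF tendsto_rabs[OF l]]) (use w in auto)
    have "(\<lambda>i. LINT x|lborel. \<bar>s i x - g x\<bar>) \<longlonglongrightarrow> (LINT x|(lborel::plane measure). 0)"
    proof (rule integral_dominated_convergence[where w = "\<lambda>x. 2 * w x"])
      show "AE x in lborel. (\<lambda>i. \<bar>s i x - g x\<bar>) \<longlonglongrightarrow> 0"
        by (intro AE_I2 tendsto_rabs_zero LIM_zero l)
      show "AE x in lborel. norm \<bar>s i x - g x\<bar> \<le> 2 * w x" for i
      proof (intro AE_I2)
        fix x show "norm \<bar>s i x - g x\<bar> \<le> 2 * w x" using gw[of x] w(2)[of i x] by simp
      qed
    qed (use g s w in \<open>auto intro!: borel_measurable_abs borel_measurable_diff\<close>)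
    then show "(\<lambda>i. LINT x|lborel. \<bar>s i x - g x\<bar>) \<longlonglongrightarrow> 0" by simp
  qed
  have diff: "P (\<lambda>x. f x - g x)" if "integrable lborel f" "integrable lborel g" "P f" "P g" for f g
    using add[OF that(1) _ that(3) scale[OF that(2,4)], of "-1"] that by simp
  have P0: "P (\<lambda>x. 0)" using scale[OF integrable_bump bump, of 0] by simp
  have sum: "P (\<lambda>x. \<Sum>i<n. s i x)" if "\<And>i. integrable lborel (s i)" "\<And>i. P (s i)"
    for s :: "nat \<Rightarrow> plane \<Rightarrow> real" and n :: nat
  proof (induction n)
    case (Suc n)
    then show ?case using add[of "\<lambda>x. \<Sum>i<n. s i x" "s n"] that by simp
  qed (simp add: P0)
  have ratbox: "P (indicator (rbox (of_rat a) (of_rat b) (of_rat c) (of_rat d)))" for a b c d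
    using bump_bounds[of a b c d]
    by (intro dom[OF integrable_rbox integrable_bump bump bump_tendsto integrable_rbox]) auto
  have box: "P (indicator (rbox a b c d))" for a b c d
  proof -
    have "\<exists>q. z < of_rat q \<and> of_rat q < z + 1 / real (Suc n)" for z :: real and n
      using of_rat_dense[of z "z + 1 / real (Suc n)"] by auto
    then obtain u where u: "\<And>z n. z < of_rat (u z n)" "\<And>z n. of_rat (u z n) < z + 1 / real (Suc n)"
      by metis
    have "\<exists>q. z - 1 / real (Suc n) < of_rat q \<and> of_rat q < z" for z :: real and n
      using of_rat_dense[of "z - 1 / real (Suc n)" z] by auto
    then obtain v where v: "\<And>z n. z - 1 / real (Suc n) < of_rat (v z n)" "\<And>z n. of_rat (v z n) < z"
      by metis
    define R where "R n = rbox (of_rat (u a n)) (of_rat (v b n)) (of_rat (u c n)) (of_rat (v d n))" for n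
    have sub: "R n \<subseteq> rbox a b c d" for n
      using u(1)[of a n] u(1)[of c n] v(2)[of b n] v(2)[of d n] by (auto simp: R_def rbox_def)
    have "P (indicator (R n))" for n unfolding R_def by (rule ratbox)
    moreover have "integrable lborel (indicator (R n) :: plane \<Rightarrow> real)" for n
      unfolding R_def by (rule integrable_rbox)
    moreover have "(\<lambda>n. indicator (R n) x :: real) \<longlonglongrightarrow> indicator (rbox a b c d) x" for x
    proof (cases "x \<in> rbox a b c d")
      case False
      then have "indicator (R n) x = (0::real)" for n
        using subsetD[OF sub[of n], of x] by (auto simp: indicator_def)
      then show ?thesis using False by simp
    next
      case True
      have U: "(\<lambda>n. of_rat (u z n) :: real) \<longlonglongrightarrow> z" for z
      proof (rule real_tendsto_sandwich[of "\<lambda>_. z" _ _ "\<lambda>n. z + 1 / real (Suc n)"])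
        show "(\<lambda>n. z + 1 / real (Suc n)) \<longlonglongrightarrow> z"
          using tendsto_add[OF tendsto_const LIMSEQ_inverse_real_of_nat, of z] by (simp add: inverse_eq_divide)
      qed (use u in \<open>auto intro!: always_eventually less_imp_le simp del: of_nat_Suc\<close>)
      have V: "(\<lambda>n. of_rat (v z n) :: real) \<longlonglongrightarrow> z" for z
      proof (rule real_tendsto_sandwich[of "\<lambda>n. z - 1 / real (Suc n)" _ _ "\<lambda>_. z"])
        show "(\<lambda>n. z - 1 / real (Suc n)) \<longlonglongrightarrow> z"
          using tendsto_diff[OF tendsto_const LIMSEQ_inverse_real_of_nat, of z] by (simp add: inverse_eq_divide)
      qed (use v in \<open>auto intro!: always_eventually less_imp_le simp del: of_nat_Suc\<close>)
      have "eventually (\<lambda>n. of_rat (u a n) < x $ 1) sequentially" "eventually (\<lambda>n. of_rat (u c n) < x $ 2) sequentially"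
        "eventually (\<lambda>n. of_rat (v b n) > x $ 1) sequentially" "eventually (\<lambda>n. of_rat (v d n) > x $ 2) sequentially"
        using True by (auto simp: rbox_def intro: order_tendstoD[OF U] order_tendstoD[OF V])
      then have "eventually (\<lambda>n. x \<in> R n) sequentially"
        by eventually_elim (auto simp: R_def rbox_def)
      then have "eventually (\<lambda>n. indicator (R n) x = (1::real)) sequentially"
        by eventually_elim auto
      then show ?thesis using True by (simp add: tendsto_eventually)
    qed
    moreover have "\<bar>indicator (R n) x :: real\<bar> \<le> indicator (rbox a b c d) x" for n x
      using sub[of n] by (auto simp: indicator_def)
    ultimately show ?thesis
      by (intro dom[OF integrable_rbox, where s = "\<lambda>n. indicator (R n)" and w = "indicator (rbox a b c d)"]
          integrable_rbox)
  qed
  have boxbox: "P (indicator (box a b))" for a b :: plane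
  proof -
    have "box a b = rbox (a $ 1) (b $ 1) (a $ 2) (b $ 2)"
      by (auto simp: rbox_def mem_box_cart forall_2)
    then show ?thesis using box by simp
  qed
  have ibox: "integrable lborel (indicator (A \<inter> box a b) :: plane \<Rightarrow> real)" if "A \<in> sets borel" for A a b
  proof (rule integrable_real_indicator)
    have "emeasure lborel (A \<inter> box a b) \<le> emeasure lborel (box a b)"
      by (intro emeasure_mono) auto
    then show "emeasure lborel (A \<inter> box a b) < \<infinity>"
      using emeasure_lborel_box_finite[of a b] by (auto elim: order_le_less_trans)
  qed (use that in auto)
  \<comment> \<open>Intersecting with a fixed box keeps all indicators integrable, so that
    complements and disjoint unions stay within L^1. Open boxes are stable under intersection and
    generate the Borel sets.\<close>
  have borel_box: "P (indicator (A \<inter> box a b))" if A: "A \<in> sets borel" for A a b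
  proof -
    have "sets (borel :: plane measure) = sigma_sets UNIV (range (\<lambda>(a, b). box a b))"
      by (subst borel_eq_box) simp
    then have 1: "A \<in> sigma_sets UNIV (range (\<lambda>(a, b). box a b))" using A by simp
    have 2: "Int_stable (range (\<lambda>(a, b). box a b :: plane set))"
      by (auto simp: Int_stable_def box_Int_box)
    have 3: "range (\<lambda>(a, b). box a b :: plane set) \<subseteq> Pow UNIV" by auto
    show ?thesis
      using 2 3 1
    proof (induction rule: sigma_sets_induct_disjoint)
      case (basic B)
      then obtain c d where "B = box c d" by auto
      then show ?case using boxbox by (simp add: box_Int_box)
    next
      case empty
      have "indicator {} = (\<lambda>x. 0::real)" by auto
      then show ?case using P0 by simp
    next
      case (compl B)
      have B: "B \<in> sets borel" using compl(1) by (simp add: borel_eq_box)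
      have "indicator ((UNIV - B) \<inter> box a b) = (\<lambda>x. indicator (UNIV \<inter> box a b) x - indicator (B \<inter> box a b) x :: real)"
        by (auto simp: indicator_def fun_eq_iff)
      then show ?case
        using diff[OF ibox[of UNIV] ibox[OF B] _ compl(2)] boxbox by simp
    next
      case (union B)
      have B: "B i \<in> sets borel" for i using union(2) by (auto simp: borel_eq_box)
      have eq: "(\<Sum>i<n. indicator (B i \<inter> box a b) x) = (indicator (\<Union>i<n. B i \<inter> box a b) x :: real)" for n x
        by (rule indicator_UN_disjoint[symmetric])
          (use union(1) in \<open>auto simp: disjoint_family_on_def\<close>)
      show ?case
      proof (rule dom)
        show "integrable lborel (indicator (\<Union> (range B) \<inter> box a b) :: plane \<Rightarrow> real)"
          by (rule ibox) (use B in auto)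
        show "integrable lborel (\<lambda>x. \<Sum>i<n. indicator (B i \<inter> box a b) x :: real)" for n
          by (intro Bochner_Integration.integrable_sum ibox B)
        show "P (\<lambda>x. \<Sum>i<n. indicator (B i \<inter> box a b) x)" for n
          by (rule sum[OF ibox[OF B] union(3)])
        show "integrable lborel (indicator (UNIV \<inter> box a b) :: plane \<Rightarrow> real)"
          by (rule ibox) simp
        fix x
        have "(\<lambda>n. indicator (\<Union>i<n. B i \<inter> box a b) x :: real) \<longlonglongrightarrow> indicator (\<Union>i. B i \<inter> box a b) x"
          by (rule LIMSEQ_indicator_UN)
        then show "(\<lambda>n. \<Sum>i<n. indicator (B i \<inter> box a b) x :: real) \<longlonglongrightarrow> indicator (\<Union> (range B) \<inter> box a b) x"
          unfolding eq by simp
        show "\<bar>\<Sum>i<n. indicator (B i \<inter> box a b) x\<bar> \<le> (indicator (UNIV \<inter> box a b) x :: real)" for n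
          unfolding eq by (auto simp: indicator_def)
      qed
    qed
  qed
  from assms(1) show ?thesis
  proof (induction rule: integrable_L1_induct)
    case (base A)
    have iA: "integrable lborel (indicator A :: plane \<Rightarrow> real)" using base by (intro integrable_real_indicator) auto
    have A: "A \<in> sets borel" using base by simp
    have l: "(\<lambda>n. indicator (A \<inter> box (- real n *\<^sub>R One) (real n *\<^sub>R One)) x :: real) \<longlonglongrightarrow> indicator A x" for x
    proof -
      obtain n0 :: nat where n0: "norm x < n0" using reals_Archimedean2 by blast
      have "x \<in> box (- real n *\<^sub>R One) (real n *\<^sub>R One)" if "n \<ge> n0" for n
      proof -
        have "\<bar>x \<bullet> b\<bar> < real n" if "b \<in> Basis" for b
          using Basis_le_norm[OF that, of x] n0 \<open>n \<ge> n0\<close> by linarith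
        then show ?thesis by (force simp: mem_box abs_less_iff)
      qed
      then have "eventually (\<lambda>n. indicator (A \<inter> box (- real n *\<^sub>R One) (real n *\<^sub>R One)) x = (indicator A x :: real)) sequentially"
        unfolding eventually_sequentially by (intro exI[of _ n0]) (auto simp: indicator_def)
      then show ?thesis by (rule tendsto_eventually)
    qed
    show ?case
      by (rule dom[OF iA ibox[OF A] borel_box[OF A] l iA]) (auto simp: indicator_def)
  next
    case (lim f s)
    then show ?case by (intro assms(5)[of f s]) auto
  qed (use add scale in auto)
qed

section \<open>A Markov difference scheme\<close>

text \<open>The logarithm, continued below \<epsilon>^2 by its tangent line, hence C^1 with
  derivative 1/max(s, \<epsilon>^2), the truncation found in \<open>Kreg\<close>. The condition is
  phrased by a set to fit \<open>has_vector_derivative_If_within_closures\<close>.\<close>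

definition glog :: "real \<Rightarrow> real \<Rightarrow> real" where
  "glog \<epsilon> s = (if s \<in> {\<epsilon>\<^sup>2..} then ln s else ln (\<epsilon>\<^sup>2) + s / \<epsilon>\<^sup>2 - 1)"

lemma glog_DERIV:
  assumes "\<epsilon> > 0"
  shows "(glog \<epsilon> has_real_derivative 1 / max s (\<epsilon>\<^sup>2)) (at s)"
proof -
  let ?S = "{\<epsilon>\<^sup>2..}" and ?T = "{..<\<epsilon>\<^sup>2}"
  have e: "\<epsilon>\<^sup>2 > 0" using assms by simp
  have cl: "closure ?S \<inter> closure ?T = {\<epsilon>\<^sup>2}" by auto
  have "(glog \<epsilon> has_vector_derivative (if s \<in> ?S then 1 / s else 1 / \<epsilon>\<^sup>2)) (at s within UNIV)"
    unfolding glog_def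
  proof (rule has_vector_derivative_If_within_closures[where T = ?T])
    show "(ln has_vector_derivative 1 / s) (at s within ?S \<union> closure ?S \<inter> closure ?T)"
      if "s \<in> ?S \<union> closure ?S \<inter> closure ?T"
    proof -
      have "s \<ge> \<epsilon>\<^sup>2" using that unfolding cl by auto
      then have "s > 0" using e by linarith
      then show ?thesis
        unfolding has_real_derivative_iff_has_vector_derivative[symmetric]
        by (auto intro!: derivative_eq_intros simp: divide_inverse)
    qed
    show "((\<lambda>s. ln (\<epsilon>\<^sup>2) + s / \<epsilon>\<^sup>2 - 1) has_vector_derivative 1 / \<epsilon>\<^sup>2) (at s within ?T \<union> closure ?S \<inter> closure ?T)"
      unfolding has_real_derivative_iff_has_vector_derivative[symmetric]
      using assms by (auto intro!: derivative_eq_intros simp: power2_eq_square)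
  qed (use e in auto)
  then show ?thesis
    unfolding has_real_derivative_iff_has_vector_derivative
    by (auto simp: max_def split: if_splits)
qed

text \<open>The Newtonian potential ln |x| / (2 pi), written with |x|^2 and regularised; its
  perpendicular gradient is \<open>Kreg \<epsilon>\<close>. It serves as the stream function of the
  scheme and, with \<delta> in place of \<epsilon>, as the interaction energy of the
  vortices.\<close>

definition Gpot :: "real \<Rightarrow> plane \<Rightarrow> real" where
  "Gpot \<epsilon> x = glog \<epsilon> (x \<bullet> x) / (4 * pi)"

lemma Gpot_has_derivative:
  assumes "\<epsilon> > 0"
  shows "(Gpot \<epsilon> has_derivative (\<lambda>q. - (perp (Kreg \<epsilon> x) \<bullet> q))) (at x)"
proof -
  have "((\<lambda>x::plane. x \<bullet> x) has_derivative (\<lambda>q. x \<bullet> q + q \<bullet> x)) (at x)"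
    by (rule has_derivative_inner[OF has_derivative_ident has_derivative_ident])
  moreover have "(glog \<epsilon> has_derivative (\<lambda>h. h * (1 / max (x \<bullet> x) (\<epsilon>\<^sup>2)))) (at (x \<bullet> x))"
    using glog_DERIV[OF assms, of "x \<bullet> x"] unfolding has_field_derivative_def
    by (rule has_derivative_eq_rhs) (simp add: fun_eq_iff)
  ultimately have "((\<lambda>x. glog \<epsilon> (x \<bullet> x)) has_derivative (\<lambda>q. (x \<bullet> q + q \<bullet> x) * (1 / max (x \<bullet> x) (\<epsilon>\<^sup>2)))) (at x)"
    by (rule has_derivative_compose)
  then have "(Gpot \<epsilon> has_derivative (\<lambda>q. (x \<bullet> q + q \<bullet> x) * (1 / max (x \<bullet> x) (\<epsilon>\<^sup>2)) / (4 * pi))) (at x)"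
    unfolding Gpot_def divide_inverse[of "glog \<epsilon> _"] divide_inverse[of _ "4 * pi"]
    by (rule has_derivative_mult_left)
  moreover have "(\<lambda>q. (x \<bullet> q + q \<bullet> x) * (1 / max (x \<bullet> x) (\<epsilon>\<^sup>2)) / (4 * pi)) = (\<lambda>q. - (perp (Kreg \<epsilon> x) \<bullet> q))"
    by (simp add: Kreg_def perp_scaleR perp_perp inner_commute[of _ x] dot_square_norm fun_eq_iff)
  ultimately show ?thesis by simp
qed

lemma Gpot_difference:
  assumes "\<epsilon> > 0" "r > 0"
  shows "\<exists>\<theta>. \<bar>\<theta>\<bar> \<le> r \<and> Gpot \<epsilon> (z + r *\<^sub>R b) - Gpot \<epsilon> (z - r *\<^sub>R b) = - (2 * r * (perp (Kreg \<epsilon> (z + \<theta> *\<^sub>R b)) \<bullet> b))"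
proof -
  have D: "((\<lambda>s. Gpot \<epsilon> (z + s *\<^sub>R b)) has_real_derivative - (perp (Kreg \<epsilon> (z + s *\<^sub>R b)) \<bullet> b)) (at s)" for s
  proof -
    have "((\<lambda>s. z + s *\<^sub>R b) has_derivative (\<lambda>s. s *\<^sub>R b)) (at s)"
      by (auto intro!: derivative_eq_intros)
    from has_derivative_compose[OF this Gpot_has_derivative[OF assms(1)]]
    have "((\<lambda>s. Gpot \<epsilon> (z + s *\<^sub>R b)) has_derivative (\<lambda>q. - (perp (Kreg \<epsilon> (z + s *\<^sub>R b)) \<bullet> (q *\<^sub>R b)))) (at s)" .
    then show ?thesis
      unfolding has_field_derivative_def
      by (rule has_derivative_eq_rhs) (simp add: fun_eq_iff mult.commute)
  qed
  have "\<exists>\<theta>>-r. \<theta> < r \<and> Gpot \<epsilon> (z + r *\<^sub>R b) - Gpot \<epsilon> (z + (-r) *\<^sub>R b) = (r - (-r)) * - (perp (Kreg \<epsilon> (z + \<theta> *\<^sub>R b)) \<bullet> b)"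
    by (rule MVT2) (use assms D in auto)
  then obtain \<theta> where \<theta>: "- r < \<theta>" "\<theta> < r" and
    eq: "Gpot \<epsilon> (z + r *\<^sub>R b) - Gpot \<epsilon> (z + (-r) *\<^sub>R b) = (r - (-r)) * - (perp (Kreg \<epsilon> (z + \<theta> *\<^sub>R b)) \<bullet> b)"
    by blast
  show ?thesis
    using eq \<theta> by (intro exI[of _ \<theta>]) (simp add: abs_le_iff)
qed

lemma continuous_on_Gpot:
  assumes "\<epsilon> > 0"
  shows "continuous_on UNIV (Gpot \<epsilon>)"
  using Gpot_has_derivative[OF assms] has_derivative_continuous continuous_at_imp_continuous_on by blast

text \<open>The discrete perpendicular gradient of the regularised logarithm: it is a small
  perturbation of \<^term>\<open>Kreg \<epsilon>\<close> and its centred discrete divergence vanishes identically.\<close>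

definition kdisc :: "real \<Rightarrow> real \<Rightarrow> plane \<Rightarrow> plane" where
  "kdisc \<epsilon> h z =
     (- (Gpot \<epsilon> (z + (h/2) *\<^sub>R axis 2 1) - Gpot \<epsilon> (z - (h/2) *\<^sub>R axis 2 1)) / h) *\<^sub>R axis 1 1 +
     ((Gpot \<epsilon> (z + (h/2) *\<^sub>R axis 1 1) - Gpot \<epsilon> (z - (h/2) *\<^sub>R axis 1 1)) / h) *\<^sub>R axis 2 1"

lemma kdisc_nth:
  "kdisc \<epsilon> h z $ 1 = - (Gpot \<epsilon> (z + (h/2) *\<^sub>R axis 2 1) - Gpot \<epsilon> (z - (h/2) *\<^sub>R axis 2 1)) / h"
  "kdisc \<epsilon> h z $ 2 = (Gpot \<epsilon> (z + (h/2) *\<^sub>R axis 1 1) - Gpot \<epsilon> (z - (h/2) *\<^sub>R axis 1 1)) / h"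
  by (simp_all add: kdisc_def axis_def)

lemma borel_measurable_kdisc:
  assumes "\<epsilon> > 0"
  shows "kdisc \<epsilon> h \<in> borel_measurable borel"
proof -
  have "continuous_on UNIV (\<lambda>z. Gpot \<epsilon> (z + c))" "continuous_on UNIV (\<lambda>z. Gpot \<epsilon> (z - c))" for c
    using continuous_on_Gpot[OF assms]
    by (auto intro!: continuous_intros continuous_on_compose2[of UNIV "Gpot \<epsilon>"])
  then have "continuous_on UNIV (kdisc \<epsilon> h)"
    unfolding kdisc_def[abs_def] divide_inverse by (intro continuous_intros)
  then show ?thesis by (rule borel_measurable_continuous_onI)
qed

text \<open>Both components are difference quotients of one function, so the two halves of the
  divergence are the same mixed second difference of \<open>Gpot\<close> with opposite signs. The
  centred differences of \<open>Kreg\<close> itself do not cancel identically, which is why the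
  scheme moves vorticity with \<open>kdisc\<close>.\<close>

lemma kdisc_div_free:
  "(\<Sum>i\<in>UNIV. kdisc \<epsilon> h (z + (h/2) *\<^sub>R axis i 1) $ i - kdisc \<epsilon> h (z - (h/2) *\<^sub>R axis i 1) $ i) = 0"
  unfolding sum_2 kdisc_nth
  by (simp add: diff_divide_distrib[symmetric] add_divide_distrib[symmetric] algebra_simps)

lemma norm_plane_le: "norm (x :: plane) \<le> \<bar>x $ 1\<bar> + \<bar>x $ 2\<bar>"
  using norm_le_l1_cart[of x] by (simp add: sum_2)

text \<open>By the mean value theorem each component of \<open>kdisc\<close> is a component of
  \<open>Kreg\<close> at a point displaced by at most h/2; the Lipschitz bound of
  \<open>Kreg\<close> is then spent once per component.\<close>

lemma norm_kdisc_minus_Kreg: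
  assumes "\<epsilon> > 0" "h > 0"
  shows "norm (kdisc \<epsilon> h z - Kreg \<epsilon> z) \<le> h / \<epsilon>\<^sup>2"
proof -
  obtain s where s: "\<bar>s\<bar> \<le> h/2" "Gpot \<epsilon> (z + (h/2) *\<^sub>R axis 2 1) - Gpot \<epsilon> (z - (h/2) *\<^sub>R axis 2 1)
      = - (2 * (h/2) * (perp (Kreg \<epsilon> (z + s *\<^sub>R axis 2 1)) \<bullet> axis 2 1))"
    using Gpot_difference[OF assms(1), of "h/2" z "axis 2 1"] assms(2) by auto
  obtain t where t: "\<bar>t\<bar> \<le> h/2" "Gpot \<epsilon> (z + (h/2) *\<^sub>R axis 1 1) - Gpot \<epsilon> (z - (h/2) *\<^sub>R axis 1 1)
      = - (2 * (h/2) * (perp (Kreg \<epsilon> (z + t *\<^sub>R axis 1 1)) \<bullet> axis 1 1))"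
    using Gpot_difference[OF assms(1), of "h/2" z "axis 1 1"] assms(2) by auto
  have 1: "kdisc \<epsilon> h z $ 1 = Kreg \<epsilon> (z + s *\<^sub>R axis 2 1) $ 1"
    unfolding kdisc_nth s(2) using assms by (simp add: inner_axis)
  have 2: "kdisc \<epsilon> h z $ 2 = Kreg \<epsilon> (z + t *\<^sub>R axis 1 1) $ 2"
    unfolding kdisc_nth t(2) using assms by (simp add: inner_axis)
  have L: "\<bar>Kreg \<epsilon> (z + s *\<^sub>R axis i 1) $ j - Kreg \<epsilon> z $ j\<bar> \<le> (h/2) / \<epsilon>\<^sup>2" if "\<bar>s\<bar> \<le> h/2" for s i j
  proof -
    have "\<bar>Kreg \<epsilon> (z + s *\<^sub>R axis i 1) $ j - Kreg \<epsilon> z $ j\<bar> \<le> norm (Kreg \<epsilon> (z + s *\<^sub>R axis i 1) - Kreg \<epsilon> z)"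
      using component_le_norm_cart[of "Kreg \<epsilon> (z + s *\<^sub>R axis i 1) - Kreg \<epsilon> z" j] by simp
    also have "\<dots> \<le> norm (s *\<^sub>R axis i (1::real)) / \<epsilon>\<^sup>2"
      using norm_Kreg_diff_le[OF assms(1), of "z + s *\<^sub>R axis i 1" z] by simp
    also have "\<dots> \<le> (h/2) / \<epsilon>\<^sup>2"
      using that by (intro divide_right_mono) (auto simp: norm_axis_1)
    finally show ?thesis .
  qed
  have "norm (kdisc \<epsilon> h z - Kreg \<epsilon> z) \<le> (h/2) / \<epsilon>\<^sup>2 + (h/2) / \<epsilon>\<^sup>2"
    using norm_plane_le[of "kdisc \<epsilon> h z - Kreg \<epsilon> z"] L[OF s(1), of 2 1] L[OF t(1), of 1 2] 1 2
    by simp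
  also have "\<dots> = h / \<epsilon>\<^sup>2" by (simp add: field_simps)
  finally show ?thesis .
qed

lemma norm_kdisc:
  assumes "\<epsilon> > 0" "h > 0" "h \<le> \<epsilon>"
  shows "norm (kdisc \<epsilon> h z) \<le> 2 / \<epsilon>"
proof -
  have "norm (kdisc \<epsilon> h z) \<le> norm (Kreg \<epsilon> z) + norm (kdisc \<epsilon> h z - Kreg \<epsilon> z)"
    using norm_triangle_ineq[of "Kreg \<epsilon> z" "kdisc \<epsilon> h z - Kreg \<epsilon> z"] by simp
  also have "\<dots> \<le> 1 / \<epsilon> + h / \<epsilon>\<^sup>2"
    using norm_Kreg[OF assms(1)] norm_kdisc_minus_Kreg[OF assms(1,2)] by (rule add_mono)
  also have "h / \<epsilon>\<^sup>2 \<le> \<epsilon> / \<epsilon>\<^sup>2" using assms by (intro divide_right_mono) auto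
  also have "\<epsilon> / \<epsilon>\<^sup>2 = 1 / \<epsilon>" using assms by (simp add: power2_eq_square)
  finally show ?thesis by simp
qed

text \<open>Conservative form: the mass crossing the edge with midpoint \<open>y\<close> in direction \<open>i\<close> is
  weighted with \<open>1/4 \<plusminus> a y $ i\<close>, the diffusive and the advective part.\<close>

definition step :: "real \<Rightarrow> (plane \<Rightarrow> plane) \<Rightarrow> (plane \<Rightarrow> real) \<Rightarrow> plane \<Rightarrow> real" where
  "step h a w x = (\<Sum>i\<in>UNIV. (1/4 + a (x - (h/2) *\<^sub>R axis i 1) $ i) * w (x - h *\<^sub>R axis i 1)
     + (1/4 - a (x + (h/2) *\<^sub>R axis i 1) $ i) * w (x + h *\<^sub>R axis i 1))"

text \<open>The adjoint of \<open>step\<close>: the expected value of \<phi> after one jump of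
  length h of a random walk along the axes. For a field without discrete divergence the weights at x
  add up to 1.\<close>

definition dual_step :: "real \<Rightarrow> (plane \<Rightarrow> plane) \<Rightarrow> (plane \<Rightarrow> real) \<Rightarrow> plane \<Rightarrow> real" where
  "dual_step h a \<phi> x = (\<Sum>i\<in>UNIV. (1/4 + a (x + (h/2) *\<^sub>R axis i 1) $ i) * \<phi> (x + h *\<^sub>R axis i 1)
     + (1/4 - a (x - (h/2) *\<^sub>R axis i 1) $ i) * \<phi> (x - h *\<^sub>R axis i 1))"

text \<open>The bound 1/4 makes all jump weights nonnegative, and the vanishing discrete divergence
  makes them sum to 1 both in \<open>step\<close> and in \<open>dual_step\<close>. The walk is
  doubly stochastic: the first sum gives the sup bound, the second conservation of mass and with it
  the L^1 bound.\<close>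

locale markov_step =
  fixes h :: real and a :: "plane \<Rightarrow> plane"
  assumes a_meas: "a \<in> borel_measurable borel"
    and a_le: "\<And>x i. \<bar>a x $ i\<bar> \<le> 1/4"
    and a_div: "\<And>x. (\<Sum>i\<in>UNIV. a (x + (h/2) *\<^sub>R axis i 1) $ i - a (x - (h/2) *\<^sub>R axis i 1) $ i) = 0"
begin

lemma a_bounds: "0 \<le> 1/4 + a x $ i" "0 \<le> 1/4 - a x $ i" "1/4 + a x $ i \<le> 1/2" "1/4 - a x $ i \<le> 1/2"
  using a_le[of x i] by auto

lemma a_abs: "\<bar>1/4 + a x $ i\<bar> = 1/4 + a x $ i" "\<bar>1/4 - a x $ i\<bar> = 1/4 - a x $ i"
  by (simp_all only: abs_of_nonneg a_bounds)

lemma a_mult_left_mono: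
  "s \<le> t \<Longrightarrow> (1/4 + a x $ i) * s \<le> (1/4 + a x $ i) * t"
  "s \<le> t \<Longrightarrow> (1/4 - a x $ i) * s \<le> (1/4 - a x $ i) * t"
  by (simp_all only: mult_left_mono a_bounds)

lemma step_bound:
  assumes "\<And>x. \<bar>w x\<bar> \<le> M"
  shows "\<bar>step h a w x\<bar> \<le> M"
proof -
  have "\<bar>step h a w x\<bar> \<le> (\<Sum>i\<in>UNIV. (1/4 + a (x - (h/2) *\<^sub>R axis i 1) $ i) * M
     + (1/4 - a (x + (h/2) *\<^sub>R axis i 1) $ i) * M)"
    unfolding step_def
  proof (rule order_trans[OF sum_abs sum_mono])
    fix i :: 2
    show "\<bar>(1/4 + a (x - (h/2) *\<^sub>R axis i 1) $ i) * w (x - h *\<^sub>R axis i 1)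
       + (1/4 - a (x + (h/2) *\<^sub>R axis i 1) $ i) * w (x + h *\<^sub>R axis i 1)\<bar>
      \<le> (1/4 + a (x - (h/2) *\<^sub>R axis i 1) $ i) * M + (1/4 - a (x + (h/2) *\<^sub>R axis i 1) $ i) * M"
      by (rule order_trans[OF abs_triangle_ineq])
        (simp only: abs_mult a_abs, intro add_mono a_mult_left_mono assms)
  qed
  also have "\<dots> = M * (1 - (\<Sum>i\<in>UNIV. a (x + (h/2) *\<^sub>R axis i 1) $ i - a (x - (h/2) *\<^sub>R axis i 1) $ i))"
    unfolding sum_2 by (simp add: algebra_simps)
  finally show ?thesis unfolding a_div by simp
qed

lemma a_shift_meas:
  "(\<lambda>x. a (x + c) $ i) \<in> borel_measurable borel" "(\<lambda>x. a (x - c) $ i) \<in> borel_measurable borel"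
  by (intro borel_measurable_nth measurable_compose[OF _ a_meas] borel_measurable_add borel_measurable_diff
      borel_measurable_const measurable_ident_sets refl)+

lemma shift_meas:
  fixes w :: "plane \<Rightarrow> real"
  assumes "w \<in> borel_measurable borel"
  shows "(\<lambda>x. w (x + c)) \<in> borel_measurable borel" "(\<lambda>x. w (x - c)) \<in> borel_measurable borel"
  by (intro measurable_compose[OF _ assms] borel_measurable_add borel_measurable_diff
      borel_measurable_const measurable_ident_sets refl)+

lemma dual_step_meas:
  assumes "w \<in> borel_measurable borel"
  shows "dual_step h a w \<in> borel_measurable borel"
  unfolding dual_step_def[abs_def]
  by (intro borel_measurable_sum borel_measurable_add borel_measurable_times borel_measurable_diff
      borel_measurable_const a_shift_meas shift_meas assms)

lemma integrable_bounded_mult: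
  fixes w :: "plane \<Rightarrow> real"
  assumes "integrable lborel w" "f \<in> borel_measurable borel" "\<And>x. \<bar>f x\<bar> \<le> B"
  shows "integrable lborel (\<lambda>x. f x * w x)"
proof (rule Bochner_Integration.integrable_bound[where f = "\<lambda>x. B * w x"])
  have "\<bar>f x\<bar> * \<bar>w x\<bar> \<le> \<bar>B\<bar> * \<bar>w x\<bar>" for x
    using assms(3)[of x] by (intro mult_right_mono) auto
  then show "AE x in lborel. norm (f x * w x) \<le> norm (B * w x)"
    by (auto simp: abs_mult)
qed (use assms in auto)

lemma
  assumes w: "integrable lborel w" and \<phi>: "\<phi> \<in> borel_measurable borel" "\<And>x. \<bar>\<phi> x\<bar> \<le> B"
  shows step_dual: "(LINT x|lborel. step h a w x * \<phi> x) = (LINT x|lborel. w x * dual_step h a \<phi> x)"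
    and step_mult_integrable: "integrable lborel (\<lambda>x. step h a w x * \<phi> x)"
proof -
  have wm: "w \<in> borel_measurable borel" using w by auto
  define e where "e i = axis i (1::real)" for i :: 2
  define f where "f i x = (1/4 + a (x + (h/2) *\<^sub>R e i) $ i) * \<phi> (x + h *\<^sub>R e i) * w x" for i x
  define g where "g i x = (1/4 - a (x - (h/2) *\<^sub>R e i) $ i) * \<phi> (x - h *\<^sub>R e i) * w x" for i x
  have B: "\<bar>(1/4 + a y $ i) * \<phi> z\<bar> \<le> 1/2 * B" "\<bar>(1/4 - a y $ i) * \<phi> z\<bar> \<le> 1/2 * B" for y z i
    unfolding abs_mult using a_bounds[of y i] \<phi>(2)[of z] by (intro mult_mono; simp)+
  have fm: "f i \<in> borel_measurable borel" and gm: "g i \<in> borel_measurable borel" for i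
    unfolding f_def[abs_def] g_def[abs_def]
    by (intro borel_measurable_add borel_measurable_times borel_measurable_diff
      borel_measurable_const a_shift_meas shift_meas wm \<phi>(1))+
  have fi: "integrable lborel (f i)" and gi: "integrable lborel (g i)" for i
    unfolding f_def[abs_def] g_def[abs_def]
    by (rule integrable_bounded_mult[OF w _ B(1)] integrable_bounded_mult[OF w _ B(2)],
      intro borel_measurable_add borel_measurable_times borel_measurable_diff
      borel_measurable_const a_shift_meas shift_meas \<phi>(1))+
  have half: "h *\<^sub>R v = (h/2) *\<^sub>R v + (h/2) *\<^sub>R v" for v :: plane
    by (simp flip: scaleR_left.add)
  \<comment> \<open>Undoing the shift by h turns the edge midpoint ahead of the old point into the
    one behind the new point: it is the same edge, so its weight is the same.\<close>
  have f': "f i (- (h *\<^sub>R e i) + x) = (1/4 + a (x - (h/2) *\<^sub>R e i) $ i) * w (x - h *\<^sub>R e i) * \<phi> x" for i x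
  proof -
    have "- (h *\<^sub>R e i) + x + (h/2) *\<^sub>R e i = x - (h/2) *\<^sub>R e i"
      unfolding half by simp
    moreover have "- (h *\<^sub>R e i) + x = x - h *\<^sub>R e i" by simp
    ultimately show ?thesis by (simp only: f_def) (simp add: mult_ac)
  qed
  have g': "g i (h *\<^sub>R e i + x) = (1/4 - a (x + (h/2) *\<^sub>R e i) $ i) * w (x + h *\<^sub>R e i) * \<phi> x" for i x
  proof -
    have "h *\<^sub>R e i + x - (h/2) *\<^sub>R e i = x + (h/2) *\<^sub>R e i"
      unfolding half by simp
    moreover have "h *\<^sub>R e i + x = x + h *\<^sub>R e i" by simp
    ultimately show ?thesis by (simp only: g_def) (simp add: mult_ac)
  qed
  have eq: "step h a w x * \<phi> x = (\<Sum>i\<in>UNIV. f i (- (h *\<^sub>R e i) + x) + g i (h *\<^sub>R e i + x))" for x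
    unfolding f' g' step_def sum_distrib_right e_def[symmetric] by (simp add: algebra_simps)
  have fi': "integrable lborel (\<lambda>x. f i (c + x))" and gi': "integrable lborel (\<lambda>x. g i (c + x))" for i c
    using fi gi by (simp_all add: integrable_lborel_translate fm gm)
  show "integrable lborel (\<lambda>x. step h a w x * \<phi> x)"
    unfolding eq by (intro Bochner_Integration.integrable_sum Bochner_Integration.integrable_add fi' gi')
  have "(LINT x|lborel. step h a w x * \<phi> x) = (\<Sum>i\<in>UNIV. (LINT x|lborel. f i x) + (LINT x|lborel. g i x))"
    unfolding eq
    by (simp only: Bochner_Integration.integral_sum[OF Bochner_Integration.integrable_add[OF fi' gi']]
        Bochner_Integration.integral_add[OF fi' gi'] integral_lborel_translate[OF fm] integral_lborel_translate[OF gm])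
  also have "\<dots> = (LINT x|lborel. (\<Sum>i\<in>UNIV. f i x + g i x))"
    by (simp only: Bochner_Integration.integral_sum[OF Bochner_Integration.integrable_add[OF fi gi]]
        Bochner_Integration.integral_add[OF fi gi])
  also have "\<dots> = (LINT x|lborel. w x * dual_step h a \<phi> x)"
    by (intro Bochner_Integration.integral_cong refl)
      (simp add: f_def g_def dual_step_def e_def sum_distrib_left algebra_simps)
  finally show "(LINT x|lborel. step h a w x * \<phi> x) = (LINT x|lborel. w x * dual_step h a \<phi> x)" .
qed

lemma dual_step_1: "dual_step h a (\<lambda>x. c) x = c"
proof -
  have "dual_step h a (\<lambda>x. c) x = c * (1 + (\<Sum>i\<in>UNIV. a (x + (h/2) *\<^sub>R axis i 1) $ i - a (x - (h/2) *\<^sub>R axis i 1) $ i))"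
    unfolding dual_step_def sum_2 by (simp add: algebra_simps)
  then show ?thesis unfolding a_div by simp
qed

lemma step_integrable: "integrable lborel w \<Longrightarrow> integrable lborel (step h a w)"
  using step_mult_integrable[of w "\<lambda>x. 1" 1] by simp

text \<open>Nonnegative weights give |step w| \<le> step |w|, and conservation of mass is duality
  with the constant 1.\<close>

lemma step_L1:
  assumes w: "integrable lborel w"
  shows "(LINT x|lborel. \<bar>step h a w x\<bar>) \<le> (LINT x|lborel. \<bar>w x\<bar>)"
proof -
  have wa: "integrable lborel (\<lambda>x. \<bar>w x\<bar>)" using w by simp
  have "(LINT x|lborel. \<bar>step h a w x\<bar>) \<le> (LINT x|lborel. step h a (\<lambda>x. \<bar>w x\<bar>) x)"
  proof (rule integral_mono)
    show "integrable lborel (\<lambda>x. \<bar>step h a w x\<bar>)" using step_integrable[OF w] by simp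
    show "integrable lborel (step h a (\<lambda>x. \<bar>w x\<bar>))" by (rule step_integrable[OF wa])
    show "\<bar>step h a w x\<bar> \<le> step h a (\<lambda>x. \<bar>w x\<bar>) x" for x
      unfolding step_def
      by (rule order_trans[OF sum_abs sum_mono], rule order_trans[OF abs_triangle_ineq])
        (simp only: abs_mult a_abs order_refl)
  qed
  also have "\<dots> = (LINT x|lborel. \<bar>w x\<bar>)"
    using step_dual[OF wa, of "\<lambda>x. 1" 1] dual_step_1[of 1] by simp
  finally show ?thesis .
qed

text \<open>The diffusion of the walk is of order \<open>h\<^sup>2\<close> and enters only through the remainder \<open>E\<close>
  of the expansion of \<open>\<phi>\<close>.\<close>

lemma dual_step_expansion:
  assumes h: "h > 0"
    and ex: "\<And>x q. norm q \<le> h \<Longrightarrow> \<bar>\<phi> (x + q) - f x - D x \<bullet> q\<bar> \<le> E"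
    and D: "\<And>x. norm (D x) \<le> C"
    and c: "\<And>x i. \<bar>a (x + (h/2) *\<^sub>R axis i 1) $ i - c x $ i\<bar> \<le> \<kappa>"
       "\<And>x i. \<bar>a (x - (h/2) *\<^sub>R axis i 1) $ i - c x $ i\<bar> \<le> \<kappa>"
  shows "\<bar>dual_step h a \<phi> x - (f x + 2 * h * (c x \<bullet> D x))\<bar> \<le> E + 4 * h * \<kappa> * C"
proof -
  define e where "e i = axis i (1::real)" for i :: 2
  define p where "p i = a (x + (h/2) *\<^sub>R e i) $ i" for i
  define m where "m i = a (x - (h/2) *\<^sub>R e i) $ i" for i
  define r where "r i = \<phi> (x + h *\<^sub>R e i) - f x - D x \<bullet> (h *\<^sub>R e i)" for i
  define s where "s i = \<phi> (x - h *\<^sub>R e i) - f x - D x \<bullet> (- (h *\<^sub>R e i))" for i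
  have ne: "norm (h *\<^sub>R e i) \<le> h" "norm (- (h *\<^sub>R e i)) \<le> h" for i
    using h by (simp_all add: e_def norm_axis_1)
  have rs: "\<bar>r i\<bar> \<le> E" "\<bar>s i\<bar> \<le> E" for i
    using ex[OF ne(1), of x i] ex[OF ne(2), of x i] by (simp_all add: r_def s_def)
  have pm: "0 \<le> 1/4 + p i" "0 \<le> 1/4 - m i" "\<bar>p i - c x $ i\<bar> \<le> \<kappa>" "\<bar>m i - c x $ i\<bar> \<le> \<kappa>" for i
    using a_bounds c unfolding p_def m_def e_def by auto
  have div: "(\<Sum>i\<in>UNIV. p i - m i) = 0" using a_div[of x] by (simp add: p_def m_def e_def)
  have De: "D x \<bullet> e i = D x $ i" for i by (simp add: e_def inner_axis)
  have DC: "\<bar>D x $ i\<bar> \<le> C" for i using component_le_norm_cart[of "D x" i] D[of x] by linarith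
  have "dual_step h a \<phi> x = (\<Sum>i\<in>UNIV. (1/4 + p i) * (f x + h * D x $ i + r i) + (1/4 - m i) * (f x - h * D x $ i + s i))"
    unfolding dual_step_def p_def[symmetric] m_def[symmetric] e_def[symmetric] r_def s_def
    by (simp add: De)
  \<comment> \<open>The constant 1/4 cancels in the first-order terms by the symmetry of the jumps,
    so only the drifts at the two opposite edges survive; the zeroth-order weight is 1 plus the
    discrete divergence.\<close>
  also have "\<dots> = f x * (1 + (\<Sum>i\<in>UNIV. p i - m i)) + h * (\<Sum>i\<in>UNIV. (p i + m i) * D x $ i)
     + (\<Sum>i\<in>UNIV. (1/4 + p i) * r i + (1/4 - m i) * s i)"
    unfolding sum_2 by algebra
  finally have eq: "dual_step h a \<phi> x - (f x + 2 * h * (c x \<bullet> D x))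
     = h * (\<Sum>i\<in>UNIV. ((p i - c x $ i) + (m i - c x $ i)) * D x $ i)
       + (\<Sum>i\<in>UNIV. (1/4 + p i) * r i + (1/4 - m i) * s i)"
    unfolding div inner_plane sum_2 by (simp add: algebra_simps)
  have "\<bar>h * (\<Sum>i\<in>UNIV. ((p i - c x $ i) + (m i - c x $ i)) * D x $ i)\<bar> \<le> h * (\<Sum>i\<in>(UNIV::2 set). (\<kappa> + \<kappa>) * C)"
    unfolding abs_mult abs_of_pos[OF h]
  proof (rule mult_left_mono[OF order_trans[OF sum_abs sum_mono]])
    fix i :: 2
    have "\<bar>(p i - c x $ i) + (m i - c x $ i)\<bar> \<le> \<kappa> + \<kappa>" using pm[of i] by linarith
    then show "\<bar>((p i - c x $ i) + (m i - c x $ i)) * D x $ i\<bar> \<le> (\<kappa> + \<kappa>) * C"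
      unfolding abs_mult using DC[of i] by (intro mult_mono) auto
  qed (use h in auto)
  moreover have "\<bar>\<Sum>i\<in>UNIV. (1/4 + p i) * r i + (1/4 - m i) * s i\<bar> \<le> E"
  proof -
    have "\<bar>\<Sum>i\<in>UNIV. (1/4 + p i) * r i + (1/4 - m i) * s i\<bar> \<le> (\<Sum>i\<in>UNIV. (1/4 + p i) * E + (1/4 - m i) * E)"
    proof (rule order_trans[OF sum_abs sum_mono])
      fix i :: 2
      show "\<bar>(1/4 + p i) * r i + (1/4 - m i) * s i\<bar> \<le> (1/4 + p i) * E + (1/4 - m i) * E"
        by (rule order_trans[OF abs_triangle_ineq])
          (simp only: abs_mult abs_of_nonneg[OF pm(1)] abs_of_nonneg[OF pm(2)], intro add_mono mult_left_mono rs pm)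
    qed
    also have "\<dots> = E * (1 + (\<Sum>i\<in>UNIV. p i - m i))"
      unfolding sum_2 by (simp add: algebra_simps)
    finally show ?thesis unfolding div by simp
  qed
  ultimately show ?thesis unfolding eq by simp
qed

text \<open>For a space-time test function, \<phi> will be its value at the new time and
  \<open>f\<close> its first-order expansion in time at the old one, so that a single estimate
  covers both the transport and the time increment.\<close>

lemma step_consistency:
  assumes h: "h > 0" and w: "integrable lborel w"
    and \<phi>: "\<phi> \<in> borel_measurable borel" "\<And>x. \<bar>\<phi> x\<bar> \<le> B"
    and ex: "\<And>x q. norm q \<le> h \<Longrightarrow> \<bar>\<phi> (x + q) - f x - D x \<bullet> q\<bar> \<le> E"
    and D: "\<And>x. norm (D x) \<le> C"
    and c: "\<And>x i. \<bar>a (x + (h/2) *\<^sub>R axis i 1) $ i - c x $ i\<bar> \<le> \<kappa>"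
       "\<And>x i. \<bar>a (x - (h/2) *\<^sub>R axis i 1) $ i - c x $ i\<bar> \<le> \<kappa>"
    and m: "integrable lborel (\<lambda>x. w x * (f x + 2 * h * (c x \<bullet> D x)))"
  shows "\<bar>(LINT x|lborel. step h a w x * \<phi> x) - (LINT x|lborel. w x * (f x + 2 * h * (c x \<bullet> D x)))\<bar>
      \<le> (E + 4 * h * \<kappa> * C) * (LINT x|lborel. \<bar>w x\<bar>)"
proof -
  note d = dual_step_expansion[OF h ex D c]
  have wa: "integrable lborel (\<lambda>x. (E + 4 * h * \<kappa> * C) * \<bar>w x\<bar>)" using w by simp
  have B: "\<bar>dual_step h a \<phi> x\<bar> \<le> B" for x
  proof -
    have "\<bar>dual_step h a \<phi> x\<bar> \<le> dual_step h a (\<lambda>x. B) x"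
      unfolding dual_step_def
      by (rule order_trans[OF sum_abs sum_mono], rule order_trans[OF abs_triangle_ineq])
        (simp only: abs_mult a_abs, intro add_mono a_mult_left_mono \<phi>(2))
    then show ?thesis by (simp add: dual_step_1)
  qed
  have i: "integrable lborel (\<lambda>x. w x * dual_step h a \<phi> x)"
    using integrable_bounded_mult[OF w dual_step_meas[OF \<phi>(1)] B] by (simp add: mult.commute)
  have "(LINT x|lborel. step h a w x * \<phi> x) - (LINT x|lborel. w x * (f x + 2 * h * (c x \<bullet> D x)))
     = (LINT x|lborel. w x * dual_step h a \<phi> x - w x * (f x + 2 * h * (c x \<bullet> D x)))"
    unfolding step_dual[OF w \<phi>] by (rule Bochner_Integration.integral_diff[OF i m, symmetric])
  also have "\<bar>\<dots>\<bar> \<le> (LINT x|lborel. \<bar>w x * dual_step h a \<phi> x - w x * (f x + 2 * h * (c x \<bullet> D x))\<bar>)"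
    by (rule integral_abs_bound)
  also have "\<dots> \<le> (LINT x|lborel. (E + 4 * h * \<kappa> * C) * \<bar>w x\<bar>)"
  proof (rule integral_mono[OF _ wa])
    show "integrable lborel (\<lambda>x. \<bar>w x * dual_step h a \<phi> x - w x * (f x + 2 * h * (c x \<bullet> D x))\<bar>)"
      by (intro Bochner_Integration.integrable_abs Bochner_Integration.integrable_diff i m)
    show "\<bar>w x * dual_step h a \<phi> x - w x * (f x + 2 * h * (c x \<bullet> D x))\<bar> \<le> (E + 4 * h * \<kappa> * C) * \<bar>w x\<bar>" for x
      unfolding right_diff_distrib[symmetric] abs_mult mult.commute[of "\<bar>w x\<bar>"]
      using d by (intro mult_right_mono) auto
  qed
  finally show ?thesis by simp
qed

end

section \<open>Velocity of a bounded integrable vorticity\<close>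

lemma C11_continuous:
  assumes "C11 C \<phi> D"
  shows "continuous_on UNIV \<phi>"
proof -
  have "(\<lambda>q. \<phi> (x + q) - \<phi> x) \<midarrow>0\<rightarrow> 0" for x
  proof (rule Lim_null_comparison)
    show "((\<lambda>q. 2 * C * norm q) \<longlongrightarrow> 0) (at 0)"
      by (auto intro!: tendsto_eq_intros)
    show "\<forall>\<^sub>F q in at 0. norm (\<phi> (x + q) - \<phi> x) \<le> 2 * C * norm q"
      using C11_Lipschitz[OF assms] by (intro always_eventually) auto
  qed
  then have "(\<lambda>q. \<phi> (x + q)) \<midarrow>0\<rightarrow> \<phi> x" for x by (rule LIM_zero_cancel)
  then show ?thesis by (simp add: continuous_on_eq_continuous_at isCont_iff)
qed

text \<open>The gradient is a pointwise limit of difference quotients of a continuous function, with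
  error at most C |b|^2 / (n + 1) in direction b.\<close>

lemma C11_gradient_measurable:
  fixes \<phi> :: "'a::euclidean_space \<Rightarrow> real"
  assumes C: "C11 C \<phi> D"
  shows "D \<in> borel_measurable borel"
proof -
  have "(\<lambda>x. D x \<bullet> b) \<in> borel_measurable borel" for b
  proof (rule borel_measurable_LIMSEQ_metric)
    let ?q = "\<lambda>n. (1 / real (Suc n)) *\<^sub>R b"
    have m: "\<phi> \<in> borel_measurable borel"
      by (rule borel_measurable_continuous_onI[OF C11_continuous[OF C]])
    show "(\<lambda>x. real (Suc n) * (\<phi> (x + ?q n) - \<phi> x)) \<in> borel_measurable borel" for n
      by (intro borel_measurable_times borel_measurable_const borel_measurable_diff
          measurable_compose[OF _ m] borel_measurable_add measurable_ident_sets refl)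
    fix x
    have "(\<lambda>n. real (Suc n) * (\<phi> (x + ?q n) - \<phi> x) - D x \<bullet> b) \<longlonglongrightarrow> 0"
    proof (rule Lim_null_comparison)
      show "(\<lambda>n. C * (norm b)\<^sup>2 * inverse (real (Suc n))) \<longlonglongrightarrow> 0"
        by (rule tendsto_mult_right_zero[OF LIMSEQ_inverse_real_of_nat])
      have "norm (real (Suc n) * (\<phi> (x + ?q n) - \<phi> x) - D x \<bullet> b) \<le> C * (norm b)\<^sup>2 * inverse (real (Suc n))" for n
      proof -
        have "real (Suc n) * (\<phi> (x + ?q n) - \<phi> x) - D x \<bullet> b = real (Suc n) * (\<phi> (x + ?q n) - \<phi> x - D x \<bullet> ?q n)"
          by (simp add: right_diff_distrib del: of_nat_Suc)
        also have "\<bar>\<dots>\<bar> \<le> real (Suc n) * (C * (norm (?q n))\<^sup>2)"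
          unfolding abs_mult using C11D(3)[OF C, of x "?q n"] by (simp add: mult_left_mono del: of_nat_Suc)
        also have "\<dots> = C * (norm b)\<^sup>2 * inverse (real (Suc n))"
          by (simp add: power_mult_distrib power2_eq_square field_simps del: of_nat_Suc)
        finally show ?thesis by simp
      qed
      then show "\<forall>\<^sub>F n in sequentially. norm (real (Suc n) * (\<phi> (x + ?q n) - \<phi> x) - D x \<bullet> b) \<le> C * (norm b)\<^sup>2 * inverse (real (Suc n))"
        by simp
    qed
    then show "(\<lambda>n. real (Suc n) * (\<phi> (x + ?q n) - \<phi> x)) \<longlonglongrightarrow> D x \<bullet> b"
      by (rule LIM_zero_cancel)
  qed
  then have "(\<lambda>x. \<Sum>b\<in>Basis. (D x \<bullet> b) *\<^sub>R b) \<in> borel_measurable borel"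
    by (intro borel_measurable_sum borel_measurable_scaleR borel_measurable_const)
  then show ?thesis by (simp add: euclidean_representation)
qed

lemma C11_snd:
  assumes "C11 C \<phi> D"
  shows "C11 C (\<lambda>p. \<phi> (snd p)) (\<lambda>p. (0, D (snd p)) :: real \<times> 'a::real_inner)"
proof -
  have "C * (norm (snd q))\<^sup>2 \<le> C * (norm q)\<^sup>2" for q :: "real \<times> 'a"
    using C11D(4)[OF assms] norm_snd_le[of "snd q" "fst q"] by (intro mult_left_mono power_mono) auto
  moreover have "\<bar>\<phi> (snd x + snd q) - \<phi> (snd x) - D (snd x) \<bullet> snd q\<bar> \<le> C * (norm (snd q))\<^sup>2" for x q :: "real \<times> 'a"
    by (rule C11D(3)[OF assms])
  ultimately show ?thesis
    unfolding C11_def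
  proof (intro conjI allI)
    fix x q :: "real \<times> 'a"
    show "\<bar>\<phi> (snd x)\<bar> \<le> C" "norm (0::real, D (snd x)) \<le> C" using C11D(1,2)[OF assms] by auto
    show "\<bar>\<phi> (snd (x + q)) - \<phi> (snd x) - (0, D (snd x)) \<bullet> q\<bar> \<le> C * (norm q)\<^sup>2"
      using C11D(3)[OF assms, of "snd x" "snd q"] \<open>\<And>q. C * (norm (snd q))\<^sup>2 \<le> C * (norm q)\<^sup>2\<close>[of q]
      by (cases q) simp
  qed
qed

lemma norm_triangle3: "norm (a + b + c) \<le> norm a + norm b + norm c"
  by (rule order_trans[OF norm_triangle_ineq add_right_mono[OF norm_triangle_ineq]])

definition conv :: "(plane \<Rightarrow> real) \<Rightarrow> (plane \<Rightarrow> plane) \<Rightarrow> plane \<Rightarrow> plane" where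
  "conv w k x = (LINT y|lborel. w y *\<^sub>R k (x - y))"

text \<open>Representatives are bounded at every point, not just almost everywhere, so pointwise
  estimates under the integral involve no null sets. Both bounds are preserved by each step of the
  scheme and by weak-* limits.\<close>

definition vort :: "real \<Rightarrow> real \<Rightarrow> (plane \<Rightarrow> real) \<Rightarrow> bool" where
  "vort M M1 w \<longleftrightarrow> (\<forall>x. \<bar>w x\<bar> \<le> M) \<and> integrable lborel w \<and> (LINT x|lborel. \<bar>w x\<bar>) \<le> M1"

lemma vortD:
  assumes "vort M M1 w"
  shows "\<bar>w x\<bar> \<le> M" "integrable lborel w" "(LINT x|lborel. \<bar>w x\<bar>) \<le> M1" "w \<in> borel_measurable borel" "M \<ge> 0" "M1 \<ge> 0"
proof -
  show *: "\<bar>w x\<bar> \<le> M" "integrable lborel w" "(LINT x|lborel. \<bar>w x\<bar>) \<le> M1" using assms by (auto simp: vort_def)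
  then show "w \<in> borel_measurable borel" by auto
  show "M \<ge> 0" using *(1) by linarith
  have "(LINT x|lborel. \<bar>w x\<bar>) \<ge> 0" by simp
  then show "M1 \<ge> 0" using *(3) by linarith
qed

lemma K_conv_eq_conv:
  assumes "w \<in> borel_measurable borel"
  shows "K_conv w x = conv w K x"
  unfolding K_conv_def conv_def using assms
  by (intro integral_completion) (auto intro!: borel_measurable_scaleR borel_measurable_K)

lemma kernel_meas:
  fixes x :: plane and k :: "plane \<Rightarrow> plane"
  assumes "w \<in> borel_measurable borel" "k \<in> borel_measurable borel"
  shows "(\<lambda>y. w y *\<^sub>R k (x - y)) \<in> borel_measurable borel"
  by (intro borel_measurable_scaleR assms(1) measurable_compose[OF _ assms(2)] borel_measurable_diff
      borel_measurable_const measurable_ident_sets refl)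

lemma kernel_integrable:
  assumes w: "integrable lborel w" and k: "k \<in> borel_measurable borel" "\<And>z. norm (k z) \<le> B"
  shows "integrable lborel (\<lambda>y. w y *\<^sub>R k (x - y :: plane) :: plane)"
proof (rule Bochner_Integration.integrable_bound[where f = "\<lambda>y. B * w y"])
  have "\<bar>w y\<bar> * norm (k (x - y)) \<le> \<bar>B\<bar> * \<bar>w y\<bar>" for y
    unfolding mult.commute[of "\<bar>w y\<bar>"] using k(2)[of "x - y"] by (intro mult_right_mono) auto
  then show "AE y in lborel. norm (w y *\<^sub>R k (x - y)) \<le> norm (B * w y)"
    by (auto simp: abs_mult)
  show "(\<lambda>y. w y *\<^sub>R k (x - y)) \<in> borel_measurable lborel"
    using kernel_meas[OF _ k(1), of w] w by auto
qed (use w in auto)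

lemma near_kernel_integrable:
  "integrable lborel (\<lambda>y. indicator (ball 0 r) (x - y) * norm (K (x - y)))"
  by (subst integrable_lborel_reflect[OF borel_measurable_indicator_K]) (rule integrable_K_ball)

lemma near_kernel_bound:
  assumes "vort M M1 w"
  shows "integrable lborel (\<lambda>y. \<bar>w y\<bar> * (indicator (ball 0 r) (x - y) * norm (K (x - y))))" (is ?I)
    and "(LINT y|lborel. \<bar>w y\<bar> * (indicator (ball 0 r) (x - y) * norm (K (x - y)))) \<le> M * K_mass r"
proof -
  note w = vortD[OF assms]
  have i: "integrable lborel (\<lambda>y. M * (indicator (ball 0 r) (x - y) * norm (K (x - y))))"
    by (intro integrable_mult_right near_kernel_integrable)
  have le: "\<bar>w y\<bar> * (indicator (ball 0 r) (x - y) * norm (K (x - y))) \<le> M * (indicator (ball 0 r) (x - y) * norm (K (x - y)))" for y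
    using w(1) by (intro mult_right_mono) auto
  show I: ?I
  proof (rule Bochner_Integration.integrable_bound[OF i])
    show "AE y in lborel. norm (\<bar>w y\<bar> * (indicator (ball 0 r) (x - y) * norm (K (x - y))))
       \<le> norm (M * (indicator (ball 0 r) (x - y) * norm (K (x - y))))"
      using le w(5) by (auto simp: abs_mult intro!: AE_I2)
    show "(\<lambda>y. \<bar>w y\<bar> * (indicator (ball 0 r) (x - y) * norm (K (x - y)))) \<in> borel_measurable lborel"
      using w(4) by (intro borel_measurable_times borel_measurable_abs
          borel_measurable_integrable[OF near_kernel_integrable]) auto
  qed
  have "(LINT y|lborel. \<bar>w y\<bar> * (indicator (ball 0 r) (x - y) * norm (K (x - y))))
     \<le> (LINT y|lborel. M * (indicator (ball 0 r) (x - y) * norm (K (x - y))))"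
    by (rule integral_mono[OF I i le])
  also have "\<dots> = M * K_mass r"
    using integral_lborel_reflect[OF borel_measurable_indicator_K, of r x] by (simp add: K_mass_def)
  finally show "(LINT y|lborel. \<bar>w y\<bar> * (indicator (ball 0 r) (x - y) * norm (K (x - y)))) \<le> M * K_mass r" .
qed

lemma norm_K_le_near: "norm (K z) \<le> indicator (ball 0 1) z * norm (K z) + 1"
proof (cases "norm z < 1")
  case False
  then have "norm z \<ge> 1" by simp
  then have "1 / norm z \<le> 1" by (simp add: divide_le_eq_1)
  then show ?thesis using norm_K_le[of z] False by simp
qed auto

lemma norm_Kreg_le_K:
  assumes "\<epsilon> > 0"
  shows "norm (Kreg \<epsilon> z) \<le> norm (K z)"
proof (cases "z = 0")
  case False
  have mx: "max ((norm z)\<^sup>2) (\<epsilon>\<^sup>2) > 0" using False by (simp add: less_max_iff_disj)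
  then have "\<bar>2 * pi * max ((norm z)\<^sup>2) (\<epsilon>\<^sup>2)\<bar> = 2 * pi * max ((norm z)\<^sup>2) (\<epsilon>\<^sup>2)"
    by (intro abs_of_nonneg mult_nonneg_nonneg) auto
  then have "norm (Kreg \<epsilon> z) = norm z / (2 * pi * max ((norm z)\<^sup>2) (\<epsilon>\<^sup>2))"
    unfolding Kreg_def norm_scaleR norm_perp abs_divide by simp
  also have "\<dots> \<le> norm z / (2 * pi * (norm z)\<^sup>2)"
  proof (rule divide_left_mono)
    have "0 < (norm z)\<^sup>2" using False by simp
    then show "0 < 2 * pi * max ((norm z)\<^sup>2) (\<epsilon>\<^sup>2) * (2 * pi * (norm z)\<^sup>2)"
      using mx by (intro mult_pos_pos) auto
  qed (auto intro: mult_left_mono)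
  also have "\<dots> = norm (K z)" using False by (simp add: norm_K power2_eq_square)
  finally show ?thesis .
qed (simp add: Kreg_def)

text \<open>The kernel is split at distance 1: near the singularity the bound M meets the
  integrability of \<open>K\<close>, farther away \<open>K\<close> is at most 1 and M1 takes over.
  The result is uniform in x and covers every kernel dominated by \<open>K\<close>, in particular
  all \<open>Kreg \<epsilon>\<close>.\<close>

lemma singular_kernel_bound:
  fixes k :: "plane \<Rightarrow> plane"
  assumes w: "vort M M1 w" and k: "k \<in> borel_measurable borel" "\<And>z. norm (k z) \<le> norm (K z)"
  shows "integrable lborel (\<lambda>y. w y *\<^sub>R k (x - y))"
    and "(LINT y|lborel. \<bar>w y\<bar> * norm (k (x - y))) \<le> M * K_mass 1 + M1"
proof -
  note w' = vortD[OF w]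
  have i: "integrable lborel (\<lambda>y. \<bar>w y\<bar> * (indicator (ball 0 1) (x - y) * norm (K (x - y))) + \<bar>w y\<bar>)"
    by (intro Bochner_Integration.integrable_add near_kernel_bound[OF w] integrable_abs w'(2))
  have le: "\<bar>w y\<bar> * norm (k (x - y)) \<le> \<bar>w y\<bar> * (indicator (ball 0 1) (x - y) * norm (K (x - y))) + \<bar>w y\<bar>" for y
    using mult_left_mono[OF order_trans[OF k(2) norm_K_le_near], of "\<bar>w y\<bar>" "x - y"] by (simp add: distrib_left)
  show I: "integrable lborel (\<lambda>y. w y *\<^sub>R k (x - y))"
  proof (rule Bochner_Integration.integrable_bound[OF i])
    show "AE y in lborel. norm (w y *\<^sub>R k (x - y)) \<le> norm (\<bar>w y\<bar> * (indicator (ball 0 1) (x - y) * norm (K (x - y))) + \<bar>w y\<bar>)"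
      using le by (auto intro!: AE_I2 order_trans[OF le])
    show "(\<lambda>y. w y *\<^sub>R k (x - y)) \<in> borel_measurable lborel"
      using kernel_meas[OF w'(4) k(1)] by simp
  qed
  have "(LINT y|lborel. \<bar>w y\<bar> * norm (k (x - y))) \<le>
     (LINT y|lborel. \<bar>w y\<bar> * (indicator (ball 0 1) (x - y) * norm (K (x - y))) + \<bar>w y\<bar>)"
    using integrable_norm[OF I] by (intro integral_mono[OF _ i le]) simp
  also have "\<dots> = (LINT y|lborel. \<bar>w y\<bar> * (indicator (ball 0 1) (x - y) * norm (K (x - y)))) + (LINT y|lborel. \<bar>w y\<bar>)"
    by (intro Bochner_Integration.integral_add near_kernel_bound[OF w] integrable_abs w'(2))
  also have "\<dots> \<le> M * K_mass 1 + M1"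
    by (intro add_mono near_kernel_bound(2)[OF w] w'(3))
  finally show "(LINT y|lborel. \<bar>w y\<bar> * norm (k (x - y))) \<le> M * K_mass 1 + M1" .
qed

lemma K_meas: "K \<in> borel_measurable borel" and Kreg_meas: "Kreg \<epsilon> \<in> borel_measurable borel"
  using borel_measurable_K[of "\<lambda>x. x" borel] borel_measurable_Kreg[of "\<lambda>x. x" borel \<epsilon>] by simp_all

lemma norm_conv_singular:
  assumes w: "vort M M1 w" and k: "k \<in> borel_measurable borel" "\<And>z. norm (k z) \<le> norm (K z)"
  shows "norm (conv w k x) \<le> M * K_mass 1 + M1"
proof -
  have "norm (conv w k x) \<le> (LINT y|lborel. norm (w y *\<^sub>R k (x - y)))"
    unfolding conv_def by (rule integral_norm_bound)
  also have "\<dots> \<le> M * K_mass 1 + M1"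
    using singular_kernel_bound(2)[OF assms] by simp
  finally show ?thesis .
qed

lemma norm_conv_bounded:
  assumes w: "vort M M1 w" and k: "k \<in> borel_measurable borel" "\<And>z. norm (k z) \<le> B"
  shows "norm (conv w k x) \<le> B * M1"
proof -
  note w' = vortD[OF w]
  have B: "B \<ge> 0" using k(2)[of 0] norm_ge_zero order_trans by blast
  have "norm (conv w k x) \<le> (LINT y|lborel. norm (w y *\<^sub>R k (x - y)))"
    unfolding conv_def by (rule integral_norm_bound)
  also have "\<dots> \<le> (LINT y|lborel. B * \<bar>w y\<bar>)"
    using k(2) by (intro integral_mono integrable_norm kernel_integrable[OF w'(2) k] integrable_mult_right integrable_abs w'(2))
      (auto simp: mult.commute[of B] intro!: mult_left_mono)
  also have "\<dots> \<le> B * M1" using mult_left_mono[OF w'(3) B] by simp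
  finally show ?thesis .
qed

lemma conv_diff_bound:
  assumes w: "vort M M1 w" and e: "\<And>y. norm (k1 (x - y) - k2 (x' - y)) \<le> e"
    and i: "integrable lborel (\<lambda>y. w y *\<^sub>R k1 (x - y))" "integrable lborel (\<lambda>y. w y *\<^sub>R k2 (x' - y))"
  shows "norm (conv w k1 x - conv w k2 x') \<le> e * M1"
proof -
  note w' = vortD[OF w]
  have e0: "e \<ge> 0" using e[of 0] norm_ge_zero order_trans by blast
  have "conv w k1 x - conv w k2 x' = (LINT y|lborel. w y *\<^sub>R k1 (x - y) - w y *\<^sub>R k2 (x' - y))"
    unfolding conv_def by (rule Bochner_Integration.integral_diff[OF i, symmetric])
  also have "norm \<dots> \<le> (LINT y|lborel. norm (w y *\<^sub>R k1 (x - y) - w y *\<^sub>R k2 (x' - y)))"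
    by (rule integral_norm_bound)
  also have "\<dots> \<le> (LINT y|lborel. e * \<bar>w y\<bar>)"
  proof (intro integral_mono integrable_norm Bochner_Integration.integrable_diff i integrable_mult_right integrable_abs w'(2))
    fix y show "norm (w y *\<^sub>R k1 (x - y) - w y *\<^sub>R k2 (x' - y)) \<le> e * \<bar>w y\<bar>"
      unfolding scaleR_diff_right[symmetric] norm_scaleR mult.commute[of e] by (intro mult_left_mono e) simp
  qed
  also have "\<dots> \<le> e * M1" using mult_left_mono[OF w'(3) e0] by simp
  finally show ?thesis .
qed

lemma conv_Kreg_minus_K:
  assumes w: "vort M M1 w" and \<epsilon>: "\<epsilon> > 0"
  shows "norm (conv w (Kreg \<epsilon>) x - conv w K x) \<le> M * K_mass \<epsilon>"
proof -
  note i = singular_kernel_bound(1)[OF w K_meas order_refl] singular_kernel_bound(1)[OF w Kreg_meas norm_Kreg_le_K[OF \<epsilon>]]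
  have "conv w (Kreg \<epsilon>) x - conv w K x = (LINT y|lborel. w y *\<^sub>R Kreg \<epsilon> (x - y) - w y *\<^sub>R K (x - y))"
    unfolding conv_def by (rule Bochner_Integration.integral_diff[OF i(2,1), symmetric])
  also have "norm \<dots> \<le> (LINT y|lborel. norm (w y *\<^sub>R Kreg \<epsilon> (x - y) - w y *\<^sub>R K (x - y)))"
    by (rule integral_norm_bound)
  also have "\<dots> \<le> (LINT y|lborel. \<bar>w y\<bar> * (indicator (ball 0 \<epsilon>) (x - y) * norm (K (x - y))))"
  proof (intro integral_mono integrable_norm Bochner_Integration.integrable_diff i near_kernel_bound(1)[OF w])
    fix y show "norm (w y *\<^sub>R Kreg \<epsilon> (x - y) - w y *\<^sub>R K (x - y)) \<le> \<bar>w y\<bar> * (indicator (ball 0 \<epsilon>) (x - y) * norm (K (x - y)))"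
      unfolding scaleR_diff_right[symmetric] norm_scaleR by (intro mult_left_mono norm_Kreg_minus_K \<epsilon>) simp
  qed
  also have "\<dots> \<le> M * K_mass \<epsilon>" by (rule near_kernel_bound(2)[OF w])
  finally show ?thesis .
qed

lemma conv_meas:
  assumes w: "w \<in> borel_measurable borel" and k: "k \<in> borel_measurable borel"
  shows "conv w k \<in> borel_measurable borel"
proof -
  have "(\<lambda>p. w (snd p) *\<^sub>R k (fst p - snd p)) \<in> borel_measurable (borel \<Otimes>\<^sub>M lborel)"
    by (intro borel_measurable_scaleR measurable_compose[OF _ w] measurable_compose[OF _ k]
        borel_measurable_diff) auto
  then show ?thesis
    unfolding conv_def[abs_def]
    by (intro sigma_finite_measure.borel_measurable_lebesgue_integral sigma_finite_lborel) (simp add: split_beta')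
qed

lemma conv_nth:
  assumes "integrable lborel (\<lambda>y. w y *\<^sub>R k (x - y))"
  shows "conv w k x $ i = (LINT y|lborel. w y * k (x - y) $ i)"
  using integral_bounded_linear[OF bounded_linear_vec_nth assms, of i] by (simp add: conv_def)

lemma weak_tendsto_vector:
  fixes g :: "plane \<Rightarrow> plane"
  assumes weak: "\<And>g. integrable lborel g \<Longrightarrow> (\<lambda>n. LINT x|lborel. w n x * g x) \<longlonglongrightarrow> (LINT x|lborel. w' x * g x)"
    and g: "integrable lborel g"
    and i: "\<And>n::nat. integrable lborel (\<lambda>x. w n x *\<^sub>R g x)" "integrable lborel (\<lambda>x. w' x *\<^sub>R g x)"
  shows "(\<lambda>n. LINT x|lborel. w n x *\<^sub>R g x) \<longlonglongrightarrow> (LINT x|lborel. w' x *\<^sub>R g x)"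
proof (rule vec_tendstoI)
  fix j
  have "integrable lborel (\<lambda>x. g x $ j)" by (rule integrable_bounded_linear[OF bounded_linear_vec_nth g])
  from weak[OF this]
  show "(\<lambda>n. (LINT x|lborel. w n x *\<^sub>R g x) $ j) \<longlonglongrightarrow> (LINT x|lborel. w' x *\<^sub>R g x) $ j"
    by (simp add: integral_bounded_linear[OF bounded_linear_vec_nth i(1), symmetric]
        integral_bounded_linear[OF bounded_linear_vec_nth i(2), symmetric])
qed

text \<open>\<open>Kreg \<rho>\<close> decays only like 1/|x|, so it is not an L^1 test function.
  Restricted to a ball of radius R it is one, and the part left out is at most 1/R, which costs M1/R
  for every density of the class.\<close>

lemma conv_Kreg_weak_tendsto:
  assumes w: "\<And>n::nat. vort M M1 (w n)" "vort M M1 w'" and \<rho>: "\<rho> > 0"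
    and weak: "\<And>g. integrable lborel g \<Longrightarrow> (\<lambda>n. LINT x|lborel. w n x * g x) \<longlonglongrightarrow> (LINT x|lborel. w' x * g x)"
  shows "(\<lambda>n. conv (w n) (Kreg \<rho>) x) \<longlonglongrightarrow> conv w' (Kreg \<rho>) x"
proof (rule metric_LIMSEQ_I)
  fix e :: real assume e: "e > 0"
  have M1: "M1 \<ge> 0" by (rule vortD(6)[OF w(2)])
  define R where "R = max 1 (4 * M1 / e + 1)"
  have R: "R > 0" "M1 / R < e / 4"
  proof -
    show "R > 0" by (simp add: R_def)
    have "4 * M1 / e < R" by (simp add: R_def)
    then show "M1 / R < e / 4" using \<open>R > 0\<close> e by (simp add: field_simps)
  qed
  define k where "k z = indicator (ball 0 R) z *\<^sub>R Kreg \<rho> z" for z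
  have km: "k \<in> borel_measurable borel"
    unfolding k_def[abs_def] by (intro borel_measurable_scaleR Kreg_meas borel_measurable_indicator_ball)
  have kb: "norm (k z) \<le> 1 / \<rho>" for z
    using norm_Kreg[OF \<rho>, of z] \<rho> by (auto simp: k_def indicator_def)
  have kK: "norm (k z - Kreg \<rho> z) \<le> 1 / R" for z
  proof (cases "norm z < R")
    case False
    then have z: "norm z \<ge> R" by simp
    have "norm (k z - Kreg \<rho> z) = norm (Kreg \<rho> z)" using False by (simp add: k_def)
    also have "\<dots> \<le> norm (K z)" by (rule norm_Kreg_le_K[OF \<rho>])
    also have "\<dots> \<le> 1 / norm z" by (rule norm_K_le)
    also have "\<dots> \<le> 1 / R" using z R(1) by (intro divide_left_mono mult_pos_pos) auto
    finally show ?thesis .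
  qed (use R in \<open>simp add: k_def\<close>)
  have ki: "integrable lborel k"
  proof (rule Bochner_Integration.integrable_bound[OF integrable_K_ball[of R]])
    show "AE z in lborel. norm (k z) \<le> norm (indicator (ball 0 R) z * norm (K z))"
      using norm_Kreg_le_K[OF \<rho>] by (auto simp: k_def indicator_def)
  qed (use km in simp)
  have kx: "integrable lborel (\<lambda>y. k (x - y))" using ki by (simp add: integrable_lborel_reflect[OF km])
  have ik: "integrable lborel (\<lambda>y. v y *\<^sub>R k (x - y))" if "vort M M1 v" for v
    by (rule kernel_integrable[OF vortD(2)[OF that] km kb])
  have iK: "integrable lborel (\<lambda>y. v y *\<^sub>R Kreg \<rho> (x - y))" if "vort M M1 v" for v
    by (rule kernel_integrable[OF vortD(2)[OF that] Kreg_meas norm_Kreg[OF \<rho>]])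
  have near: "norm (conv v k x - conv v (Kreg \<rho>) x) < e / 4" if v: "vort M M1 v" for v
    using conv_diff_bound[OF v, of k x "Kreg \<rho>" x "1 / R", OF kK ik[OF v] iK[OF v]] R(2)
    unfolding times_divide_eq_left mult_1 by linarith
  have "(\<lambda>n. conv (w n) k x) \<longlonglongrightarrow> conv w' k x"
    unfolding conv_def by (rule weak_tendsto_vector[OF weak kx ik[OF w(1)] ik[OF w(2)]])
  then obtain N where N: "\<And>n. n \<ge> N \<Longrightarrow> dist (conv (w n) k x) (conv w' k x) < e / 4"
    using e by (metis LIMSEQ_def zero_less_divide_iff zero_less_numeral)
  show "\<exists>N. \<forall>n\<ge>N. dist (conv (w n) (Kreg \<rho>) x) (conv w' (Kreg \<rho>) x) < e"
  proof (intro exI[of _ N] allI impI)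
    fix n assume "n \<ge> N"
    have tri: "norm (p - s) \<le> norm (a - p) + norm (a - b) + norm (b - s)" for p s a b :: plane
      using dist_triangle[of p s a] dist_triangle[of a s b] by (simp add: dist_norm norm_minus_commute)
    show "dist (conv (w n) (Kreg \<rho>) x) (conv w' (Kreg \<rho>) x) < e"
      using tri[of "conv (w n) (Kreg \<rho>) x" "conv w' (Kreg \<rho>) x" "conv (w n) k x" "conv w' k x"]
        near[OF w(1)[of n]] near[OF w(2)] N[OF \<open>n \<ge> N\<close>] e unfolding dist_norm by linarith
  qed
qed

text \<open>All comparisons go through \<open>Kreg \<rho>\<close> for one small \<rho>: replacing
  \<open>K\<close> costs \<open>M * K_mass \<rho>\<close> uniformly in n, moving the point costs M1
  |x n - x'|/\<rho>^2, and at the fixed point weak convergence applies. The sequences u and d admit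
  regularised kernels that change with n.\<close>

lemma conv_near_K_tendsto:
  assumes w: "\<And>n::nat. vort M M1 (w n)" "vort M M1 w'"
    and weak: "\<And>g. integrable lborel g \<Longrightarrow> (\<lambda>n. LINT x|lborel. w n x * g x) \<longlonglongrightarrow> (LINT x|lborel. w' x * g x)"
    and x: "x \<longlonglongrightarrow> x'"
    and u: "\<And>n. norm (u n - conv (w n) K (x n)) \<le> d n" and d: "d \<longlonglongrightarrow> 0"
  shows "u \<longlonglongrightarrow> conv w' K x'"
proof (rule metric_LIMSEQ_I)
  fix e :: real assume e: "e > 0"
  have M: "M \<ge> 0" "M1 \<ge> 0" by (rule vortD[OF w(2)])+
  have "(\<lambda>n. M * K_mass (inverse (real (Suc n)))) \<longlonglongrightarrow> 0"
    by (intro tendsto_mult_right_zero K_mass_tendsto_0 LIMSEQ_inverse_real_of_nat)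
  then have "eventually (\<lambda>n. M * K_mass (inverse (real (Suc n))) < e / 6) sequentially"
    by (rule order_tendstoD) (use e in simp)
  then obtain n0 where "M * K_mass (inverse (real (Suc n0))) < e / 6"
    by (auto simp: eventually_sequentially)
  then obtain \<rho> where \<rho>: "\<rho> > 0" "M * K_mass \<rho> < e / 6"
    using that[of "inverse (real (Suc n0))"] by simp
  have "(\<lambda>n. norm (x n - x') / \<rho>\<^sup>2 * M1) \<longlonglongrightarrow> norm (x' - x') / \<rho>\<^sup>2 * M1"
    using \<rho> by (intro tendsto_intros x) auto
  then have 1: "eventually (\<lambda>n. norm (x n - x') / \<rho>\<^sup>2 * M1 < e / 6) sequentially"
    by (rule order_tendstoD) (use e in simp)
  have 2: "eventually (\<lambda>n. d n < e / 6) sequentially"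
    by (rule order_tendstoD[OF d]) (use e in simp)
  have 3: "eventually (\<lambda>n. dist (conv (w n) (Kreg \<rho>) x') (conv w' (Kreg \<rho>) x') < e / 6) sequentially"
    by (rule tendstoD[OF conv_Kreg_weak_tendsto[OF w \<rho>(1) weak]]) (use e in auto)
  have "eventually (\<lambda>n. dist (u n) (conv w' K x') < e) sequentially"
    using 1 2 3
  proof eventually_elim
    case (elim n)
    have a: "norm (conv (w n) (Kreg \<rho>) (x n) - conv (w n) (Kreg \<rho>) x') \<le> norm (x n - x') / \<rho>\<^sup>2 * M1"
    proof (rule conv_diff_bound[OF w(1)])
      show "norm (Kreg \<rho> (x n - y) - Kreg \<rho> (x' - y)) \<le> norm (x n - x') / \<rho>\<^sup>2" for y
        using norm_Kreg_diff_le[OF \<rho>(1), of "x n - y" "x' - y"] by simp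
    qed (rule kernel_integrable[OF vortD(2)[OF w(1)] Kreg_meas norm_Kreg[OF \<rho>(1)]])+
    have b: "norm (conv (w n) (Kreg \<rho>) (x n) - conv (w n) K (x n)) < e / 6"
      using conv_Kreg_minus_K[OF w(1) \<rho>(1), of n "x n"] \<rho>(2) by linarith
    have c: "norm (conv w' (Kreg \<rho>) x' - conv w' K x') < e / 6"
      using conv_Kreg_minus_K[OF w(2) \<rho>(1), of x'] \<rho>(2) by linarith
    have t: "norm (p - q) \<le> norm (p - a) + norm (b - a) + norm (b - c) + norm (c - d) + norm (d - q)" for p q a b c d :: plane
      using dist_triangle[of p q a] dist_triangle[of a q b] dist_triangle[of b q c] dist_triangle[of c q d]
      unfolding dist_norm norm_minus_commute[of a b] by linarith
    show ?case
      using t[of "u n" "conv w' K x'" "conv (w n) K (x n)" "conv (w n) (Kreg \<rho>) (x n)" "conv (w n) (Kreg \<rho>) x'" "conv w' (Kreg \<rho>) x'"]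
        a b c elim u[of n] e unfolding dist_norm by linarith
  qed
  then show "\<exists>N. \<forall>n\<ge>N. dist (u n) (conv w' K x') < e"
    by (auto simp: eventually_sequentially)
qed

section \<open>The coupled scheme\<close>

definition vfield :: "(plane \<Rightarrow> plane) \<Rightarrow> nat \<Rightarrow> (nat \<Rightarrow> real) \<Rightarrow> (plane \<Rightarrow> real) \<Rightarrow> (nat \<Rightarrow> plane) \<Rightarrow> plane \<Rightarrow> plane" where
  "vfield k N \<gamma> w H x = conv w k x + (\<Sum>j=1..N. \<gamma> j *\<^sub>R k (x - H j))"

text \<open>The kernel k acts between fluid and vortex and is sent to \<open>K\<close> in the limit;
  the vortex-vortex kernel is truncated at the separate scale \<delta>, which stays fixed, so that
  the acceleration is under control even if vortices collide.\<close>

definition acc :: "(plane \<Rightarrow> plane) \<Rightarrow> real \<Rightarrow> nat \<Rightarrow> (nat \<Rightarrow> real) \<Rightarrow> (nat \<Rightarrow> real) \<Rightarrow>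
    (plane \<Rightarrow> real) \<Rightarrow> (nat \<Rightarrow> plane) \<Rightarrow> (nat \<Rightarrow> plane) \<Rightarrow> nat \<Rightarrow> plane" where
  "acc k \<delta> N m \<gamma> w H L j = (\<gamma> j / m j) *\<^sub>R perp (L j - conv w k (H j)
      - (\<Sum>i\<in>{1..N} - {j}. \<gamma> i *\<^sub>R Kreg \<delta> (H j - H i)))"

locale vortex_data =
  fixes N :: nat and m \<gamma> :: "nat \<Rightarrow> real" and \<delta> M M1 :: real
    and \<omega>0 :: "plane \<Rightarrow> real" and h0 l0 :: "nat \<Rightarrow> plane"
  assumes vort0: "vort M M1 \<omega>0" and \<delta>: "\<delta> > 0"
begin

definition \<Gamma> :: real where "\<Gamma> = (\<Sum>j=1..N. \<bar>\<gamma> j\<bar>)"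
text \<open>A bound for the fluid speed, uniform over the densities of the class and over all
  kernels dominated by \<open>K\<close>.\<close>

definition U :: real where "U = M * K_mass 1 + M1"
definition cL :: real where "cL = (\<Sum>j=1..N. \<bar>\<gamma> j / m j\<bar>)"
definition BA :: real where "BA = U + \<Gamma> / \<delta>"
text \<open>A Gronwall bound, up to time T, for the speed of a vortex plus \<open>BA\<close>, where
  \<open>BA\<close> bounds everything in the acceleration apart from the vortex's own speed.\<close>

definition Lmax :: "real \<Rightarrow> real" where
  "Lmax T = exp (cL * T) * ((\<Sum>j=1..N. norm (l0 j)) + BA)"

lemma M_nonneg: "M \<ge> 0" "M1 \<ge> 0"
  using vortD[OF vort0] by auto

lemma const_nonneg: "\<Gamma> \<ge> 0" "U \<ge> 0" "cL \<ge> 0" "BA \<ge> 0"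
proof -
  show "\<Gamma> \<ge> 0" "U \<ge> 0" "cL \<ge> 0"
    unfolding \<Gamma>_def U_def cL_def using M_nonneg K_mass_nonneg[of 1] by (auto intro: sum_nonneg)
  then show "BA \<ge> 0" unfolding BA_def using \<delta> by auto
qed

lemma vortex_sum_bound:
  assumes "\<And>j. j \<in> S \<Longrightarrow> norm (f j) \<le> B" "S \<subseteq> {1..N}" "B \<ge> 0"
  shows "norm (\<Sum>j\<in>S. \<gamma> j *\<^sub>R f j) \<le> \<Gamma> * B"
proof -
  have "norm (\<Sum>j\<in>S. \<gamma> j *\<^sub>R f j) \<le> (\<Sum>j\<in>S. \<bar>\<gamma> j\<bar> * B)"
    by (rule order_trans[OF norm_sum sum_mono]) (use assms in \<open>auto intro: mult_left_mono\<close>)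
  also have "\<dots> \<le> (\<Sum>j=1..N. \<bar>\<gamma> j\<bar> * B)"
    using assms by (intro sum_mono2) auto
  finally show ?thesis by (simp add: \<Gamma>_def sum_distrib_right)
qed

lemma norm_acc:
  assumes w: "vort M M1 w" and k: "k \<in> borel_measurable borel" "\<And>z. norm (k z) \<le> norm (K z)" and j: "j \<in> {1..N}"
  shows "norm (acc k \<delta> N m \<gamma> w H L j) \<le> cL * (norm (L j) + BA)"
proof -
  have c: "\<bar>\<gamma> j / m j\<bar> \<le> cL"
    unfolding cL_def by (rule member_le_sum) (use j in auto)
  have s: "norm (\<Sum>i\<in>{1..N} - {j}. \<gamma> i *\<^sub>R Kreg \<delta> (H j - H i)) \<le> \<Gamma> * (1 / \<delta>)"
    by (rule vortex_sum_bound) (use norm_Kreg[OF \<delta>] \<delta> in auto)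
  have t: "norm (p - q - r) \<le> norm p + norm q + norm r" for p q r :: plane
    using norm_triangle3[of p "- q" "- r"] by simp
  have "norm (L j - conv w k (H j) - (\<Sum>i\<in>{1..N} - {j}. \<gamma> i *\<^sub>R Kreg \<delta> (H j - H i))) \<le> norm (L j) + BA"
    using t[of "L j" "conv w k (H j)" "\<Sum>i\<in>{1..N} - {j}. \<gamma> i *\<^sub>R Kreg \<delta> (H j - H i)"]
      s norm_conv_singular[OF w k, of "H j"] unfolding BA_def U_def by simp
  then show ?thesis
    unfolding acc_def norm_scaleR norm_perp using c const_nonneg by (intro mult_mono) auto
qed

text \<open>The roles of vortex and fluid are exchanged: the integral of |w(x)| |k(x - H j)| over x
  is a singular convolution evaluated at H j, bounded by \<open>U\<close> wherever the vortex sits.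
  The pairing is thus bounded independently of \<epsilon>, although the velocity near a vortex is
  not.\<close>

lemma vfield_pairing:
  assumes w: "vort M M1 w" and k: "k \<in> borel_measurable borel" "\<And>z. norm (k z) \<le> norm (K z)"
    and D: "D \<in> borel_measurable borel" "\<And>x. norm (D x) \<le> C"
  shows "integrable lborel (\<lambda>x. w x * (vfield k N \<gamma> w H x \<bullet> D x))" (is ?I)
    and "\<bar>LINT x|lborel. w x * (vfield k N \<gamma> w H x \<bullet> D x)\<bar> \<le> C * (U * M1 + \<Gamma> * U)"
proof -
  note w' = vortD[OF w]
  have C0: "C \<ge> 0" using D(2)[of 0] norm_ge_zero order_trans by blast
  have CS: "\<bar>w x * (vfield k N \<gamma> w H x \<bullet> D x)\<bar> \<le> \<bar>w x\<bar> * (norm (vfield k N \<gamma> w H x) * C)" for x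
  proof -
    have "\<bar>vfield k N \<gamma> w H x \<bullet> D x\<bar> \<le> norm (vfield k N \<gamma> w H x) * norm (D x)"
      by (rule Cauchy_Schwarz_ineq2)
    also have "\<dots> \<le> norm (vfield k N \<gamma> w H x) * C"
      by (rule mult_left_mono[OF D(2)]) simp
    finally show ?thesis unfolding abs_mult by (rule mult_left_mono) simp
  qed
  \<comment> \<open>The reflected kernel puts the integrand into the form k'(H j - x) that
    \<open>singular_kernel_bound\<close> expects.\<close>
  define k' where "k' z = - k (- z)" for z
  have "?I \<and> \<bar>LINT x|lborel. w x * (vfield k N \<gamma> w H x \<bullet> D x)\<bar> \<le> C * (U * M1 + \<Gamma> * U)"
  proof -
    define F' where "F' x = C * (\<bar>w x\<bar> * U + (\<Sum>j=1..N. \<bar>\<gamma> j\<bar> * (\<bar>w x\<bar> * norm (k' (H j - x)))))" for x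
    have k'm: "k' \<in> borel_measurable borel"
      unfolding k'_def[abs_def]
      by (intro borel_measurable_uminus measurable_compose[OF _ k(1)] measurable_ident_sets refl)
    have k'b: "norm (k' z) \<le> norm (K z)" for z
      using k(2)[of "- z"] by (simp add: k'_def norm_K)
    have ki': "integrable lborel (\<lambda>x. \<bar>w x\<bar> * norm (k' (y - x)))" for y
      using integrable_norm[OF singular_kernel_bound(1)[OF w k'm k'b, of y]] by simp
    have FI': "integrable lborel F'"
      unfolding F'_def[abs_def]
      by (intro integrable_mult_right integrable_mult_left Bochner_Integration.integrable_add
          Bochner_Integration.integrable_sum ki' integrable_abs w'(2))
    have le: "\<bar>w x * (vfield k N \<gamma> w H x \<bullet> D x)\<bar> \<le> F' x" for x
    proof -
      have "norm (vfield k N \<gamma> w H x) \<le> norm (conv w k x) + norm (\<Sum>j=1..N. \<gamma> j *\<^sub>R k (x - H j))"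
        unfolding vfield_def by (rule norm_triangle_ineq)
      also have "\<dots> \<le> U + (\<Sum>j=1..N. \<bar>\<gamma> j\<bar> * norm (k (x - H j)))"
        unfolding U_def
        by (intro add_mono norm_conv_singular[OF w k] order_trans[OF norm_sum]) simp
      finally have "norm (vfield k N \<gamma> w H x) \<le> U + (\<Sum>j=1..N. \<bar>\<gamma> j\<bar> * norm (k' (H j - x)))"
        by (simp add: k'_def)
      then have "\<bar>w x\<bar> * (norm (vfield k N \<gamma> w H x) * C) \<le> \<bar>w x\<bar> * ((U + (\<Sum>j=1..N. \<bar>\<gamma> j\<bar> * norm (k' (H j - x)))) * C)"
        using C0 by (intro mult_left_mono mult_right_mono) auto
      also have "\<dots> = F' x"
        by (simp add: F'_def algebra_simps sum_distrib_left)
      finally show ?thesis using CS[of x] by linarith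
    qed
    have meas: "(\<lambda>x. w x * (vfield k N \<gamma> w H x \<bullet> D x)) \<in> borel_measurable borel"
      unfolding vfield_def
      by (intro borel_measurable_times borel_measurable_inner borel_measurable_add borel_measurable_sum
          borel_measurable_scaleR borel_measurable_const conv_meas w'(4) k(1) D(1)
          measurable_compose[OF _ k(1)] borel_measurable_diff measurable_ident_sets refl)
    have I: ?I
    proof (rule Bochner_Integration.integrable_bound[OF FI'])
      show "AE x in lborel. norm (w x * (vfield k N \<gamma> w H x \<bullet> D x)) \<le> norm (F' x)"
        using le by (auto intro!: AE_I2 intro: order_trans[OF _ abs_ge_self])
    qed (use meas in simp)
    define P where "P j = (LINT x|lborel. \<bar>w x\<bar> * norm (k' (H j - x)))" for j
    have P: "P j \<le> U" for j
      unfolding U_def P_def by (rule singular_kernel_bound(2)[OF w k'm k'b])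
    have F'P: "(LINT x|lborel. F' x) = C * ((LINT x|lborel. \<bar>w x\<bar>) * U + (\<Sum>j=1..N. \<bar>\<gamma> j\<bar> * P j))"
    proof -
      have a: "integrable lborel (\<lambda>x. \<bar>w x\<bar> * U)" using w'(2) by simp
      have b: "integrable lborel (\<lambda>x. \<bar>\<gamma> j\<bar> * (\<bar>w x\<bar> * norm (k' (H j - x))))" for j by (intro integrable_mult_right ki')
      show ?thesis unfolding F'_def P_def
        by (simp only: integral_mult_right_zero integral_mult_left_zero
            Bochner_Integration.integral_add[OF a Bochner_Integration.integrable_sum[OF b]]
            Bochner_Integration.integral_sum[OF b])
    qed
    have "(\<Sum>j=1..N. \<bar>\<gamma> j\<bar> * P j) \<le> (\<Sum>j=1..N. \<bar>\<gamma> j\<bar> * U)"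
      by (intro sum_mono mult_left_mono P) simp
    moreover have "(LINT x|lborel. \<bar>w x\<bar>) * U \<le> M1 * U"
      by (rule mult_right_mono[OF w'(3) const_nonneg(2)])
    ultimately have "(LINT x|lborel. \<bar>w x\<bar>) * U + (\<Sum>j=1..N. \<bar>\<gamma> j\<bar> * P j) \<le> U * M1 + \<Gamma> * U"
      unfolding \<Gamma>_def sum_distrib_right mult.commute[of U M1] by linarith
    then have "(LINT x|lborel. F' x) \<le> C * (U * M1 + \<Gamma> * U)"
      unfolding F'P by (rule mult_left_mono[OF _ C0])
    moreover have "(LINT x|lborel. \<bar>w x * (vfield k N \<gamma> w H x \<bullet> D x)\<bar>) \<le> (LINT x|lborel. F' x)"
      by (rule integral_mono[OF integrable_abs[OF I] FI' le])
    moreover have "\<bar>LINT x|lborel. w x * (vfield k N \<gamma> w H x \<bullet> D x)\<bar> \<le> (LINT x|lborel. \<bar>w x * (vfield k N \<gamma> w H x \<bullet> D x)\<bar>)"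
      by (rule integral_abs_bound)
    ultimately show ?thesis using I by linarith
  qed
  then show ?I "\<bar>LINT x|lborel. w x * (vfield k N \<gamma> w H x \<bullet> D x)\<bar> \<le> C * (U * M1 + \<Gamma> * U)" by auto
qed

end

text \<open>The field built from \<open>kdisc\<close> is at most 2 (M1 + \<Gamma>)/\<epsilon>, and
  the drift is \<tau>/(2 h) times this field; \<open>CFL\<close> says exactly that the resulting
  bound is at most 1/4.\<close>

locale vortex_scheme = vortex_data +
  fixes \<epsilon> h \<tau> :: real
  assumes eps: "0 < \<epsilon>" "\<epsilon> \<le> 1" and h: "0 < h" "h \<le> \<epsilon>" and tau: "0 < \<tau>"
    and CFL: "4 * \<tau> * (M1 + \<Gamma>) \<le> h * \<epsilon>"
begin

text \<open>The mean displacement of one jump is 2 h times the drift, to leading order, and has to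
  be \<tau> times the velocity.\<close>

definition drift :: "(plane \<Rightarrow> real) \<Rightarrow> (nat \<Rightarrow> plane) \<Rightarrow> plane \<Rightarrow> plane" where
  "drift w H x = (\<tau> / (2 * h)) *\<^sub>R vfield (kdisc \<epsilon> h) N \<gamma> w H x"

text \<open>All three components advance from the old state. Only the transport step calls for a
  field with vanishing discrete divergence, so the vorticity is moved by \<open>kdisc\<close> while
  the vortices feel \<open>Kreg\<close>.\<close>

primrec st :: "nat \<Rightarrow> (plane \<Rightarrow> real) \<times> (nat \<Rightarrow> plane) \<times> (nat \<Rightarrow> plane)" where
  "st 0 = (\<omega>0, h0, l0)"
| "st (Suc i) = (case st i of (w, H, L) \<Rightarrow>
     (step h (drift w H) w, \<lambda>j. H j + \<tau> *\<^sub>R L j, \<lambda>j. L j + \<tau> *\<^sub>R acc (Kreg \<epsilon>) \<delta> N m \<gamma> w H L j))"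

definition "W i = fst (st i)"
definition "H i = fst (snd (st i))"
definition "L i = snd (snd (st i))"

lemma st_0: "W 0 = \<omega>0" "H 0 = h0" "L 0 = l0"
  by (simp_all add: W_def H_def L_def)

lemma st_Suc:
  "W (Suc i) = step h (drift (W i) (H i)) (W i)"
  "H (Suc i) j = H i j + \<tau> *\<^sub>R L i j"
  "L (Suc i) j = L i j + \<tau> *\<^sub>R acc (Kreg \<epsilon>) \<delta> N m \<gamma> (W i) (H i) (L i) j"
  by (simp_all add: W_def H_def L_def case_prod_beta)

lemma kdisc_integrable:
  assumes "vort M M1 w"
  shows "integrable lborel (\<lambda>y. w y *\<^sub>R kdisc \<epsilon> h (x - y))"
  by (rule kernel_integrable[OF vortD(2)[OF assms] borel_measurable_kdisc[OF eps(1)] norm_kdisc[OF eps(1) h]])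

lemma markov:
  assumes w: "vort M M1 w"
  shows "markov_step h (drift w Hv)"
proof
  note km = borel_measurable_kdisc[OF eps(1), of h]
  show "drift w Hv \<in> borel_measurable borel"
    unfolding drift_def[abs_def] vfield_def
    by (intro borel_measurable_scaleR borel_measurable_const borel_measurable_add borel_measurable_sum
        conv_meas vortD(4)[OF w] km measurable_compose[OF _ km] borel_measurable_diff measurable_ident_sets refl)
  show "\<bar>drift w Hv x $ i\<bar> \<le> 1/4" for x i
  proof -
    have "norm (vfield (kdisc \<epsilon> h) N \<gamma> w Hv x) \<le> norm (conv w (kdisc \<epsilon> h) x) + norm (\<Sum>j=1..N. \<gamma> j *\<^sub>R kdisc \<epsilon> h (x - Hv j))"
      unfolding vfield_def by (rule norm_triangle_ineq)
    also have "\<dots> \<le> 2 / \<epsilon> * M1 + \<Gamma> * (2 / \<epsilon>)"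
    proof (rule add_mono)
      show "norm (conv w (kdisc \<epsilon> h) x) \<le> 2 / \<epsilon> * M1"
        by (rule norm_conv_bounded[OF w km norm_kdisc[OF eps(1) h]])
      show "norm (\<Sum>j=1..N. \<gamma> j *\<^sub>R kdisc \<epsilon> h (x - Hv j)) \<le> \<Gamma> * (2 / \<epsilon>)"
        by (rule vortex_sum_bound[OF norm_kdisc[OF eps(1) h]]) (use eps in simp_all)
    qed
    also have "\<dots> = 2 * (M1 + \<Gamma>) / \<epsilon>" using eps by (simp add: field_simps)
    finally have v: "norm (vfield (kdisc \<epsilon> h) N \<gamma> w Hv x) \<le> 2 * (M1 + \<Gamma>) / \<epsilon>" .
    have "\<bar>drift w Hv x $ i\<bar> \<le> norm (drift w Hv x)" by (rule component_le_norm_cart)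
    also have "\<dots> \<le> \<tau> / (2 * h) * (2 * (M1 + \<Gamma>) / \<epsilon>)"
    proof -
      have "norm (drift w Hv x) = \<tau> / (2 * h) * norm (vfield (kdisc \<epsilon> h) N \<gamma> w Hv x)"
        using tau h by (simp add: drift_def)
      then show ?thesis using mult_left_mono[OF v, of "\<tau> / (2 * h)"] tau h by simp
    qed
    also have "\<dots> = (4 * \<tau> * (M1 + \<Gamma>)) / (4 * (h * \<epsilon>))" using h eps by (simp add: field_simps)
    also have "\<dots> \<le> (h * \<epsilon>) / (4 * (h * \<epsilon>))"
      using CFL h eps by (intro divide_right_mono) auto
    also have "\<dots> = 1/4" using h eps by simp
    finally show ?thesis .
  qed
  fix x
  \<comment> \<open>The discrete divergence commutes with translations, so it passes under the
    convolution and into the sum over the vortices, where it meets the kernel alone.\<close>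
  let ?k = "kdisc \<epsilon> h" and ?e = "\<lambda>i. (h/2) *\<^sub>R axis i (1::real) :: plane"
  have c: "conv w ?k z $ i = (LINT y|lborel. w y * ?k (z - y) $ i)" for z i
    by (rule conv_nth[OF kdisc_integrable[OF w]])
  have ci: "integrable lborel (\<lambda>y. w y * ?k (z - y) $ i)" for z i
    using integrable_bounded_linear[OF bounded_linear_vec_nth kdisc_integrable[OF w, of z], of i] by simp
  have sh: "?k (x + ?e i - y) = ?k ((x - y) + ?e i)" "?k (x - ?e i - y) = ?k ((x - y) - ?e i)" for i y
    by (simp_all add: algebra_simps)
  have "(\<Sum>i\<in>UNIV. conv w ?k (x + ?e i) $ i - conv w ?k (x - ?e i) $ i)
     = (LINT y|lborel. (\<Sum>i\<in>UNIV. w y * ?k (x + ?e i - y) $ i - w y * ?k (x - ?e i - y) $ i))"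
    unfolding c
    by (simp only: Bochner_Integration.integral_sum[OF Bochner_Integration.integrable_diff[OF ci ci]]
        Bochner_Integration.integral_diff[OF ci ci])
  also have "\<dots> = (LINT y|lborel. w y * (\<Sum>i\<in>UNIV. ?k ((x - y) + ?e i) $ i - ?k ((x - y) - ?e i) $ i))"
    unfolding sh by (simp add: sum_distrib_left right_diff_distrib)
  also have "\<dots> = 0" unfolding kdisc_div_free by simp
  finally have 1: "(\<Sum>i\<in>UNIV. conv w ?k (x + ?e i) $ i - conv w ?k (x - ?e i) $ i) = 0" .
  have 2: "(\<Sum>i\<in>UNIV. (\<Sum>j=1..N. \<gamma> j * ?k (x + ?e i - Hv j) $ i) - (\<Sum>j=1..N. \<gamma> j * ?k (x - ?e i - Hv j) $ i)) = 0"
  proof -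
    have "(\<Sum>i\<in>UNIV. (\<Sum>j=1..N. \<gamma> j * ?k (x + ?e i - Hv j) $ i) - (\<Sum>j=1..N. \<gamma> j * ?k (x - ?e i - Hv j) $ i))
      = (\<Sum>j=1..N. \<gamma> j * (\<Sum>i\<in>UNIV. ?k ((x - Hv j) + ?e i) $ i - ?k ((x - Hv j) - ?e i) $ i))"
      unfolding sh sum_subtractf[symmetric] sum_distrib_left right_diff_distrib by (rule sum.swap)
    then show ?thesis unfolding kdisc_div_free by simp
  qed
  have "(\<Sum>i\<in>UNIV. drift w Hv (x + ?e i) $ i - drift w Hv (x - ?e i) $ i)
     = \<tau> / (2 * h) * ((\<Sum>i\<in>UNIV. conv w ?k (x + ?e i) $ i - conv w ?k (x - ?e i) $ i)
       + (\<Sum>i\<in>UNIV. (\<Sum>j=1..N. \<gamma> j * ?k (x + ?e i - Hv j) $ i) - (\<Sum>j=1..N. \<gamma> j * ?k (x - ?e i - Hv j) $ i)))"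
    unfolding drift_def vfield_def sum_2 by (simp add: algebra_simps)
  then show "(\<Sum>i\<in>UNIV. drift w Hv (x + ?e i) $ i - drift w Hv (x - ?e i) $ i) = 0"
    unfolding 1 2 by simp
qed

lemma vort_step:
  assumes w: "vort M M1 w"
  shows "vort M M1 (step h (drift w Hv) w)"
proof -
  interpret markov_step h "drift w Hv" by (rule markov[OF w])
  show ?thesis
    unfolding vort_def using step_bound[OF vortD(1)[OF w]] step_integrable[OF vortD(2)[OF w]]
      step_L1[OF vortD(2)[OF w]] vortD(3)[OF w] by auto
qed

lemma vort_W: "vort M M1 (W i)"
  by (induction i) (simp_all add: st_0 st_Suc vort0 vort_step)

text \<open>Kernel and displaced point together change the field by 2 h/\<epsilon>^2 per unit of
  circulation, and this h is used up by the factor \<tau>/(2 h) of the drift. It comes back in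
  \<open>step_consistency\<close>, where \<kappa> is multiplied by h.\<close>

lemma drift_near:
  assumes w: "vort M M1 w" and q: "norm q \<le> h/2"
  shows "\<bar>drift w Hv (x + q) $ i - ((\<tau> / (2 * h)) *\<^sub>R vfield (Kreg \<epsilon>) N \<gamma> w Hv x) $ i\<bar> \<le> \<tau> * (M1 + \<Gamma>) / \<epsilon>\<^sup>2"
proof -
  have e: "norm (kdisc \<epsilon> h (z + q) - Kreg \<epsilon> z) \<le> 2 * h / \<epsilon>\<^sup>2" for z
  proof -
    have "norm (kdisc \<epsilon> h (z + q) - Kreg \<epsilon> z) \<le> norm (kdisc \<epsilon> h (z + q) - Kreg \<epsilon> (z + q)) + norm (Kreg \<epsilon> (z + q) - Kreg \<epsilon> z)"
      using norm_triangle_ineq[of "kdisc \<epsilon> h (z + q) - Kreg \<epsilon> (z + q)" "Kreg \<epsilon> (z + q) - Kreg \<epsilon> z"] by simp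
    also have "\<dots> \<le> h / \<epsilon>\<^sup>2 + norm q / \<epsilon>\<^sup>2"
      using norm_kdisc_minus_Kreg[OF eps(1) h(1), of "z + q"] norm_Kreg_diff_le[OF eps(1), of "z + q" z] by simp
    also have "\<dots> \<le> h / \<epsilon>\<^sup>2 + h / \<epsilon>\<^sup>2"
      using q h by (intro add_left_mono divide_right_mono) auto
    finally show ?thesis by simp
  qed
  have 1: "norm (conv w (kdisc \<epsilon> h) (x + q) - conv w (Kreg \<epsilon>) x) \<le> 2 * h / \<epsilon>\<^sup>2 * M1"
  proof (rule conv_diff_bound[OF w])
    show "norm (kdisc \<epsilon> h (x + q - y) - Kreg \<epsilon> (x - y)) \<le> 2 * h / \<epsilon>\<^sup>2" for y
      using e[of "x - y"] by (simp add: algebra_simps)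
    show "integrable lborel (\<lambda>y. w y *\<^sub>R kdisc \<epsilon> h (x + q - y))" by (rule kdisc_integrable[OF w])
    show "integrable lborel (\<lambda>y. w y *\<^sub>R Kreg \<epsilon> (x - y))"
      by (rule kernel_integrable[OF vortD(2)[OF w] Kreg_meas norm_Kreg[OF eps(1)]])
  qed
  have 2: "norm (\<Sum>j=1..N. \<gamma> j *\<^sub>R (kdisc \<epsilon> h (x + q - Hv j) - Kreg \<epsilon> (x - Hv j))) \<le> \<Gamma> * (2 * h / \<epsilon>\<^sup>2)"
  proof (rule vortex_sum_bound)
    show "norm (kdisc \<epsilon> h (x + q - Hv j) - Kreg \<epsilon> (x - Hv j)) \<le> 2 * h / \<epsilon>\<^sup>2" for j
      using e[of "x - Hv j"] by (simp add: algebra_simps)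
  qed (use h in auto)
  have "vfield (kdisc \<epsilon> h) N \<gamma> w Hv (x + q) - vfield (Kreg \<epsilon>) N \<gamma> w Hv x
     = (conv w (kdisc \<epsilon> h) (x + q) - conv w (Kreg \<epsilon>) x)
      + (\<Sum>j=1..N. \<gamma> j *\<^sub>R (kdisc \<epsilon> h (x + q - Hv j) - Kreg \<epsilon> (x - Hv j)))"
    by (simp add: vfield_def scaleR_diff_right sum_subtractf)
  then have v: "norm (vfield (kdisc \<epsilon> h) N \<gamma> w Hv (x + q) - vfield (Kreg \<epsilon>) N \<gamma> w Hv x) \<le> 2 * h / \<epsilon>\<^sup>2 * M1 + \<Gamma> * (2 * h / \<epsilon>\<^sup>2)"
    by (simp only: norm_triangle_mono[OF 1 2])
  have "\<bar>drift w Hv (x + q) $ i - ((\<tau> / (2 * h)) *\<^sub>R vfield (Kreg \<epsilon>) N \<gamma> w Hv x) $ i\<bar>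
     = \<bar>((\<tau> / (2 * h)) *\<^sub>R (vfield (kdisc \<epsilon> h) N \<gamma> w Hv (x + q) - vfield (Kreg \<epsilon>) N \<gamma> w Hv x)) $ i\<bar>"
    by (simp add: drift_def right_diff_distrib)
  also have "\<dots> \<le> norm ((\<tau> / (2 * h)) *\<^sub>R (vfield (kdisc \<epsilon> h) N \<gamma> w Hv (x + q) - vfield (Kreg \<epsilon>) N \<gamma> w Hv x))"
    by (rule component_le_norm_cart)
  also have "\<dots> \<le> \<tau> / (2 * h) * (2 * h / \<epsilon>\<^sup>2 * M1 + \<Gamma> * (2 * h / \<epsilon>\<^sup>2))"
  proof -
    have "\<bar>\<tau> / (2 * h)\<bar> = \<tau> / (2 * h)" using tau h by simp
    then show ?thesis unfolding norm_scaleR using mult_left_mono[OF v, of "\<tau> / (2 * h)"] tau h by simp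
  qed
  also have "\<dots> = \<tau> * (M1 + \<Gamma>) / \<epsilon>\<^sup>2" using h by (simp add: field_simps)
  finally show ?thesis .
qed

definition flux :: "(real \<times> plane \<Rightarrow> real \<times> plane) \<Rightarrow> nat \<Rightarrow> real \<Rightarrow> real" where
  "flux D i t = (LINT x|lborel. W i x * (fst (D (t, x)) + vfield (Kreg \<epsilon>) N \<gamma> (W i) (H i) x \<bullet> snd (D (t, x))))"

text \<open>The consistency error per unit time: numerical diffusion of the walk, Euler error in
  time, and the replacement of the discrete kernel at edge midpoints by
  \<open>Kreg \<epsilon>\<close>.\<close>

definition err :: real where
  "err = h\<^sup>2 / \<tau> + \<tau> + 4 * h * (M1 + \<Gamma>) / \<epsilon>\<^sup>2"

lemma flux_integrable:
  assumes C: "C11 C \<phi> D"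
  shows "integrable lborel (\<lambda>x. W i x * fst (D (t, x)))"
    and "integrable lborel (\<lambda>x. W i x * (vfield (Kreg \<epsilon>) N \<gamma> (W i) (H i) x \<bullet> snd (D (t, x))))"
    and "\<bar>flux D i t\<bar> \<le> C * (M1 + U * M1 + \<Gamma> * U)"
proof -
  note w = vort_W[of i] and w' = vortD[OF vort_W[of i]]
  have Dm: "D \<in> borel_measurable borel" by (rule C11_gradient_measurable[OF C])
  have Dt: "(\<lambda>x. D (t, x)) \<in> borel_measurable borel"
    by (rule measurable_compose[OF _ Dm]) (intro borel_measurable_continuous_onI continuous_intros)
  have D1: "(\<lambda>x. fst (D (t, x))) \<in> borel_measurable borel" and D2: "(\<lambda>x. snd (D (t, x))) \<in> borel_measurable borel"
    by (rule measurable_compose[OF Dt]; intro borel_measurable_continuous_onI continuous_intros)+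
  have b: "\<bar>fst (D p)\<bar> \<le> C" "norm (snd (D p)) \<le> C" for p
    using C11D(2)[OF C, of p] norm_fst_le[of "fst (D p)" "snd (D p)"] norm_snd_le[of "snd (D p)" "fst (D p)"] by auto
  have i1: "integrable lborel (\<lambda>x. W i x * fst (D (t, x)))"
  proof (rule Bochner_Integration.integrable_bound[where f = "\<lambda>x. C * W i x"])
    have "\<bar>W i x\<bar> * \<bar>fst (D (t, x))\<bar> \<le> \<bar>W i x\<bar> * \<bar>C\<bar>" for x
      using b(1)[of "(t, x)"] by (intro mult_left_mono) auto
    then show "AE x in lborel. norm (W i x * fst (D (t, x))) \<le> norm (C * W i x)"
      by (auto simp: abs_mult mult.commute)
  qed (use w' D1 in auto)
  then show "integrable lborel (\<lambda>x. W i x * fst (D (t, x)))" .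
  note p = vfield_pairing[OF w Kreg_meas norm_Kreg_le_K[OF eps(1)] D2 b(2), of "H i"]
  show "integrable lborel (\<lambda>x. W i x * (vfield (Kreg \<epsilon>) N \<gamma> (W i) (H i) x \<bullet> snd (D (t, x))))" by (rule p(1))
  have "flux D i t = (LINT x|lborel. W i x * fst (D (t, x))) + (LINT x|lborel. W i x * (vfield (Kreg \<epsilon>) N \<gamma> (W i) (H i) x \<bullet> snd (D (t, x))))"
    unfolding flux_def distrib_left by (rule Bochner_Integration.integral_add[OF i1 p(1)])
  moreover have "\<bar>LINT x|lborel. W i x * fst (D (t, x))\<bar> \<le> C * M1"
  proof -
    have "\<bar>LINT x|lborel. W i x * fst (D (t, x))\<bar> \<le> (LINT x|lborel. \<bar>W i x * fst (D (t, x))\<bar>)"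
      by (rule integral_abs_bound)
    also have "\<dots> \<le> (LINT x|lborel. C * \<bar>W i x\<bar>)"
      using b(1) by (intro integral_mono integrable_abs i1 integrable_mult_right w'(2))
        (auto simp: abs_mult mult.commute[of C] intro!: mult_left_mono)
    also have "\<dots> \<le> C * M1" using mult_left_mono[OF w'(3) C11D(4)[OF C]] by simp
    finally show ?thesis .
  qed
  ultimately show "\<bar>flux D i t\<bar> \<le> C * (M1 + U * M1 + \<Gamma> * U)"
    using p(2) by (simp add: algebra_simps)
qed

lemma consistency:
  assumes C: "C11 C \<phi> D"
  shows "\<bar>(LINT x|lborel. W (Suc i) x * \<phi> (t + \<tau>, x)) - (LINT x|lborel. W i x * \<phi> (t, x)) - \<tau> * flux D i t\<bar> \<le> \<tau> * (C * M1 * err)"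
proof -
  note w = vort_W[of i] and w' = vortD[OF vort_W[of i]]
  interpret markov_step h "drift (W i) (H i)" by (rule markov[OF w])
  have pm: "(\<lambda>x. \<phi> (s, x)) \<in> borel_measurable borel" for s
    by (intro borel_measurable_continuous_onI continuous_on_compose2[OF C11_continuous[OF C]] continuous_intros) auto
  have i0: "integrable lborel (\<lambda>x. W i x * \<phi> (t, x))"
    using integrable_bounded_mult[OF w'(2) pm C11D(1)[OF C]] by (simp add: mult.commute)
  define v where "v = vfield (Kreg \<epsilon>) N \<gamma> (W i) (H i)"
  define c where "c x = (\<tau> / (2 * h)) *\<^sub>R v x" for x
  \<comment> \<open>The expansion in time at the old time t; the remainder of \<phi> at the
    displacement (\<tau>, q) is then at most C (\<tau>^2 + h^2).\<close>
  define f where "f x = \<phi> (t, x) + \<tau> * fst (D (t, x))" for x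
  note fi = flux_integrable(1,2)[OF C, of i t, folded v_def]
  have eq: "W i x * (f x + 2 * h * (c x \<bullet> snd (D (t, x)))) =
      W i x * \<phi> (t, x) + \<tau> * (W i x * fst (D (t, x)) + W i x * (v x \<bullet> snd (D (t, x))))" for x
    using h by (simp add: f_def c_def algebra_simps)
  have mi: "integrable lborel (\<lambda>x. W i x * (f x + 2 * h * (c x \<bullet> snd (D (t, x)))))"
    unfolding eq by (intro Bochner_Integration.integrable_add integrable_mult_right i0 fi)
  have int: "(LINT x|lborel. W i x * (f x + 2 * h * (c x \<bullet> snd (D (t, x))))) = (LINT x|lborel. W i x * \<phi> (t, x)) + \<tau> * flux D i t"
  proof -
    have fl: "flux D i t = (LINT x|lborel. W i x * fst (D (t, x)) + W i x * (v x \<bullet> snd (D (t, x))))"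
      unfolding flux_def v_def[symmetric] distrib_left ..
    show ?thesis
      by (simp only: eq fl Bochner_Integration.integral_add[OF i0 integrable_mult_right[OF Bochner_Integration.integrable_add[OF fi]]]
          integral_mult_right_zero)
  qed
  have "\<bar>(LINT x|lborel. step h (drift (W i) (H i)) (W i) x * \<phi> (t + \<tau>, x)) - (LINT x|lborel. W i x * (f x + 2 * h * (c x \<bullet> snd (D (t, x)))))\<bar>
      \<le> (C * (\<tau>\<^sup>2 + h\<^sup>2) + 4 * h * (\<tau> * (M1 + \<Gamma>) / \<epsilon>\<^sup>2) * C) * (LINT x|lborel. \<bar>W i x\<bar>)"
  proof (rule step_consistency[OF h(1) w'(2) pm C11D(1)[OF C]])
    fix x q :: plane assume q: "norm q \<le> h"
    have "\<bar>\<phi> ((t, x) + (\<tau>, q)) - \<phi> (t, x) - D (t, x) \<bullet> (\<tau>, q)\<bar> \<le> C * (norm (\<tau>, q))\<^sup>2"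
      by (rule C11D(3)[OF C])
    also have "(norm (\<tau>, q))\<^sup>2 = \<tau>\<^sup>2 + (norm q)\<^sup>2" by (simp add: norm_Pair)
    also have "C * (\<tau>\<^sup>2 + (norm q)\<^sup>2) \<le> C * (\<tau>\<^sup>2 + h\<^sup>2)"
      using q C11D(4)[OF C] by (intro mult_left_mono add_left_mono power_mono) auto
    finally show "\<bar>\<phi> (t + \<tau>, x + q) - f x - snd (D (t, x)) \<bullet> q\<bar> \<le> C * (\<tau>\<^sup>2 + h\<^sup>2)"
      by (cases "D (t, x)") (simp add: f_def mult.commute algebra_simps)
  next
    show "norm (snd (D (t, x))) \<le> C" for x
      using C11D(2)[OF C, of "(t, x)"] norm_snd_le[of "snd (D (t, x))" "fst (D (t, x))"] by auto
    show "\<bar>drift (W i) (H i) (x + (h / 2) *\<^sub>R axis j 1) $ j - c x $ j\<bar> \<le> \<tau> * (M1 + \<Gamma>) / \<epsilon>\<^sup>2" for x j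
      unfolding c_def v_def using h by (intro drift_near[OF w]) auto
    show "\<bar>drift (W i) (H i) (x - (h / 2) *\<^sub>R axis j 1) $ j - c x $ j\<bar> \<le> \<tau> * (M1 + \<Gamma>) / \<epsilon>\<^sup>2" for x j
      unfolding c_def v_def using h drift_near[OF w, of "- ((h / 2) *\<^sub>R axis j 1)" "H i" x j] by simp
  qed (rule mi)
  also have "\<dots> \<le> (C * (\<tau>\<^sup>2 + h\<^sup>2) + 4 * h * (\<tau> * (M1 + \<Gamma>) / \<epsilon>\<^sup>2) * C) * M1"
    using C11D(4)[OF C] h tau M_nonneg const_nonneg
    by (intro mult_left_mono w'(3) add_nonneg_nonneg mult_nonneg_nonneg divide_nonneg_nonneg) auto
  also have "\<dots> = \<tau> * (C * M1 * err)"
    unfolding err_def using tau by (simp add: field_simps power2_eq_square)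
  finally show ?thesis unfolding int st_Suc(1) by (simp add: algebra_simps)
qed

text \<open>Discrete Gronwall: adding \<open>BA\<close> makes the affine growth bound homogeneous,
  with factor 1 + \<tau> cL \<le> exp(\<tau> cL) per step.\<close>

lemma L_bound:
  assumes j: "j \<in> {1..N}"
  shows "norm (L i j) + BA \<le> exp (cL * (\<tau> * real i)) * (norm (l0 j) + BA)"
proof (induction i)
  case 0
  then show ?case by (simp add: st_0)
next
  case (Suc i)
  have "norm (L (Suc i) j) \<le> norm (L i j) + \<tau> * norm (acc (Kreg \<epsilon>) \<delta> N m \<gamma> (W i) (H i) (L i) j)"
    unfolding st_Suc using norm_triangle_ineq[of "L i j" "\<tau> *\<^sub>R acc (Kreg \<epsilon>) \<delta> N m \<gamma> (W i) (H i) (L i) j"] tau by simp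
  also have "\<dots> \<le> norm (L i j) + \<tau> * (cL * (norm (L i j) + BA))"
    using tau norm_acc[OF vort_W Kreg_meas norm_Kreg_le_K[OF eps(1)] j] by (intro add_left_mono mult_left_mono) auto
  finally have "norm (L (Suc i) j) + BA \<le> (1 + \<tau> * cL) * (norm (L i j) + BA)"
    by (simp add: algebra_simps)
  also have "\<dots> \<le> exp (\<tau> * cL) * (exp (cL * (\<tau> * real i)) * (norm (l0 j) + BA))"
    using Suc tau const_nonneg by (intro mult_mono exp_ge_add_one_self) auto
  also have "\<dots> = exp (cL * (\<tau> * real (Suc i))) * (norm (l0 j) + BA)"
    by (simp add: algebra_simps exp_add)
  finally show ?case .
qed

lemma L_bound_uniform:
  assumes j: "j \<in> {1..N}" and i: "\<tau> * real i \<le> T"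
  shows "norm (L i j) + BA \<le> Lmax T"
proof -
  have "norm (l0 j) \<le> (\<Sum>j=1..N. norm (l0 j))"
    by (rule member_le_sum) (use j in auto)
  moreover have "cL * (\<tau> * real i) \<le> cL * T" using i const_nonneg by (intro mult_left_mono) auto
  ultimately have "exp (cL * (\<tau> * real i)) * (norm (l0 j) + BA) \<le> Lmax T"
    unfolding Lmax_def using const_nonneg by (intro mult_mono) auto
  then show ?thesis using L_bound[OF j, of i] by linarith
qed

end

section \<open>Weak-* limits of the scheme\<close>

definition idx :: "real \<Rightarrow> real \<Rightarrow> nat" where
  "idx \<tau> t = nat \<lfloor>t / \<tau>\<rfloor>"

lemma idx_bounds:
  assumes "\<tau> > 0" "t \<ge> 0"
  shows "\<tau> * real (idx \<tau> t) \<le> t" "t < \<tau> * real (idx \<tau> t) + \<tau>"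
proof -
  have r: "real (idx \<tau> t) = of_int \<lfloor>t / \<tau>\<rfloor>"
    using assms by (simp add: idx_def)
  have "of_int \<lfloor>t / \<tau>\<rfloor> \<le> t / \<tau>" by linarith
  then show "\<tau> * real (idx \<tau> t) \<le> t"
    unfolding r using assms by (simp only: pos_le_divide_eq mult.commute[of \<tau>])
  have "t / \<tau> < of_int \<lfloor>t / \<tau>\<rfloor> + 1" by linarith
  then show "t < \<tau> * real (idx \<tau> t) + \<tau>"
    unfolding r using assms by (simp add: pos_divide_less_eq algebra_simps)
qed

lemma idx_eqI:
  assumes "\<tau> > 0" "\<tau> * real k \<le> t" "t < \<tau> * real k + \<tau>"
  shows "idx \<tau> t = k"
proof -
  have "\<lfloor>t / \<tau>\<rfloor> = int k"
    using assms by (intro floor_unique) (simp_all add: field_simps)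
  then show ?thesis by (simp add: idx_def)
qed

lemma idx_tendsto:
  assumes "\<And>n. \<tau> n > 0" "\<tau> \<longlonglongrightarrow> 0" "t \<ge> 0"
  shows "(\<lambda>n::nat. \<tau> n * real (idx (\<tau> n) t)) \<longlonglongrightarrow> t"
proof (rule real_tendsto_sandwich)
  show "(\<lambda>n. t - \<tau> n) \<longlonglongrightarrow> t" using tendsto_diff[OF tendsto_const assms(2), of t] by simp
  show "\<forall>\<^sub>F n in sequentially. t - \<tau> n \<le> \<tau> n * real (idx (\<tau> n) t)"
    using idx_bounds(2)[OF assms(1,3)] by (intro always_eventually allI) (simp add: less_imp_le algebra_simps)
  show "\<forall>\<^sub>F n in sequentially. \<tau> n * real (idx (\<tau> n) t) \<le> t"
    using idx_bounds(1)[OF assms(1,3)] by (intro always_eventually allI) simp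
qed simp

text \<open>A step function can jump by \<tau> B within an arbitrarily short time, so the Lipschitz
  bound carries one extra step length. This is the asymptotic equicontinuity that
  \<open>asymptotic_Ascoli\<close> accepts.\<close>

lemma idx_Lipschitz:
  fixes f :: "nat \<Rightarrow> 'b::real_normed_vector"
  assumes \<tau>: "\<tau> > 0" and B: "B \<ge> 0"
    and f: "\<And>i. \<tau> * real i \<le> T \<Longrightarrow> norm (f (Suc i) - f i) \<le> \<tau> * B"
    and st: "s \<in> {0..T}" "t \<in> {0..T}"
  shows "norm (f (idx \<tau> t) - f (idx \<tau> s)) \<le> B * (\<bar>t - s\<bar> + \<tau>)"
proof -
  have *: "norm (f (i + k) - f i) \<le> \<tau> * real k * B" if "\<tau> * real (i + k) \<le> T" for i k
    using that
  proof (induction k)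
    case (Suc k)
    have le: "\<tau> * real (i + k) \<le> T"
      using Suc.prems \<tau> by (simp add: algebra_simps)
    have "norm (f (i + Suc k) - f i) \<le> norm (f (Suc (i + k)) - f (i + k)) + norm (f (i + k) - f i)"
      using norm_triangle_ineq[of "f (Suc (i + k)) - f (i + k)" "f (i + k) - f i"] by simp
    also have "\<dots> \<le> \<tau> * B + \<tau> * real k * B"
      using f[OF le] Suc.IH[OF le] by (rule add_mono)
    finally show ?case by (simp add: algebra_simps)
  qed simp
  have main: "norm (f (idx \<tau> t) - f (idx \<tau> s)) \<le> B * (\<bar>t - s\<bar> + \<tau>)" if "s \<le> t" "s \<in> {0..T}" "t \<in> {0..T}" for s t
  proof -
    have st': "s \<ge> 0" "t \<ge> 0" using that by auto
    have "idx \<tau> s \<le> idx \<tau> t"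
      unfolding idx_def using that \<tau> by (intro nat_mono floor_mono divide_right_mono) auto
    then obtain k where k: "idx \<tau> t = idx \<tau> s + k" using le_Suc_ex by blast
    have "norm (f (idx \<tau> t) - f (idx \<tau> s)) \<le> \<tau> * real k * B"
      unfolding k using idx_bounds(1)[OF \<tau> st'(2)] that k by (intro *) auto
    moreover have "\<tau> * real k \<le> \<bar>t - s\<bar> + \<tau>"
      using idx_bounds(1)[OF \<tau> st'(2)] idx_bounds(2)[OF \<tau> st'(1)] k that by (simp add: algebra_simps)
    then have "\<tau> * real k * B \<le> (\<bar>t - s\<bar> + \<tau>) * B" by (rule mult_right_mono[OF _ B])
    ultimately show ?thesis by (simp add: mult.commute)
  qed
  show ?thesis
  proof (cases "s \<le> t")
    case True
    then show ?thesis by (rule main) (use st in auto)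
  next
    case False
    then show ?thesis using main[of t s] st by (simp add: norm_minus_commute abs_minus_commute)
  qed
qed

lemma step_fun_has_integral:
  fixes X :: "nat \<Rightarrow> 'b::euclidean_space"
  assumes \<tau>: "\<tau> > 0"
  shows "((\<lambda>s. X (idx \<tau> s)) has_integral (\<tau> *\<^sub>R (\<Sum>k<j. X k))) {0..\<tau> * real j}"
proof (induction j)
  case 0
  show ?case by (simp add: has_integral_refl)
next
  case (Suc j)
  have "((\<lambda>s. X j) has_integral ((\<tau> * real (Suc j) - \<tau> * real j) *\<^sub>R X j)) {\<tau> * real j..\<tau> * real (Suc j)}"
    using \<tau> has_integral_const_real[of "X j" "\<tau> * real j" "\<tau> * real (Suc j)"] by (simp add: algebra_simps)
  then have "((\<lambda>s. X (idx \<tau> s)) has_integral ((\<tau> * real (Suc j) - \<tau> * real j) *\<^sub>R X j)) {\<tau> * real j..\<tau> * real (Suc j)}"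
  \<comment> \<open>The right end point already belongs to the next cell; a single point does not
    change the integral.\<close>
  proof (rule has_integral_spike_finite[of "{\<tau> * real (Suc j)}", rotated 2])
    fix x assume "x \<in> {\<tau> * real j..\<tau> * real (Suc j)} - {\<tau> * real (Suc j)}"
    then have "idx \<tau> x = j" by (intro idx_eqI[OF \<tau>]) (auto simp: algebra_simps)
    then show "X (idx \<tau> x) = X j" by simp
  qed simp
  then have "((\<lambda>s. X (idx \<tau> s)) has_integral (\<tau> *\<^sub>R (\<Sum>k<j. X k) + (\<tau> * real (Suc j) - \<tau> * real j) *\<^sub>R X j)) {0..\<tau> * real (Suc j)}"
    using \<tau> by (intro has_integral_combine[OF _ _ Suc]) auto
  then show ?case by (simp add: algebra_simps)
qed

text \<open>The Euler sum is the integral of the step function up to the last grid time before t.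
  Dominated convergence treats the integral up to t, and the incomplete last cell costs at most B
  \<tau>.\<close>

lemma step_sum_tendsto_integral:
  fixes X :: "nat \<Rightarrow> nat \<Rightarrow> 'b::euclidean_space"
  assumes \<tau>: "\<And>n. \<tau> n > 0" "\<tau> \<longlonglongrightarrow> 0"
    and B: "\<And>n k. \<tau> n * real k \<le> T \<Longrightarrow> norm (X n k) \<le> B"
    and f: "\<And>t. t \<in> {0..T} \<Longrightarrow> (\<lambda>n. X n (idx (\<tau> n) t)) \<longlonglongrightarrow> f t"
    and t: "t \<in> {0..T}"
  shows "f integrable_on {0..t}"
    and "(\<lambda>n. \<tau> n *\<^sub>R (\<Sum>k<idx (\<tau> n) t. X n k)) \<longlonglongrightarrow> integral {0..t} f"
proof -
  define F where "F n s = X n (idx (\<tau> n) s)" for n s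
  have t0: "t \<ge> 0" using t by simp
  have FB: "norm (F n s) \<le> B" if "s \<in> {0..t}" for n s
    unfolding F_def using idx_bounds(1)[OF \<tau>(1), of s n] that t by (intro B) auto
  have Fi: "F n integrable_on {0..t}" for n
  proof (rule integrable_on_subinterval)
    show "F n integrable_on {0..\<tau> n * real (Suc (idx (\<tau> n) t))}"
      unfolding F_def[abs_def] using step_fun_has_integral[OF \<tau>(1)] by blast
    show "{0..t} \<subseteq> {0..\<tau> n * real (Suc (idx (\<tau> n) t))}"
      using idx_bounds(2)[OF \<tau>(1) t0, of n] by (auto simp: algebra_simps)
  qed
  have Flim: "(\<lambda>n. F n s) \<longlonglongrightarrow> f s" if "s \<in> {0..t}" for s
    unfolding F_def using that t by (intro f) auto
  have dc: "f integrable_on {0..t}" "(\<lambda>n. integral {0..t} (F n)) \<longlonglongrightarrow> integral {0..t} f"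
    using dominated_convergence[of F "{0..t}" "\<lambda>_. B" f] Fi FB Flim by auto
  then show "f integrable_on {0..t}" by simp
  have "(\<lambda>n. integral {0..t} (F n) - \<tau> n *\<^sub>R (\<Sum>k<idx (\<tau> n) t. X n k)) \<longlonglongrightarrow> 0"
  proof (rule Lim_null_comparison)
    show "(\<lambda>n. B * \<tau> n) \<longlonglongrightarrow> 0" by (rule tendsto_mult_right_zero[OF \<tau>(2)])
    have "norm (integral {0..t} (F n) - \<tau> n *\<^sub>R (\<Sum>k<idx (\<tau> n) t. X n k)) \<le> B * \<tau> n" for n
    proof -
      define a where "a = \<tau> n * real (idx (\<tau> n) t)"
      have a: "0 \<le> a" "a \<le> t" "t - a \<le> \<tau> n"
        using idx_bounds[OF \<tau>(1) t0, of n] less_imp_le[OF \<tau>(1)[of n]] by (auto simp: a_def)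
      have 1: "integral {0..a} (F n) = \<tau> n *\<^sub>R (\<Sum>k<idx (\<tau> n) t. X n k)"
        unfolding a_def F_def[abs_def] by (rule integral_unique[OF step_fun_has_integral[OF \<tau>(1)]])
      have "integral {0..a} (F n) + integral {a..t} (F n) = integral {0..t} (F n)"
        by (rule Henstock_Kurzweil_Integration.integral_combine[OF a(1,2) Fi])
      then have "integral {0..t} (F n) - \<tau> n *\<^sub>R (\<Sum>k<idx (\<tau> n) t. X n k) = integral {a..t} (F n)"
        using 1 by (metis add_diff_cancel_left')
      moreover have "norm (integral {a..t} (F n)) \<le> B * (t - a)"
      proof -
        have B0: "B \<ge> 0" using order_trans[OF norm_ge_zero FB[of 0 n]] t0 by simp
        have "norm (integral {a..t} (F n)) \<le> B * measure lborel {a..t}"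
        proof (rule has_integral_bound_real[OF B0, of "{}"])
          show "(F n has_integral integral {a..t} (F n)) {a..t}"
            using integrable_on_subinterval[OF Fi, of a t n] a by (auto simp: has_integral_integral)
        qed (use FB a in auto)
        then show ?thesis using a by simp
      qed
      moreover have "B * (t - a) \<le> B * \<tau> n"
        using a order_trans[OF norm_ge_zero FB[of 0 n]] t0 by (intro mult_left_mono) auto
      ultimately show ?thesis by simp
    qed
    then show "\<forall>\<^sub>F n in sequentially. norm (integral {0..t} (F n) - \<tau> n *\<^sub>R (\<Sum>k<idx (\<tau> n) t. X n k)) \<le> B * \<tau> n"
      by simp
  qed
  from tendsto_diff[OF dc(2) this]
  show "(\<lambda>n. \<tau> n *\<^sub>R (\<Sum>k<idx (\<tau> n) t. X n k)) \<longlonglongrightarrow> integral {0..t} f" by simp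
qed

section \<open>Pairings with L^1 functions and weak-* compactness\<close>

lemma bounded_mult_integrable:
  fixes f g :: "'a::euclidean_space \<Rightarrow> real"
  assumes "f \<in> borel_measurable borel" "\<And>x. \<bar>f x\<bar> \<le> M" "integrable lborel g"
  shows "integrable lborel (\<lambda>x. f x * g x)"
proof (rule Bochner_Integration.integrable_bound[where f = "\<lambda>x. M * g x"])
  have "\<bar>f x\<bar> * \<bar>g x\<bar> \<le> \<bar>M\<bar> * \<bar>g x\<bar>" for x
    using assms(2)[of x] by (intro mult_right_mono) auto
  then show "AE x in lborel. norm (f x * g x) \<le> norm (M * g x)" by (auto simp: abs_mult)
qed (use assms in auto)

lemma bounded_pairing_le:
  fixes f g :: "'a::euclidean_space \<Rightarrow> real"
  assumes "f \<in> borel_measurable borel" "\<And>x. \<bar>f x\<bar> \<le> M" "integrable lborel g"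
  shows "\<bar>LINT x|lborel. f x * g x\<bar> \<le> M * (LINT x|lborel. \<bar>g x\<bar>)"
proof -
  have "\<bar>LINT x|lborel. f x * g x\<bar> \<le> (LINT x|lborel. \<bar>f x * g x\<bar>)" by (rule integral_abs_bound)
  also have "\<dots> \<le> (LINT x|lborel. M * \<bar>g x\<bar>)"
    using assms(2) by (intro integral_mono integrable_abs bounded_mult_integrable[OF assms] integrable_mult_right assms(3))
      (auto simp: abs_mult intro!: mult_right_mono)
  finally show ?thesis by simp
qed

lemma vort_pairing:
  assumes "vort M M1 w" "integrable lborel g"
  shows "integrable lborel (\<lambda>x. w x * g x)" "\<bar>LINT x|lborel. w x * g x\<bar> \<le> M * (LINT x|lborel. \<bar>g x\<bar>)"
  by (rule bounded_mult_integrable[OF vortD(4)[OF assms(1)] vortD(1)[OF assms(1)] assms(2)]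
      bounded_pairing_le[OF vortD(4)[OF assms(1)] vortD(1)[OF assms(1)] assms(2)])+

lemma vort_pairing_diff:
  assumes "vort M M1 w" "integrable lborel f" "integrable lborel g"
  shows "\<bar>(LINT x|lborel. w x * f x) - (LINT x|lborel. w x * g x)\<bar> \<le> M * (LINT x|lborel. \<bar>f x - g x\<bar>)"
proof -
  have "(LINT x|lborel. w x * f x) - (LINT x|lborel. w x * g x) = (LINT x|lborel. w x * (f x - g x))"
    using vort_pairing(1)[OF assms(1)] assms by (simp add: right_diff_distrib)
  then show ?thesis using vort_pairing(2)[OF assms(1), of "\<lambda>x. f x - g x"] assms by simp
qed

text \<open>Pairings with the bumps determine pairings with all of L^1, in particular with
  indicators of bounded Borel sets. Localising to balls makes the functions integrable, as
  \<open>density_unique_real\<close> demands.\<close>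

lemma bounded_AE_eqI:
  fixes f g :: "plane \<Rightarrow> real"
  assumes f: "f \<in> borel_measurable borel" "\<And>x. \<bar>f x\<bar> \<le> M" and g: "g \<in> borel_measurable borel" "\<And>x. \<bar>g x\<bar> \<le> M"
    and eq: "\<And>j. (LINT x|lborel. f x * bump j x) = (LINT x|lborel. g x * bump j x)"
  shows "AE x in lborel. f x = g x"
proof -
  have all: "(LINT x|lborel. f x * u x) = (LINT x|lborel. g x * u x)" if "integrable lborel u" for u
    using that
  proof (induction rule: L1_bump_induct)
    case (bump j)
    show ?case by (rule eq)
  next
    case (add u v)
    then show ?case
      by (simp add: distrib_left bounded_mult_integrable[OF f] bounded_mult_integrable[OF g])
  next
    case (scale c u)
    then show ?case by (simp add: mult.left_commute[of _ c])
  next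
    case (lim u s)
    have l: "(\<lambda>i. LINT x|lborel. k x * s i x) \<longlonglongrightarrow> (LINT x|lborel. k x * u x)"
      if k: "k \<in> borel_measurable borel" "\<And>x. \<bar>k x\<bar> \<le> M" for k
    proof (rule LIM_zero_cancel, rule Lim_null_comparison)
      show "(\<lambda>i. M * (LINT x|lborel. \<bar>s i x - u x\<bar>)) \<longlonglongrightarrow> 0"
        by (rule tendsto_mult_right_zero[OF lim.hyps(3)])
      have "norm ((LINT x|lborel. k x * s i x) - (LINT x|lborel. k x * u x)) \<le> M * (LINT x|lborel. \<bar>s i x - u x\<bar>)" for i
      proof -
        have "(LINT x|lborel. k x * s i x) - (LINT x|lborel. k x * u x) = (LINT x|lborel. k x * (s i x - u x))"
          using lim.hyps(1,2) by (simp add: right_diff_distrib bounded_mult_integrable[OF k])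
        then show ?thesis using bounded_pairing_le[OF k, of "\<lambda>x. s i x - u x"] lim.hyps(1,2) by simp
      qed
      then show "\<forall>\<^sub>F i in sequentially. norm ((LINT x|lborel. k x * s i x) - (LINT x|lborel. k x * u x)) \<le> M * (LINT x|lborel. \<bar>s i x - u x\<bar>)"
        by simp
    qed
    from LIMSEQ_unique[OF l[OF f]] l[OF g] show ?case unfolding lim.IH by blast
  qed
  have "AE x in lborel. f x * indicator (ball 0 (real n)) x = g x * indicator (ball 0 (real n)) x" for n
  proof (rule density_unique_real)
    have b: "integrable lborel (indicator (ball 0 (real n)) :: plane \<Rightarrow> real)"
      using emeasure_lborel_ball_finite[of "0::plane" "real n"] by (intro integrable_real_indicator) auto
    show "integrable lborel (\<lambda>x. f x * indicator (ball 0 (real n)) x)" "integrable lborel (\<lambda>x. g x * indicator (ball 0 (real n)) x)"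
      by (rule bounded_mult_integrable[OF f b] bounded_mult_integrable[OF g b])+
    fix A :: "plane set" assume A: "A \<in> sets lborel"
    have i: "integrable lborel (\<lambda>x. indicator A x * indicator (ball 0 (real n)) x :: real)"
      using A by (intro bounded_mult_integrable[where M = 1] b) (auto simp: indicator_def)
    show "(LINT x:A|lborel. f x * indicator (ball 0 (real n)) x) = (LINT x:A|lborel. g x * indicator (ball 0 (real n)) x)"
      using all[OF i] by (simp add: set_lebesgue_integral_def mult_ac)
  qed
  then have "AE x in lborel. \<forall>n. f x * indicator (ball 0 (real n)) x = g x * indicator (ball 0 (real n)) x"
    unfolding AE_all_countable by blast
  then show ?thesis
  proof eventually_elim
    case (elim x)
    obtain n :: nat where "norm x < n" using reals_Archimedean2 by blast
    then show ?case using elim[rule_format, of n] by simp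
  qed
qed

text \<open>A sequential Banach-Alaoglu theorem: convergence on the bumps extends to L^1 by density,
  and the limit functional is represented by duality. The L^1 bound is recovered by testing with the
  sign of the limit on growing balls.\<close>

lemma weak_limit_exists:
  assumes w: "\<And>n::nat. vort M M1 (w n)"
    and cv: "\<And>j. convergent (\<lambda>n. LINT x|lborel. w n x * bump j x)"
  shows "\<exists>w'. vort M M1 w' \<and>
     (\<forall>g. integrable lborel g \<longrightarrow> (\<lambda>n. LINT x|lborel. w n x * g x) \<longlonglongrightarrow> (LINT x|lborel. w' x * g x))"
proof -
  have M: "M \<ge> 0" "M1 \<ge> 0" by (rule vortD[OF w])+
  note wi = vort_pairing(1)[OF w]
  have cv': "convergent (\<lambda>n. LINT x|lborel. w n x * g x)" if "integrable lborel g" for g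
    using that
  proof (induction rule: L1_bump_induct)
    case (bump j)
    show ?case by (rule cv)
  next
    case (add f g)
    then show ?case using convergent_add[OF add(3,4)] by (simp add: distrib_left wi)
  next
    case (scale c f)
    then show ?case using convergent_mult[OF convergent_const scale(2), of c] by (simp add: mult.left_commute[of _ c])
  next
    case (lim f s)
    show ?case
    proof (rule Cauchy_convergent, rule metric_CauchyI)
      fix e :: real assume e: "e > 0"
      have "eventually (\<lambda>i. M * (LINT x|lborel. \<bar>s i x - f x\<bar>) < e / 4) sequentially"
        by (rule order_tendstoD(2)[OF tendsto_mult_right_zero[OF lim.hyps(3)]]) (use e in simp)
      then obtain i where i: "M * (LINT x|lborel. \<bar>s i x - f x\<bar>) < e / 4"
        by (auto simp: eventually_sequentially)
      have near: "\<bar>(LINT x|lborel. w n x * s i x) - (LINT x|lborel. w n x * f x)\<bar> < e / 4" for n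
        using vort_pairing_diff[OF w lim.hyps(2) lim.hyps(1), of n i] i by linarith
      have "Cauchy (\<lambda>n. LINT x|lborel. w n x * s i x)" by (rule convergent_Cauchy[OF lim.IH])
      then obtain N where N: "\<And>m n. m \<ge> N \<Longrightarrow> n \<ge> N \<Longrightarrow> dist (LINT x|lborel. w m x * s i x) (LINT x|lborel. w n x * s i x) < e / 4"
        using e unfolding Cauchy_def by (meson zero_less_divide_iff zero_less_numeral)
      show "\<exists>N. \<forall>m\<ge>N. \<forall>n\<ge>N. dist (LINT x|lborel. w m x * f x) (LINT x|lborel. w n x * f x) < e"
      proof (intro exI[of _ N] allI impI)
        fix m n assume "N \<le> m" "N \<le> n"
        then show "dist (LINT x|lborel. w m x * f x) (LINT x|lborel. w n x * f x) < e"
          using N[of m n] near[of m] near[of n] e unfolding dist_real_def by linarith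
      qed
    qed
  qed
  define \<Lambda> where "\<Lambda> g = lim (\<lambda>n. LINT x|lborel. w n x * g x)" for g
  have \<Lambda>: "(\<lambda>n. LINT x|lborel. w n x * g x) \<longlonglongrightarrow> \<Lambda> g" if "integrable lborel g" for g
    unfolding \<Lambda>_def using cv'[OF that] by (rule convergent_LIMSEQ_iff[THEN iffD1])
  have "\<exists>k\<in>borel_measurable borel. (\<forall>x. \<bar>k x\<bar> \<le> M) \<and> (\<forall>f. integrable lborel f \<longrightarrow> \<Lambda> f = (LINT x|lborel. k x * f x))"
  proof (rule L1_functional_lborel[OF M(1)])
    fix f g :: "plane \<Rightarrow> real" and c assume f: "integrable lborel f"
    have "(\<lambda>n. c * (LINT x|lborel. w n x * f x)) \<longlonglongrightarrow> c * \<Lambda> f" by (intro tendsto_mult_left \<Lambda> f)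
    moreover have "(LINT x|lborel. w n x * (c * f x)) = c * (LINT x|lborel. w n x * f x)" for n
      by (simp add: mult.left_commute[of _ c])
    ultimately show "\<Lambda> (\<lambda>x. c * f x) = c * \<Lambda> f"
      using \<Lambda>[of "\<lambda>x. c * f x"] f LIMSEQ_unique by simp
    show "\<bar>\<Lambda> f\<bar> \<le> M * (LINT x|lborel. \<bar>f x\<bar>)"
      by (rule LIMSEQ_le_const2[OF tendsto_rabs[OF \<Lambda>[OF f]]]) (use vort_pairing(2)[OF w f] in auto)
    assume g: "integrable lborel g"
    have "(\<lambda>n. (LINT x|lborel. w n x * f x) + (LINT x|lborel. w n x * g x)) \<longlonglongrightarrow> \<Lambda> f + \<Lambda> g"
      by (intro tendsto_add \<Lambda> f g)
    moreover have "(LINT x|lborel. w n x * (f x + g x)) = (LINT x|lborel. w n x * f x) + (LINT x|lborel. w n x * g x)" for n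
      by (simp add: distrib_left wi f g)
    ultimately show "\<Lambda> (\<lambda>x. f x + g x) = \<Lambda> f + \<Lambda> g"
      using \<Lambda>[of "\<lambda>x. f x + g x"] f g LIMSEQ_unique by simp
  qed
  then obtain k where k: "k \<in> borel_measurable borel" "\<And>x. \<bar>k x\<bar> \<le> M"
    "\<And>f. integrable lborel f \<Longrightarrow> \<Lambda> f = (LINT x|lborel. k x * f x)" by blast
  \<comment> \<open>The sign of k becomes an L^1 test function only after cutting to a ball; the
    bound on the whole L^1 norm then follows by monotone convergence.\<close>
  define u where "u n x = \<bar>k x\<bar> * indicator (ball 0 (real n)) x" for n and x :: plane
  have b: "integrable lborel (indicator (ball 0 (real n)) :: plane \<Rightarrow> real)" for n
    using emeasure_lborel_ball_finite[of "0::plane" "real n"] by (intro integrable_real_indicator) auto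
  have ui: "integrable lborel (u n)" for n
    unfolding u_def[abs_def] using k by (intro bounded_mult_integrable[where M = M] b) auto
  have uM: "(LINT x|lborel. u n x) \<le> M1" for n
  proof -
    define g where "g x = sgn (k x) * indicator (ball 0 (real n)) x" for x :: plane
    have g: "integrable lborel g"
      unfolding g_def[abs_def] using k(1) by (intro bounded_mult_integrable[where M = 1] b) (auto simp: sgn_if)
    have "(LINT x|lborel. u n x) = \<Lambda> g"
      unfolding k(3)[OF g] u_def g_def by (simp add: mult.assoc[symmetric] abs_sgn)
    also have "\<dots> \<le> M1"
    proof (rule LIMSEQ_le_const2[OF \<Lambda>[OF g]], intro exI allI impI)
      fix i
      have "(LINT x|lborel. w i x * g x) \<le> (LINT x|lborel. \<bar>w i x\<bar>)"
        by (intro integral_mono wi[OF g] integrable_abs vortD(2)[OF w])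
          (auto simp: g_def indicator_def sgn_if abs_if)
      then show "(LINT x|lborel. w i x * g x) \<le> M1" using vortD(3)[OF w, of i] by linarith
    qed
    finally show ?thesis .
  qed
  have mono_u: "u m x \<le> u n x" if "m \<le> n" for m n x
    unfolding u_def using that by (intro mult_left_mono) (auto simp: indicator_def)
  have "incseq (\<lambda>n. LINT x|lborel. u n x)"
    by (intro incseq_SucI integral_mono ui mono_u) simp
  then obtain l where l: "(\<lambda>n. LINT x|lborel. u n x) \<longlonglongrightarrow> l"
    using uM incseq_convergent[of "\<lambda>n. LINT x|lborel. u n x" M1] by blast
  have "l \<le> M1" by (rule LIMSEQ_le_const2[OF l]) (use uM in auto)
  have ulim: "(\<lambda>n. u n x) \<longlonglongrightarrow> \<bar>k x\<bar>" for x
  proof -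
    obtain n0 :: nat where n0: "norm x < n0" using reals_Archimedean2 by blast
    have "eventually (\<lambda>n. u n x = \<bar>k x\<bar>) sequentially"
      unfolding eventually_sequentially using n0 by (intro exI[of _ n0]) (auto simp: u_def)
    then show ?thesis by (rule tendsto_eventually)
  qed
  have m1: "AE x in lborel. mono (\<lambda>n. u n x)" using mono_u by (intro AE_I2) (simp add: mono_def)
  have m2: "AE x in lborel. (\<lambda>n. u n x) \<longlonglongrightarrow> \<bar>k x\<bar>" by (intro AE_I2 ulim)
  have m3: "(\<lambda>x. \<bar>k x\<bar>) \<in> borel_measurable lborel" using k(1) by simp
  have "integrable lborel (\<lambda>x. \<bar>k x\<bar>)" and kl: "(LINT x|lborel. \<bar>k x\<bar>) = l"
    by (rule integrable_monotone_convergence[OF ui m1 m2 l m3] integral_monotone_convergence[OF ui m1 m2 l m3])+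
  then have "integrable lborel k"
    using k(1) by (subst (asm) integrable_abs_iff) auto
  then have "vort M M1 k"
    unfolding vort_def kl using k(2) \<open>l \<le> M1\<close> by blast
  moreover have "\<forall>g. integrable lborel g \<longrightarrow> (\<lambda>n. LINT x|lborel. w n x * g x) \<longlonglongrightarrow> (LINT x|lborel. k x * g x)"
  proof (intro allI impI)
    fix g :: "plane \<Rightarrow> real" assume g: "integrable lborel g"
    show "(\<lambda>n. LINT x|lborel. w n x * g x) \<longlonglongrightarrow> (LINT x|lborel. k x * g x)"
      using \<Lambda>[OF g] unfolding k(3)[OF g] .
  qed
  ultimately show ?thesis by blast
qed

text \<open>Since all w t share the bound M, pairings with an L^1-convergent sequence of test
  functions converge uniformly in t, and continuity survives uniform limits.\<close>

lemma weakstar_continuity: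
  assumes w: "\<And>t. t \<in> S \<Longrightarrow> vort M M1 (w t)"
    and b: "\<And>j. continuous_on S (\<lambda>t. LINT x|lborel. w t x * bump j x)"
    and g: "integrable lborel g"
  shows "continuous_on S (\<lambda>t. LINT x|lborel. w t x * g x)"
  using g
proof (induction rule: L1_bump_induct)
  case (bump j)
  show ?case by (rule b)
next
  case (add f g)
  have "continuous_on S (\<lambda>t. (LINT x|lborel. w t x * f x) + (LINT x|lborel. w t x * g x))"
    by (rule continuous_on_add[OF add(3,4)])
  moreover have "(LINT x|lborel. w t x * (f x + g x)) = (LINT x|lborel. w t x * f x) + (LINT x|lborel. w t x * g x)" if "t \<in> S" for t
    by (simp add: distrib_left vort_pairing(1)[OF w[OF that]] add(1,2))
  ultimately show ?case by (simp cong: continuous_on_cong)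
next
  case (scale c f)
  have "(LINT x|lborel. w t x * (c * f x)) = c * (LINT x|lborel. w t x * f x)" for t
    by (simp add: mult.left_commute[of _ c])
  then show ?case using continuous_on_mult_left[OF scale(2), of c] by simp
next
  case (lim f s)
  show ?case
  proof (rule uniform_limit_theorem)
    show "\<forall>\<^sub>F i in sequentially. continuous_on S (\<lambda>t. LINT x|lborel. w t x * s i x)"
      using lim.IH by simp
    show "uniform_limit S (\<lambda>i t. LINT x|lborel. w t x * s i x) (\<lambda>t. LINT x|lborel. w t x * f x) sequentially"
    proof (rule uniform_limitI)
      fix e :: real assume e: "e > 0"
      have "eventually (\<lambda>i. M * (LINT x|lborel. \<bar>s i x - f x\<bar>) < e) sequentially"
        by (rule order_tendstoD(2)[OF tendsto_mult_right_zero[OF lim.hyps(3)] e])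
      then show "\<forall>\<^sub>F i in sequentially. \<forall>t\<in>S. dist (LINT x|lborel. w t x * s i x) (LINT x|lborel. w t x * f x) < e"
      proof eventually_elim
        case (elim i)
        show ?case
        proof
          fix t assume "t \<in> S"
          from vort_pairing_diff[OF w[OF this] lim.hyps(2) lim.hyps(1), of i] elim
          show "dist (LINT x|lborel. w t x * s i x) (LINT x|lborel. w t x * f x) < e"
            unfolding dist_real_def by linarith
        qed
      qed
    qed
  qed simp
qed

text \<open>The space-time representative is obtained by duality on \<open>L\<^sup>1(\<real> \<times> \<real>\<^sup>2)\<close>; the
  approximations at grid times only serve to make the functional well-defined.\<close>

lemma joint_version:
  fixes w :: "real \<Rightarrow> plane \<Rightarrow> real"
  assumes w: "\<And>t. vort M M1 (w t)"
    and cont: "\<And>g. integrable lborel g \<Longrightarrow> continuous_on UNIV (\<lambda>t. LINT x|lborel. w t x * g x)"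
  shows "\<exists>f\<in>borel_measurable borel. AE t in lborel. AE x in lborel. f (t, x) = w t x"
proof -
  have M: "M \<ge> 0" using vortD(5)[OF w] .
  \<comment> \<open>Grid times at or just below t. Freezing w on each cell makes w (q n t) x jointly
    measurable in (t,x), because only countably many densities occur.\<close>
  define q where "q n t = of_int \<lfloor>t * real (Suc n)\<rfloor> / real (Suc n)" for n and t :: real
  have q: "(\<lambda>n. q n t) \<longlonglongrightarrow> t" for t
  proof (rule real_tendsto_sandwich[of "\<lambda>n. t - 1 / real (Suc n)" "\<lambda>n. q n t" _ "\<lambda>n. t"])
    have b: "t - 1 / real (Suc n) \<le> q n t \<and> q n t \<le> t" for n
    proof -
      have "of_int \<lfloor>t * real (Suc n)\<rfloor> \<le> t * real (Suc n)" "t * real (Suc n) - 1 \<le> of_int \<lfloor>t * real (Suc n)\<rfloor>" by linarith+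
      then have "of_int \<lfloor>t * real (Suc n)\<rfloor> / real (Suc n) \<le> t * real (Suc n) / real (Suc n)"
        "(t * real (Suc n) - 1) / real (Suc n) \<le> of_int \<lfloor>t * real (Suc n)\<rfloor> / real (Suc n)"
        by (intro divide_right_mono; simp)+
      then show ?thesis by (simp add: q_def diff_divide_distrib del: of_nat_Suc)
    qed
    then show "\<forall>\<^sub>F n in sequentially. t - 1 / real (Suc n) \<le> q n t" "\<forall>\<^sub>F n in sequentially. q n t \<le> t" by auto
    show "(\<lambda>n. t - 1 / real (Suc n)) \<longlonglongrightarrow> t"
      using tendsto_diff[OF tendsto_const LIMSEQ_inverse_real_of_nat, of t] by (simp add: inverse_eq_divide)
  qed simp
  define A where "A n p = w (q n (fst p)) (snd p)" for n and p :: "real \<times> plane"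
  have Am: "A n \<in> borel_measurable (borel \<Otimes>\<^sub>M borel)" for n
  proof -
    have "(\<lambda>p::real \<times> plane. w (of_int \<lfloor>fst p * real (Suc n)\<rfloor> / real (Suc n)) (snd p)) \<in> borel_measurable (borel \<Otimes>\<^sub>M borel)"
    proof (rule measurable_compose_countable[where f = "\<lambda>i p. w (of_int i / real (Suc n)) (snd p)"
          and g = "\<lambda>p. \<lfloor>fst p * real (Suc n)\<rfloor>"])
      show "(\<lambda>p::real \<times> plane. w (of_int i / real (Suc n)) (snd p)) \<in> borel_measurable (borel \<Otimes>\<^sub>M borel)" for i
        by (rule measurable_compose[OF measurable_snd vortD(4)[OF w]])
      have "(\<lambda>p::real \<times> plane. fst p * real (Suc n)) \<in> borel_measurable (borel \<Otimes>\<^sub>M borel)"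
        by (intro borel_measurable_times measurable_fst borel_measurable_const)
      then show "(\<lambda>p::real \<times> plane. \<lfloor>fst p * real (Suc n)\<rfloor>) \<in> measurable (borel \<Otimes>\<^sub>M borel) (count_space UNIV)"
        by (rule measurable_compose) measurable
    qed
    then show ?thesis by (simp add: A_def[abs_def] q_def)
  qed
  define G where "G n g t = (LINT x|lborel. A n (t, x) * g (t, x))" for n t and g :: "real \<times> plane \<Rightarrow> real"
  \<comment> \<open>The limit is the pairing of w t with the section g(t,.) whenever that section is
    integrable, that is for almost every t. Elsewhere \<open>lim\<close> may be unspecified, but
    measurability in t holds throughout.\<close>
  define L where "L g t = lim (\<lambda>n. G n g t)" for t and g :: "real \<times> plane \<Rightarrow> real"
  have sets_eq: "sets (borel \<Otimes>\<^sub>M lborel) = sets (borel \<Otimes>\<^sub>M borel :: (real \<times> plane) measure)"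
    by (intro sets_pair_measure_cong) auto
  have Gm: "G n g \<in> borel_measurable borel" if "g \<in> borel_measurable borel" for n g
    unfolding G_def[abs_def]
  proof (rule sigma_finite_measure.borel_measurable_lebesgue_integral[OF sigma_finite_lborel])
    have "(\<lambda>p. A n p * g p) \<in> borel_measurable (borel \<Otimes>\<^sub>M borel)"
      using that by (intro borel_measurable_times Am) (simp add: borel_prod)
    then show "case_prod (\<lambda>t x. A n (t, x) * g (t, x)) \<in> borel_measurable (borel \<Otimes>\<^sub>M lborel)"
      by (simp add: split_beta' measurable_cong_sets[OF sets_eq refl])
  qed
  have Lm: "L g \<in> borel_measurable borel" if "g \<in> borel_measurable borel" for g
    unfolding L_def[abs_def] by (intro borel_measurable_lim_metric Gm that)
  have L: "L g t = (LINT x|lborel. w t x * g (t, x))" if "integrable lborel (\<lambda>x. g (t, x))" for g t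
  proof -
    have "(\<lambda>n. LINT x|lborel. w (q n t) x * g (t, x)) \<longlonglongrightarrow> (LINT x|lborel. w t x * g (t, x))"
      by (rule continuous_on_tendsto_compose[OF cont[OF that] q]) auto
    then show ?thesis unfolding L_def G_def A_def by (simp add: limI)
  qed
  have pr: "integrable (lborel \<Otimes>\<^sub>M lborel) g" if "integrable lborel g" for g :: "real \<times> plane \<Rightarrow> real"
    using that by (simp add: lborel_prod)
  have good: "AE t in lborel. integrable lborel (\<lambda>x. g (t, x))" if "integrable lborel g" for g :: "real \<times> plane \<Rightarrow> real"
    by (rule lborel_pair.AE_integrable_fst'[OF pr[OF that]])
  have I1: "integrable lborel (\<lambda>t. LINT x|lborel. \<bar>g (t, x)\<bar>)"
    and I2: "(LINT t|lborel. LINT x|lborel. \<bar>g (t, x)\<bar>) = (LINT p|lborel. \<bar>g p\<bar>)"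
    if "integrable lborel g" for g :: "real \<times> plane \<Rightarrow> real"
    using lborel_pair.integrable_fst'[OF pr[OF integrable_abs[OF that]]]
      lborel_pair.integral_fst'[OF pr[OF integrable_abs[OF that]]] by (simp_all add: lborel_prod)
  have bm: "g \<in> borel_measurable borel" if "integrable lborel g" for g :: "real \<times> plane \<Rightarrow> real"
    using borel_measurable_integrable[OF that] by simp
  have Lb: "AE t in lborel. \<bar>L g t\<bar> \<le> M * (LINT x|lborel. \<bar>g (t, x)\<bar>)" if "integrable lborel g" for g
    using good[OF that] by eventually_elim (simp only: L vort_pairing(2)[OF w])
  have Li: "integrable lborel (L g)" if g: "integrable lborel g" for g
  proof (rule Bochner_Integration.integrable_bound[OF integrable_mult_right[OF I1[OF g]]])
    show "AE t in lborel. norm (L g t) \<le> norm (M * (LINT x|lborel. \<bar>g (t, x)\<bar>))"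
      using Lb[OF g] by eventually_elim (auto intro: order_trans[OF _ abs_ge_self])
  qed (use Lm[OF bm[OF g]] in simp)
  define \<Lambda> where "\<Lambda> g = (LINT t|lborel. L g t)" for g
  have "\<exists>k\<in>borel_measurable borel. (\<forall>x. \<bar>k x\<bar> \<le> M) \<and> (\<forall>f. integrable lborel f \<longrightarrow> \<Lambda> f = (LINT x|lborel. k x * f x))"
  proof (rule L1_functional_lborel[OF M])
    fix f g :: "real \<times> plane \<Rightarrow> real" and c assume f: "integrable lborel f"
    have "\<Lambda> (\<lambda>p. c * f p) = (LINT t|lborel. c * L f t)"
      unfolding \<Lambda>_def
    proof (rule integral_cong_AE)
      show "AE t in lborel. L (\<lambda>p. c * f p) t = c * L f t"
        using good[OF f] by eventually_elim (simp add: L mult.left_commute[of _ c])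
    qed (use Lm[OF bm[OF f]] Lm[OF bm[OF integrable_mult_right[OF f]]] in auto)
    then show "\<Lambda> (\<lambda>p. c * f p) = c * \<Lambda> f" by (simp add: \<Lambda>_def)
    have "\<bar>\<Lambda> f\<bar> \<le> (LINT t|lborel. \<bar>L f t\<bar>)" unfolding \<Lambda>_def by (rule integral_abs_bound)
    also have "\<dots> \<le> (LINT t|lborel. M * (LINT x|lborel. \<bar>f (t, x)\<bar>))"
      by (rule integral_mono_AE[OF integrable_abs[OF Li[OF f]] integrable_mult_right[OF I1[OF f]] Lb[OF f]])
    also have "\<dots> = M * (LINT p|lborel. \<bar>f p\<bar>)" using I2[OF f] by simp
    finally show "\<bar>\<Lambda> f\<bar> \<le> M * (LINT p|lborel. \<bar>f p\<bar>)" .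
    assume g: "integrable lborel g"
    have "\<Lambda> (\<lambda>p. f p + g p) = (LINT t|lborel. L f t + L g t)"
      unfolding \<Lambda>_def
    proof (rule integral_cong_AE)
      show "AE t in lborel. L (\<lambda>p. f p + g p) t = L f t + L g t"
        using good[OF f] good[OF g] by eventually_elim (simp add: L distrib_left vort_pairing(1)[OF w])
    qed (use Lm[OF bm[OF f]] Lm[OF bm[OF g]] Lm[OF bm[OF Bochner_Integration.integrable_add[OF f g]]] in auto)
    then show "\<Lambda> (\<lambda>p. f p + g p) = \<Lambda> f + \<Lambda> g" using Li[OF f] Li[OF g] by (simp add: \<Lambda>_def)
  qed
  then obtain k where k: "k \<in> borel_measurable borel" "\<And>p. \<bar>k p\<bar> \<le> M"
    "\<And>f. integrable lborel f \<Longrightarrow> \<Lambda> f = (LINT x|lborel. k x * f x)" by blast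
  have km: "(\<lambda>x. k (t, x)) \<in> borel_measurable borel" for t
    by (rule measurable_compose[OF _ k(1)]) (intro borel_measurable_continuous_onI continuous_intros)
  have ki: "(\<lambda>t. LINT x|lborel. k (t, x) * bump j x) \<in> borel_measurable borel" for j
  proof (rule sigma_finite_measure.borel_measurable_lebesgue_integral[OF sigma_finite_lborel])
    have "(\<lambda>p. k p * bump j (snd p)) \<in> borel_measurable (borel \<Otimes>\<^sub>M borel)"
      using k(1) by (intro borel_measurable_times measurable_compose[OF measurable_snd borel_measurable_bump]) (simp add: borel_prod)
    then show "case_prod (\<lambda>t x. k (t, x) * bump j x) \<in> borel_measurable (borel \<Otimes>\<^sub>M lborel)"
      by (simp add: split_beta' measurable_cong_sets[OF sets_eq refl])
  qed
  have ae: "AE t in lborel. indicator {- real m..real m} t * (LINT x|lborel. w t x * bump j x)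
      = indicator {- real m..real m} t * (LINT x|lborel. k (t, x) * bump j x)" for m j
  proof (rule density_unique_real)
    let ?I = "{- real m..real m}" and ?B = "M * (LINT x|lborel. \<bar>bump j x\<bar>)"
    have iI: "integrable lborel (indicator ?I :: real \<Rightarrow> real)" by (intro integrable_real_indicator) auto
    have wm: "(\<lambda>t. LINT x|lborel. w t x * bump j x) \<in> borel_measurable borel"
      by (rule borel_measurable_continuous_onI[OF cont[OF integrable_bump]])
    have "integrable lborel (\<lambda>t. (LINT x|lborel. w t x * bump j x) * indicator ?I t)"
      by (rule bounded_mult_integrable[OF wm vort_pairing(2)[OF w integrable_bump] iI])
    then show "integrable lborel (\<lambda>t. indicator ?I t * (LINT x|lborel. w t x * bump j x))" by (simp add: mult.commute)
    have "integrable lborel (\<lambda>t. (LINT x|lborel. k (t, x) * bump j x) * indicator ?I t)"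
      by (rule bounded_mult_integrable[OF ki bounded_pairing_le[OF km k(2) integrable_bump] iI])
    then show "integrable lborel (\<lambda>t. indicator ?I t * (LINT x|lborel. k (t, x) * bump j x))" by (simp add: mult.commute)
    fix S :: "real set" assume S: "S \<in> sets lborel"
    \<comment> \<open>Test functions of product form isolate the spatial pairing at almost every t;
      the interval [-m,m] makes them integrable on space-time.\<close>
    define g where "g p = (indicator S (fst p) * indicator ?I (fst p)) * bump j (snd p)" for p :: "real \<times> plane"
    have gm: "g \<in> borel_measurable (lborel \<Otimes>\<^sub>M lborel)"
      unfolding g_def[abs_def] using S borel_measurable_bump[of j] by (intro borel_measurable_times) auto
    have g: "integrable (lborel \<Otimes>\<^sub>M lborel) g"
    proof (rule lborel_pair.Fubini_integrable[OF gm])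
      have "integrable lborel (\<lambda>t. indicator S t * indicator ?I t * (LINT x|lborel. \<bar>bump j x\<bar>))"
        using S by (intro integrable_mult_left bounded_mult_integrable[where M = 1] iI) (auto simp: indicator_def)
      then show "integrable lborel (\<lambda>t. LINT x|lborel. norm (g (t, x)))"
        by (simp add: g_def abs_mult)
      show "AE t in lborel. integrable lborel (\<lambda>x. g (t, x))" by (simp add: g_def integrable_bump)
    qed
    then have gl: "integrable lborel g" by (simp add: lborel_prod)
    have "(LINT t:S|lborel. indicator ?I t * (LINT x|lborel. w t x * bump j x)) = \<Lambda> g"
      unfolding \<Lambda>_def set_lebesgue_integral_def
      by (intro Bochner_Integration.integral_cong refl)
        (subst L, simp_all add: g_def integrable_bump mult.left_commute[of "w _ _"])
    also have "\<dots> = (LINT p|(lborel \<Otimes>\<^sub>M lborel). k p * g p)" unfolding k(3)[OF gl] by (simp add: lborel_prod)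
    also have "\<dots> = (LINT t|lborel. LINT x|lborel. k (t, x) * g (t, x))"
      using bounded_mult_integrable[OF k(1,2) gl] by (intro lborel_pair.integral_fst'[symmetric]) (simp add: lborel_prod)
    also have "\<dots> = (LINT t:S|lborel. indicator ?I t * (LINT x|lborel. k (t, x) * bump j x))"
      unfolding set_lebesgue_integral_def
      by (intro Bochner_Integration.integral_cong refl) (simp add: g_def mult.left_commute[of "k _"])
    finally show "(LINT t:S|lborel. indicator ?I t * (LINT x|lborel. w t x * bump j x))
       = (LINT t:S|lborel. indicator ?I t * (LINT x|lborel. k (t, x) * bump j x))" .
  qed
  \<comment> \<open>There are countably many bumps and intervals, so one null set of times serves
    all of them.\<close>
  then have "AE t in lborel. \<forall>m j. indicator {- real m..real m} t * (LINT x|lborel. w t x * bump j x)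
      = indicator {- real m..real m} t * (LINT x|lborel. k (t, x) * bump j x)"
    unfolding AE_all_countable by blast
  then have "AE t in lborel. AE x in lborel. k (t, x) = w t x"
  proof eventually_elim
    case (elim t)
    obtain m :: nat where "\<bar>t\<bar> < m" using reals_Archimedean2 by blast
    then have "t \<in> {- real m..real m}" by auto
    then have "(LINT x|lborel. k (t, x) * bump j x) = (LINT x|lborel. w t x * bump j x)" for j
      using elim[rule_format, of m j] by simp
    then show ?case by (rule bounded_AE_eqI[OF km k(2) vortD(4)[OF w] vortD(1)[OF w]])
  qed
  then show ?thesis using k(1) by blast
qed

context vortex_data
begin

definition pairing :: "(plane \<Rightarrow> plane) \<Rightarrow> (real \<times> plane \<Rightarrow> real \<times> plane) \<Rightarrow> (plane \<Rightarrow> real) \<Rightarrow> (nat \<Rightarrow> plane) \<Rightarrow> real \<Rightarrow> real" where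
  "pairing k D w H t = (LINT x|lborel. w x * (fst (D (t, x)) + vfield k N \<gamma> w H x \<bullet> snd (D (t, x))))"

text \<open>All that the passage to the limit uses about the scheme, detached from its locale: the
  sequence has parameters varying with n, which a single locale context fixes. The shift length h
  survives only inside the error e.\<close>

definition approx :: "real \<Rightarrow> real \<Rightarrow> real \<Rightarrow> (nat \<Rightarrow> plane \<Rightarrow> real) \<Rightarrow> (nat \<Rightarrow> nat \<Rightarrow> plane) \<Rightarrow> (nat \<Rightarrow> nat \<Rightarrow> plane) \<Rightarrow> bool" where
  "approx \<epsilon> \<tau> e W H L \<longleftrightarrow> 0 < \<epsilon> \<and> 0 < \<tau> \<and> W 0 = \<omega>0 \<and> H 0 = h0 \<and> L 0 = l0 \<and> (\<forall>i. vort M M1 (W i)) \<and>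
     (\<forall>i j. H (Suc i) j = H i j + \<tau> *\<^sub>R L i j) \<and>
     (\<forall>i j. L (Suc i) j = L i j + \<tau> *\<^sub>R acc (Kreg \<epsilon>) \<delta> N m \<gamma> (W i) (H i) (L i) j) \<and>
     (\<forall>C \<phi> D i t. C11 C \<phi> D \<longrightarrow> \<bar>(LINT x|lborel. W (Suc i) x * \<phi> (t + \<tau>, x)) - (LINT x|lborel. W i x * \<phi> (t, x))
         - \<tau> * pairing (Kreg \<epsilon>) D (W i) (H i) t\<bar> \<le> \<tau> * (C * M1 * e)) \<and>
     (\<forall>C \<phi> D i t. C11 C \<phi> D \<longrightarrow> \<bar>pairing (Kreg \<epsilon>) D (W i) (H i) t\<bar> \<le> C * (M1 + U * M1 + \<Gamma> * U)) \<and>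
     (\<forall>T i j. j \<in> {1..N} \<longrightarrow> \<tau> * real i \<le> T \<longrightarrow> norm (L i j) + BA \<le> Lmax T)"

lemma approxD:
  assumes "approx \<epsilon> \<tau> e W H L"
  shows "0 < \<epsilon>" "0 < \<tau>" "W 0 = \<omega>0" "H 0 = h0" "L 0 = l0" "vort M M1 (W i)"
    "H (Suc i) j = H i j + \<tau> *\<^sub>R L i j"
    "L (Suc i) j = L i j + \<tau> *\<^sub>R acc (Kreg \<epsilon>) \<delta> N m \<gamma> (W i) (H i) (L i) j"
    "C11 C \<phi> D \<Longrightarrow> \<bar>(LINT x|lborel. W (Suc i) x * \<phi> (t + \<tau>, x)) - (LINT x|lborel. W i x * \<phi> (t, x))
         - \<tau> * pairing (Kreg \<epsilon>) D (W i) (H i) t\<bar> \<le> \<tau> * (C * M1 * e)"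
    "C11 C \<phi> D \<Longrightarrow> \<bar>pairing (Kreg \<epsilon>) D (W i) (H i) t\<bar> \<le> C * (M1 + U * M1 + \<Gamma> * U)"
    "j \<in> {1..N} \<Longrightarrow> \<tau> * real i \<le> T \<Longrightarrow> norm (L i j) + BA \<le> Lmax T"
  using assms unfolding approx_def by blast+

end

lemma (in vortex_scheme) approx_scheme:
  "approx \<epsilon> \<tau> (h\<^sup>2 / \<tau> + \<tau> + 4 * h * (M1 + \<Gamma>) / \<epsilon>\<^sup>2) W H L"
  unfolding approx_def
proof (intro conjI allI impI)
  fix C t :: real and \<phi> :: "real \<times> plane \<Rightarrow> real" and D i assume C: "C11 C \<phi> D"
  show "\<bar>(LINT x|lborel. W (Suc i) x * \<phi> (t + \<tau>, x)) - (LINT x|lborel. W i x * \<phi> (t, x))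
         - \<tau> * pairing (Kreg \<epsilon>) D (W i) (H i) t\<bar> \<le> \<tau> * (C * M1 * (h\<^sup>2 / \<tau> + \<tau> + 4 * h * (M1 + \<Gamma>) / \<epsilon>\<^sup>2))"
    using consistency[OF C, of i t] unfolding flux_def pairing_def err_def .
  show "\<bar>pairing (Kreg \<epsilon>) D (W i) (H i) t\<bar> \<le> C * (M1 + U * M1 + \<Gamma> * U)"
    using flux_integrable(3)[OF C, of i t] unfolding flux_def pairing_def .
next
  fix T i j assume "j \<in> {1..N}" "\<tau> * real i \<le> T"
  then show "norm (L i j) + BA \<le> Lmax T" using L_bound_uniform by blast
qed (use eps tau in \<open>simp_all add: st_0 st_Suc vort_W\<close>)

context vortex_data
begin

lemma approx_sequence:
  "\<exists>\<epsilon> \<tau> e W H L. (\<forall>n::nat. approx (\<epsilon> n) (\<tau> n) (e n) (W n) (H n) (L n)) \<and> \<epsilon> \<longlonglongrightarrow> 0 \<and> \<tau> \<longlonglongrightarrow> 0 \<and> e \<longlonglongrightarrow> 0"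
proof -
  define X where "X = M1 + \<Gamma>"
  have X: "X \<ge> 0" using M_nonneg const_nonneg by (simp add: X_def)
  \<comment> \<open>With h = \<epsilon>^3 and \<tau> = \<epsilon>^5/(4 X + 1): 4 \<tau> X \<le>
    \<epsilon>^5 \<le> h \<epsilon> is the CFL condition, h^2/\<tau> = (4 X + 1) \<epsilon> makes
    the diffusion vanish, and h/\<epsilon>^2 = \<epsilon> does the same for the error of the
    kernel.\<close>
  define \<epsilon> where "\<epsilon> n = inverse (real (Suc n))" for n
  define h where "h n = \<epsilon> n ^ 3" for n
  define \<tau> where "\<tau> n = \<epsilon> n ^ 5 / (4 * X + 1)" for n
  define e where "e n = (h n)\<^sup>2 / \<tau> n + \<tau> n + 4 * h n * (M1 + \<Gamma>) / (\<epsilon> n)\<^sup>2" for n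
  have eps: "0 < \<epsilon> n" "\<epsilon> n \<le> 1" for n by (simp_all add: \<epsilon>_def inverse_le_1_iff)
  have tau: "0 < \<tau> n" "\<tau> n \<le> \<epsilon> n" for n
  proof -
    show "0 < \<tau> n" using X eps[of n] by (simp add: \<tau>_def)
    have "\<tau> n \<le> \<epsilon> n ^ 5 / 1" unfolding \<tau>_def using X eps[of n] by (intro divide_left_mono) auto
    also have "\<dots> \<le> \<epsilon> n" using eps[of n] power_decreasing[of 1 5 "\<epsilon> n"] by simp
    finally show "\<tau> n \<le> \<epsilon> n" .
  qed
  have ex: "\<exists>W H L. approx (\<epsilon> n) (\<tau> n) (e n) W H L" for n
  proof -
    interpret S: vortex_scheme N m \<gamma> \<delta> M M1 \<omega>0 h0 l0 "\<epsilon> n" "h n" "\<tau> n"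
    proof
      show "0 < \<epsilon> n" "\<epsilon> n \<le> 1" "0 < \<tau> n" by (rule eps tau)+
      show "0 < h n" using eps by (simp add: h_def)
      show "h n \<le> \<epsilon> n" using eps[of n] power_decreasing[of 1 3 "\<epsilon> n"] by (simp add: h_def)
      have "4 * \<tau> n * X = \<epsilon> n ^ 5 * (4 * X / (4 * X + 1))" by (simp add: \<tau>_def)
      also have "\<dots> \<le> \<epsilon> n ^ 5 * 1" using X eps[of n] by (intro mult_left_mono) auto
      also have "\<dots> \<le> \<epsilon> n ^ 4" using eps[of n] power_decreasing[of 4 5 "\<epsilon> n"] by simp
      also have "\<dots> = h n * \<epsilon> n" by (simp add: h_def power_Suc2[symmetric] del: power_Suc)
      finally show "4 * \<tau> n * (M1 + \<Gamma>) \<le> h n * \<epsilon> n" by (simp add: X_def)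
    qed
    show ?thesis using S.approx_scheme unfolding e_def by blast
  qed
  then obtain W H L where "\<And>n. approx (\<epsilon> n) (\<tau> n) (e n) (W n) (H n) (L n)" by metis
  moreover have \<epsilon>0: "\<epsilon> \<longlonglongrightarrow> 0" unfolding \<epsilon>_def[abs_def] by (rule LIMSEQ_inverse_real_of_nat)
  moreover have \<tau>0: "\<tau> \<longlonglongrightarrow> 0"
    by (rule real_tendsto_sandwich[OF _ _ tendsto_const \<epsilon>0]) (use tau in \<open>auto intro!: always_eventually less_imp_le\<close>)
  moreover have "e n = (4 * X + 1) * \<epsilon> n + \<tau> n + 4 * X * \<epsilon> n" for n
  proof -
    have "(h n)\<^sup>2 / \<tau> n = (4 * X + 1) * \<epsilon> n"
      using eps(1)[of n] X by (simp add: h_def \<tau>_def power_mult[symmetric] field_simps eval_nat_numeral)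
    moreover have "4 * h n * (M1 + \<Gamma>) / (\<epsilon> n)\<^sup>2 = 4 * X * \<epsilon> n"
      using eps(1)[of n] by (simp add: h_def X_def field_simps eval_nat_numeral)
    ultimately show ?thesis by (simp add: e_def)
  qed
  then have "e = (\<lambda>n. (4 * X + 1) * \<epsilon> n + \<tau> n + 4 * X * \<epsilon> n)" by (rule ext)
  then have "e \<longlonglongrightarrow> 0"
    using tendsto_add[OF tendsto_add[OF tendsto_mult_right_zero[OF \<epsilon>0, of "4 * X + 1"] \<tau>0] tendsto_mult_right_zero[OF \<epsilon>0, of "4 * X"]]
    by simp
  ultimately show ?thesis by blast
qed

text \<open>The order of the quantifiers is the content: B may depend on the bump and on the bound E
  for the consistency errors, but neither on the approximation nor on its time step.\<close>

definition bump_Lipschitz :: "real \<Rightarrow> real \<Rightarrow> rat \<times> rat \<times> rat \<times> rat \<times> nat \<Rightarrow> bool" where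
  "bump_Lipschitz E B j \<longleftrightarrow> B \<ge> 0 \<and> (\<forall>\<epsilon> \<tau> e W H L s t T. approx \<epsilon> \<tau> e W H L \<longrightarrow> \<bar>e\<bar> \<le> E \<longrightarrow> s \<in> {0..T} \<longrightarrow> t \<in> {0..T} \<longrightarrow>
     \<bar>(LINT x|lborel. W (idx \<tau> t) x * bump j x) - (LINT x|lborel. W (idx \<tau> s) x * bump j x)\<bar> \<le> B * (\<bar>t - s\<bar> + \<tau>))"

lemma bump_LipschitzD:
  assumes "bump_Lipschitz E B j"
  shows "B \<ge> 0" "approx \<epsilon> \<tau> e W H L \<Longrightarrow> \<bar>e\<bar> \<le> E \<Longrightarrow> s \<in> {0..T} \<Longrightarrow> t \<in> {0..T} \<Longrightarrow>
     \<bar>(LINT x|lborel. W (idx \<tau> t) x * bump j x) - (LINT x|lborel. W (idx \<tau> s) x * bump j x)\<bar> \<le> B * (\<bar>t - s\<bar> + \<tau>)"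
  using assms unfolding bump_Lipschitz_def by blast+

lemma approx_bump_Lipschitz:
  assumes E: "E \<ge> 0"
  shows "\<exists>B. bump_Lipschitz E B j"
proof -
  obtain C D where Cb: "C11 C (bump j) D"
    using tame_bump unfolding tame_def by metis
  note C = C11_snd[OF Cb]
  define B where "B = C * (M1 + U * M1 + \<Gamma> * U) + C * M1 * E"
  have B: "B \<ge> 0"
    unfolding B_def using C11D(4)[OF Cb] M_nonneg const_nonneg E by auto
  have "\<bar>(LINT x|lborel. W (idx \<tau> t) x * bump j x) - (LINT x|lborel. W (idx \<tau> s) x * bump j x)\<bar> \<le> B * (\<bar>t - s\<bar> + \<tau>)"
    if a: "approx \<epsilon> \<tau> e W H L" and e: "\<bar>e\<bar> \<le> E" and st: "s \<in> {0..T}" "t \<in> {0..T}" for \<epsilon> \<tau> e W H L s t T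
  proof -
    note \<tau> = approxD(2)[OF a]
    have inc: "norm ((LINT x|lborel. W (Suc i) x * bump j x) - (LINT x|lborel. W i x * bump j x)) \<le> \<tau> * B" for i
    proof -
      define p where "p = pairing (Kreg \<epsilon>) (\<lambda>p. (0, D (snd p))) (W i) (H i) 0"
      have "\<bar>\<tau> * p\<bar> = \<tau> * \<bar>p\<bar>" using \<tau> by (simp add: abs_mult)
      then have "\<bar>(LINT x|lborel. W (Suc i) x * bump j x) - (LINT x|lborel. W i x * bump j x)\<bar>
        \<le> \<tau> * (C * M1 * e) + \<tau> * \<bar>p\<bar>"
        using approxD(9)[OF a C, of i 0] unfolding p_def[symmetric] snd_conv by linarith
      also have "\<dots> \<le> \<tau> * (C * M1 * E) + \<tau> * (C * (M1 + U * M1 + \<Gamma> * U))"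
        using approxD(10)[OF a C, of i 0] e \<tau> C11D(4)[OF Cb] M_nonneg unfolding p_def
        by (intro add_mono mult_left_mono mult_nonneg_nonneg) auto
      finally show ?thesis by (simp add: B_def algebra_simps)
    qed
    show ?thesis
      using idx_Lipschitz[where f = "\<lambda>i. LINT x|lborel. W i x * bump j x", OF \<tau> B inc st] by simp
  qed
  then have "bump_Lipschitz E B j" unfolding bump_Lipschitz_def using B by blast
  then show ?thesis ..
qed

lemma approx_convergent:
  assumes T: "T > 0"
  shows "\<exists>\<epsilon> \<tau> e W H L. (\<forall>n::nat. approx (\<epsilon> n) (\<tau> n) (e n) (W n) (H n) (L n)) \<and> \<epsilon> \<longlonglongrightarrow> 0 \<and> \<tau> \<longlonglongrightarrow> 0 \<and> e \<longlonglongrightarrow> 0 \<and>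
     (\<forall>t\<in>{0..T}. (\<forall>j. convergent (\<lambda>n. LINT x|lborel. W n (idx (\<tau> n) t) x * bump j x)) \<and>
       (\<forall>j\<in>{1..N}. convergent (\<lambda>n. H n (idx (\<tau> n) t) j) \<and> convergent (\<lambda>n. L n (idx (\<tau> n) t) j)))"
proof -
  obtain \<epsilon> \<tau> e W H L where a: "\<And>n::nat. approx (\<epsilon> n) (\<tau> n) (e n) (W n) (H n) (L n)"
    and lims: "\<epsilon> \<longlonglongrightarrow> 0" "\<tau> \<longlonglongrightarrow> 0" "e \<longlonglongrightarrow> 0"
    using approx_sequence by blast
  note \<tau> = approxD(2)[OF a]
  obtain E where E: "\<And>n. \<bar>e n\<bar> \<le> E" "E \<ge> 0"
    using convergent_imp_Bseq[OF convergentI[OF lims(3)]] by (auto simp: Bseq_def dest: less_imp_le)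
  obtain tm where tm: "\<And>n. \<bar>\<tau> n\<bar> \<le> tm"
    using convergent_imp_Bseq[OF convergentI[OF lims(2)]] by (auto simp: Bseq_def)
  have idx0: "idx s 0 = 0" for s by (simp add: idx_def)
  obtain Bb where BbL: "\<And>j. bump_Lipschitz E (Bb j) j"
    using approx_bump_Lipschitz[OF E(2)] by metis
  have Lm: "norm (L n i j) \<le> Lmax T" if "j \<in> {1..N}" "\<tau> n * real i \<le> T" for n i j
    using approxD(11)[OF a that] const_nonneg(4) by linarith
  have Lm0: "Lmax T \<ge> 0" unfolding Lmax_def using const_nonneg by (auto intro!: mult_nonneg_nonneg add_nonneg_nonneg sum_nonneg)
  note W1 = bump_LipschitzD(2)[OF BbL a E(1)]
  define f1 where "f1 n j t = (LINT x|lborel. W n (idx (\<tau> n) t) x * bump j x)" for n j t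
  obtain r1 where r1: "strict_mono (r1 :: nat \<Rightarrow> nat)" "\<And>j t. t \<in> {0..T} \<Longrightarrow> convergent (\<lambda>n. f1 (r1 n) j t)"
  proof (rule asymptotic_Ascoli[of T f1 "\<lambda>j. M * (LINT x|lborel. \<bar>bump j x\<bar>)" Bb "\<lambda>j n. Bb j * \<tau> n"])
    show "norm (f1 n j t) \<le> M * (LINT x|lborel. \<bar>bump j x\<bar>)" for n j t
      unfolding f1_def using vort_pairing(2)[OF approxD(6)[OF a] integrable_bump] by simp
    show "norm (f1 n j t - f1 n j s) \<le> Bb j * \<bar>t - s\<bar> + Bb j * \<tau> n" if "s \<in> {0..T}" "t \<in> {0..T}" for n j s t
      using W1[OF that] by (simp add: f1_def distrib_left)
    show "(\<lambda>n. Bb j * \<tau> n) \<longlonglongrightarrow> 0" for j by (rule tendsto_mult_right_zero[OF lims(2)])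
  qed (use T that in auto)
  \<comment> \<open>The index type of \<open>asymptotic_Ascoli\<close> contains all natural numbers,
    while the bounds concern the labels from 1 to N; the other labels are given the value 0.\<close>
  define f2 where "f2 n j t = (if j \<in> {1..N} then H (r1 n) (idx (\<tau> (r1 n)) t) j else 0)" for n j t
  have H1: "norm (H n (idx (\<tau> n) t) j - H n (idx (\<tau> n) s) j) \<le> Lmax T * (\<bar>t - s\<bar> + \<tau> n)"
    if "s \<in> {0..T}" "t \<in> {0..T}" "j \<in> {1..N}" for n j s t
    using Lm[OF that(3)] \<tau>[of n]
    by (intro idx_Lipschitz[OF \<tau> Lm0 _ that(1,2), of n "\<lambda>i. H n i j"]) (simp add: approxD(7)[OF a])
  have \<tau>r: "(\<lambda>n. \<tau> (r1 n)) \<longlonglongrightarrow> 0" using LIMSEQ_subseq_LIMSEQ[OF lims(2) r1(1)] by (simp add: o_def)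
  obtain r2 where r2: "strict_mono (r2 :: nat \<Rightarrow> nat)" "\<And>j t. t \<in> {0..T} \<Longrightarrow> convergent (\<lambda>n. f2 (r2 n) j t)"
  proof (rule asymptotic_Ascoli[of T f2 "\<lambda>j. norm (h0 j) + Lmax T * (T + tm)" "\<lambda>j. Lmax T" "\<lambda>j n. Lmax T * \<tau> (r1 n)"])
    show "norm (f2 n j t) \<le> norm (h0 j) + Lmax T * (T + tm)" if t: "t \<in> {0..T}" for n j t
    proof (cases "j \<in> {1..N}")
      case True
      have "norm (H (r1 n) (idx (\<tau> (r1 n)) t) j - h0 j) \<le> Lmax T * (\<bar>t - 0\<bar> + \<tau> (r1 n))"
        using H1[OF _ t True, of 0 "r1 n"] T by (simp add: idx0 approxD(4)[OF a])
      also have "\<dots> \<le> Lmax T * (T + tm)"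
        using t tm[of "r1 n"] by (intro mult_left_mono Lm0) auto
      finally show ?thesis using True norm_triangle_ineq2[of "H (r1 n) (idx (\<tau> (r1 n)) t) j" "h0 j"] by (simp add: f2_def)
    next
      case False
      have "tm \<ge> 0" using tm[of 0] by linarith
      then show ?thesis using False Lm0 T by (auto simp: f2_def)
    qed
    show "norm (f2 n j t - f2 n j s) \<le> Lmax T * \<bar>t - s\<bar> + Lmax T * \<tau> (r1 n)" if "s \<in> {0..T}" "t \<in> {0..T}" for n j s t
      using H1[OF that, of j "r1 n"] Lm0 \<tau>[of "r1 n"] by (auto simp: f2_def distrib_left intro!: add_nonneg_nonneg mult_nonneg_nonneg less_imp_le)
    show "(\<lambda>n. Lmax T * \<tau> (r1 n)) \<longlonglongrightarrow> 0" by (rule tendsto_mult_right_zero[OF \<tau>r])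
  qed (use T that in auto)
  define f3 where "f3 n j t = (if j \<in> {1..N} then L (r1 (r2 n)) (idx (\<tau> (r1 (r2 n))) t) j else 0)" for n j t
  have L1: "norm (L n (idx (\<tau> n) t) j - L n (idx (\<tau> n) s) j) \<le> (cL * Lmax T) * (\<bar>t - s\<bar> + \<tau> n)"
    if "s \<in> {0..T}" "t \<in> {0..T}" "j \<in> {1..N}" for n j s t
  proof (rule idx_Lipschitz[where f = "\<lambda>i. L n i j", OF \<tau> _ _ that(1,2)])
    show "0 \<le> cL * Lmax T" using const_nonneg Lm0 by simp
    fix i assume i: "\<tau> n * real i \<le> T"
    have "norm (acc (Kreg (\<epsilon> n)) \<delta> N m \<gamma> (W n i) (H n i) (L n i) j) \<le> cL * (norm (L n i j) + BA)"
      by (rule norm_acc[OF approxD(6)[OF a] Kreg_meas norm_Kreg_le_K[OF approxD(1)[OF a]] that(3)])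
    also have "\<dots> \<le> cL * Lmax T" by (rule mult_left_mono[OF approxD(11)[OF a that(3) i] const_nonneg(3)])
    finally show "norm (L n (Suc i) j - L n i j) \<le> \<tau> n * (cL * Lmax T)"
      using \<tau>[of n] by (simp add: approxD(8)[OF a])
  qed
  have \<tau>r2: "(\<lambda>n. \<tau> (r1 (r2 n))) \<longlonglongrightarrow> 0" using LIMSEQ_subseq_LIMSEQ[OF \<tau>r r2(1)] by (simp add: o_def)
  obtain r3 where r3: "strict_mono (r3 :: nat \<Rightarrow> nat)" "\<And>j t. t \<in> {0..T} \<Longrightarrow> convergent (\<lambda>n. f3 (r3 n) j t)"
  proof (rule asymptotic_Ascoli[of T f3 "\<lambda>j. Lmax T" "\<lambda>j. cL * Lmax T" "\<lambda>j n. cL * Lmax T * \<tau> (r1 (r2 n))"])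
    show "norm (f3 n j t) \<le> Lmax T" if t: "t \<in> {0..T}" for n j t
      using Lm[of j "r1 (r2 n)" "idx (\<tau> (r1 (r2 n))) t"] idx_bounds(1)[OF \<tau>, of t "r1 (r2 n)"] t Lm0
      by (auto simp: f3_def)
    show "norm (f3 n j t - f3 n j s) \<le> cL * Lmax T * \<bar>t - s\<bar> + cL * Lmax T * \<tau> (r1 (r2 n))" if "s \<in> {0..T}" "t \<in> {0..T}" for n j s t
      using L1[OF that, of j "r1 (r2 n)"] Lm0 const_nonneg(3) \<tau>[of "r1 (r2 n)"]
      by (auto simp: f3_def distrib_left intro!: add_nonneg_nonneg mult_nonneg_nonneg less_imp_le)
    show "(\<lambda>n. cL * Lmax T * \<tau> (r1 (r2 n))) \<longlonglongrightarrow> 0" by (rule tendsto_mult_right_zero[OF \<tau>r2])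
  qed (use T that in auto)
  \<comment> \<open>Vorticity, positions and velocities are extracted one after another; the earlier
    limits survive along the later subsequences.\<close>
  define r where "r = r1 \<circ> (r2 \<circ> r3)"
  have r: "strict_mono r" unfolding r_def by (intro strict_mono_o r1 r2 r3)
  have sub: "convergent (\<lambda>n. g (s n))" if "convergent g" "strict_mono (s :: nat \<Rightarrow> nat)" for g :: "nat \<Rightarrow> real" and s
    using convergent_subseq_convergent[OF that] by (simp add: o_def)
  have A: "\<forall>n. approx (\<epsilon> (r n)) (\<tau> (r n)) (e (r n)) (W (r n)) (H (r n)) (L (r n))" using a by blast
  have B: "(\<lambda>n. \<epsilon> (r n)) \<longlonglongrightarrow> 0" "(\<lambda>n. \<tau> (r n)) \<longlonglongrightarrow> 0" "(\<lambda>n. e (r n)) \<longlonglongrightarrow> 0"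
    using LIMSEQ_subseq_LIMSEQ[OF lims(1) r] LIMSEQ_subseq_LIMSEQ[OF lims(2) r] LIMSEQ_subseq_LIMSEQ[OF lims(3) r]
    by (simp_all add: o_def)
  have C: "convergent (\<lambda>n. LINT x|lborel. W (r n) (idx (\<tau> (r n)) t) x * bump j x)" if "t \<in> {0..T}" for t j
    using sub[OF r1(2)[OF that, of j] strict_mono_o[OF r2(1) r3(1)]] by (simp add: f1_def r_def)
  have D: "convergent (\<lambda>n. H (r n) (idx (\<tau> (r n)) t) j)" if "t \<in> {0..T}" "j \<in> {1..N}" for t j
    using convergent_subseq_convergent[OF r2(2)[OF that(1), of j] r3(1)] that(2) by (simp add: f2_def r_def o_def)
  have E: "convergent (\<lambda>n. L (r n) (idx (\<tau> (r n)) t) j)" if "t \<in> {0..T}" "j \<in> {1..N}" for t j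
    using r3(2)[OF that(1), of j] that(2) by (simp add: f3_def r_def)
  have F: "\<forall>t\<in>{0..T}. (\<forall>j. convergent (\<lambda>n. LINT x|lborel. W (r n) (idx (\<tau> (r n)) t) x * bump j x)) \<and>
       (\<forall>j\<in>{1..N}. convergent (\<lambda>n. H (r n) (idx (\<tau> (r n)) t) j) \<and> convergent (\<lambda>n. L (r n) (idx (\<tau> (r n)) t) j))"
    using C D E by blast
  show ?thesis
    by (rule exI[of _ "\<lambda>n. \<epsilon> (r n)"], rule exI[of _ "\<lambda>n. \<tau> (r n)"], rule exI[of _ "\<lambda>n. e (r n)"], rule exI[of _ "\<lambda>n. W (r n)"],
        rule exI[of _ "\<lambda>n. H (r n)"], rule exI[of _ "\<lambda>n. L (r n)"], intro conjI A B F)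
qed

end

section \<open>The truncated system\<close>

lemma Kreg_minus: "Kreg \<epsilon> (- x) = - Kreg \<epsilon> x" and K_minus: "K (- x) = - K x"
  by (simp_all add: Kreg_def K_def perp_minus)

lemma vort_mult:
  assumes w: "vort M M1 w" and g: "g \<in> borel_measurable borel" "\<And>x. \<bar>g x\<bar> \<le> C"
  shows "vort (M * C) (M1 * C) (\<lambda>x. w x * g x)"
proof -
  note w' = vortD[OF w]
  have C: "C \<ge> 0" using g(2)[of 0] by linarith
  have i: "integrable lborel (\<lambda>x. w x * g x)"
    using bounded_mult_integrable[OF g w'(2)] by (simp add: mult.commute)
  have "(LINT x|lborel. \<bar>w x * g x\<bar>) \<le> (LINT x|lborel. \<bar>w x\<bar> * C)"
    using g(2) by (intro integral_mono integrable_abs i integrable_mult_left w'(2)) (auto simp: abs_mult intro!: mult_left_mono)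
  also have "\<dots> \<le> M1 * C" using w'(3) C by (simp add: mult_right_mono)
  finally show ?thesis
    unfolding vort_def using w'(1) g(2) i w'(5) by (auto simp: abs_mult intro!: mult_mono)
qed

text \<open>Oddness of k moves the singularity: as a function of y, the pairing is a sum of
  components of the velocities generated by the densities w g_i. Such velocities are bounded and
  converge at moving points by \<open>conv_near_K_tendsto\<close>.\<close>

lemma vortex_pairing_eq_conv:
  assumes w: "vort M M1 w" and k: "k \<in> borel_measurable borel" "\<And>z. norm (k z) \<le> norm (K z)" "\<And>z. k (- z) = - k z"
    and g: "g \<in> borel_measurable borel" "\<And>x. norm (g x) \<le> C"
  shows "integrable lborel (\<lambda>x. w x * (k (x - y) \<bullet> g x))"
    and "(LINT x|lborel. w x * (k (x - y) \<bullet> g x)) = - (\<Sum>i\<in>UNIV. conv (\<lambda>x. w x * g x $ i) k y $ i)"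
proof -
  have gm: "(\<lambda>x. g x $ i) \<in> borel_measurable borel" for i by (rule borel_measurable_nth[OF g(1)])
  have gb: "\<bar>g x $ i\<bar> \<le> C" for x i using component_le_norm_cart[of "g x" i] g(2)[of x] by linarith
  note v = vort_mult[OF w gm gb]
  note ii = singular_kernel_bound(1)[OF v k(1,2)]
  have ci: "integrable lborel (\<lambda>x. (w x * g x $ i) * k (y - x) $ i)" for i
    using integrable_bounded_linear[OF bounded_linear_vec_nth ii[of i y], of i] by simp
  have eq: "w x * (k (x - y) \<bullet> g x) = - (\<Sum>i\<in>UNIV. (w x * g x $ i) * k (y - x) $ i)" for x
    using k(3)[of "y - x"] by (simp add: inner_vec_def sum_2 algebra_simps)
  show "integrable lborel (\<lambda>x. w x * (k (x - y) \<bullet> g x))"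
    unfolding eq by (intro Bochner_Integration.integrable_minus Bochner_Integration.integrable_sum ci)
  show "(LINT x|lborel. w x * (k (x - y) \<bullet> g x)) = - (\<Sum>i\<in>UNIV. conv (\<lambda>x. w x * g x $ i) k y $ i)"
    unfolding eq conv_nth[OF ii] by (simp add: Bochner_Integration.integral_sum[OF ci])
qed

context vortex_data
begin

lemma conv_pairing_integrable:
  assumes w: "vort M M1 w" and k: "k \<in> borel_measurable borel" "\<And>z. norm (k z) \<le> norm (K z)"
    and g: "integrable lborel (g :: plane \<Rightarrow> plane)"
  shows "integrable lborel (\<lambda>x. conv w k x \<bullet> g x)" "\<bar>conv w k x \<bullet> g x\<bar> \<le> U * norm (g x)"
proof -
  have b: "\<bar>conv w k x \<bullet> g x\<bar> \<le> U * norm (g x)" for x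
    using Cauchy_Schwarz_ineq2[of "conv w k x" "g x"] mult_right_mono[OF norm_conv_singular[OF w k, of x], of "norm (g x)"]
    unfolding U_def by simp
  then show "\<bar>conv w k x \<bullet> g x\<bar> \<le> U * norm (g x)" .
  show "integrable lborel (\<lambda>x. conv w k x \<bullet> g x)"
  proof (rule Bochner_Integration.integrable_bound[where f = "\<lambda>x. U * norm (g x)"])
    show "(\<lambda>x. conv w k x \<bullet> g x) \<in> borel_measurable lborel"
      using conv_meas[OF vortD(4)[OF w] k(1)] g by (intro borel_measurable_inner) auto
    show "AE x in lborel. norm (conv w k x \<bullet> g x) \<le> norm (U * norm (g x))"
      using b by (auto intro!: AE_I2 intro: order_trans[OF _ abs_ge_self])
  qed (use g in simp)
qed

lemma vfield_pairing_split:
  assumes w: "vort M M1 w" and k: "k \<in> borel_measurable borel" "\<And>z. norm (k z) \<le> norm (K z)" "\<And>z. k (- z) = - k z"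
    and g: "g \<in> borel_measurable borel" "\<And>x. norm (g x) \<le> C" and gi: "integrable lborel g"
  shows "(LINT x|lborel. w x * (vfield k N \<gamma> w H x \<bullet> g x)) = (LINT x|lborel. w x * (conv w k x \<bullet> g x))
     - (\<Sum>j=1..N. \<gamma> j * (\<Sum>i\<in>UNIV. conv (\<lambda>x. w x * g x $ i) k (H j) $ i))"
proof -
  note v = vortex_pairing_eq_conv[OF w k g]
  have i1: "integrable lborel (\<lambda>x. w x * (conv w k x \<bullet> g x))"
    by (rule vort_pairing(1)[OF w conv_pairing_integrable(1)[OF w k(1,2) gi]])
  have i2: "integrable lborel (\<lambda>x. \<gamma> j * (w x * (k (x - H j) \<bullet> g x)))" for j
    by (intro integrable_mult_right v(1))
  have eq: "w x * (vfield k N \<gamma> w H x \<bullet> g x) = w x * (conv w k x \<bullet> g x) + (\<Sum>j=1..N. \<gamma> j * (w x * (k (x - H j) \<bullet> g x)))" for x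
    by (simp add: vfield_def inner_add_left inner_sum_left distrib_left sum_distrib_left mult.left_commute)
  have "(LINT x|lborel. w x * (vfield k N \<gamma> w H x \<bullet> g x)) = (LINT x|lborel. w x * (conv w k x \<bullet> g x))
     + (\<Sum>j=1..N. \<gamma> j * (LINT x|lborel. w x * (k (x - H j) \<bullet> g x)))"
    unfolding eq
    by (simp only: Bochner_Integration.integral_add[OF i1 Bochner_Integration.integrable_sum[OF i2]]
        Bochner_Integration.integral_sum[OF i2] integral_mult_right_zero)
  then show ?thesis unfolding v(2) by (simp add: sum_negf)
qed

lemma pairing_bound:
  assumes w: "vort M M1 w" and k: "k \<in> borel_measurable borel" "\<And>z. norm (k z) \<le> norm (K z)"
    and D: "D \<in> borel_measurable borel" "\<And>x. norm (D (t, x)) \<le> C"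
  shows "integrable lborel (\<lambda>x. w x * (fst (D (t, x)) + vfield k N \<gamma> w H x \<bullet> snd (D (t, x))))"
    and "pairing k D w H t = (LINT x|lborel. w x * fst (D (t, x))) + (LINT x|lborel. w x * (vfield k N \<gamma> w H x \<bullet> snd (D (t, x))))"
    and "\<bar>pairing k D w H t\<bar> \<le> C * (M1 + U * M1 + \<Gamma> * U)"
proof -
  note w' = vortD[OF w]
  have C: "C \<ge> 0" using D(2)[of 0] norm_ge_zero order_trans by blast
  have Dt: "(\<lambda>x. D (t, x)) \<in> borel_measurable borel"
    by (rule measurable_compose[OF _ D(1)]) (intro borel_measurable_continuous_onI continuous_intros)
  have D1: "(\<lambda>x. fst (D (t, x))) \<in> borel_measurable borel" and D2: "(\<lambda>x. snd (D (t, x))) \<in> borel_measurable borel"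
    by (rule measurable_compose[OF Dt]; intro borel_measurable_continuous_onI continuous_intros)+
  have b: "\<bar>fst (D (t, x))\<bar> \<le> C" "norm (snd (D (t, x))) \<le> C" for x
    using D(2)[of x] norm_fst_le[of "fst (D (t, x))" "snd (D (t, x))"] norm_snd_le[of "snd (D (t, x))" "fst (D (t, x))"] by auto
  note v = vort_mult[OF w D1 b(1)]
  note p = vfield_pairing[OF w k D2 b(2), of H]
  show "integrable lborel (\<lambda>x. w x * (fst (D (t, x)) + vfield k N \<gamma> w H x \<bullet> snd (D (t, x))))"
    unfolding distrib_left by (rule Bochner_Integration.integrable_add[OF vortD(2)[OF v] p(1)])
  show eq: "pairing k D w H t = (LINT x|lborel. w x * fst (D (t, x))) + (LINT x|lborel. w x * (vfield k N \<gamma> w H x \<bullet> snd (D (t, x))))"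
    unfolding pairing_def distrib_left by (rule Bochner_Integration.integral_add[OF vortD(2)[OF v] p(1)])
  have "\<bar>LINT x|lborel. w x * fst (D (t, x))\<bar> \<le> C * M1"
    using order_trans[OF integral_abs_bound vortD(3)[OF v]] by (simp only: mult.commute[of C])
  then show "\<bar>pairing k D w H t\<bar> \<le> C * (M1 + U * M1 + \<Gamma> * U)"
    unfolding eq using p(2) by (simp add: algebra_simps)
qed

text \<open>Two nonlinear terms occur. In w times its own velocity, the velocity converges strongly
  in L^1 once multiplied by the compactly supported gradient; the vortex part is rewritten by
  \<open>vfield_pairing_split\<close> as velocities evaluated at the vortices.\<close>

lemma pairing_tendsto:
  assumes w: "\<And>n::nat. vort M M1 (w n)" "vort M M1 w'"
    and weak: "\<And>g. integrable lborel g \<Longrightarrow> (\<lambda>n. LINT x|lborel. w n x * g x) \<longlonglongrightarrow> (LINT x|lborel. w' x * g x)"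
    and \<epsilon>: "\<And>n. \<epsilon> n > 0" "\<epsilon> \<longlonglongrightarrow> 0"
    and H: "\<And>j. j \<in> {1..N} \<Longrightarrow> (\<lambda>n. H n j) \<longlonglongrightarrow> H' j" and s: "s \<longlonglongrightarrow> t"
    and D: "D \<in> borel_measurable borel" "\<And>p. norm (D p) \<le> C" "\<And>s s' x. norm (D (s, x) - D (s', x)) \<le> C * \<bar>s - s'\<bar>"
    and supp: "\<And>s x. norm x \<ge> R \<Longrightarrow> D (s, x) = 0"
  shows "(\<lambda>n. pairing (Kreg (\<epsilon> n)) D (w n) (H n) (s n)) \<longlonglongrightarrow> pairing K D w' H' t"
proof -
  note Kr = Kreg_meas norm_Kreg_le_K[OF \<epsilon>(1)]
  have Dt: "(\<lambda>x. D (t, x)) \<in> borel_measurable borel"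
    by (rule measurable_compose[OF _ D(1)]) (intro borel_measurable_continuous_onI continuous_intros)
  define g1 where "g1 x = fst (D (t, x))" for x
  define g2 where "g2 x = snd (D (t, x))" for x
  have g1m: "g1 \<in> borel_measurable borel" and g2m: "g2 \<in> borel_measurable borel"
    unfolding g1_def[abs_def] g2_def[abs_def]
    by (rule measurable_compose[OF Dt]; intro borel_measurable_continuous_onI continuous_intros)+
  have gb: "\<bar>g1 x\<bar> \<le> C" "norm (g2 x) \<le> C" for x
    using D(2)[of "(t, x)"] norm_fst_le[of "fst (D (t, x))" "snd (D (t, x))"] norm_snd_le[of "snd (D (t, x))" "fst (D (t, x))"]
    by (auto simp: g1_def g2_def)
  have g2c: "\<bar>g2 x $ i\<bar> \<le> C" for x i using component_le_norm_cart[of "g2 x" i] gb(2)[of x] by linarith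
  have bi: "integrable lborel (\<lambda>x::plane. C * indicator (ball 0 R) x :: real)"
    using emeasure_lborel_ball_finite[of "0::plane" R] by (intro integrable_mult_right integrable_real_indicator) auto
  have C0: "C \<ge> 0" using gb(1)[of 0] by linarith
  have g1i: "integrable lborel g1"
  proof (rule Bochner_Integration.integrable_bound[OF bi])
    show "AE x in lborel. norm (g1 x) \<le> norm (C * indicator (ball 0 R) x :: real)"
      using gb(1) supp C0 by (auto intro!: AE_I2 simp: g1_def indicator_def not_less)
  qed (use g1m in simp)
  have g2i: "integrable lborel g2"
  proof (rule Bochner_Integration.integrable_bound[OF bi])
    show "AE x in lborel. norm (g2 x) \<le> norm (C * indicator (ball 0 R) x :: real)"
      using gb(2) supp C0 by (auto intro!: AE_I2 simp: g2_def indicator_def not_less)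
  qed (use g2m in simp)
  \<comment> \<open>The time argument of D is frozen at t. The cost is the uniform bound on
    pairings, applied to the difference field E, which is of size C |s n - t|.\<close>
  have "(\<lambda>n. pairing (Kreg (\<epsilon> n)) D (w n) (H n) (s n) - pairing (Kreg (\<epsilon> n)) D (w n) (H n) t) \<longlonglongrightarrow> 0"
  proof (rule Lim_null_comparison)
    let ?B = "M1 + U * M1 + \<Gamma> * U"
    have "(\<lambda>n. C * \<bar>s n - t\<bar> * ?B) \<longlonglongrightarrow> C * \<bar>t - t\<bar> * ?B" by (intro tendsto_intros s)
    then show "(\<lambda>n. C * \<bar>s n - t\<bar> * ?B) \<longlonglongrightarrow> 0" by simp
    have "norm (pairing (Kreg (\<epsilon> n)) D (w n) (H n) (s n) - pairing (Kreg (\<epsilon> n)) D (w n) (H n) t) \<le> C * \<bar>s n - t\<bar> * ?B" for n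
    proof -
      define E where "E p = D (s n, snd p) - D (t, snd p)" for p :: "real \<times> plane"
      have Em: "E \<in> borel_measurable borel"
        unfolding E_def[abs_def]
        by (intro borel_measurable_diff measurable_compose[OF _ D(1)] borel_measurable_continuous_onI continuous_intros)
      have Eb: "norm (E (0, x)) \<le> C * \<bar>s n - t\<bar>" for x using D(3) by (simp add: E_def)
      have "pairing (Kreg (\<epsilon> n)) E (w n) (H n) 0 = pairing (Kreg (\<epsilon> n)) D (w n) (H n) (s n) - pairing (Kreg (\<epsilon> n)) D (w n) (H n) t"
        unfolding pairing_def
        by (subst Bochner_Integration.integral_diff[symmetric, OF pairing_bound(1)[OF w(1) Kr D(1,2)] pairing_bound(1)[OF w(1) Kr D(1,2)]])
          (simp add: E_def inner_diff_right algebra_simps)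
      then show ?thesis using pairing_bound(3)[OF w(1) Kr Em Eb, of n n "H n"] by simp
    qed
    then show "\<forall>\<^sub>F n in sequentially. norm (pairing (Kreg (\<epsilon> n)) D (w n) (H n) (s n) - pairing (Kreg (\<epsilon> n)) D (w n) (H n) t) \<le> C * \<bar>s n - t\<bar> * ?B"
      by simp
  qed
  note stepA = this
  have Km: "(\<lambda>n. M * K_mass (\<epsilon> n)) \<longlonglongrightarrow> 0" for M by (rule tendsto_mult_right_zero[OF K_mass_tendsto_0[OF \<epsilon>(2)]])
  have cv: "(\<lambda>n. conv (w n) (Kreg (\<epsilon> n)) x) \<longlonglongrightarrow> conv w' K x" for x
    by (rule conv_near_K_tendsto[OF w weak tendsto_const conv_Kreg_minus_K[OF w(1) \<epsilon>(1)] Km])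
  note ci = conv_pairing_integrable[OF w(1) Kr g2i] and ci' = conv_pairing_integrable[OF w(2) K_meas order_refl g2i]
  have B2: "(\<lambda>n. LINT x|lborel. w n x * (conv (w n) (Kreg (\<epsilon> n)) x \<bullet> g2 x)) \<longlonglongrightarrow> (LINT x|lborel. w' x * (conv w' K x \<bullet> g2 x))"
  proof -
    have l: "(\<lambda>n. LINT x|lborel. \<bar>conv (w n) (Kreg (\<epsilon> n)) x \<bullet> g2 x - conv w' K x \<bullet> g2 x\<bar>) \<longlonglongrightarrow> (LINT x|(lborel :: plane measure). 0)"
    proof (rule integral_dominated_convergence[where w = "\<lambda>x. 2 * (U * norm (g2 x))"])
      show "AE x in lborel. (\<lambda>n. \<bar>conv (w n) (Kreg (\<epsilon> n)) x \<bullet> g2 x - conv w' K x \<bullet> g2 x\<bar>) \<longlonglongrightarrow> 0"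
        by (intro AE_I2 tendsto_rabs_zero LIM_zero tendsto_inner cv tendsto_const)
      show "AE x in lborel. norm \<bar>conv (w n) (Kreg (\<epsilon> n)) x \<bullet> g2 x - conv w' K x \<bullet> g2 x\<bar> \<le> 2 * (U * norm (g2 x))" for n
      proof (intro AE_I2)
        fix x show "norm \<bar>conv (w n) (Kreg (\<epsilon> n)) x \<bullet> g2 x - conv w' K x \<bullet> g2 x\<bar> \<le> 2 * (U * norm (g2 x))"
          using ci(2)[of n n x] ci'(2)[of x] by simp
      qed
      show "integrable lborel (\<lambda>x. 2 * (U * norm (g2 x)))" by (intro integrable_mult_right integrable_norm g2i)
    qed (use borel_measurable_integrable[OF ci(1)] borel_measurable_integrable[OF ci'(1)] in \<open>auto intro!: borel_measurable_abs borel_measurable_diff\<close>)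
    \<comment> \<open>Strong L^1 convergence of the tested velocity is played against the uniform
      sup bound M; what remains has a fixed L^1 test function and converges weakly.\<close>
    have "(\<lambda>n. (LINT x|lborel. w n x * (conv (w n) (Kreg (\<epsilon> n)) x \<bullet> g2 x)) - (LINT x|lborel. w n x * (conv w' K x \<bullet> g2 x))) \<longlonglongrightarrow> 0"
    proof (rule Lim_null_comparison)
      show "(\<lambda>n. M * (LINT x|lborel. \<bar>conv (w n) (Kreg (\<epsilon> n)) x \<bullet> g2 x - conv w' K x \<bullet> g2 x\<bar>)) \<longlonglongrightarrow> 0"
        using l by (intro tendsto_mult_right_zero) simp
      show "\<forall>\<^sub>F n in sequentially. norm ((LINT x|lborel. w n x * (conv (w n) (Kreg (\<epsilon> n)) x \<bullet> g2 x)) - (LINT x|lborel. w n x * (conv w' K x \<bullet> g2 x)))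
         \<le> M * (LINT x|lborel. \<bar>conv (w n) (Kreg (\<epsilon> n)) x \<bullet> g2 x - conv w' K x \<bullet> g2 x\<bar>)"
        using vort_pairing_diff[OF w(1) ci(1) ci'(1)] by (intro always_eventually allI) simp
    qed
    from tendsto_add[OF this weak[OF ci'(1)]] show ?thesis by simp
  qed
  have g2n: "(\<lambda>x. g2 x $ i) \<in> borel_measurable borel" for i by (rule borel_measurable_nth[OF g2m])
  have B3: "(\<lambda>n. conv (\<lambda>x. w n x * g2 x $ i) (Kreg (\<epsilon> n)) (H n j) $ i) \<longlonglongrightarrow> conv (\<lambda>x. w' x * g2 x $ i) K (H' j) $ i"
    if j: "j \<in> {1..N}" for i j
  proof (intro tendsto_vec_nth conv_near_K_tendsto[OF vort_mult[OF w(1) g2n g2c] vort_mult[OF w(2) g2n g2c] _ H[OF j]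
        conv_Kreg_minus_K[OF vort_mult[OF w(1) g2n g2c] \<epsilon>(1)] Km])
    fix g :: "plane \<Rightarrow> real" assume g: "integrable lborel g"
    show "(\<lambda>n. LINT x|lborel. w n x * g2 x $ i * g x) \<longlonglongrightarrow> (LINT x|lborel. w' x * g2 x $ i * g x)"
      using weak[OF bounded_mult_integrable[OF g2n g2c g]] by (simp add: mult.assoc)
  qed
  have "(\<lambda>n. pairing (Kreg (\<epsilon> n)) D (w n) (H n) t) \<longlonglongrightarrow> pairing K D w' H' t"
    unfolding pairing_bound(2)[OF w(1) Kr D(1,2)] pairing_bound(2)[OF w(2) K_meas order_refl D(1,2)] g1_def[symmetric] g2_def[symmetric]
      vfield_pairing_split[OF w(1) Kr Kreg_minus g2m gb(2) g2i] vfield_pairing_split[OF w(2) K_meas order_refl K_minus g2m gb(2) g2i]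
    by (intro tendsto_add tendsto_diff tendsto_sum tendsto_mult tendsto_const weak[OF g1i] B2 B3)
  from tendsto_add[OF stepA this] show ?thesis by simp
qed

text \<open>Kernel and error are kept general because the limit is taken twice: along the scheme,
  with \<open>Kreg\<close> and error \<open>M * K_mass \<epsilon>\<close>, and along times
  converging to t, with \<open>K\<close> and error 0, which yields continuity of the
  acceleration.\<close>

lemma acc_tendsto:
  assumes w: "\<And>n::nat. vort M M1 (w n)" "vort M M1 w'"
    and weak: "\<And>g. integrable lborel g \<Longrightarrow> (\<lambda>n. LINT x|lborel. w n x * g x) \<longlonglongrightarrow> (LINT x|lborel. w' x * g x)"
    and H: "\<And>j. j \<in> {1..N} \<Longrightarrow> (\<lambda>n. H n j) \<longlonglongrightarrow> H' j" and L: "(\<lambda>n. L n j) \<longlonglongrightarrow> L' j" and j: "j \<in> {1..N}"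
    and k: "\<And>n. norm (conv (w n) (k n) (H n j) - conv (w n) K (H n j)) \<le> d n" "d \<longlonglongrightarrow> 0"
  shows "(\<lambda>n. acc (k n) \<delta> N m \<gamma> (w n) (H n) (L n) j) \<longlonglongrightarrow> acc K \<delta> N m \<gamma> w' H' L' j"
proof -
  have c: "(\<lambda>n. conv (w n) (k n) (H n j)) \<longlonglongrightarrow> conv w' K (H' j)"
    by (rule conv_near_K_tendsto[OF w weak H[OF j] k])
  have Kc: "isCont (Kreg \<delta>) z" for z
    using continuous_on_Kreg[OF \<delta> continuous_on_id, of UNIV] by (simp add: continuous_on_eq_continuous_at)
  have "(\<lambda>n. Kreg \<delta> (H n j - H n i)) \<longlonglongrightarrow> Kreg \<delta> (H' j - H' i)" if "i \<in> {1..N} - {j}" for i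
    using that j by (intro isCont_tendsto_compose[OF Kc] tendsto_diff H) auto
  then show ?thesis
    unfolding acc_def by (intro tendsto_scaleR tendsto_const tendsto_perp tendsto_diff L c tendsto_sum)
qed

text \<open>Since the vortex-vortex kernel is truncated, solutions exist on every time interval.
  Regularity in time is gained in stages: the limits satisfy integral equations, so h and l are
  continuous; together with weak-* continuity of the vorticity this makes the acceleration
  continuous, and then the integral equations can be differentiated.\<close>

theorem regularised_solution:
  assumes T: "T > 0"
  shows "\<exists>\<omega> h l. (\<forall>t. vort M M1 (\<omega> t)) \<and> \<omega> 0 = \<omega>0 \<and>
     (\<forall>g. integrable lborel g \<longrightarrow> continuous_on {0..T} (\<lambda>t. LINT x|lborel. \<omega> t x * g x)) \<and>
     (\<forall>j\<in>{1..N}. h j 0 = h0 j \<and> l j 0 = l0 j \<and>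
        (\<forall>t\<in>{0..T}. (h j has_vector_derivative l j t) (at t within {0..T}) \<and>
           (l j has_vector_derivative acc K \<delta> N m \<gamma> (\<omega> t) (\<lambda>i. h i t) (\<lambda>i. l i t) j) (at t within {0..T})) \<and>
        continuous_on {0..T} (\<lambda>t. acc K \<delta> N m \<gamma> (\<omega> t) (\<lambda>i. h i t) (\<lambda>i. l i t) j)) \<and>
     (\<forall>C \<phi> D R \<eta>. C11 C \<phi> D \<longrightarrow> (\<forall>s s' x. norm (D (s, x) - D (s', x)) \<le> C * \<bar>s - s'\<bar>) \<longrightarrow>
        (\<forall>s x. norm x \<ge> R \<longrightarrow> D (s, x) = 0) \<longrightarrow> 0 < \<eta> \<longrightarrow> (\<forall>t x. t \<le> 0 \<or> T - \<eta> \<le> t \<longrightarrow> \<phi> (t, x) = 0) \<longrightarrow>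
        ((\<lambda>t. pairing K D (\<omega> t) (\<lambda>i. h i t) t) has_integral 0) {0..T})"
proof -
  obtain \<epsilon> \<tau> e W H L where seq: "(\<forall>n::nat. approx (\<epsilon> n) (\<tau> n) (e n) (W n) (H n) (L n)) \<and> \<epsilon> \<longlonglongrightarrow> 0 \<and> \<tau> \<longlonglongrightarrow> 0 \<and> e \<longlonglongrightarrow> 0 \<and>
     (\<forall>t\<in>{0..T}. (\<forall>j. convergent (\<lambda>n. LINT x|lborel. W n (idx (\<tau> n) t) x * bump j x)) \<and>
       (\<forall>j\<in>{1..N}. convergent (\<lambda>n. H n (idx (\<tau> n) t) j) \<and> convergent (\<lambda>n. L n (idx (\<tau> n) t) j)))"
    using approx_convergent[OF T] by (elim exE) (rule that)
  then have a: "\<And>n. approx (\<epsilon> n) (\<tau> n) (e n) (W n) (H n) (L n)"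
    and lims: "\<epsilon> \<longlonglongrightarrow> 0" "\<tau> \<longlonglongrightarrow> 0" "e \<longlonglongrightarrow> 0"
    by simp_all
  note cvT = bspec[OF conjunct2[OF conjunct2[OF conjunct2[OF conjunct2[OF seq]]]]]
  have cv: "convergent (\<lambda>n. LINT x|lborel. W n (idx (\<tau> n) t) x * bump j x)" if "t \<in> {0..T}" for t j
    by (rule spec[OF conjunct1[OF cvT[OF that]]])
  have cv': "convergent (\<lambda>n. H n (idx (\<tau> n) t) j)" "convergent (\<lambda>n. L n (idx (\<tau> n) t) j)"
    if "t \<in> {0..T}" "j \<in> {1..N}" for t j
    using bspec[OF conjunct2[OF cvT[OF that(1)]] that(2)] by (rule conjunct1, rule conjunct2)
  note \<tau> = approxD(2)[OF a] and \<epsilon> = approxD(1)[OF a] and vW = approxD(6)[OF a]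
  have idx0: "idx s 0 = 0" for s by (simp add: idx_def)
  \<comment> \<open>At time 0 the initial density itself is demanded, not merely a weak limit, so
    that the initial condition holds exactly. Outside [0,T] every member of the class is admissible,
    and the initial density is taken.\<close>
  define Q where "Q t w' \<longleftrightarrow> vort M M1 w' \<and> (t = 0 \<longrightarrow> w' = \<omega>0) \<and> (t \<in> {0..T} \<longrightarrow>
     (\<forall>g. integrable lborel g \<longrightarrow> (\<lambda>n. LINT x|lborel. W n (idx (\<tau> n) t) x * g x) \<longlonglongrightarrow> (LINT x|lborel. w' x * g x)))" for t w'
  have "\<exists>w'. Q t w'" for t
  proof (cases "t \<in> {0..T} \<and> t \<noteq> 0")
    case True
    then obtain w' where "vort M M1 w'"
       "\<forall>g. integrable lborel g \<longrightarrow> (\<lambda>n. LINT x|lborel. W n (idx (\<tau> n) t) x * g x) \<longlonglongrightarrow> (LINT x|lborel. w' x * g x)"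
      using weak_limit_exists[of M M1 "\<lambda>n. W n (idx (\<tau> n) t)", OF vW cv] by blast
    then have "Q t w'" unfolding Q_def using True by blast
    then show ?thesis by (rule exI[of "Q t" w'])
  next
    case False
    have "Q t \<omega>0"
      unfolding Q_def using False by (auto simp: vort0 idx0 approxD(3)[OF a])
    then show ?thesis by (rule exI[of "Q t" \<omega>0])
  qed
  then have "\<forall>t. \<exists>w'. Q t w'" by (rule allI)
  from choice[OF this] obtain \<omega> where Q: "\<forall>t. Q t (\<omega> t)" ..
  have \<omega>: "vort M M1 (\<omega> t)" "\<omega> 0 = \<omega>0" for t
    using Q[rule_format, of t] Q[rule_format, of 0] unfolding Q_def by simp_all
  have weak: "(\<lambda>n. LINT x|lborel. W n (idx (\<tau> n) t) x * g x) \<longlonglongrightarrow> (LINT x|lborel. \<omega> t x * g x)"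
    if "t \<in> {0..T}" "integrable lborel g" for t g
    using Q[rule_format, of t] that unfolding Q_def by blast
  define h where "h j t = lim (\<lambda>n. H n (idx (\<tau> n) t) j)" for j t
  define l where "l j t = lim (\<lambda>n. L n (idx (\<tau> n) t) j)" for j t
  have Hl: "(\<lambda>n. H n (idx (\<tau> n) t) j) \<longlonglongrightarrow> h j t" and Ll: "(\<lambda>n. L n (idx (\<tau> n) t) j) \<longlonglongrightarrow> l j t"
    if "t \<in> {0..T}" "j \<in> {1..N}" for t j
    unfolding h_def l_def using cv'[OF that] by (simp_all add: convergent_LIMSEQ_iff)
  define A where "A j t = acc K \<delta> N m \<gamma> (\<omega> t) (\<lambda>i. h i t) (\<lambda>i. l i t) j" for j t
  have Lm: "norm (L n i j) \<le> Lmax T" if "j \<in> {1..N}" "\<tau> n * real i \<le> T" for n i j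
    using approxD(11)[OF a that] const_nonneg(4) by linarith
  have h_int: "h j t = h0 j + integral {0..t} (l j)" and l_ib: "l j integrable_on {0..t}" if t: "t \<in> {0..T}" and j: "j \<in> {1..N}" for j t
  proof -
    have sum: "H n i j = h0 j + \<tau> n *\<^sub>R (\<Sum>k<i. L n k j)" for n i
      by (induction i) (simp_all add: approxD(4)[OF a] approxD(7)[OF a] algebra_simps)
    note lim = step_sum_tendsto_integral[where X = "\<lambda>n k. L n k j" and \<tau> = \<tau> and T = T, OF \<tau> lims(2) Lm[OF j] Ll[OF _ j] t]
    show "l j integrable_on {0..t}" by (rule lim(1))
    have "(\<lambda>n. H n (idx (\<tau> n) t) j) \<longlonglongrightarrow> h0 j + integral {0..t} (l j)"
      unfolding sum by (intro tendsto_add tendsto_const lim(2))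
    then show "h j t = h0 j + integral {0..t} (l j)" using Hl[OF t j] LIMSEQ_unique by blast
  qed
  have Km: "(\<lambda>n. M * K_mass (\<epsilon> n)) \<longlonglongrightarrow> 0" by (rule tendsto_mult_right_zero[OF K_mass_tendsto_0[OF lims(1)]])
  have l_int: "l j t = l0 j + integral {0..t} (A j)" and A_ib: "A j integrable_on {0..t}" if t: "t \<in> {0..T}" and j: "j \<in> {1..N}" for j t
  proof -
    define X where "X n k = acc (Kreg (\<epsilon> n)) \<delta> N m \<gamma> (W n k) (H n k) (L n k) j" for n k
    have sum: "L n i j = l0 j + \<tau> n *\<^sub>R (\<Sum>k<i. X n k)" for n i
      by (induction i) (simp_all add: approxD(5)[OF a] approxD(8)[OF a] X_def algebra_simps)
    have XB: "norm (X n k) \<le> cL * Lmax T" if "\<tau> n * real k \<le> T" for n k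
    proof -
      have "norm (X n k) \<le> cL * (norm (L n k j) + BA)"
        unfolding X_def by (rule norm_acc[OF vW Kreg_meas norm_Kreg_le_K[OF \<epsilon>] j])
      also have "\<dots> \<le> cL * Lmax T"
        by (rule mult_left_mono[OF approxD(11)[OF a j that] const_nonneg(3)])
      finally show ?thesis .
    qed
    have Xl: "(\<lambda>n. X n (idx (\<tau> n) s)) \<longlonglongrightarrow> A j s" if s: "s \<in> {0..T}" for s
      unfolding X_def A_def
      by (rule acc_tendsto[where w = "\<lambda>n. W n (idx (\<tau> n) s)" and w' = "\<omega> s" and H = "\<lambda>n. H n (idx (\<tau> n) s)"
            and H' = "\<lambda>i. h i s" and L = "\<lambda>n. L n (idx (\<tau> n) s)" and L' = "\<lambda>i. l i s" and k = "\<lambda>n. Kreg (\<epsilon> n)"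
            and d = "\<lambda>n. M * K_mass (\<epsilon> n)"])
        (rule vW \<omega>(1) weak[OF s] Hl[OF s] Ll[OF s j] j conv_Kreg_minus_K[OF vW \<epsilon>] Km; assumption?)+
    note lim = step_sum_tendsto_integral[where X = X and \<tau> = \<tau> and T = T, OF \<tau> lims(2) XB Xl t]
    show "A j integrable_on {0..t}" by (rule lim(1))
    have "(\<lambda>n. L n (idx (\<tau> n) t) j) \<longlonglongrightarrow> l0 j + integral {0..t} (A j)"
      unfolding sum by (intro tendsto_add tendsto_const lim(2))
    then show "l j t = l0 j + integral {0..t} (A j)" using Ll[OF t j] LIMSEQ_unique by blast
  qed
  have TT: "T \<in> {0..T}" "0 \<in> {0..T}" using T by auto
  have hc: "continuous_on {0..T} (h j)" and lc: "continuous_on {0..T} (l j)" if j: "j \<in> {1..N}" for j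
  proof -
    have "continuous_on {0..T} (\<lambda>t. h0 j + integral {0..t} (l j))"
      by (intro continuous_on_add continuous_on_const indefinite_integral_continuous_1 l_ib[OF TT(1) j])
    then show "continuous_on {0..T} (h j)" by (rule continuous_on_eq) (simp add: h_int[OF _ j])
    have "continuous_on {0..T} (\<lambda>t. l0 j + integral {0..t} (A j))"
      by (intro continuous_on_add continuous_on_const indefinite_integral_continuous_1 A_ib[OF TT(1) j])
    then show "continuous_on {0..T} (l j)" by (rule continuous_on_eq) (simp add: l_int[OF _ j])
  qed
  obtain E where E: "\<And>n. \<bar>e n\<bar> \<le> E" "E \<ge> 0"
    using convergent_imp_Bseq[OF convergentI[OF lims(3)]] by (auto simp: Bseq_def dest: less_imp_le)
  have wc: "continuous_on {0..T} (\<lambda>t. LINT x|lborel. \<omega> t x * g x)" if g: "integrable lborel g" for g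
  proof (rule weakstar_continuity[OF \<omega>(1) _ g])
    fix j
    obtain B where BL: "bump_Lipschitz E B j"
      using approx_bump_Lipschitz[OF E(2)] by metis
    note B = bump_LipschitzD(1)[OF BL]
    have "dist (LINT x|lborel. \<omega> t x * bump j x) (LINT x|lborel. \<omega> s x * bump j x) \<le> B * dist t s"
      if "t \<in> {0..T}" "s \<in> {0..T}" for t s
    proof -
      have "(\<lambda>n. B * (\<bar>t - s\<bar> + \<tau> n)) \<longlonglongrightarrow> B * (\<bar>t - s\<bar> + 0)" by (intro tendsto_intros lims)
      moreover have "(\<lambda>n. \<bar>(LINT x|lborel. W n (idx (\<tau> n) t) x * bump j x) - (LINT x|lborel. W n (idx (\<tau> n) s) x * bump j x)\<bar>)
         \<longlonglongrightarrow> \<bar>(LINT x|lborel. \<omega> t x * bump j x) - (LINT x|lborel. \<omega> s x * bump j x)\<bar>"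
        by (intro tendsto_rabs tendsto_diff weak that integrable_bump)
      ultimately show ?thesis
        unfolding dist_real_def using bump_LipschitzD(2)[OF BL a E(1) that(2,1)] by (intro LIMSEQ_le) auto
    qed
    then have "B-lipschitz_on {0..T} (\<lambda>t. LINT x|lborel. \<omega> t x * bump j x)" using B by (intro lipschitz_onI)
    then show "continuous_on {0..T} (\<lambda>t. LINT x|lborel. \<omega> t x * bump j x)" by (rule lipschitz_on_continuous_on)
  qed
  have Ac: "continuous_on {0..T} (A j)" if j: "j \<in> {1..N}" for j
    unfolding continuous_on_sequentially
  proof (intro allI ballI impI)
    fix s t assume st: "t \<in> {0..T}" and "(\<forall>n. s n \<in> {0..T}) \<and> s \<longlonglongrightarrow> t"
    then have s: "\<And>n. s n \<in> {0..T}" "s \<longlonglongrightarrow> t" by auto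

    have "(\<lambda>n. acc K \<delta> N m \<gamma> (\<omega> (s n)) (\<lambda>i. h i (s n)) (\<lambda>i. l i (s n)) j) \<longlonglongrightarrow> acc K \<delta> N m \<gamma> (\<omega> t) (\<lambda>i. h i t) (\<lambda>i. l i t) j"
    proof (rule acc_tendsto[where w = "\<lambda>n. \<omega> (s n)" and w' = "\<omega> t" and H = "\<lambda>n i. h i (s n)"
            and H' = "\<lambda>i. h i t" and L = "\<lambda>n i. l i (s n)" and L' = "\<lambda>i. l i t" and k = "\<lambda>n. K" and d = "\<lambda>_. 0"])
      show "(\<lambda>n. LINT x|lborel. \<omega> (s n) x * g x) \<longlonglongrightarrow> (LINT x|lborel. \<omega> t x * g x)" if "integrable lborel g" for g
        using continuous_on_tendsto_compose[OF wc[OF that] s(2) st] s(1) by simp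
      show "(\<lambda>n. h i (s n)) \<longlonglongrightarrow> h i t" if "i \<in> {1..N}" for i
        using continuous_on_tendsto_compose[OF hc[OF that] s(2) st] s(1) by simp
      show "(\<lambda>n. l j (s n)) \<longlonglongrightarrow> l j t"
        using continuous_on_tendsto_compose[OF lc[OF j] s(2) st] s(1) by simp
    qed (use j in \<open>simp_all add: \<omega>\<close>)
    then show "(A j \<circ> s) \<longlonglongrightarrow> A j t" by (simp add: A_def o_def)
  qed
  have hd: "(h j has_vector_derivative l j t) (at t within {0..T})"
    and ld: "(l j has_vector_derivative A j t) (at t within {0..T})" if t: "t \<in> {0..T}" and j: "j \<in> {1..N}" for j t
  proof -
    have "((\<lambda>t. h0 j + integral {0..t} (l j)) has_vector_derivative 0 + l j t) (at t within {0..T})"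
      by (intro has_vector_derivative_add has_vector_derivative_const integral_has_vector_derivative lc j t)
    then have *: "((\<lambda>t. h0 j + integral {0..t} (l j)) has_vector_derivative l j t) (at t within {0..T})" by simp
    show "(h j has_vector_derivative l j t) (at t within {0..T})"
      by (rule has_vector_derivative_transform[OF t _ *]) (rule h_int[OF _ j])
    have "((\<lambda>t. l0 j + integral {0..t} (A j)) has_vector_derivative 0 + A j t) (at t within {0..T})"
      by (intro has_vector_derivative_add has_vector_derivative_const integral_has_vector_derivative Ac j t)
    then have *: "((\<lambda>t. l0 j + integral {0..t} (A j)) has_vector_derivative A j t) (at t within {0..T})" by simp
    show "(l j has_vector_derivative A j t) (at t within {0..T})"
      by (rule has_vector_derivative_transform[OF t _ *]) (rule l_int[OF _ j])
  qed
  have transport: "((\<lambda>t. pairing K D (\<omega> t) (\<lambda>i. h i t) t) has_integral 0) {0..T}"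
    if C: "C11 C \<phi> D" and DL: "\<And>s s' x. norm (D (s, x) - D (s', x)) \<le> C * \<bar>s - s'\<bar>"
      and supp: "\<And>s x. norm x \<ge> R \<Longrightarrow> D (s, x) = 0" and \<eta>: "0 < \<eta>" and ends: "\<And>t x. t \<le> 0 \<or> T - \<eta> \<le> t \<Longrightarrow> \<phi> (t, x) = 0" for C \<phi> D R \<eta>
  proof -
    define X where "X n k = pairing (Kreg (\<epsilon> n)) D (W n k) (H n k) (\<tau> n * real k)" for n k
    define S where "S n i = (LINT x|lborel. W n i x * \<phi> (\<tau> n * real i, x))" for n i
    \<comment> \<open>Summation of the one-step errors: over i steps they amount to the elapsed time
      \<tau> i times the consistency error.\<close>
    have tel: "\<bar>S n i - S n 0 - \<tau> n * (\<Sum>k<i. X n k)\<bar> \<le> \<tau> n * real i * (C * M1 * e n)" for n i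
    proof (induction i)
      case (Suc i)
      have "\<bar>S n (Suc i) - S n i - \<tau> n * X n i\<bar> \<le> \<tau> n * (C * M1 * e n)"
        using approxD(9)[OF a C, of n i "\<tau> n * real i"] by (simp add: S_def X_def algebra_simps)
      moreover have "\<tau> n * (\<Sum>k<Suc i. X n k) = \<tau> n * (\<Sum>k<i. X n k) + \<tau> n * X n i" by (simp add: distrib_left)
      moreover have "\<tau> n * real (Suc i) * (C * M1 * e n) = \<tau> n * real i * (C * M1 * e n) + \<tau> n * (C * M1 * e n)"
        by (simp add: algebra_simps)
      ultimately show ?case using Suc by linarith
    qed simp
    have S0: "S n 0 = 0" for n by (simp add: S_def ends)
    \<comment> \<open>The last grid time lies less than one step before T, hence beyond T - \<eta>
      once \<tau> < \<eta>, where the test function vanishes; both boundary terms of the telescoping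
      sum thus disappear.\<close>
    have SI: "eventually (\<lambda>n. S n (idx (\<tau> n) T) = 0) sequentially"
      using order_tendstoD(2)[OF lims(2) \<eta>]
    proof eventually_elim
      case (elim n)
      have "T - \<eta> \<le> \<tau> n * real (idx (\<tau> n) T)" using idx_bounds(2)[OF \<tau>, of T n] T elim by simp
      then show ?case by (simp add: S_def ends)
    qed
    have "(\<lambda>n. \<tau> n *\<^sub>R (\<Sum>k<idx (\<tau> n) T. X n k)) \<longlonglongrightarrow> 0"
    proof (rule Lim_null_comparison)
      show "(\<lambda>n. T * (C * M1 * \<bar>e n\<bar>)) \<longlonglongrightarrow> 0"
        by (intro tendsto_mult_right_zero tendsto_rabs_zero lims)
      show "\<forall>\<^sub>F n in sequentially. norm (\<tau> n *\<^sub>R (\<Sum>k<idx (\<tau> n) T. X n k)) \<le> T * (C * M1 * \<bar>e n\<bar>)"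
        using SI
      proof eventually_elim
        case (elim n)
        have "\<bar>\<tau> n * (\<Sum>k<idx (\<tau> n) T. X n k)\<bar> \<le> \<tau> n * real (idx (\<tau> n) T) * (C * M1 * e n)"
          using tel[of n "idx (\<tau> n) T"] elim S0[of n] by simp
        also have "\<dots> \<le> T * (C * M1 * \<bar>e n\<bar>)"
          using idx_bounds(1)[OF \<tau>, of T n] T C11D(4)[OF C] M_nonneg less_imp_le[OF \<tau>[of n]]
          by (intro order_trans[OF mult_left_mono[of _ "C * M1 * \<bar>e n\<bar>"] mult_right_mono]) (auto intro!: mult_left_mono mult_nonneg_nonneg)
        finally show ?case by simp
      qed
    qed
    moreover note Dm = C11_gradient_measurable[OF C]
    have XB: "norm (X n k) \<le> C * (M1 + U * M1 + \<Gamma> * U)" for n k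
      unfolding X_def using approxD(10)[OF a C] by simp
    have Xl: "(\<lambda>n. X n (idx (\<tau> n) t)) \<longlonglongrightarrow> pairing K D (\<omega> t) (\<lambda>i. h i t) t" if t: "t \<in> {0..T}" for t
      unfolding X_def
    proof (rule pairing_tendsto[where w = "\<lambda>n. W n (idx (\<tau> n) t)" and w' = "\<omega> t" and H = "\<lambda>n. H n (idx (\<tau> n) t)"
            and H' = "\<lambda>i. h i t" and C = C and R = R])
      show "(\<lambda>n. \<tau> n * real (idx (\<tau> n) t)) \<longlonglongrightarrow> t" by (rule idx_tendsto[OF \<tau> lims(2)]) (use t in simp)
    qed (rule vW \<omega>(1) weak[OF t] \<epsilon> lims(1) Hl[OF t] Dm C11D(2)[OF C] DL supp; assumption?)+
    note lim = step_sum_tendsto_integral[where X = X and \<tau> = \<tau> and T = T, OF \<tau> lims(2) XB Xl TT(1)]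
    ultimately have "integral {0..T} (\<lambda>t. pairing K D (\<omega> t) (\<lambda>i. h i t) t) = 0"
      using lim(2) LIMSEQ_unique by blast
    then show ?thesis using lim(1) by (simp add: has_integral_integral)
  qed
  have init: "h j 0 = h0 j \<and> l j 0 = l0 j" if j: "j \<in> {1..N}" for j
    using h_int[OF TT(2) j] l_int[OF TT(2) j] by simp
  have odes: "\<forall>j\<in>{1..N}. h j 0 = h0 j \<and> l j 0 = l0 j \<and>
        (\<forall>t\<in>{0..T}. (h j has_vector_derivative l j t) (at t within {0..T}) \<and>
           (l j has_vector_derivative acc K \<delta> N m \<gamma> (\<omega> t) (\<lambda>i. h i t) (\<lambda>i. l i t) j) (at t within {0..T})) \<and>
        continuous_on {0..T} (\<lambda>t. acc K \<delta> N m \<gamma> (\<omega> t) (\<lambda>i. h i t) (\<lambda>i. l i t) j)"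
    using init hd ld Ac unfolding A_def[abs_def] by blast
  have transports: "\<forall>C \<phi> D R \<eta>. C11 C \<phi> D \<longrightarrow> (\<forall>s s' x. norm (D (s, x) - D (s', x)) \<le> C * \<bar>s - s'\<bar>) \<longrightarrow>
        (\<forall>s x. norm x \<ge> R \<longrightarrow> D (s, x) = 0) \<longrightarrow> 0 < \<eta> \<longrightarrow> (\<forall>t x. t \<le> 0 \<or> T - \<eta> \<le> t \<longrightarrow> \<phi> (t, x) = 0) \<longrightarrow>
        ((\<lambda>t. pairing K D (\<omega> t) (\<lambda>i. h i t) t) has_integral 0) {0..T}"
  proof (intro allI impI)
    fix C R \<eta> :: real and \<phi> :: "real \<times> plane \<Rightarrow> real" and D
    assume "C11 C \<phi> D" "\<forall>s s' x. norm (D (s, x) - D (s', x)) \<le> C * \<bar>s - s'\<bar>"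
      "\<forall>s x. R \<le> norm x \<longrightarrow> D (s, x) = 0" "0 < \<eta>" "\<forall>t x. t \<le> 0 \<or> T - \<eta> \<le> t \<longrightarrow> \<phi> (t, x) = 0"
    then show "((\<lambda>t. pairing K D (\<omega> t) (\<lambda>i. h i t) t) has_integral 0) {0..T}"
      by (intro transport[of C \<phi> D R \<eta>]) blast+
  qed
  have wcs: "\<forall>g. integrable lborel g \<longrightarrow> continuous_on {0..T} (\<lambda>t. LINT x|lborel. \<omega> t x * g x)"
    using wc by blast
  have vorts: "\<forall>t. vort M M1 (\<omega> t)" using \<omega>(1) by blast
  show ?thesis
    by (rule exI[of _ \<omega>], rule exI[of _ h], rule exI[of _ l], intro conjI vorts \<omega>(2) wcs odes transports)
qed

end

section \<open>Test functions and Lebesgue measurability\<close>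

lemma frechet_derivative_sum_Basis:
  assumes "f differentiable (at x)"
  shows "frechet_derivative f (at x) q = (\<Sum>b\<in>Basis. (q \<bullet> b) * frechet_derivative f (at x) b)"
proof -
  have l: "linear (frechet_derivative f (at x))" by (rule linear_frechet_derivative[OF assms])
  have "frechet_derivative f (at x) q = frechet_derivative f (at x) (\<Sum>b\<in>Basis. (q \<bullet> b) *\<^sub>R b)"
    by (simp add: euclidean_representation)
  also have "\<dots> = (\<Sum>b\<in>Basis. (q \<bullet> b) * frechet_derivative f (at x) b)"
    by (simp add: linear_sum[OF l] linear_cmul[OF l])
  finally show ?thesis .
qed

lemma frechet_derivative_zero_outside:
  assumes S: "closed S" and f: "\<And>p. p \<notin> S \<Longrightarrow> f p = (0::real)" and p: "p \<notin> S"
  shows "frechet_derivative f (at p) q = 0"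
proof -
  have "(f has_derivative (\<lambda>q. 0)) (at p)"
    by (rule has_derivative_transform_within_open[OF has_derivative_const[of 0], of "- S"])
      (use S f p in auto)
  then have "frechet_derivative f (at p) = (\<lambda>q. 0)" by (rule frechet_derivative_at[symmetric])
  then show ?thesis by simp
qed

lemma C1_compact_support_Lipschitz:
  fixes f :: "'a::euclidean_space \<Rightarrow> real"
  assumes S: "compact S" and f: "\<And>p. p \<notin> S \<Longrightarrow> f p = 0" and C: "Ck (Suc 0) f"
  shows "\<exists>B\<ge>0. \<forall>p q. \<bar>f p\<bar> \<le> B \<and> \<bar>f p - f q\<bar> \<le> B * norm (p - q)"
proof -
  have bdd: "\<exists>B\<ge>0. \<forall>p. \<bar>g p\<bar> \<le> B" if g: "continuous_on UNIV g" "\<And>p. p \<notin> S \<Longrightarrow> g p = 0" for g :: "'a \<Rightarrow> real"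
  proof -
    have "compact (g ` S)" by (rule compact_continuous_image[OF continuous_on_subset[OF g(1)] S]) simp
    then obtain B where "B > 0" "\<And>y. y \<in> g ` S \<Longrightarrow> norm y \<le> B"
      using bounded_pos[of "g ` S"] compact_imp_bounded by blast
    then show ?thesis using g(2) by (intro exI[of _ B]) (metis abs_zero imageI less_imp_le real_norm_def)
  qed
  have df: "f differentiable_on UNIV" and dc: "\<And>b. b \<in> Basis \<Longrightarrow> continuous_on UNIV (\<lambda>x. frechet_derivative f (at x) b)"
    using C by auto
  have d: "f differentiable (at x)" for x using df by (simp add: differentiable_on_def)
  obtain B0 where B0: "B0 \<ge> 0" "\<And>p. \<bar>f p\<bar> \<le> B0"
    using bdd[OF differentiable_imp_continuous_on[OF df] f] by blast
  have ex: "\<exists>B. B \<ge> 0 \<and> (\<forall>p. \<bar>frechet_derivative f (at p) b\<bar> \<le> B)" if "b \<in> Basis" for b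
    by (rule bdd[OF dc[OF that] frechet_derivative_zero_outside[OF compact_imp_closed[OF S] f]])
  define Bd where "Bd b = (SOME B. B \<ge> 0 \<and> (\<forall>p. \<bar>frechet_derivative f (at p) b\<bar> \<le> B))" for b
  have Bd': "Bd b \<ge> 0 \<and> (\<forall>p. \<bar>frechet_derivative f (at p) b\<bar> \<le> Bd b)" if "b \<in> Basis" for b
    unfolding Bd_def by (rule someI_ex[OF ex[OF that]])
  have Bd: "Bd b \<ge> 0" "\<bar>frechet_derivative f (at p) b\<bar> \<le> Bd b" if "b \<in> Basis" for b p
    by (rule conjunct1[OF Bd'[OF that]], rule spec[OF conjunct2[OF Bd'[OF that]]])
  define B1 where "B1 = (\<Sum>b\<in>(Basis::'a set). Bd b)"
  have B1: "B1 \<ge> 0" unfolding B1_def by (intro sum_nonneg Bd)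
  have on: "onorm (frechet_derivative f (at p)) \<le> B1" for p
  proof (rule onorm_bound[OF B1])
    fix q
    have "\<bar>frechet_derivative f (at p) q\<bar> \<le> (\<Sum>b\<in>Basis. norm q * Bd b)"
    proof (subst frechet_derivative_sum_Basis[OF d], rule order_trans[OF sum_abs sum_mono])
      fix b :: 'a assume b: "b \<in> Basis"
      show "\<bar>q \<bullet> b * frechet_derivative f (at p) b\<bar> \<le> norm q * Bd b"
        unfolding abs_mult by (intro mult_mono Basis_le_norm[OF b] Bd(2)[OF b]) auto
    qed
    then show "norm (frechet_derivative f (at p) q) \<le> B1 * norm q"
      by (simp add: B1_def sum_distrib_left mult.commute)
  qed
  have "norm (f p - f q) \<le> B1 * norm (p - q)" for p q
  proof (rule differentiable_bound[of UNIV f "\<lambda>x. frechet_derivative f (at x)"])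
    show "(f has_derivative frechet_derivative f (at x)) (at x within UNIV)" for x
      using d frechet_derivative_works by blast
  qed (use on in auto)
  note L = this
  have "\<bar>f p - f q\<bar> \<le> max B0 B1 * norm (p - q)" for p q
    using order_trans[OF L[of p q] mult_right_mono[of B1 "max B0 B1" "norm (p - q)"]] by simp
  moreover have "\<bar>f p\<bar> \<le> max B0 B1" for p using B0(2)[of p] by linarith
  ultimately show ?thesis using B0(1) by (intro exI[of _ "max B0 B1"]) auto
qed

text \<open>Two continuous derivatives and compact support are enough: the partial derivatives are
  bounded and Lipschitz, and the mean value theorem applied to \<phi> minus its linear part gives
  the quadratic remainder.\<close>

lemma test_function_C11:
  assumes \<phi>: "test_function T \<phi>" and T: "T > 0"
  defines "D \<equiv> \<lambda>p. (partial_t \<phi> p, grad_x \<phi> p)"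
  shows "\<exists>C R \<eta>. C11 C \<phi> D \<and> (\<forall>s s' x. norm (D (s, x) - D (s', x)) \<le> C * \<bar>s - s'\<bar>) \<and>
     (\<forall>s x. norm x \<ge> R \<longrightarrow> D (s, x) = 0) \<and> 0 < \<eta> \<and> (\<forall>t x. t \<le> 0 \<or> T - \<eta> \<le> t \<longrightarrow> \<phi> (t, x) = 0)"
proof -
  define S where "S = closure {p. \<phi> p \<noteq> 0}"
  have S: "compact S" "S \<subseteq> {0<..<T} \<times> UNIV" and Ck: "\<And>n. Ck n \<phi>"
    using \<phi> by (auto simp: test_function_def S_def)
  have \<phi>0: "\<phi> p = 0" if "p \<notin> S" for p
    using that closure_subset[of "{p. \<phi> p \<noteq> 0}"] by (auto simp: S_def)
  have d: "\<phi> differentiable (at p)" for p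
    using Ck[of "Suc 0"] by (cases p) (simp add: differentiable_on_def)
  define g where "g b p = frechet_derivative \<phi> (at p) b" for b p
  have g0: "g b p = 0" if "p \<notin> S" for b p
    unfolding g_def by (rule frechet_derivative_zero_outside[OF compact_imp_closed[OF S(1)] \<phi>0 that])
  have ex: "\<exists>B. B \<ge> 0 \<and> (\<forall>p q. \<bar>g b p\<bar> \<le> B \<and> \<bar>g b p - g b q\<bar> \<le> B * norm (p - q))" if b: "b \<in> Basis" for b
  proof (rule C1_compact_support_Lipschitz[OF S(1) g0])
    show "Ck (Suc 0) (g b)" using Ck[of "Suc (Suc 0)"] b unfolding g_def[abs_def] by (simp del: Ck.simps(1))
  qed
  define B where "B b = (SOME B. B \<ge> 0 \<and> (\<forall>p q. \<bar>g b p\<bar> \<le> B \<and> \<bar>g b p - g b q\<bar> \<le> B * norm (p - q)))" for b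
  have Bb: "B b \<ge> 0 \<and> (\<forall>p q. \<bar>g b p\<bar> \<le> B b \<and> \<bar>g b p - g b q\<bar> \<le> B b * norm (p - q))" if "b \<in> Basis" for b
    unfolding B_def by (rule someI_ex[OF ex[OF that]])
  have B: "B b \<ge> 0" "\<bar>g b p\<bar> \<le> B b" "\<bar>g b p - g b q\<bar> \<le> B b * norm (p - q)" if "b \<in> Basis" for b p q
    using Bb[OF that] by blast+
  obtain B0 where B0: "B0 \<ge> 0" "\<And>p. \<bar>\<phi> p\<bar> \<le> B0"
    using C1_compact_support_Lipschitz[OF S(1) \<phi>0 Ck] by blast
  have DF: "D p \<bullet> q = frechet_derivative \<phi> (at p) q" for p q
  proof -
    have l: "linear (frechet_derivative \<phi> (at p))" by (rule linear_frechet_derivative[OF d])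
    have snd_q: "snd q = (\<Sum>i\<in>UNIV. (snd q $ i) *\<^sub>R axis i 1)"
      by (simp add: vec_eq_iff sum_2 axis_def forall_2)
    have "q = fst q *\<^sub>R (1, 0) + (\<Sum>i\<in>UNIV. (snd q $ i) *\<^sub>R (0, axis i 1))"
      by (subst (1) prod_eqI[of q "(fst q, \<Sum>i\<in>UNIV. (snd q $ i) *\<^sub>R axis i 1)"])
        (use snd_q in \<open>auto simp: sum_2\<close>)
    then have "frechet_derivative \<phi> (at p) q = frechet_derivative \<phi> (at p) (fst q *\<^sub>R (1, 0) + (\<Sum>i\<in>UNIV. (snd q $ i) *\<^sub>R (0, axis i 1)))"
      by simp
    also have "\<dots> = fst q * partial_t \<phi> p + (\<Sum>i\<in>UNIV. snd q $ i * grad_x \<phi> p $ i)"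
      by (simp only: linear_add[OF l] linear_sum[OF l] linear_cmul[OF l] partial_t_def grad_x_def vec_lambda_beta real_scaleR_def)
    also have "\<dots> = D p \<bullet> q"
      unfolding D_def by (simp add: inner_prod_def inner_vec_def mult.commute)
    finally show ?thesis by simp
  qed
  have Dg: "D p \<bullet> b = g b p" for p b by (simp add: DF g_def)
  define BD where "BD = (\<Sum>b\<in>(Basis::(real \<times> plane) set). B b)"
  have BD0: "BD \<ge> 0" unfolding BD_def by (intro sum_nonneg B)
  have DL: "norm (D p - D q) \<le> BD * norm (p - q)" for p q
  proof -
    have "norm (D p - D q) \<le> (\<Sum>b\<in>Basis. \<bar>(D p - D q) \<bullet> b\<bar>)" by (rule norm_le_l1)
    also have "\<dots> \<le> (\<Sum>b\<in>Basis. B b * norm (p - q))"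
      by (intro sum_mono) (simp add: inner_diff_left Dg B(3))
    finally show ?thesis by (simp add: BD_def sum_distrib_right)
  qed
  have DB: "norm (D p) \<le> BD" for p
  proof -
    have "norm (D p) \<le> (\<Sum>b\<in>Basis. \<bar>D p \<bullet> b\<bar>)" by (rule norm_le_l1)
    also have "\<dots> \<le> BD" unfolding BD_def by (intro sum_mono) (simp add: Dg B(2))
    finally show ?thesis .
  qed
  have rem: "\<bar>\<phi> (p + q) - \<phi> p - D p \<bullet> q\<bar> \<le> BD * (norm q)\<^sup>2" for p q
  proof -
    have "norm ((\<phi> (p + q) - D p \<bullet> (p + q)) - (\<phi> p - D p \<bullet> p)) \<le> (BD * norm q) * norm ((p + q) - p)"
    proof (rule differentiable_bound[of "cball p (norm q)" "\<lambda>x. \<phi> x - D p \<bullet> x" "\<lambda>x y. (D x - D p) \<bullet> y"])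
      fix x assume x: "x \<in> cball p (norm q)"
      have "(\<phi> has_derivative (\<lambda>y. D x \<bullet> y)) (at x)"
        unfolding DF using d[of x] frechet_derivative_works by (simp add: frechet_derivative_works[symmetric])
      then show "((\<lambda>x. \<phi> x - D p \<bullet> x) has_derivative (\<lambda>y. (D x - D p) \<bullet> y)) (at x within cball p (norm q))"
        unfolding inner_diff_left
        by (intro has_derivative_diff has_derivative_inner_right has_derivative_ident) (rule has_derivative_at_withinI)
      show "onorm (\<lambda>y. (D x - D p) \<bullet> y) \<le> BD * norm q"
      proof (rule onorm_bound)
        fix y
        have "norm ((D x - D p) \<bullet> y) \<le> norm (D x - D p) * norm y" using Cauchy_Schwarz_ineq2 by simp
        also have "\<dots> \<le> (BD * norm (x - p)) * norm y" by (intro mult_right_mono DL) simp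
        also have "\<dots> \<le> (BD * norm q) * norm y"
          using x BD0 by (intro mult_right_mono mult_left_mono) (auto simp: dist_norm norm_minus_commute)
        finally show "norm ((D x - D p) \<bullet> y) \<le> BD * norm q * norm y" .
      qed (use BD0 in simp)
    qed (auto simp: dist_norm)
    then show ?thesis by (simp add: inner_add_right power2_eq_square algebra_simps)
  qed
  define C where "C = max B0 BD"
  have C: "B0 \<le> C" "BD \<le> C" by (auto simp: C_def)
  have "C11 C \<phi> D"
    unfolding C11_def using B0(2) DB rem C mult_right_mono[OF C(2)] by (meson order_trans zero_le_power2)
  moreover have "norm (D (s, x) - D (s', x)) \<le> C * \<bar>s - s'\<bar>" for s s' x
    using DL[of "(s, x)" "(s', x)"] mult_right_mono[OF C(2), of "\<bar>s - s'\<bar>"] by (simp add: norm_Pair)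
  moreover obtain R where R: "\<And>p. p \<in> S \<Longrightarrow> norm p \<le> R"
    using compact_imp_bounded[OF S(1)] by (auto simp: bounded_iff)
  have "D (s, x) = 0" if "norm x \<ge> R + 1" for s x
  proof -
    have "(s, x) \<notin> S"
    proof
      assume "(s, x) \<in> S"
      then show False using R[of "(s, x)"] norm_snd_le[of x s] that by linarith
    qed
    then have "norm (D (s, x)) \<le> (\<Sum>b\<in>(Basis::(real \<times> plane) set). 0)"
      using norm_le_l1[of "D (s, x)"] by (simp add: Dg g0)
    then show ?thesis by simp
  qed
  \<comment> \<open>The compact support has a largest time m < T; half of the remaining gap serves
    as \<eta>.\<close>
  moreover have "\<exists>\<eta>>0. \<forall>t x. t \<le> 0 \<or> T - \<eta> \<le> t \<longrightarrow> \<phi> (t, x) = 0"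
  proof (cases "S = {}")
    case True
    then show ?thesis using \<phi>0 by (intro exI[of _ 1]) auto
  next
    case False
    have "compact (fst ` S)" by (intro compact_continuous_image continuous_intros S)
    then obtain m where m: "m \<in> fst ` S" "\<And>t. t \<in> fst ` S \<Longrightarrow> t \<le> m"
      using compact_attains_sup[of "fst ` S"] False by auto
    have "m < T" using m(1) S(2) by auto
    moreover have "\<phi> (t, x) = 0" if "t \<le> 0 \<or> T - (T - m) / 2 \<le> t" for t x
    proof (rule \<phi>0, rule notI)
      assume "(t, x) \<in> S"
      then have "t \<in> fst ` S" "t > 0" using S(2) by force+
      then show False using m(2)[of t] that \<open>m < T\<close> by (simp add: field_simps)
    qed
    ultimately show ?thesis by (intro exI[of _ "(T - m) / 2"]) auto
  qed
  ultimately show ?thesis by blast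
qed

text \<open>Completeness of Lebesgue measure: preimages under g differ from those under F only
  inside a null set.\<close>

lemma lebesgue_measurable_AE_eq:
  fixes g :: "'a::euclidean_space \<Rightarrow> real"
  assumes F: "F \<in> borel_measurable borel" and ae: "AE p in lborel. g p = F p"
  shows "g \<in> borel_measurable lebesgue"
proof -
  obtain N where N: "N \<in> null_sets lborel" "{p. g p \<noteq> F p} \<subseteq> N"
    using ae unfolding eventually_ae_filter by auto
  then have N': "N \<in> null_sets lebesgue" by (rule_tac null_sets_completionI) auto
  have FL: "F \<in> borel_measurable lebesgue" using F by (intro measurable_completion) simp
  show ?thesis
  proof (rule measurableI)
    fix A :: "real set" assume A: "A \<in> sets borel"
    have 1: "g -` A \<inter> N \<in> null_sets lebesgue"
      by (rule complete_measure.complete2[OF _ _ N']) (auto simp: completion.complete_measure_axioms)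
    have 2: "F -` A \<inter> space lebesgue - N \<in> sets lebesgue"
      using measurable_sets[OF FL A] N' by auto
    have "g -` A \<inter> space lebesgue = (F -` A \<inter> space lebesgue - N) \<union> (g -` A \<inter> N)"
      using N(2) by auto
    then show "g -` A \<inter> space lebesgue \<in> sets lebesgue"
      using sets.Un[OF 2 null_setsD2[OF 1]] by simp
  qed simp
qed

section \<open>From the truncated system to weak solutions\<close>

text \<open>Clipping at M and cutting to the ball changes the datum on a null set only and produces
  the pointwise bound of \<open>vort\<close>; integrability comes from the bounded support.\<close>

lemma Linfty_borel_representative:
  assumes "Linfty \<omega>0" "AE x in lebesgue. x \<notin> ball 0 R \<longrightarrow> \<omega>0 x = 0"
  shows "\<exists>M M1 w. vort M M1 w \<and> (AE x in lborel. w x = \<omega>0 x)"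
proof -
  obtain C where C: "\<omega>0 \<in> borel_measurable lebesgue" "AE x in lebesgue. \<bar>\<omega>0 x\<bar> \<le> C"
    using assms(1) by (auto simp: Linfty_def)
  obtain g where g: "g \<in> borel_measurable lborel" "AE x in lborel. \<omega>0 x = g x"
    using completion_ex_borel_measurable_real[OF C(1)] by blast
  define M where "M = \<bar>C\<bar>"
  define w where "w x = (max (- M) (min M (g x))) * indicator (ball 0 R) x" for x
  have wm: "w \<in> borel_measurable borel"
    unfolding w_def[abs_def] using g(1)
    by (intro borel_measurable_times borel_measurable_indicator_ball borel_measurable_max borel_measurable_min borel_measurable_const) simp
  have wM: "\<bar>w x\<bar> \<le> M" for x by (auto simp: w_def M_def indicator_def)
  have wi: "integrable lborel w"
  proof -
    have b: "integrable lborel (indicator (ball 0 R) :: plane \<Rightarrow> real)"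
      using emeasure_lborel_ball_finite[of "0::plane" R] by (intro integrable_real_indicator) auto
    show ?thesis
      unfolding w_def[abs_def] using g(1)
      by (intro bounded_mult_integrable[where M = M] b borel_measurable_max borel_measurable_min borel_measurable_const)
        (auto simp: M_def)
  qed
  have "AE x in lborel. w x = \<omega>0 x"
    using g(2) C(2)[unfolded AE_completion_iff] assms(2)[unfolded AE_completion_iff]
    by eventually_elim (auto simp: w_def M_def indicator_def)
  moreover have "vort M (LINT x|lborel. \<bar>w x\<bar>) w" unfolding vort_def using wM wi by simp
  ultimately show ?thesis by blast
qed

lemma integral_lebesgue_AE_borel:
  fixes f g :: "'a::euclidean_space \<Rightarrow> 'b::{banach, second_countable_topology}"
  assumes "f \<in> borel_measurable borel" "g \<in> borel_measurable borel" "AE x in lborel. f x = g x"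
  shows "(LINT x|lebesgue. f x) = (LINT x|lborel. g x)"
  using assms by (subst integral_completion) (auto intro!: integral_cong_AE)

context vortex_data
begin

text \<open>Two adjustments turn a truncated solution into a weak one: separation makes
  \<open>Kreg \<delta>\<close> coincide with \<open>K\<close> along the trajectories, and the
  vorticity is replaced by a jointly measurable version that differs from it, at each single time,
  on a null set only.\<close>

lemma weak_solution_of_regularised:
  assumes T: "T > 0" and m: "\<And>k. k \<in> {1..N} \<Longrightarrow> m k > 0" and w0: "AE x in lborel. \<omega>0 x = w0 x"
    and \<omega>: "\<And>t. vort M M1 (\<omega> t)" "\<omega> 0 = \<omega>0"
    and wc: "\<And>g. integrable lborel g \<Longrightarrow> continuous_on {0..T} (\<lambda>t. LINT x|lborel. \<omega> t x * g x)"
    and init: "\<And>j. j \<in> {1..N} \<Longrightarrow> h j 0 = h0 j \<and> l j 0 = l0 j"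
    and hd: "\<And>j t. j \<in> {1..N} \<Longrightarrow> t \<in> {0..T} \<Longrightarrow> (h j has_vector_derivative l j t) (at t within {0..T})"
    and ld: "\<And>j t. j \<in> {1..N} \<Longrightarrow> t \<in> {0..T} \<Longrightarrow>
       (l j has_vector_derivative acc K \<delta> N m \<gamma> (\<omega> t) (\<lambda>i. h i t) (\<lambda>i. l i t) j) (at t within {0..T})"
    and ac: "\<And>j. j \<in> {1..N} \<Longrightarrow> continuous_on {0..T} (\<lambda>t. acc K \<delta> N m \<gamma> (\<omega> t) (\<lambda>i. h i t) (\<lambda>i. l i t) j)"
    and tr: "\<And>C \<phi> D R \<eta>. C11 C \<phi> D \<Longrightarrow> (\<forall>s s' x. norm (D (s, x) - D (s', x)) \<le> C * \<bar>s - s'\<bar>) \<Longrightarrow>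
        (\<forall>s x. norm x \<ge> R \<longrightarrow> D (s, x) = 0) \<Longrightarrow> 0 < \<eta> \<Longrightarrow> (\<forall>t x. t \<le> 0 \<or> T - \<eta> \<le> t \<longrightarrow> \<phi> (t, x) = 0) \<Longrightarrow>
        ((\<lambda>t. pairing K D (\<omega> t) (\<lambda>i. h i t) t) has_integral 0) {0..T}"
    and sep: "\<And>t i j. t \<in> {0..T} \<Longrightarrow> i \<in> {1..N} \<Longrightarrow> j \<in> {1..N} \<Longrightarrow> i \<noteq> j \<Longrightarrow> \<delta> \<le> norm (h i t - h j t)"
  shows "\<exists>\<omega> h. weak_solution T N m \<gamma> w0 h0 l0 \<omega> h"
proof -
  define cl where "cl t = max 0 (min T t)" for t
  have cl: "cl t \<in> {0..T}" "t \<in> {0..T} \<Longrightarrow> cl t = t" for t using T by (auto simp: cl_def)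
  have clc: "continuous_on UNIV cl" unfolding cl_def[abs_def] by (intro continuous_intros)
  have "continuous_on UNIV (\<lambda>t. LINT x|lborel. \<omega> (cl t) x * g x)" if "integrable lborel g" for g
    by (rule continuous_on_compose2[OF wc[OF that] clc]) (use cl in auto)
  then obtain f where f: "f \<in> borel_measurable borel" "AE t in lborel. AE x in lborel. f (t, x) = \<omega> (cl t) x"
    using joint_version[of M M1 "\<lambda>t. \<omega> (cl t)", OF \<omega>(1)] by blast
  \<comment> \<open>For almost every t in [0,T] the section of the measurable function f agrees with
    \<omega> t and is used; at the exceptional times \<omega> t is kept. Thus \<omega>' t = \<omega>
    t almost everywhere for every t, and \<omega>' agrees with f on [0,T] off a null set of
    times.\<close>
  define good where "good t \<longleftrightarrow> t \<in> {0..T} \<and> (AE x in lborel. f (t, x) = \<omega> t x)" for t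
  define \<omega>' where "\<omega>' t x = (if good t then f (t, x) else \<omega> t x)" for t x
  have fm: "(\<lambda>x. f (t, x)) \<in> borel_measurable borel" for t
    by (rule measurable_compose[OF _ f(1)]) (intro borel_measurable_continuous_onI continuous_intros)
  have wm: "\<omega>' t \<in> borel_measurable borel" for t
    unfolding \<omega>'_def[abs_def] using fm vortD(4)[OF \<omega>(1)] by (cases "good t") auto
  have wae: "AE x in lborel. \<omega>' t x = \<omega> t x" for t
    by (cases "good t") (auto simp: \<omega>'_def good_def)
  note \<omega>m = vortD(4)[OF \<omega>(1)]
  have wi: "integrable lborel (\<omega>' t)" for t
    using vortD(2)[OF \<omega>(1), of t] integrable_cong_AE[of "\<omega>' t" lborel "\<omega> t"] wm wae \<omega>m by simp
  have kc: "K_conv (\<omega>' t) x = conv (\<omega> t) K x" for t x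
  proof -
    have "K_conv (\<omega>' t) x = (LINT y|lborel. \<omega>' t y *\<^sub>R K (x - y))"
      unfolding K_conv_eq_conv[OF wm] conv_def ..
    also have "\<dots> = conv (\<omega> t) K x"
      unfolding conv_def
    proof (rule integral_cong_AE)
      show "AE y in lborel. \<omega>' t y *\<^sub>R K (x - y) = \<omega> t y *\<^sub>R K (x - y)"
        using wae[of t] by eventually_elim simp
    qed (use kernel_meas[OF wm K_meas] kernel_meas[OF \<omega>m K_meas] in simp_all)
    finally show ?thesis .
  qed
  have P1: "Linfty_L1_Linfty T \<omega>'"
    unfolding Linfty_L1_Linfty_def
  proof (intro conjI exI[of _ "max M M1"])
    obtain N1 where N1: "N1 \<in> null_sets lborel" "{t. \<not> (AE x in lborel. f (t, x) = \<omega> (cl t) x)} \<subseteq> N1"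
      using f(2) unfolding eventually_ae_filter by auto
    define g where "g p = (if fst p \<in> {0..T} then \<omega>' (fst p) (snd p) else 0)" for p
    have "AE p in lborel. g p = indicator ({0..T} \<times> UNIV) p * f p"
    proof (rule AE_I')
      have "emeasure (lborel \<Otimes>\<^sub>M lborel) (N1 \<times> (UNIV :: plane set)) = emeasure lborel N1 * emeasure lborel (UNIV :: plane set)"
        using N1(1) by (intro lborel.emeasure_pair_measure_Times) auto
      also have "\<dots> = 0" using N1(1) by (simp add: null_sets_def)
      finally have "N1 \<times> (UNIV :: plane set) \<in> null_sets (lborel \<Otimes>\<^sub>M lborel)"
        using N1(1) by (intro null_setsI pair_measureI) auto
      then show "N1 \<times> (UNIV :: plane set) \<in> null_sets lborel" by (simp add: lborel_prod)
      show "{p \<in> space lborel. g p \<noteq> indicator ({0..T} \<times> UNIV) p * f p} \<subseteq> N1 \<times> UNIV"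
      proof
        fix p assume "p \<in> {p \<in> space lborel. g p \<noteq> indicator ({0..T} \<times> UNIV) p * f p}"
        then have "fst p \<in> {0..T}" "\<not> good (fst p)"
          by (cases p; auto simp: g_def \<omega>'_def indicator_def split: if_splits)+
        then have "\<not> (AE x in lborel. f (fst p, x) = \<omega> (cl (fst p)) x)" by (simp add: good_def cl(2))
        then show "p \<in> N1 \<times> UNIV" using N1(2) by (cases p) auto
      qed
    qed
    moreover have "(\<lambda>p. indicator ({0..T} \<times> UNIV) p * f p) \<in> borel_measurable borel"
      by (intro borel_measurable_times f(1) borel_measurable_indicator borel_closed closed_Times) auto
    ultimately have "g \<in> borel_measurable lebesgue" by (intro lebesgue_measurable_AE_eq)
    then have "g \<in> borel_measurable (lebesgue_on ({0..T} \<times> UNIV))" by (rule measurable_restrict_space1)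
    moreover have "(\<lambda>(t, x). \<omega>' t x) \<in> borel_measurable (lebesgue_on ({0..T} \<times> UNIV)) \<longleftrightarrow> g \<in> borel_measurable (lebesgue_on ({0..T} \<times> UNIV))"
      by (rule measurable_cong) (auto simp: g_def)
    ultimately show "(\<lambda>(t, x). \<omega>' t x) \<in> borel_measurable (lebesgue_on ({0..T} \<times> UNIV))" by simp
    show "AE t in lebesgue_on {0..T}. integrable lebesgue (\<omega>' t) \<and> (LINT x|lebesgue. \<bar>\<omega>' t x\<bar>) \<le> max M M1 \<and>
        (AE x in lebesgue. \<bar>\<omega>' t x\<bar> \<le> max M M1)"
    proof (rule AE_I2, intro conjI)
      fix t
      show "integrable lebesgue (\<omega>' t)" using wi wm by (subst integrable_completion) auto
      have "AE x in lborel. \<bar>\<omega>' t x\<bar> = \<bar>\<omega> t x\<bar>" using wae[of t] by eventually_elim simp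
      then have "(LINT x|lebesgue. \<bar>\<omega>' t x\<bar>) = (LINT x|lborel. \<bar>\<omega> t x\<bar>)"
        using wm \<omega>m by (intro integral_lebesgue_AE_borel borel_measurable_abs)
      then show "(LINT x|lebesgue. \<bar>\<omega>' t x\<bar>) \<le> max M M1" using vortD(3)[OF \<omega>(1), of t] by linarith
      have "AE x in lborel. \<bar>\<omega>' t x\<bar> \<le> max M M1"
        using wae[of t] by eventually_elim (use vortD(1)[OF \<omega>(1), of t] in \<open>auto intro: max.coboundedI1\<close>)
      then show "AE x in lebesgue. \<bar>\<omega>' t x\<bar> \<le> max M M1" by (rule AE_completion)
    qed
  qed
  have P2: "weakstar_continuous T \<omega>'"
    unfolding weakstar_continuous_def
  proof (intro conjI ballI allI impI)
    fix t
    have "AE x in lborel. \<bar>\<omega>' t x\<bar> \<le> M"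
      using wae[of t] by eventually_elim (use vortD(1)[OF \<omega>(1), of t] in simp)
    then show "Linfty (\<omega>' t)"
      unfolding Linfty_def using measurable_completion[of "\<omega>' t" lborel] wm AE_completion[of _ lborel] by fastforce
  next
    fix g :: "plane \<Rightarrow> real" assume g: "integrable lebesgue g"
    obtain g' where g': "g' \<in> borel_measurable lborel" "AE x in lborel. g x = g' x"
      using completion_ex_borel_measurable_real[OF borel_measurable_integrable[OF g]] by blast
    have g'L: "g' \<in> borel_measurable lebesgue" using g'(1) by (rule measurable_completion)
    have "integrable lebesgue g'"
      using g integrable_cong_AE[OF borel_measurable_integrable[OF g] g'L AE_completion[OF g'(2)]] by simp
    then have g'i: "integrable lborel g'" using g'(1) by (simp add: integrable_completion)
    have "(LINT x|lebesgue. \<omega>' t x * g x) = (LINT x|lborel. \<omega> t x * g' x)" for t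
    proof -
      have wL: "\<omega>' t \<in> borel_measurable lebesgue" "\<omega> t \<in> borel_measurable lebesgue"
        using wm \<omega>m by (auto intro!: measurable_completion)
      have "(LINT x|lebesgue. \<omega>' t x * g x) = (LINT x|lebesgue. \<omega> t x * g' x)"
      proof (rule integral_cong_AE)
        show "AE x in lebesgue. \<omega>' t x * g x = \<omega> t x * g' x"
          using AE_completion[OF wae[of t]] AE_completion[OF g'(2)] by eventually_elim simp
      qed (use wL g'L borel_measurable_integrable[OF g] in auto)
      also have "\<dots> = (LINT x|lborel. \<omega> t x * g' x)"
        using \<omega>m g'(1) by (intro integral_completion) auto
      finally show ?thesis .
    qed
    then show "continuous_on {0..T} (\<lambda>t. LINT x|lebesgue. \<omega>' t x * g x)" using wc[OF g'i] by simp
  qed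
  have td1: "time_deriv T (h k) t = l k t" if "k \<in> {1..N}" "t \<in> {0..T}" for k t
    unfolding time_deriv_def by (rule vector_derivative_within_closed_interval[OF T that(2) hd[OF that]])
  define A where "A k t = acc K \<delta> N m \<gamma> (\<omega> t) (\<lambda>i. h i t) (\<lambda>i. l i t) k" for k t
  have d2: "(time_deriv T (h k) has_vector_derivative A k t) (at t within {0..T})" if "k \<in> {1..N}" "t \<in> {0..T}" for k t
    unfolding A_def by (rule has_vector_derivative_transform[OF that(2) _ ld[OF that]]) (rule td1[OF that(1)])
  have td2: "time_deriv T (time_deriv T (h k)) t = A k t" if "k \<in> {1..N}" "t \<in> {0..T}" for k t
    unfolding time_deriv_def[of T "time_deriv T (h k)"]
    by (rule vector_derivative_within_closed_interval[OF T that(2) d2[OF that]])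
  have P3: "C2_on_interval T (h k)" if k: "k \<in> {1..N}" for k
    unfolding C2_on_interval_def
  proof (intro conjI)
    show "h k differentiable_on {0..T}"
      unfolding differentiable_on_def using differentiableI_vector[OF hd[OF k]] by blast
    show "time_deriv T (h k) differentiable_on {0..T}"
      unfolding differentiable_on_def using differentiableI_vector[OF d2[OF k]] by blast
    show "continuous_on {0..T} (time_deriv T (time_deriv T (h k)))"
      using ac[OF k] unfolding A_def[symmetric] by (rule continuous_on_eq) (simp add: td2[OF k])
  qed
  have P4: "transport_distributional T (velocity N \<gamma> \<omega>' h) \<omega>'"
    unfolding transport_distributional_def
  proof (intro allI impI)
    fix \<phi> assume \<phi>: "test_function T \<phi>"
    define D where "D p = (partial_t \<phi> p, grad_x \<phi> p)" for p
    obtain C R \<eta> where C: "C11 C \<phi> D" and D: "\<forall>s s' x. norm (D (s, x) - D (s', x)) \<le> C * \<bar>s - s'\<bar>"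
       "\<forall>s x. norm x \<ge> R \<longrightarrow> D (s, x) = 0" "0 < \<eta>" "\<forall>t x. t \<le> 0 \<or> T - \<eta> \<le> t \<longrightarrow> \<phi> (t, x) = 0"
      using test_function_C11[OF \<phi> T] unfolding D_def[abs_def] by blast
    have pint: "((\<lambda>t. pairing K D (\<omega> t) (\<lambda>i. h i t) t) has_integral 0) {0..T}" by (rule tr[OF C D])
    define S where "S = {0<..<T} \<times> (UNIV :: plane set)"
    define F where "F p = \<omega>' (fst p) (snd p) * (partial_t \<phi> p + velocity N \<gamma> \<omega>' h (fst p) (snd p) \<bullet> grad_x \<phi> p)" for p
    have Fc: "(\<lambda>(t, x). \<omega>' t x * (partial_t \<phi> (t, x) + velocity N \<gamma> \<omega>' h t x \<bullet> grad_x \<phi> (t, x))) = F"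
      by (auto simp: F_def)
    have Sm: "S \<inter> space lebesgue \<in> sets lebesgue"
      unfolding S_def by (simp add: open_Times borel_open)
    show "(LINT (t, x)|lebesgue_on ({0<..<T} \<times> UNIV). \<omega>' t x * (partial_t \<phi> (t, x) + velocity N \<gamma> \<omega>' h t x \<bullet> grad_x \<phi> (t, x))) = 0"
      unfolding Fc S_def[symmetric]
    proof (cases "integrable (lebesgue_on S) F")
      \<comment> \<open>The Bochner integral of a function that is not integrable is 0 by
        convention, so Fubini is applied only to an integrable F.\<close>
      case False
      then show "integral\<^sup>L (lebesgue_on S) F = 0" by (rule not_integrable_integral_eq)
    next
      case True
      define \<Psi> where "\<Psi> p = indicator S p * F p" for p
      have \<Psi>i: "integrable lebesgue \<Psi>" using True unfolding \<Psi>_def[abs_def] by (subst (asm) integrable_restrict_space[OF Sm]) simp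
      obtain \<Psi>' where \<Psi>': "\<Psi>' \<in> borel_measurable lborel" "AE p in lborel. \<Psi> p = \<Psi>' p"
        using completion_ex_borel_measurable_real[OF borel_measurable_integrable[OF \<Psi>i]] by blast
      have \<Psi>'L: "\<Psi>' \<in> borel_measurable lebesgue" using \<Psi>'(1) by (rule measurable_completion)
      have "integrable lebesgue \<Psi>'"
        using \<Psi>i integrable_cong_AE[OF borel_measurable_integrable[OF \<Psi>i] \<Psi>'L AE_completion[OF \<Psi>'(2)]] by simp
      then have \<Psi>'i: "integrable (lborel \<Otimes>\<^sub>M lborel) \<Psi>'" using \<Psi>'(1) by (simp add: integrable_completion lborel_prod)
      have "integral\<^sup>L (lebesgue_on S) F = integral\<^sup>L lebesgue \<Psi>"
        unfolding \<Psi>_def[abs_def] by (subst integral_restrict_space[OF Sm]) simp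
      also have "\<dots> = integral\<^sup>L lebesgue \<Psi>'"
        by (rule integral_cong_AE[OF borel_measurable_integrable[OF \<Psi>i] \<Psi>'L AE_completion[OF \<Psi>'(2)]])
      also have "\<dots> = integral\<^sup>L (lborel \<Otimes>\<^sub>M lborel) \<Psi>'" using \<Psi>'(1) by (simp add: integral_completion lborel_prod)
      also have "\<dots> = (LINT t|lborel. LINT x|lborel. \<Psi>' (t, x))" by (rule lborel_pair.integral_fst'[OF \<Psi>'i, symmetric])
      finally have I: "integral\<^sup>L (lebesgue_on S) F = (LINT t|lborel. LINT x|lborel. \<Psi>' (t, x))" .
      have ii: "integrable lborel (\<lambda>t. LINT x|lborel. \<Psi>' (t, x))" by (rule lborel_pair.integrable_fst'[OF \<Psi>'i])
      define J where "J t = (if t \<in> {0<..<T} then pairing K D (\<omega> t) (\<lambda>i. h i t) t else 0)" for t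
      have "AE p in lborel \<Otimes>\<^sub>M lborel. \<Psi> p = \<Psi>' p" unfolding lborel_prod by (rule \<Psi>'(2))
      then have "AE t in lborel. AE x in lborel. \<Psi> (t, x) = \<Psi>' (t, x)" by (rule lborel_pair.AE_pair)
      then have J: "AE t in lborel. (LINT x|lborel. \<Psi>' (t, x)) = J t"
      proof eventually_elim
        case (elim t)
        have pm: "(\<lambda>x. \<Psi>' (t, x)) \<in> borel_measurable lborel"
          by (rule measurable_compose[of "\<lambda>x. (t, x)" _ borel]) (use \<Psi>'(1) in \<open>auto intro!: borel_measurable_continuous_onI continuous_intros\<close>)
        show ?case
        proof (cases "t \<in> {0<..<T}")
          case False
          have "AE x in lborel. \<Psi>' (t, x) = 0"
            using elim by eventually_elim (use False in \<open>simp add: \<Psi>_def S_def\<close>)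
          then have "(LINT x|lborel. \<Psi>' (t, x)) = (LINT x|(lborel :: plane measure). 0)" using pm by (intro integral_cong_AE) auto
          then show ?thesis using False by (auto simp: J_def)
        next
          case True
          have vel: "velocity N \<gamma> \<omega>' h t x = vfield K N \<gamma> (\<omega> t) (\<lambda>i. h i t) x" for x
            by (simp add: velocity_def vfield_def kc)
          let ?G = "\<lambda>x. \<omega> t x * (fst (D (t, x)) + vfield K N \<gamma> (\<omega> t) (\<lambda>i. h i t) x \<bullet> snd (D (t, x)))"
          have Gi: "integrable lborel ?G"
            by (rule pairing_bound(1)[OF \<omega>(1) K_meas order_refl C11_gradient_measurable[OF C] C11D(2)[OF C]])
          have "AE x in lborel. \<Psi>' (t, x) = ?G x"
            using elim wae[of t]
          proof eventually_elim
            case (elim x)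
            have "\<Psi> (t, x) = F (t, x)" using True by (simp add: \<Psi>_def S_def)
            then show ?case using elim by (simp add: F_def vel D_def)
          qed
          then have "(LINT x|lborel. \<Psi>' (t, x)) = integral\<^sup>L lborel ?G"
            using pm borel_measurable_integrable[OF Gi] by (intro integral_cong_AE)
          then show ?thesis using True by (simp add: J_def pairing_def)
        qed
      qed
      then obtain N1 where N1: "N1 \<in> null_sets lborel" "{t. (LINT x|lborel. \<Psi>' (t, x)) \<noteq> J t} \<subseteq> N1"
        unfolding eventually_ae_filter by auto
      have ng: "negligible (N1 \<union> {0, T})"
        using N1(1) by (intro negligible_Un) (auto simp: negligible_iff_null_sets null_sets_completionI)
      \<comment> \<open>The Lebesgue integral in time and the integral of the pairing are both read
        as gauge integrals over the whole line, where the integrands differ on a null set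
        only.\<close>
      have pU: "((\<lambda>t. if t \<in> {0..T} then pairing K D (\<omega> t) (\<lambda>i. h i t) t else 0) has_integral 0) UNIV"
        using pint by (subst has_integral_restrict_UNIV)
      have "((\<lambda>t. LINT x|lborel. \<Psi>' (t, x)) has_integral 0) UNIV"
      proof (rule has_integral_spike[OF ng _ pU])
        fix t assume t: "t \<in> UNIV - (N1 \<union> {0, T})"
        then have "(LINT x|lborel. \<Psi>' (t, x)) = J t" using N1(2) by blast
        then show "(LINT x|lborel. \<Psi>' (t, x)) = (if t \<in> {0..T} then pairing K D (\<omega> t) (\<lambda>i. h i t) t else 0)"
          using t by (auto simp: J_def)
      qed
      then show "integral\<^sup>L (lebesgue_on S) F = 0"
        unfolding I using has_integral_unique[OF has_integral_integral_lborel[OF ii]] by blast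
    qed
  qed
  have P5: "vortex_odes T N m \<gamma> \<omega>' h"
    unfolding vortex_odes_def
  proof (intro ballI conjI)
    fix t assume t: "t \<in> {0..T}"
    show "inj_on (\<lambda>k. h k t) {1..N}"
    proof (rule inj_onI, rule ccontr)
      fix i j assume "i \<in> {1..N}" "j \<in> {1..N}" "h i t = h j t" "i \<noteq> j"
      then show False using sep[OF t, of i j] \<delta> by simp
    qed
    fix k assume k: "k \<in> {1..N}"
    have "Kreg \<delta> (h k t - h j t) = K (h k t - h j t)" if "j \<in> {1..N} - {k}" for j
      using sep[OF t k, of j] that by (intro Kreg_eq_K \<delta>) auto
    then have "(\<Sum>j\<in>{1..N} - {k}. \<gamma> j *\<^sub>R Kreg \<delta> (h k t - h j t)) = (\<Sum>j\<in>{1..N} - {k}. \<gamma> j *\<^sub>R K (h k t - h j t))"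
      by (intro sum.cong) auto
    then show "m k *\<^sub>R time_deriv T (time_deriv T (h k)) t =
           \<gamma> k *\<^sub>R perp (time_deriv T (h k) t - K_conv (\<omega>' t) (h k t) - (\<Sum>j\<in>{1..N} - {k}. \<gamma> j *\<^sub>R K (h k t - h j t)))"
      unfolding td2[OF k t] td1[OF k t] kc A_def acc_def using m[OF k] by simp
  qed
  have P6: "AE x in lebesgue. \<omega>' 0 x = w0 x"
  proof (rule AE_completion)
    show "AE x in lborel. \<omega>' 0 x = w0 x"
      using wae[of 0] w0 by eventually_elim (simp add: \<omega>(2))
  qed
  have P7: "h k 0 = h0 k \<and> time_deriv T (h k) 0 = l0 k" if "k \<in> {1..N}" for k
    using init[OF that] td1[OF that, of 0] T by simp
  have "weak_solution T N m \<gamma> w0 h0 l0 \<omega>' h"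
    unfolding weak_solution_def using P1 P2 P3 P4 P5 P6 P7 by blast
  then show ?thesis by blast
qed

end

section \<open>Separation of the vortices\<close>

lemma norm_diff_le_speed:
  fixes f :: "real \<Rightarrow> 'a::real_normed_vector"
  assumes "\<And>t. t \<in> {0..T} \<Longrightarrow> (f has_vector_derivative f' t) (at t within {0..T})"
    and "\<And>t. t \<in> {0..T} \<Longrightarrow> norm (f' t) \<le> B" and t: "t \<in> {0..T}"
  shows "norm (f t - f 0) \<le> B * t"
proof -
  have "norm (f t - f 0) \<le> B * norm (t - 0)"
  proof (rule differentiable_bound[where f' = "\<lambda>t h. h *\<^sub>R f' t" and S = "{0..T}"])
    show "(f has_derivative (\<lambda>h. h *\<^sub>R f' t)) (at t within {0..T})" if "t \<in> {0..T}" for t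
      using assms(1)[OF that] by (simp add: has_vector_derivative_def)
    show "onorm (\<lambda>h. h *\<^sub>R f' t) \<le> B" if "t \<in> {0..T}" for t
    proof (rule onorm_le)
      show "norm (h *\<^sub>R f' t) \<le> B * norm h" for h
        using mult_right_mono[OF assms(2)[OF that], of "\<bar>h\<bar>"] by (simp add: mult.commute)
    qed
  qed (use t in auto)
  then show ?thesis using t by simp
qed

text \<open>A maximal speed that is attained turns the estimates below into one algebraic inequality
  for a number S, in place of a differential inequality.\<close>

lemma maximal_norm_attained:
  fixes l :: "nat \<Rightarrow> real \<Rightarrow> 'a::real_normed_vector"
  assumes "T \<ge> 0" "N \<ge> 1" "\<And>j. j \<in> {1..N} \<Longrightarrow> continuous_on {0..T} (l j)"
  shows "\<exists>k\<in>{1..N}. \<exists>s\<in>{0..T}. \<forall>j\<in>{1..N}. \<forall>t\<in>{0..T}. norm (l j t) \<le> norm (l k s)"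
proof -
  have "\<exists>s\<in>{0..T}. \<forall>t\<in>{0..T}. norm (l j t) \<le> norm (l j s)" if "j \<in> {1..N}" for j
    by (rule continuous_attains_sup) (use assms that in \<open>auto intro!: continuous_intros\<close>)
  then obtain \<tau> where \<tau>: "\<And>j. j \<in> {1..N} \<Longrightarrow> \<tau> j \<in> {0..T}"
    "\<And>j t. j \<in> {1..N} \<Longrightarrow> t \<in> {0..T} \<Longrightarrow> norm (l j t) \<le> norm (l j (\<tau> j))"
    by metis
  define A where "A = (\<lambda>j. norm (l j (\<tau> j))) ` {1..N}"
  have A: "finite A" "A \<noteq> {}" using assms(2) by (auto simp: A_def)
  obtain k where k: "k \<in> {1..N}" "Max A = norm (l k (\<tau> k))" using Max_in[OF A] unfolding A_def by blast
  have "norm (l j t) \<le> norm (l k (\<tau> k))" if "j \<in> {1..N}" "t \<in> {0..T}" for j t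
    using \<tau>(2)[OF that] Max_ge[OF A(1), of "norm (l j (\<tau> j))"] k(2) that(1) unfolding A_def by fastforce
  then show ?thesis using k(1) \<tau>(1)[OF k(1)] by blast
qed

lemma Gpot_far:
  assumes "\<epsilon> > 0" "\<epsilon> \<le> norm x"
  shows "Gpot \<epsilon> x = ln ((norm x)\<^sup>2) / (4 * pi)"
proof -
  have "\<epsilon>\<^sup>2 \<le> (norm x)\<^sup>2" using assms by (intro power_mono) auto
  then show ?thesis by (simp add: Gpot_def glog_def power2_norm_eq_inner)
qed

lemma Gpot_near:
  assumes "\<epsilon> > 0" "norm x < \<epsilon>"
  shows "Gpot \<epsilon> x \<le> ln (\<epsilon>\<^sup>2) / (4 * pi)"
proof -
  have s: "x \<bullet> x < \<epsilon>\<^sup>2"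
    using assms by (simp add: power2_norm_eq_inner[symmetric] power_strict_mono)
  then have "(x \<bullet> x) / \<epsilon>\<^sup>2 \<le> 1" using assms(1) by simp
  then have "glog \<epsilon> (x \<bullet> x) \<le> ln (\<epsilon>\<^sup>2)" using s by (simp add: glog_def)
  then show ?thesis unfolding Gpot_def by (intro divide_right_mono) auto
qed

text \<open>From ln r \<le> r. It makes |x| - Gpot x nonnegative, so that no interaction term is
  negative once the distances have been added to the energy.\<close>

lemma Gpot_le_norm:
  assumes "0 < \<epsilon>" "\<epsilon> \<le> 1"
  shows "Gpot \<epsilon> x \<le> norm x"
proof (cases "\<epsilon> \<le> norm x")
  case True
  then have x: "norm x > 0" using assms by linarith
  have "ln ((norm x)\<^sup>2) = 2 * ln (norm x)" using x by (simp add: ln_realpow)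
  also have "\<dots> \<le> 2 * norm x" using ln_le_minus_one[OF x] by simp
  also have "\<dots> \<le> norm x * (4 * pi)"
    using mult_left_mono[of 2 "4 * pi" "norm x"] two_pi_gt_3 by simp
  finally show ?thesis using Gpot_far[OF assms(1) True] by (simp add: divide_le_eq)
next
  case False
  have "ln (\<epsilon>\<^sup>2) \<le> 0" using assms by (simp add: power_le_one)
  then have "ln (\<epsilon>\<^sup>2) / (4 * pi) \<le> 0" by (simp add: divide_nonpos_pos)
  then show ?thesis using Gpot_near[OF assms(1), of x] False norm_ge_zero[of x] by linarith
qed

context vortex_data
begin

text \<open>The part of the truncated system on which the separation arguments rest: the fluid
  enters only through membership in the class \<open>vort M M1\<close>.\<close>

definition motion :: "real \<Rightarrow> (real \<Rightarrow> plane \<Rightarrow> real) \<Rightarrow> (nat \<Rightarrow> real \<Rightarrow> plane) \<Rightarrow> (nat \<Rightarrow> real \<Rightarrow> plane) \<Rightarrow> bool" where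
  "motion T \<omega> h l \<longleftrightarrow> (\<forall>t. vort M M1 (\<omega> t)) \<and> (\<forall>j\<in>{1..N}. h j 0 = h0 j \<and> l j 0 = l0 j \<and>
     (\<forall>t\<in>{0..T}. (h j has_vector_derivative l j t) (at t within {0..T}) \<and>
        (l j has_vector_derivative acc K \<delta> N m \<gamma> (\<omega> t) (\<lambda>i. h i t) (\<lambda>i. l i t) j) (at t within {0..T})))"

lemma motionD:
  assumes "motion T \<omega> h l"
  shows "vort M M1 (\<omega> t)" "j \<in> {1..N} \<Longrightarrow> h j 0 = h0 j" "j \<in> {1..N} \<Longrightarrow> l j 0 = l0 j"
    "j \<in> {1..N} \<Longrightarrow> t \<in> {0..T} \<Longrightarrow> (h j has_vector_derivative l j t) (at t within {0..T})"
    "j \<in> {1..N} \<Longrightarrow> t \<in> {0..T} \<Longrightarrow>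
      (l j has_vector_derivative acc K \<delta> N m \<gamma> (\<omega> t) (\<lambda>i. h i t) (\<lambda>i. l i t) j) (at t within {0..T})"
  using assms unfolding motion_def by blast+

lemma motion_maximal_speed:
  assumes mo: "motion T \<omega> h l" and "T > 0" "N \<ge> 1"
  shows "\<exists>k\<in>{1..N}. \<exists>s\<in>{0..T}. \<forall>j\<in>{1..N}. \<forall>t\<in>{0..T}. norm (l j t) \<le> norm (l k s)"
proof (rule maximal_norm_attained)
  show "continuous_on {0..T} (l j)" if "j \<in> {1..N}" for j
    by (rule continuous_on_vector_derivative[OF motionD(5)[OF mo that]])
qed (use assms in auto)

lemma motion_displacement:
  assumes mo: "motion T \<omega> h l" and S: "\<And>j t. j \<in> {1..N} \<Longrightarrow> t \<in> {0..T} \<Longrightarrow> norm (l j t) \<le> S"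
    and j: "j \<in> {1..N}" and t: "t \<in> {0..T}"
  shows "norm (h j t - h0 j) \<le> S * T"
proof -
  have "norm (h j t - h j 0) \<le> S * t"
    by (rule norm_diff_le_speed[OF motionD(4)[OF mo j] S[OF j] t])
  also have "\<dots> \<le> S * T"
    using t order_trans[OF norm_ge_zero S[OF j t]] by (intro mult_left_mono) auto
  finally show ?thesis using motionD(2)[OF mo j] by simp
qed

text \<open>Because T cL \<le> 1/2, the attained maximal speed S satisfies S \<le> (S + BA)/2 + S0
  with S0 the sum of the initial speeds, so S \<le> 2 S0 + BA. No vortex then moves by more than
  \<delta>/2, and initial distances of at least 2 \<delta> leave \<delta>.\<close>

lemma short_time_separation:
  assumes mo: "motion T \<omega> h l" and T: "T > 0" "T * cL \<le> 1/2" and N: "N \<ge> 1"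
    and small: "T * (2 * (\<Sum>j=1..N. norm (l0 j)) + BA) \<le> \<delta> / 2"
    and h0: "\<And>i j. i \<in> {1..N} \<Longrightarrow> j \<in> {1..N} \<Longrightarrow> i \<noteq> j \<Longrightarrow> 2 * \<delta> \<le> norm (h0 i - h0 j)"
    and ij: "i \<in> {1..N}" "j \<in> {1..N}" "i \<noteq> j" and t: "t \<in> {0..T}"
  shows "\<delta> \<le> norm (h i t - h j t)"
proof -
  define S0 where "S0 = (\<Sum>j=1..N. norm (l0 j))"
  obtain k s where k: "k \<in> {1..N}" "s \<in> {0..T}"
    and mx: "\<And>j t. j \<in> {1..N} \<Longrightarrow> t \<in> {0..T} \<Longrightarrow> norm (l j t) \<le> norm (l k s)"
    using motion_maximal_speed[OF mo T(1) N] by blast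
  define S where "S = norm (l k s)"
  have S: "S \<ge> 0" by (simp add: S_def)
  have "norm (l k s - l k 0) \<le> (cL * (S + BA)) * s"
  proof (rule norm_diff_le_speed[OF motionD(5)[OF mo k(1)] _ k(2)])
    fix t assume t: "t \<in> {0..T}"
    have "norm (acc K \<delta> N m \<gamma> (\<omega> t) (\<lambda>i. h i t) (\<lambda>i. l i t) k) \<le> cL * (norm (l k t) + BA)"
      by (rule norm_acc[OF motionD(1)[OF mo] K_meas order_refl k(1)])
    also have "\<dots> \<le> cL * (S + BA)"
      using mx[OF k(1) t] const_nonneg by (intro mult_left_mono) (auto simp: S_def)
    finally show "norm (acc K \<delta> N m \<gamma> (\<omega> t) (\<lambda>i. h i t) (\<lambda>i. l i t) k) \<le> cL * (S + BA)" .
  qed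
  also have "\<dots> \<le> (cL * (S + BA)) * T"
    using k(2) const_nonneg S by (intro mult_left_mono) auto
  also have "\<dots> = (T * cL) * (S + BA)" by (simp add: mult_ac)
  also have "\<dots> \<le> 1/2 * (S + BA)" using T(2) const_nonneg S by (intro mult_right_mono) auto
  finally have "norm (l k s - l0 k) \<le> (S + BA) / 2" using motionD(3)[OF mo k(1)] by simp
  moreover have "norm (l0 k) \<le> S0" unfolding S0_def by (rule member_le_sum) (use k in auto)
  moreover have "S \<le> norm (l k s - l0 k) + norm (l0 k)"
    using norm_triangle_ineq[of "l k s - l0 k" "l0 k"] by (simp add: S_def)
  ultimately have "S \<le> (S + BA) / 2 + S0" by (meson add_mono order_trans)
  then have Sb: "S \<le> 2 * S0 + BA" by (simp add: field_simps)
  have d: "norm (h j t - h0 j) \<le> \<delta> / 2" if "j \<in> {1..N}" for j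
  proof -
    have "norm (h j t - h0 j) \<le> S * T"
      by (rule motion_displacement[OF mo _ that t]) (use mx in \<open>auto simp: S_def\<close>)
    also have "\<dots> \<le> (2 * S0 + BA) * T" using Sb T by (intro mult_right_mono) auto
    finally show ?thesis using small by (simp add: S0_def mult.commute)
  qed
  have "norm (h0 i - h0 j) \<le> norm (h i t - h j t) + norm (h j t - h0 j) + norm (h i t - h0 i)"
    using norm_triangle3[of "h i t - h j t" "h j t - h0 j" "h0 i - h i t"] by (simp add: norm_minus_commute)
  then show ?thesis using d[OF ij(1)] d[OF ij(2)] h0[OF ij] by linarith
qed

text \<open>The sum runs over ordered pairs, hence the factor 1/2, and the diagonal is switched off
  because the truncated potential is finite at 0. With \<open>Gpot \<delta>\<close> the energy is
  differentiable through collisions as well, so nothing about separation is presupposed.\<close>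

definition energy :: "(nat \<Rightarrow> plane) \<Rightarrow> (nat \<Rightarrow> plane) \<Rightarrow> real" where
  "energy H L = (\<Sum>j=1..N. m j / 2 * (L j \<bullet> L j)) -
     (\<Sum>i=1..N. \<Sum>j=1..N. (if i = j then 0 else \<gamma> i * \<gamma> j) / 2 * Gpot \<delta> (H j - H i))"

text \<open>The gyroscopic term does no work and the vortex--vortex forces derive from \<open>Gpot\<close>,
  so only the fluid velocity changes the energy.\<close>

lemma energy_derivative:
  assumes mo: "motion T \<omega> h l" and m: "\<And>k. k \<in> {1..N} \<Longrightarrow> m k > 0" and t: "t \<in> {0..T}"
  shows "((\<lambda>t. energy (\<lambda>j. h j t) (\<lambda>j. l j t)) has_vector_derivative
     - (\<Sum>j=1..N. \<gamma> j * (l j t \<bullet> perp (conv (\<omega> t) K (h j t))))) (at t within {0..T})"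
proof -
  define c where "c i j = (if i = j then 0 else \<gamma> i * \<gamma> j)" for i j
  define P where "P i j = perp (Kreg \<delta> (h j t - h i t))" for i j
  define A where "A j = acc K \<delta> N m \<gamma> (\<omega> t) (\<lambda>i. h i t) (\<lambda>i. l i t) j" for j
  define u where "u j = conv (\<omega> t) K (h j t)" for j
  have c: "c i j = c j i" for i j by (simp add: c_def)
  have P: "P i j = - P j i" for i j
    using Kreg_minus[of \<delta> "h i t - h j t"] by (simp add: P_def perp_minus)
  have k: "((\<lambda>t. m j / 2 * (l j t \<bullet> l j t)) has_vector_derivative m j * (l j t \<bullet> A j)) (at t within {0..T})"
    if "j \<in> {1..N}" for j
  proof -
    have "((\<lambda>t. l j t \<bullet> l j t) has_vector_derivative l j t \<bullet> A j + A j \<bullet> l j t) (at t within {0..T})"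
      unfolding A_def by (rule bounded_bilinear.has_vector_derivative[OF bounded_bilinear_inner
        motionD(5)[OF mo that t] motionD(5)[OF mo that t]])
    from has_vector_derivative_mult_right[OF this, of "m j / 2"] show ?thesis
      by (simp add: inner_commute algebra_simps)
  qed
  have g: "((\<lambda>t. c i j / 2 * Gpot \<delta> (h j t - h i t)) has_vector_derivative
      c i j / 2 * (- (P i j \<bullet> (l j t - l i t)))) (at t within {0..T})" if "i \<in> {1..N}" "j \<in> {1..N}" for i j
  proof (rule has_vector_derivative_mult_right)
    have "((\<lambda>t. h j t - h i t) has_vector_derivative l j t - l i t) (at t within {0..T})"
      by (rule has_vector_derivative_diff[OF motionD(4)[OF mo that(2) t] motionD(4)[OF mo that(1) t]])
    from vector_derivative_diff_chain_within[OF this has_derivative_at_withinI[OF Gpot_has_derivative[OF \<delta>]]]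
    show "((\<lambda>t. Gpot \<delta> (h j t - h i t)) has_vector_derivative - (P i j \<bullet> (l j t - l i t))) (at t within {0..T})"
      by (simp add: o_def P_def)
  qed
  have E: "((\<lambda>t. energy (\<lambda>j. h j t) (\<lambda>j. l j t)) has_vector_derivative
      (\<Sum>j=1..N. m j * (l j t \<bullet> A j)) - (\<Sum>i=1..N. \<Sum>j=1..N. c i j / 2 * (- (P i j \<bullet> (l j t - l i t))))) (at t within {0..T})"
    unfolding energy_def c_def[symmetric]
    by (intro has_vector_derivative_diff has_vector_derivative_sum k g)
  have acc: "m j * (l j t \<bullet> A j) = - (\<gamma> j * (l j t \<bullet> perp (u j))) - (\<Sum>i=1..N. c i j * (P i j \<bullet> l j t))"
    if j: "j \<in> {1..N}" for j
  proof -
    have "perp (\<Sum>i\<in>{1..N} - {j}. \<gamma> i *\<^sub>R Kreg \<delta> (h j t - h i t)) = (\<Sum>i\<in>{1..N} - {j}. \<gamma> i *\<^sub>R P i j)"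
      unfolding P_def linear_sum[OF bounded_linear.linear[OF bounded_linear_perp]] perp_scaleR ..
    then have "m j * (l j t \<bullet> A j) = \<gamma> j * (l j t \<bullet> (perp (l j t) - perp (u j) - (\<Sum>i\<in>{1..N} - {j}. \<gamma> i *\<^sub>R P i j)))"
      using m[OF j] unfolding A_def acc_def u_def perp_diff by simp
    also have "\<dots> = - (\<gamma> j * (l j t \<bullet> perp (u j))) - (\<Sum>i\<in>{1..N} - {j}. c i j * (P i j \<bullet> l j t))"
    proof -
      have "\<gamma> j * (\<Sum>i\<in>{1..N} - {j}. \<gamma> i * (l j t \<bullet> P i j)) = (\<Sum>i\<in>{1..N} - {j}. c i j * (P i j \<bullet> l j t))"
        unfolding sum_distrib_left by (rule sum.cong) (auto simp: c_def inner_commute)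
      then show ?thesis by (simp add: inner_diff_right inner_sum_right right_diff_distrib)
    qed
    also have "(\<Sum>i\<in>{1..N} - {j}. c i j * (P i j \<bullet> l j t)) = (\<Sum>i=1..N. c i j * (P i j \<bullet> l j t))"
      by (rule sum.mono_neutral_left) (auto simp: c_def)
    finally show ?thesis .
  qed
  \<comment> \<open>c is symmetric and P antisymmetric, so exchanging the indices turns the terms
    with l i into minus those with l j. The work of the pair forces is then cancelled by the
    derivative of the potential.\<close>
  define Q where "Q = (\<Sum>j=1..N. \<Sum>i=1..N. c i j * (P i j \<bullet> l j t))"
  have Q1: "(\<Sum>i=1..N. \<Sum>j=1..N. c i j * (P i j \<bullet> l j t)) = Q"
    unfolding Q_def by (rule sum.swap)
  have Q2: "(\<Sum>i=1..N. \<Sum>j=1..N. c i j * (P i j \<bullet> l i t)) = - Q"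
    unfolding Q_def sum_negf[symmetric]
    by (intro sum.cong refl) (use c P in \<open>metis inner_minus_left mult_minus_right\<close>)
  have "(\<Sum>i=1..N. \<Sum>j=1..N. c i j / 2 * (- (P i j \<bullet> (l j t - l i t)))) =
      (\<Sum>i=1..N. \<Sum>j=1..N. (c i j * (P i j \<bullet> l i t) - c i j * (P i j \<bullet> l j t)) / 2)"
    by (intro sum.cong refl) (simp add: inner_diff_right field_simps)
  also have "\<dots> = - Q"
    unfolding sum_divide_distrib[symmetric] sum_subtractf Q1 Q2 by simp
  finally have p: "(\<Sum>i=1..N. \<Sum>j=1..N. c i j / 2 * (- (P i j \<bullet> (l j t - l i t)))) = - Q" .
  have "(\<Sum>j=1..N. m j * (l j t \<bullet> A j)) = (\<Sum>j=1..N. - (\<gamma> j * (l j t \<bullet> perp (u j))) - (\<Sum>i=1..N. c i j * (P i j \<bullet> l j t)))"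
    by (rule sum.cong) (use acc in auto)
  also have "\<dots> = - (\<Sum>j=1..N. \<gamma> j * (l j t \<bullet> perp (u j))) - Q"
    unfolding Q_def sum_subtractf sum_negf ..
  finally show ?thesis using E unfolding p u_def by simp
qed

text \<open>The logarithm is unbounded at large distances too, so the interaction energy alone has
  no sign. Adding |h_j - h_i| for each pair repairs this; the price is proportional to the
  distances, which grow by multiples of S T, and is thus linear in S like the work of the
  fluid.\<close>

lemma energy_estimate:
  assumes mo: "motion T \<omega> h l" and T: "T > 0" and m: "\<And>k. k \<in> {1..N} \<Longrightarrow> m k > 0" and \<delta>1: "\<delta> \<le> 1"
    and \<gamma>: "\<And>i j. i \<in> {1..N} \<Longrightarrow> j \<in> {1..N} \<Longrightarrow> 0 \<le> \<gamma> i * \<gamma> j"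
    and S: "\<And>j t. j \<in> {1..N} \<Longrightarrow> t \<in> {0..T} \<Longrightarrow> norm (l j t) \<le> S" "S \<ge> 0"
    and t: "t \<in> {0..T}"
  shows "(\<Sum>j=1..N. m j / 2 * (norm (l j t))\<^sup>2) +
      (\<Sum>i=1..N. \<Sum>j=1..N. (if i = j then 0 else \<gamma> i * \<gamma> j) / 2 * (norm (h j t - h i t) - Gpot \<delta> (h j t - h i t)))
    \<le> energy h0 l0 + \<Gamma>\<^sup>2 * (\<Sum>j=1..N. norm (h0 j)) + (\<Gamma> * U * T + \<Gamma>\<^sup>2 * T) * S"
proof -
  define c where "c i j = (if i = j then 0 else \<gamma> i * \<gamma> j)" for i j
  define D where "D = (\<Sum>j=1..N. norm (h0 j))"
  have c: "0 \<le> c i j" "c i j \<le> \<bar>\<gamma> i\<bar> * \<bar>\<gamma> j\<bar>" if "i \<in> {1..N}" "j \<in> {1..N}" for i j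
    using \<gamma>[OF that] by (auto simp: c_def abs_mult[symmetric])
  have h: "norm (h j t) \<le> D + S * T" if "j \<in> {1..N}" for j
  proof -
    have "norm (h0 j) \<le> D" unfolding D_def by (rule member_le_sum) (use that in auto)
    then show ?thesis
      using motion_displacement[OF mo S(1) that t] norm_triangle_ineq[of "h j t - h0 j" "h0 j"] by simp
  qed
  have D: "D \<ge> 0" "D + S * T \<ge> 0" using S(2) T by (auto simp: D_def intro!: sum_nonneg add_nonneg_nonneg)
  have "(\<Sum>i=1..N. \<Sum>j=1..N. c i j / 2 * norm (h j t - h i t)) \<le> (\<Sum>i=1..N. \<Sum>j=1..N. \<bar>\<gamma> i\<bar> * \<bar>\<gamma> j\<bar> * (D + S * T))"
  proof (intro sum_mono)
    fix i j assume ij: "i \<in> {1..N}" "j \<in> {1..N}"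
    have "c i j * (norm (h j t - h i t) / 2) \<le> (\<bar>\<gamma> i\<bar> * \<bar>\<gamma> j\<bar>) * (D + S * T)"
      using c[OF ij] h[OF ij(1)] h[OF ij(2)] norm_triangle_ineq4[of "h j t" "h i t"] D
      by (intro mult_mono) auto
    then show "c i j / 2 * norm (h j t - h i t) \<le> \<bar>\<gamma> i\<bar> * \<bar>\<gamma> j\<bar> * (D + S * T)" by simp
  qed
  also have "\<dots> = \<Gamma>\<^sup>2 * (D + S * T)"
    unfolding sum_distrib_right[symmetric] sum_distrib_left[symmetric] \<Gamma>_def power2_eq_square ..
  finally have pot: "(\<Sum>i=1..N. \<Sum>j=1..N. c i j / 2 * norm (h j t - h i t)) \<le> \<Gamma>\<^sup>2 * (D + S * T)" .
  have "norm (energy (\<lambda>j. h j t) (\<lambda>j. l j t) - energy (\<lambda>j. h j 0) (\<lambda>j. l j 0)) \<le> (\<Gamma> * U * S) * t"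
  proof (rule norm_diff_le_speed[OF energy_derivative[OF mo m] _ t])
    fix t assume t: "t \<in> {0..T}"
    have "\<bar>\<gamma> j * (l j t \<bullet> perp (conv (\<omega> t) K (h j t)))\<bar> \<le> \<bar>\<gamma> j\<bar> * (S * U)" if j: "j \<in> {1..N}" for j
    proof -
      have "\<bar>l j t \<bullet> perp (conv (\<omega> t) K (h j t))\<bar> \<le> norm (l j t) * norm (conv (\<omega> t) K (h j t))"
        using Cauchy_Schwarz_ineq2[of "l j t" "perp (conv (\<omega> t) K (h j t))"] by simp
      also have "\<dots> \<le> S * U"
        using S(1)[OF j t] S(2) norm_conv_singular[OF motionD(1)[OF mo] K_meas order_refl]
        unfolding U_def by (intro mult_mono) auto
      finally show ?thesis by (simp add: abs_mult mult_left_mono)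
    qed
    then have "(\<Sum>j=1..N. \<bar>\<gamma> j * (l j t \<bullet> perp (conv (\<omega> t) K (h j t)))\<bar>) \<le> (\<Sum>j=1..N. \<bar>\<gamma> j\<bar> * (S * U))"
      by (intro sum_mono)
    also have "\<dots> = \<Gamma> * U * S" unfolding sum_distrib_right[symmetric] \<Gamma>_def by simp
    finally show "norm (- (\<Sum>j=1..N. \<gamma> j * (l j t \<bullet> perp (conv (\<omega> t) K (h j t))))) \<le> \<Gamma> * U * S"
      unfolding real_norm_def abs_minus_cancel by (rule order_trans[OF sum_abs])
  qed
  also have "\<dots> \<le> (\<Gamma> * U * S) * T" using t S(2) const_nonneg by (intro mult_left_mono) auto
  also have "energy (\<lambda>j. h j 0) (\<lambda>j. l j 0) = energy h0 l0"
    unfolding energy_def using motionD(2,3)[OF mo] by (intro arg_cong2[where f = "(-)"] sum.cong) auto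
  finally have en: "energy (\<lambda>j. h j t) (\<lambda>j. l j t) \<le> energy h0 l0 + \<Gamma> * U * S * T" by simp
  have "(\<Sum>j=1..N. m j / 2 * (norm (l j t))\<^sup>2) + (\<Sum>i=1..N. \<Sum>j=1..N. c i j / 2 * (norm (h j t - h i t) - Gpot \<delta> (h j t - h i t)))
      = energy (\<lambda>j. h j t) (\<lambda>j. l j t) + (\<Sum>i=1..N. \<Sum>j=1..N. c i j / 2 * norm (h j t - h i t))"
    unfolding energy_def c_def[symmetric] right_diff_distrib sum_subtractf power2_norm_eq_inner by simp
  also have "\<dots> \<le> (energy h0 l0 + \<Gamma> * U * S * T) + \<Gamma>\<^sup>2 * (D + S * T)" by (rule add_mono[OF en pot])
  also have "\<dots> = energy h0 l0 + \<Gamma>\<^sup>2 * D + (\<Gamma> * U * T + \<Gamma>\<^sup>2 * T) * S" by (simp add: algebra_simps)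
  finally show ?thesis unfolding c_def D_def .
qed

text \<open>The energy estimate gives a S^2 \<le> A + C S, hence S \<le> 1 + (A + C)/a. Then B
  bounds every single interaction term, while two vortices closer than \<delta> would produce a term
  of at least B + 1. The constants are parameters so that \<delta> can be chosen after them.\<close>

lemma same_sign_separation:
  fixes A C S B a g :: real
  assumes mo: "motion T \<omega> h l" and T: "T > 0" and N: "N \<ge> 1" and m: "\<And>k. k \<in> {1..N} \<Longrightarrow> m k > 0"
    and \<delta>1: "\<delta> \<le> 1" and a: "a > 0" "\<And>k. k \<in> {1..N} \<Longrightarrow> a \<le> m k / 2"
    and g: "g > 0" "\<And>i j. i \<in> {1..N} \<Longrightarrow> j \<in> {1..N} \<Longrightarrow> g \<le> \<gamma> i * \<gamma> j"
    and A: "A \<ge> 0" "energy h0 l0 + \<Gamma>\<^sup>2 * (\<Sum>j=1..N. norm (h0 j)) \<le> A" and C: "C = \<Gamma> * U * T + \<Gamma>\<^sup>2 * T"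
    and B: "B = A + C * (1 + (A + C) / a)" and \<delta>B: "\<delta> \<le> exp (- (4 * pi * (B + 1) / g))"
    and ij: "i \<in> {1..N}" "j \<in> {1..N}" "i \<noteq> j" and t: "t \<in> {0..T}"
  shows "\<delta> \<le> norm (h i t - h j t)"
proof (rule ccontr)
  assume "\<not> \<delta> \<le> norm (h i t - h j t)"
  then have cl: "norm (h j t - h i t) < \<delta>" by (simp add: norm_minus_commute)
  obtain k s where k: "k \<in> {1..N}" "s \<in> {0..T}"
    and mx: "\<And>j t. j \<in> {1..N} \<Longrightarrow> t \<in> {0..T} \<Longrightarrow> norm (l j t) \<le> norm (l k s)"
    using motion_maximal_speed[OF mo T N] by blast
  define S where "S = norm (l k s)"
  have S: "S \<ge> 0" by (simp add: S_def)
  have C0: "C \<ge> 0" unfolding C using const_nonneg T by auto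
  have \<gamma>: "0 \<le> \<gamma> i * \<gamma> j" if "i \<in> {1..N}" "j \<in> {1..N}" for i j using g(2)[OF that] g(1) by simp
  define kin where "kin t = (\<Sum>j=1..N. m j / 2 * (norm (l j t))\<^sup>2)" for t
  define V where "V t i j = (if i = j then 0 else \<gamma> i * \<gamma> j) / 2 * (norm (h j t - h i t) - Gpot \<delta> (h j t - h i t))" for t i j
  have est: "kin t + (\<Sum>i=1..N. \<Sum>j=1..N. V t i j) \<le> A + C * S" if "t \<in> {0..T}" for t
    using energy_estimate[OF mo T m \<delta>1 \<gamma> _ S that] mx A(2) unfolding C S_def kin_def V_def by force
  have kin: "0 \<le> kin t" for t
    unfolding kin_def using m by (intro sum_nonneg mult_nonneg_nonneg) (auto simp: less_imp_le)
  have V: "0 \<le> V t i j" if "i \<in> {1..N}" "j \<in> {1..N}" for t i j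
    unfolding V_def using \<gamma>[OF that] Gpot_le_norm[OF \<delta> \<delta>1] by (intro mult_nonneg_nonneg) auto
  have "a * S\<^sup>2 \<le> m k / 2 * (norm (l k s))\<^sup>2"
    unfolding S_def using a(2)[OF k(1)] by (intro mult_right_mono) auto
  also have "\<dots> \<le> kin s"
    unfolding kin_def by (rule member_le_sum) (use k m in \<open>auto simp: less_imp_le\<close>)
  also have "\<dots> \<le> A + C * S"
    using est[OF k(2)] V by (smt (verit) sum_nonneg)
  finally have q: "a * S\<^sup>2 \<le> A + C * S" .
  \<comment> \<open>If S > 1 then A \<le> A S, and the quadratic inequality can be divided by
    S.\<close>
  have Sb: "S \<le> 1 + (A + C) / a"
  proof (cases "S \<le> 1")
    case True
    then show ?thesis using A(1) C0 a(1) by (simp add: add_increasing2)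
  next
    case False
    then have "A \<le> A * S" using A(1) mult_left_mono[of 1 S A] by simp
    then have "(a * S) * S \<le> (A + C) * S" using q by (simp add: algebra_simps power2_eq_square)
    then have "a * S \<le> A + C" using False by simp
    then have "S \<le> (A + C) / a" using a(1) by (simp add: pos_le_divide_eq mult.commute)
    then show ?thesis by simp
  qed
  have ln: "ln (\<delta>\<^sup>2) = 2 * ln \<delta>" using \<delta> by (simp add: ln_realpow)
  have ld: "ln \<delta> \<le> - (4 * pi * (B + 1) / g)"
    using \<delta>B \<delta> by (metis ln_exp ln_mono exp_gt_zero)
  have B0: "B \<ge> 0" unfolding B using A(1) C0 a(1) by auto
  then have "4 * pi * (B + 1) / g \<ge> 0" using g(1) by auto
  \<comment> \<open>The exponent in the hypothesis on \<delta> is made for this line: with -ln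
    \<delta> at least 4 pi (B + 1)/g, the product of g/2 and -2 ln \<delta>/(4 pi) is at least B +
    1.\<close>
  have "B + 1 = g / 2 * (2 * (4 * pi * (B + 1) / g) / (4 * pi))" using g(1) by simp
  also have "\<dots> \<le> g / 2 * (- (2 * ln \<delta>) / (4 * pi))"
    using ld g(1) by (intro mult_left_mono divide_right_mono) auto
  also have "\<dots> \<le> (\<gamma> i * \<gamma> j) / 2 * (- (2 * ln \<delta>) / (4 * pi))"
    using g(2)[OF ij(1,2)] \<delta> \<delta>1 by (intro mult_right_mono divide_nonneg_pos) auto
  also have "\<dots> \<le> (\<gamma> i * \<gamma> j) / 2 * (norm (h j t - h i t) - Gpot \<delta> (h j t - h i t))"
  proof (rule mult_left_mono)
    show "- (2 * ln \<delta>) / (4 * pi) \<le> norm (h j t - h i t) - Gpot \<delta> (h j t - h i t)"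
      using Gpot_near[OF \<delta> cl] norm_ge_zero[of "h j t - h i t"]
      unfolding ln minus_divide_left[symmetric] by linarith
  qed (use \<gamma>[OF ij(1,2)] in simp)
  also have "\<dots> = V t i j" using ij by (simp add: V_def)
  also have "\<dots> \<le> (\<Sum>j=1..N. V t i j)"
    by (rule member_le_sum) (use ij V in auto)
  also have "\<dots> \<le> (\<Sum>i=1..N. \<Sum>j=1..N. V t i j)"
    by (rule member_le_sum[of i _ "\<lambda>i. \<Sum>j=1..N. V t i j"]) (use ij V in \<open>auto intro!: sum_nonneg\<close>)
  also have "\<dots> \<le> A + C * S" using est[OF t] kin[of t] by simp
  also have "\<dots> \<le> B" unfolding B using Sb C0 by (intro add_left_mono mult_left_mono)
  finally show False by simp
qed

lemma weak_solution_of_separation: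
  assumes T: "T > 0" and m: "\<And>k. k \<in> {1..N} \<Longrightarrow> m k > 0" and w0: "AE x in lborel. \<omega>0 x = w0 x"
    and sep: "\<And>\<omega> h l t i j. motion T \<omega> h l \<Longrightarrow> t \<in> {0..T} \<Longrightarrow> i \<in> {1..N} \<Longrightarrow> j \<in> {1..N} \<Longrightarrow> i \<noteq> j \<Longrightarrow>
      \<delta> \<le> norm (h i t - h j t)"
  shows "\<exists>\<omega> h. weak_solution T N m \<gamma> w0 h0 l0 \<omega> h"
  using regularised_solution[OF T]
proof (elim exE conjE, goal_cases)
  case (1 \<omega> h l)
  have mo: "motion T \<omega> h l" unfolding motion_def using 1(1,4) by blast
  show ?case
  proof (rule weak_solution_of_regularised[OF T m w0, of \<omega> h l])
    show "vort M M1 (\<omega> t)" for t by (rule motionD(1)[OF mo])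
    show "\<omega> 0 = \<omega>0" by (rule 1(2))
    show "continuous_on {0..T} (\<lambda>t. LINT x|lborel. \<omega> t x * g x)" if "integrable lborel g" for g
      using 1(3) that by blast
    show "h j 0 = h0 j \<and> l j 0 = l0 j" if "j \<in> {1..N}" for j using motionD(2,3)[OF mo that] ..
    show "(h j has_vector_derivative l j t) (at t within {0..T})"
      "(l j has_vector_derivative acc K \<delta> N m \<gamma> (\<omega> t) (\<lambda>i. h i t) (\<lambda>i. l i t) j) (at t within {0..T})"
      if "j \<in> {1..N}" "t \<in> {0..T}" for j t
      by (rule motionD(4)[OF mo that], rule motionD(5)[OF mo that])
    show "continuous_on {0..T} (\<lambda>t. acc K \<delta> N m \<gamma> (\<omega> t) (\<lambda>i. h i t) (\<lambda>i. l i t) j)" if "j \<in> {1..N}" for j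
      using 1(4) that by blast
    show "((\<lambda>t. pairing K D (\<omega> t) (\<lambda>i. h i t) t) has_integral 0) {0..T}"
      if "C11 C \<phi> D" "\<forall>s s' x. norm (D (s, x) - D (s', x)) \<le> C * \<bar>s - s'\<bar>"
        "\<forall>s x. norm x \<ge> R \<longrightarrow> D (s, x) = 0" "0 < \<eta>" "\<forall>t x. t \<le> 0 \<or> T - \<eta> \<le> t \<longrightarrow> \<phi> (t, x) = 0" for C \<phi> D R \<eta>
      by (rule 1(5)[rule_format]) (use that in \<open>assumption | blast\<close>)+
    show "\<delta> \<le> norm (h i t - h j t)" if "t \<in> {0..T}" "i \<in> {1..N}" "j \<in> {1..N}" "i \<noteq> j" for t i j
      by (rule sep[OF mo that])
  qed
qed

end

section \<open>Choice of the constants\<close>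

text \<open>The inserted 1 covers the empty set, which occurs for the pairs of distinct labels when
  N = 1.\<close>

lemma finite_positive_lower_bound:
  fixes f :: "'a \<Rightarrow> real"
  assumes "finite A" "\<And>x. x \<in> A \<Longrightarrow> f x > 0"
  shows "\<exists>c>0. \<forall>x\<in>A. c \<le> f x"
  by (rule exI[of _ "Min (insert 1 (f ` A))"]) (use assms in auto)

theorem theorem1p2:
  fixes N :: nat and m \<gamma> :: "nat \<Rightarrow> real"
    and \<omega>0 :: "plane \<Rightarrow> real" and R0 :: real and h0 l0 :: "nat \<Rightarrow> plane"
  assumes "N \<ge> 1"
    and "\<And>k. k \<in> {1..N} \<Longrightarrow> m k > 0"
    and "Linfty \<omega>0"
    and "R0 > 0" and "AE x in lebesgue. x \<notin> ball 0 R0 \<longrightarrow> \<omega>0 x = 0"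
    and "inj_on h0 {1..N}"
  shows "\<exists>Tstar :: ereal. Tstar > 0 \<and>
    ((\<forall>k\<in>{1..N}. \<gamma> k > 0) \<or> (\<forall>k\<in>{1..N}. \<gamma> k < 0) \<longrightarrow> Tstar = \<infinity>) \<and>
    (\<forall>T :: real. 0 < T \<and> ereal T < Tstar \<longrightarrow>
       (\<exists>\<omega> h. weak_solution T N m \<gamma> \<omega>0 h0 l0 \<omega> h))"
proof -
  obtain M M1 w where w: "vort M M1 w" "AE x in lborel. w x = \<omega>0 x"
    using Linfty_borel_representative[OF assms(3,5)] by blast
  have "finite {p \<in> {1..N} \<times> {1..N}. fst p \<noteq> snd p}" by (rule finite_subset[of _ "{1..N} \<times> {1..N}"]) auto
  then obtain d where d: "d > 0" "\<And>i j. i \<in> {1..N} \<Longrightarrow> j \<in> {1..N} \<Longrightarrow> i \<noteq> j \<Longrightarrow> d \<le> norm (h0 i - h0 j)"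
    using finite_positive_lower_bound[of "{p \<in> {1..N} \<times> {1..N}. fst p \<noteq> snd p}" "\<lambda>p. norm (h0 (fst p) - h0 (snd p))"]
      inj_onD[OF assms(6)] by fastforce
  show ?thesis
  proof (cases "(\<forall>k\<in>{1..N}. \<gamma> k > 0) \<or> (\<forall>k\<in>{1..N}. \<gamma> k < 0)")
    case True
    \<comment> \<open>The truncation \<delta> depends on T through C, so every time horizon gets its
      own truncated system.\<close>
    have "\<exists>\<omega> h. weak_solution T N m \<gamma> \<omega>0 h0 l0 \<omega> h" if T: "0 < T" for T
    proof -
      obtain a where a: "a > 0" "\<And>k. k \<in> {1..N} \<Longrightarrow> a \<le> m k / 2"
        using finite_positive_lower_bound[of "{1..N}" "\<lambda>k. m k / 2"] assms(2) by auto
      have "0 < \<gamma> (fst p) * \<gamma> (snd p)" if "p \<in> {1..N} \<times> {1..N}" for p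
        using True that by (auto intro: mult_pos_pos mult_neg_neg)
      then obtain g where g: "g > 0" "\<And>i j. i \<in> {1..N} \<Longrightarrow> j \<in> {1..N} \<Longrightarrow> g \<le> \<gamma> i * \<gamma> j"
        using finite_positive_lower_bound[of "{1..N} \<times> {1..N}" "\<lambda>p. \<gamma> (fst p) * \<gamma> (snd p)"] by fastforce
      \<comment> \<open>The initial energy with the untruncated logarithm. It equals
        \<open>energy h0 l0\<close> as soon as \<delta> is at most the initial distances, and being
        free of \<delta> it breaks the circle between \<delta> and the energy bound.\<close>
      define E where "E = (\<Sum>j=1..N. m j / 2 * (l0 j \<bullet> l0 j)) -
        (\<Sum>i=1..N. \<Sum>j=1..N. (if i = j then 0 else \<gamma> i * \<gamma> j) / 2 * (ln ((norm (h0 j - h0 i))\<^sup>2) / (4 * pi)))"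
      \<comment> \<open>\<Gamma> and \<open>U\<close> do not involve \<delta> and can be named
        before \<delta> is fixed.\<close>
      define G where "G = vortex_data.\<Gamma> N \<gamma>"
      define W where "W = vortex_data.U M M1"
      define A where "A = \<bar>E + G\<^sup>2 * (\<Sum>j=1..N. norm (h0 j))\<bar>"
      define C where "C = G * W * T + G\<^sup>2 * T"
      define B where "B = A + C * (1 + (A + C) / a)"
      \<comment> \<open>The entry 1 serves \<open>Gpot_le_norm\<close>, d keeps the initial energy
        equal to E, and the exponential is the threshold of
        \<open>same_sign_separation\<close>.\<close>
      define \<delta> where "\<delta> = min (min 1 d) (exp (- (4 * pi * (B + 1) / g)))"
      interpret vortex_data N m \<gamma> \<delta> M M1 w h0 l0
        by unfold_locales (use w(1) d(1) in \<open>auto simp: \<delta>_def\<close>)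
      have "energy h0 l0 = E"
        unfolding energy_def E_def
      proof (intro arg_cong2[where f = "(-)"] sum.cong refl)
        fix i j assume "i \<in> {1..N}" "j \<in> {1..N}"
        then have "i \<noteq> j \<Longrightarrow> \<delta> \<le> norm (h0 j - h0 i)" using d(2)[of j i] by (auto simp: \<delta>_def)
        then show "(if i = j then 0 else \<gamma> i * \<gamma> j) / 2 * Gpot \<delta> (h0 j - h0 i) =
           (if i = j then 0 else \<gamma> i * \<gamma> j) / 2 * (ln ((norm (h0 j - h0 i))\<^sup>2) / (4 * pi))"
          using Gpot_far[OF \<delta>] by (cases "i = j") auto
      qed
      then have A: "A \<ge> 0" "energy h0 l0 + G\<^sup>2 * (\<Sum>j=1..N. norm (h0 j)) \<le> A"
        by (auto simp: A_def)
      show ?thesis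
        by (rule weak_solution_of_separation[OF T assms(2) w(2)],
            assumption,
            rule same_sign_separation[OF _ T assms(1,2) _ a g A[unfolded G_def] C_def[unfolded G_def W_def] B_def])
          (auto simp: \<delta>_def)
    qed
    then show ?thesis by (intro exI[of _ "\<infinity>"]) auto
  next
    case False
    \<comment> \<open>Half of a lower bound for the initial distances, so that the vortices start at
      least 2 \<delta> apart.\<close>
    interpret vortex_data N m \<gamma> "d / 2" M M1 w h0 l0
      by unfold_locales (use w(1) d(1) in auto)
    define V where "V = 2 * (\<Sum>j=1..N. norm (l0 j)) + BA"
    have V: "V \<ge> 0" using const_nonneg by (auto simp: V_def intro!: sum_nonneg add_nonneg_nonneg)
    \<comment> \<open>The two entries yield the hypotheses T cL \<le> 1/2 and T V \<le> d/4 of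
      \<open>short_time_separation\<close>; 1 is added in the denominators because cL and V may
      vanish.\<close>
    define T0 where "T0 = min (1 / (2 * (cL + 1))) (d / (4 * (V + 1)))"
    have "\<exists>\<omega> h. weak_solution T N m \<gamma> \<omega>0 h0 l0 \<omega> h" if T: "0 < T" "T < T0" for T
    proof -
      have "T < 1 / (2 * (cL + 1))" "T < d / (4 * (V + 1))" using T(2) by (auto simp: T0_def)
      then have "T * (2 * (cL + 1)) < 1" "T * (4 * (V + 1)) < d"
        using const_nonneg V by (simp_all add: pos_less_divide_eq)
      then have TT: "T * cL \<le> 1/2" "T * (2 * (\<Sum>j=1..N. norm (l0 j)) + BA) \<le> (d / 2) / 2"
        using T(1) unfolding V_def[symmetric] by (auto simp: algebra_simps)
      have d2: "2 * (d / 2) \<le> norm (h0 i - h0 j)" if "i \<in> {1..N}" "j \<in> {1..N}" "i \<noteq> j" for i j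
        using d(2)[OF that] by simp
      show ?thesis
        by (rule weak_solution_of_separation[OF T(1) assms(2) w(2)],
            assumption, rule short_time_separation[OF _ T(1) TT(1) assms(1) TT(2) d2])
    qed
    moreover have "T0 > 0" using const_nonneg V d(1) by (auto simp: T0_def)
    ultimately show ?thesis using False by (intro exI[of _ "ereal T0"]) auto
  qed
qed

end
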